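(* Assume there exists a positive semi-definite solution $P$ of the algebraic Riccati equation $AP+PA'-PSP+R=0$ such that $\mu(A-PS)<0$. Let $(\overline X_t,\breve X_t)$ be two Kalman-Bucy diffusions starting from random states with covariance matrices $(P_0,\check P_0)$, and let $\pi_t=\mathrm{Law}(\overline X_t)$, $\breve\pi_t=\mathrm{Law}(\breve X_t)$. Then for any $n\ge1$ and any $\epsilon\in\,]0,1/2]$ there is a finite constant $c(\epsilon)$, whose value depends on $\epsilon$ and on the initial matrices $(P_0,\check P_0)$, such that for any $t\ge 0$ $$\mathbb W_{2n}(\pi_t,\breve\pi_t)\le c(\epsilon)\,\exp\left[(1-\epsilon)\,\mu(A-PS)\,t\right]\left(\mathbb W_{2n}(\pi_0,\breve\pi_0)+\|P_0-\check P_0\|_F\right).$$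
   Context: Filtering model: $dX_t=(AX_t+a)dt+R_1^{1/2}dW_t$, $dY_t=(CX_t+c)dt+R_2^{1/2}dV_t$, $Y_0=0$, where $(W_t,V_t)$ is an $(r_1+r_2)$-dimensional Brownian motion, $X_0$ is an $\mathbb R^{r_1}$-valued Gaussian vector independent of $(W,V)$; $A$ is $r_1\times r_1$, $C$ is $r_2\times r_1$, $a\in\mathbb R^{r_1}$, $c\in\mathbb R^{r_2}$, and $R_1^{1/2},R_2^{1/2}$ are symmetric invertible. Prime denotes transposition. $R=R_1$, $S=C'R_2^{-1}C$, $\mathcal F_t=\sigma(Y_s,s\le t)$. Standing assumption: $(A,R_1^{1/2})$ is a controllable pair and $(A,C)$ is observable. Kalman-Bucy diffusion: the conditional McKean-Vlasov diffusion $$d\overline X_t=(A\overline X_t+a)dt+R_1^{1/2}d\overline W_t+\mathcal P_{\eta_t}C'R_2^{-1}\left[dY_t-\left((C\overline X_t+c)dt+R_2^{1/2}d\overline V_t\right)\right],$$ where $(\overline W,\overline V)$ is an independent copy of $(W,V)$, $\overline X_0$ is a random state, $(\overline W,\overline V,\overline X_0)$ is independent of the signal and the observation, $\eta_t=\mathrm{Law}(\overline X_t\mid\mathcal F_t)$ and $\mathcal P_{\eta}$ is the covariance matrix of the distribution $\eta$. (Equivalently, $\mathcal P_{\eta_t}=P_t$ where $\partial_tP_t=AP_t+P_tA'-P_tSP_t+R$ starts at the covariance matrix $P_0$ of $\overline X_0$.) Both diffusions $\overline X_t$ and $\breve X_t$ are driven by the same observation process $Y$. $\mu(B)=\lambda_{\max}((B+B')/2)$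 is the logarithmic norm; $\|\cdot\|_F$ is the Frobenius norm; $\mathbb W_n(\nu_1,\nu_2)=\inf\mathbb E(\|Z_1-Z_2\|^n)^{1/n}$ (infimum over couplings, Euclidean norm) is the $n$-th Wasserstein distance.
   Formalization: The initial states are assumed to have finite 2n-th moments, and c(ε) may also depend on n, the model and a bound K on these moments; without this the claim fails (same initial mean m→∞ with P_0≠P̌_0, or heavy-tailed initial states). *)

theory Defs
  imports "HOL-Probability.Probability"
begin

section \<open>Matrices\<close>

(* The power operator of the vec type is componentwise, so matrix powers are iterated products. *)
definition matpow :: "real^'n^'n \<Rightarrow> nat \<Rightarrow> real^'n^'n" where
  "matpow A k = (((**) A) ^^ k) (mat 1)"

(* Rank of the block matrix [B, A B, ..., A^(d-1) B] with d = CARD('n): the dimension of the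
   span of all the columns of its blocks. *)
definition controllable_pair :: "real^'n^'n \<Rightarrow> real^'m^'n \<Rightarrow> bool" where
  "controllable_pair A B \<longleftrightarrow> dim (\<Union>k<CARD('n). columns (matpow A k ** B)) = CARD('n)"

(* Rank of the stacked block matrix with blocks C, C A, ..., C A^(d-1). *)
definition observable_pair :: "real^'n^'n \<Rightarrow> real^'n^'m \<Rightarrow> bool" where
  "observable_pair A C \<longleftrightarrow> dim (\<Union>k<CARD('n). rows (C ** matpow A k)) = CARD('n)"

definition pos_semidef :: "real^'n^'n \<Rightarrow> bool" where
  "pos_semidef P \<longleftrightarrow> transpose P = P \<and> (\<forall>x. 0 \<le> x \<bullet> (P *v x))"

(* For symmetric matrices: the (finite, nonempty) set of real eigenvalues then is the spectrum. *)
definition lambda_max :: "real^'n^'n \<Rightarrow> real" where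
  "lambda_max B = Max {l. \<exists>v. v \<noteq> 0 \<and> B *v v = l *\<^sub>R v}"

definition log_norm :: "real^'n^'n \<Rightarrow> real" where
  "log_norm B = lambda_max ((1/2) *\<^sub>R (B + transpose B))"

definition frobenius_norm :: "real^'n^'m \<Rightarrow> real" where
  "frobenius_norm B = sqrt (\<Sum>i\<in>UNIV. \<Sum>j\<in>UNIV. (B $ i $ j)\<^sup>2)"


section \<open>Laws, couplings and Wasserstein distances\<close>

definition mean_vector :: "(real^'n) measure \<Rightarrow> real^'n" where
  "mean_vector \<nu> = (\<chi> i. \<integral>x. x $ i \<partial>\<nu>)"

definition covariance_matrix :: "(real^'n) measure \<Rightarrow> real^'n^'n" where
  "covariance_matrix \<nu> =
     (\<chi> i j. \<integral>x. (x $ i - mean_vector \<nu> $ i) * (x $ j - mean_vector \<nu> $ j) \<partial>\<nu>)"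

definition couplings ::
  "('a::euclidean_space) measure \<Rightarrow> 'a measure \<Rightarrow> ('a \<times> 'a) measure set" where
  "couplings \<nu>1 \<nu>2 =
     {\<gamma>. sets \<gamma> = sets borel \<and> distr \<gamma> borel fst = \<nu>1 \<and> distr \<gamma> borel snd = \<nu>2}"

definition ennreal_root :: "nat \<Rightarrow> ennreal \<Rightarrow> ennreal" where
  "ennreal_root p x = (if x = \<infinity> then \<infinity> else ennreal (root p (enn2real x)))"

definition wasserstein :: "nat \<Rightarrow> ('a::euclidean_space) measure \<Rightarrow> 'a measure \<Rightarrow> ennreal" where
  "wasserstein p \<nu>1 \<nu>2 =
     (INF \<gamma>\<in>couplings \<nu>1 \<nu>2. ennreal_root p (\<integral>\<^sup>+z. ennreal (norm (fst z - snd z) ^ p) \<partial>\<gamma>))"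

(* The normal law with standard deviation \<sigma> \<ge> 0; a point mass if \<sigma> = 0. *)
definition normal_law :: "real \<Rightarrow> real \<Rightarrow> real measure" where
  "normal_law m \<sigma> = (if \<sigma> = 0 then return borel m else density lborel (normal_density m \<sigma>))"

definition gaussian_vector :: "'w measure \<Rightarrow> ('w \<Rightarrow> 'a::euclidean_space) \<Rightarrow> bool" where
  "gaussian_vector M X \<longleftrightarrow> X \<in> borel_measurable M \<and>
     (\<forall>u. \<exists>m. \<exists>\<sigma>\<ge>0. distr M borel (\<lambda>\<omega>. u \<bullet> X \<omega>) = normal_law m \<sigma>)"


section \<open>Processes indexed by nonnegative time\<close>

definition process_sigma ::
  "'w measure \<Rightarrow> real set \<Rightarrow> (real \<Rightarrow> 'w \<Rightarrow> 'a::topological_space) \<Rightarrow> 'w measure" where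
  "process_sigma M T Z =
     sigma (space M) (\<Union>s\<in>T. {Z s -` B \<inter> space M | B. B \<in> sets borel})"

definition continuous_process ::
  "'w measure \<Rightarrow> (real \<Rightarrow> 'w \<Rightarrow> 'a::topological_space) \<Rightarrow> bool" where
  "continuous_process M Z \<longleftrightarrow>
     (\<forall>t\<ge>0. Z t \<in> borel_measurable M) \<and> (\<forall>\<omega>\<in>space M. continuous_on {0..} (\<lambda>t. Z t \<omega>))"

(* Standard Brownian motion in a Euclidean space. The increment over [s,t] is centred Gaussian
   with covariance (t - s) times the identity, expressed through its one-dimensional
   projections. *)
definition brownian_motion ::
  "'w measure \<Rightarrow> (real \<Rightarrow> 'w \<Rightarrow> 'a::euclidean_space) \<Rightarrow> bool" where
  "brownian_motion M B \<longleftrightarrow>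
     continuous_process M B \<and>
     (AE \<omega> in M. B 0 \<omega> = 0) \<and>
     (\<forall>s t u. 0 \<le> s \<and> s \<le> t \<longrightarrow>
        distr M borel (\<lambda>\<omega>. u \<bullet> (B t \<omega> - B s \<omega>)) = normal_law 0 (norm u * sqrt (t - s))) \<and>
     (\<forall>s t. 0 \<le> s \<and> s \<le> t \<longrightarrow>
        prob_space.indep_set M (sets (process_sigma M {0..s} B))
          (sets (vimage_algebra (space M) (\<lambda>\<omega>. B t \<omega> - B s \<omega>) borel)))"

(* The Ito integral I of a path-continuous matrix process H against Z: for every t, the
   left-endpoint Riemann sums along partitions 0 = \<tau> 0 \<le> ... \<le> \<tau> N = t converge in
   probability to I t as the mesh tends to 0. For a continuous adapted integrand and a
   continuous semimartingale integrator this determines the Ito integral. *)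
definition has_ito_integral ::
  "'w measure \<Rightarrow> (real \<Rightarrow> 'w \<Rightarrow> real^'m^'n) \<Rightarrow> (real \<Rightarrow> 'w \<Rightarrow> real^'m) \<Rightarrow> (real \<Rightarrow> 'w \<Rightarrow> real^'n) \<Rightarrow> bool"
where
  "has_ito_integral M H Z I \<longleftrightarrow>
     (\<forall>t\<ge>0. H t \<in> borel_measurable M) \<and> (AE \<omega> in M. continuous_on {0..} (\<lambda>t. H t \<omega>)) \<and>
     continuous_process M Z \<and> continuous_process M I \<and>
     (\<forall>t\<ge>0. \<forall>e>0. \<exists>d>0. \<forall>N \<tau>.
        \<tau> 0 = 0 \<and> \<tau> N = t \<and> (\<forall>i<N. \<tau> i \<le> \<tau> (Suc i) \<and> \<tau> (Suc i) - \<tau> i < d) \<longrightarrow>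
        measure M {\<omega>\<in>space M.
          norm (I t \<omega> - (\<Sum>i<N. H (\<tau> i) \<omega> *v (Z (\<tau> (Suc i)) \<omega> - Z (\<tau> i) \<omega>))) > e} < e)"

(* \<eta> is a regular conditional law of X given the sub-sigma-algebra F of M. *)
definition is_conditional_law ::
  "'w measure \<Rightarrow> 'w measure \<Rightarrow> ('w \<Rightarrow> 'a::topological_space) \<Rightarrow> ('w \<Rightarrow> 'a measure) \<Rightarrow> bool" where
  "is_conditional_law M F X \<eta> \<longleftrightarrow>
     \<eta> \<in> measurable F (prob_algebra borel) \<and>
     (\<forall>B\<in>sets borel. AE \<omega> in M.
        measure (\<eta> \<omega>) B = real_cond_exp M F (\<lambda>\<omega>. indicator B (X \<omega>)) \<omega>)"


section \<open>The filtering model and the Kalman-Bucy diffusion\<close>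

(* R1h and R2h are the square roots of the covariance matrices R1 and R2. The initial value of
   the signal is X 0; the equation for Y at time 0 gives Y 0 = 0. *)
definition filtering_model ::
  "'w measure \<Rightarrow> real^'n^'n \<Rightarrow> real^'n \<Rightarrow> real^'n^'m \<Rightarrow> real^'m \<Rightarrow> real^'n^'n \<Rightarrow> real^'m^'m \<Rightarrow>
   (real \<Rightarrow> 'w \<Rightarrow> real^'n) \<Rightarrow> (real \<Rightarrow> 'w \<Rightarrow> real^'m) \<Rightarrow>
   (real \<Rightarrow> 'w \<Rightarrow> real^'n) \<Rightarrow> (real \<Rightarrow> 'w \<Rightarrow> real^'m) \<Rightarrow> bool" where
  "filtering_model M A a C c R1h R2h W V X Y \<longleftrightarrow>
     prob_space M \<and>
     transpose R1h = R1h \<and> invertible R1h \<and> transpose R2h = R2h \<and> invertible R2h \<and>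
     brownian_motion M (\<lambda>t \<omega>. (W t \<omega>, V t \<omega>)) \<and>
     gaussian_vector M (X 0) \<and>
     prob_space.indep_set M (sets (process_sigma M {0} X))
       (sets (process_sigma M {0..} (\<lambda>t \<omega>. (W t \<omega>, V t \<omega>)))) \<and>
     continuous_process M X \<and> continuous_process M Y \<and>
     (AE \<omega> in M. \<forall>t\<ge>0.
        X t \<omega> = X 0 \<omega> + integral {0..t} (\<lambda>s. A *v X s \<omega> + a) + R1h *v W t \<omega> \<and>
        Y t \<omega> = integral {0..t} (\<lambda>s. C *v X s \<omega> + c) + R2h *v V t \<omega>)"

(* S = C' R2^(-1) C *)
definition information_matrix :: "real^'n^'m \<Rightarrow> real^'m^'m \<Rightarrow> real^'n^'n" where
  "information_matrix C R2h = transpose C ** matrix_inv (R2h ** R2h) ** C"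

(* Xb solves the conditional McKean-Vlasov equation driven by the observation Y of the signal X,
   with noises Wb, Vb and with \<eta> t a version of the conditional law of Xb t given Y on [0,t]
   (square integrability of Xb makes its covariance meaningful; the versions are chosen with
   continuous covariance paths, so that the Ito integral is one of a continuous integrand).
   Wb, Vb and Xb 0 are mutually independent, and jointly independent of (X, Y). *)
definition kalman_bucy_diffusion ::
  "'w measure \<Rightarrow> real^'n^'n \<Rightarrow> real^'n \<Rightarrow> real^'n^'m \<Rightarrow> real^'m \<Rightarrow> real^'n^'n \<Rightarrow> real^'m^'m \<Rightarrow>
   (real \<Rightarrow> 'w \<Rightarrow> real^'n) \<Rightarrow> (real \<Rightarrow> 'w \<Rightarrow> real^'m) \<Rightarrow>
   (real \<Rightarrow> 'w \<Rightarrow> real^'n) \<Rightarrow> (real \<Rightarrow> 'w \<Rightarrow> real^'m) \<Rightarrow>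
   (real \<Rightarrow> 'w \<Rightarrow> real^'n) \<Rightarrow> (real \<Rightarrow> 'w \<Rightarrow> (real^'n) measure) \<Rightarrow> bool" where
  "kalman_bucy_diffusion M A a C c R1h R2h X Y Wb Vb Xb \<eta> \<longleftrightarrow>
     brownian_motion M (\<lambda>t \<omega>. (Wb t \<omega>, Vb t \<omega>)) \<and>
     continuous_process M Xb \<and>
     (\<forall>t\<ge>0. integrable M (\<lambda>\<omega>. (norm (Xb t \<omega>))\<^sup>2)) \<and>
     prob_space.indep_set M (sets (process_sigma M {0} Xb))
       (sets (process_sigma M {0..} (\<lambda>t \<omega>. (Wb t \<omega>, Vb t \<omega>)))) \<and>
     prob_space.indep_set M
       (sets (process_sigma M {0..} (\<lambda>t \<omega>. (Wb t \<omega>, Vb t \<omega>, Xb 0 \<omega>))))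
       (sets (process_sigma M {0..} (\<lambda>t \<omega>. (X t \<omega>, Y t \<omega>)))) \<and>
     (\<forall>t\<ge>0. is_conditional_law M (process_sigma M {0..t} Y) (Xb t) (\<eta> t)) \<and>
     (\<exists>I. has_ito_integral M
            (\<lambda>t \<omega>. covariance_matrix (\<eta> t \<omega>) ** transpose C ** matrix_inv (R2h ** R2h))
            (\<lambda>t \<omega>. Y t \<omega> - (integral {0..t} (\<lambda>s. C *v Xb s \<omega> + c) + R2h *v Vb t \<omega>))
            I \<and>
          (AE \<omega> in M. \<forall>t\<ge>0.
             Xb t \<omega> = Xb 0 \<omega> + integral {0..t} (\<lambda>s. A *v Xb s \<omega> + a) + R1h *v Wb t \<omega> + I t \<omega>))"

end

theory Submission
  imports Defs
begin

text \<open>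
  The difference between a Kalman-Bucy diffusion and the signal solves a linear equation whose
  only nonlinear ingredient is the gain. An Euler scheme for the adjoint equation makes the modulus
  of the conditional characteristic function given the observation explicit: it is the modulus of
  that of the initial state, transported by the flow \<open>\<Phi>\<close> of the gain, times a Gaussian factor.
  Reading off the variance shows that the conditional covariance is the deterministic solution of
  the Riccati equation. Variation of constants then writes the diffusion as \<open>\<Phi>\<^sub>t\<close> applied to its
  initial state, plus a Wiener integral of its own noise, plus a term that depends on the signal.

  Two diffusions are coupled by any coupling \<open>(z\<^sub>1, z\<^sub>2)\<close> of their initial states and one common copy
  of the noise. Their difference is the sum of \<open>\<Phi>\<^sub>t (z\<^sub>1 - z\<^sub>2)\<close>, of \<open>(\<Phi>\<^sub>t - \<Psi>\<^sub>t) (z\<^sub>2 - X\<^sub>0)\<close>, where \<open>\<Psi>\<close> is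
  the second flow, and of Gaussian vectors whose kernels are differences of the two flows. Since two
  Riccati solutions satisfy \<open>p\<^sub>t - q\<^sub>t = \<Phi>\<^sub>t (p\<^sub>0 - q\<^sub>0) \<Psi>\<^sub>t'\<close>, all these differences are bounded by
  a multiple of \<open>exp (\<mu> t) \<parallel>p\<^sub>0 - q\<^sub>0\<parallel>\<close>, where \<open>\<mu>\<close> is the logarithmic norm of \<open>A - P S\<close>.
\<close>

section \<open>Matrices\<close>

text \<open>The gain is a functional of the conditional law, so at the outset it is an unknown
  random process adapted to \<open>Y\<close>, and the adjoint vector that carries a test vector
  \<open>u\<close> back from time \<open>T\<close> depends on the observation up to
  \<open>T\<close>. Against the noise it would be an anticipating integrand. Conditioning repairs
  this: noise and initial state are independent of \<open>Y\<close>, so in a finite sum the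
  observation may be frozen by Fubini, and only afterwards is the mesh sent to zero. This is the
  reason for working with discrete sums. Only the modulus is followed because the terms that involve
  \<open>Y\<close> alone enter as a phase; their limit is never computed. The resulting gain is
  deterministic and differentiable in time, so that from then on stochastic integrals are pathwise
  integrals by parts. No existence theorem for the Riccati equation enters: the diffusion itself
  supplies a solution, and uniqueness follows from the same difference formula that gives the
  stability estimate.\<close>

lemma bounded_bilinear_matrix_mult:
  "bounded_bilinear ((**) :: real^'n^'m \<Rightarrow> real^'k^'n \<Rightarrow> real^'k^'m)"
  unfolding bilinear_conv_bounded_bilinear[symmetric] bilinear_def
  by (auto intro!: linearI simp: vec_eq_iff matrix_matrix_mult_def algebra_simps sum.distrib
      sum_distrib_left)

lemma bounded_bilinear_matrix_vector_mult:
  "bounded_bilinear ((*v) :: real^'n^'m \<Rightarrow> real^'n \<Rightarrow> real^'m)"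
  unfolding bilinear_conv_bounded_bilinear[symmetric] bilinear_def
  by (auto intro!: linearI simp: matrix_vector_right_distrib matrix_vector_mult_add_rdistrib
      scaleR_matrix_vector_assoc matrix_vector_mult_scaleR)

lemma bounded_linear_transpose: "bounded_linear (transpose :: real^'n^'m \<Rightarrow> real^'m^'n)"
  by (intro linear_conv_bounded_linear[THEN iffD1] linearI)
     (auto simp: transpose_def vec_eq_iff)

interpretation mmult: bounded_bilinear "(**) :: real^'n^'m \<Rightarrow> real^'k^'n \<Rightarrow> real^'k^'m"
  by (rule bounded_bilinear_matrix_mult)

interpretation mvmult: bounded_bilinear "(*v) :: real^'n^'m \<Rightarrow> real^'n \<Rightarrow> real^'m"
  by (rule bounded_bilinear_matrix_vector_mult)

text \<open>Nested vectors carry the Euclidean norm of all entries, so the norm of the matrix type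
  is the Frobenius norm of the theorem; estimates can be stated with \<open>norm\<close>
  throughout.\<close>

lemma norm_eq_frobenius: "norm (B :: real^'n^'m) = frobenius_norm B"
  by (simp add: norm_vec_def frobenius_norm_def L2_set_def real_sqrt_pow2 sum_nonneg)

lemma norm_matrix_vector_le: "norm (B *v x) \<le> norm B * norm x"
  for B :: "real^'n^'m"
proof -
  have "norm (B *v x) = L2_set (\<lambda>i. norm (B $ i \<bullet> x)) UNIV"
    by (simp add: norm_vec_def matrix_vector_mul_component)
  also have "\<dots> \<le> L2_set (\<lambda>i. norm (B $ i) * norm x) UNIV"
    by (intro L2_set_mono) (auto simp: Cauchy_Schwarz_ineq2)
  also have "\<dots> = norm B * norm x"
    by (simp add: norm_vec_def L2_set_left_distrib)
  finally show ?thesis .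
qed

lemma norm_transpose: "norm (transpose B) = norm B" for B :: "real^'n^'m"
  unfolding norm_eq_frobenius frobenius_norm_def transpose_def
  by (subst sum.swap) simp

lemma row_matrix_mult: "(B ** D) $ i = transpose D *v (B $ i)"
  for B :: "real^'n^'m" and D :: "real^'k^'n"
  by (simp add: vec_eq_iff matrix_matrix_mult_def matrix_vector_mult_def transpose_def mult.commute)

lemma norm_matrix_mult_le: "norm (B ** D) \<le> norm B * norm D"
  for B :: "real^'n^'m" and D :: "real^'k^'n"
proof -
  have "norm (B ** D) = L2_set (\<lambda>i. norm (transpose D *v (B $ i))) UNIV"
    by (simp add: norm_vec_def[of "B ** D"] row_matrix_mult)
  also have "\<dots> \<le> L2_set (\<lambda>i. norm (B $ i) * norm D) UNIV"
  proof (rule L2_set_mono)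
    show "norm (transpose D *v (B $ i)) \<le> norm (B $ i) * norm D" for i
      using norm_matrix_vector_le[of "transpose D" "B $ i"] unfolding norm_transpose
      by (simp only: mult.commute)
  qed simp
  also have "\<dots> = norm B * norm D"
    by (simp add: norm_vec_def[of B] L2_set_left_distrib)
  finally show ?thesis .
qed

text \<open>The columns of \<open>B\<close> are its values at unit vectors, so each has norm at most
  \<open>c\<close>. The factor \<open>CARD('n)\<close> is the price for passing from the operator
  norm, in which the flow estimates come out, to the Frobenius norm.\<close>

lemma norm_matrix_le_of_operator_bound:
  fixes B :: "real^'n^'m"
  assumes "\<And>x. norm (B *v x) \<le> c * norm x"
  shows "norm B \<le> c * CARD('n)"
proof -
  have "norm B = L2_set (\<lambda>j. norm (transpose B $ j)) UNIV"
    by (metis norm_transpose norm_vec_def)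
  also have "\<dots> \<le> (\<Sum>j\<in>UNIV. norm (transpose B $ j))"
    by (intro L2_set_le_sum) auto
  also have "\<dots> \<le> (\<Sum>j\<in>(UNIV::'n set). c)"
  proof (rule sum_mono)
    fix j
    have "transpose B $ j = B *v axis j 1"
      by (simp add: matrix_vector_mul_component vec_eq_iff transpose_def inner_axis)
    with assms[of "axis j 1"] show "norm (transpose B $ j) \<le> c"
      by simp
  qed
  finally show ?thesis
    by (simp add: mult.commute)
qed

section \<open>Transposition and quadratic forms of matrices\<close>

lemma transpose_add: "transpose (B + D) = transpose B + transpose D"
  by (simp add: transpose_def vec_eq_iff)

lemma transpose_diff: "transpose (B - D) = transpose B - transpose D"
  for B D :: "'a::ab_group_add^'n^'m"
  by (simp add: transpose_def vec_eq_iff)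

lemma inner_matrix_transpose: "x \<bullet> (B *v y) = (transpose B *v x) \<bullet> y"
  for B :: "real^'n^'m"
  by (simp add: dot_lmul_matrix)

lemma inner_transpose_matrix: "x \<bullet> (transpose B *v y) = (B *v x) \<bullet> y"
  for B :: "real^'n^'m"
  by (metis dot_lmul_matrix inner_commute transpose_matrix_vector)

text \<open>Polarization: the form at \<open>axis i 1 + axis j 1\<close> with \<open>i = j\<close>
  determines the diagonal, and then the other entries. Only finitely many test vectors occur, which
  lets almost sure identities for each of them be read as one identity of matrices.\<close>

lemma symmetric_eqI_inner:
  fixes B D :: "real^'n^'n"
  assumes "transpose B = B" "transpose D = D"
    and eq: "\<And>i j. (axis i 1 + axis j 1) \<bullet> (B *v (axis i 1 + axis j 1)) =
      (axis i 1 + axis j 1) \<bullet> (D *v (axis i 1 + axis j 1))"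
  shows "B = D"
proof -
  have comp: "axis i 1 \<bullet> (E *v axis j 1) = E $ i $ j" for E :: "real^'n^'n" and i j
    by (simp add: inner_axis' matrix_vector_mul_component inner_axis)
  have q: "(axis i 1 + axis j 1) \<bullet> (E *v (axis i 1 + axis j 1)) =
      E $ i $ i + E $ j $ j + E $ i $ j + E $ j $ i" for E :: "real^'n^'n" and i j
    by (simp add: inner_add_left inner_add_right matrix_vector_right_distrib comp)
  have tr: "E $ j $ i = E $ i $ j" if "transpose E = E" for E :: "real^'n^'n" and i j
    using arg_cong[OF that, of "\<lambda>E. E $ i $ j"] by (simp add: transpose_def)
  note sym = tr[OF assms(1)] tr[OF assms(2)]
  have "B $ i $ i = D $ i $ i" for i
    using eq[of i i] unfolding q by simp
  with eq have "B $ i $ j = D $ i $ j" for i j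
    unfolding q using sym(1)[of i j] sym(2)[of i j] by (smt (verit))
  thus ?thesis
    by (simp add: vec_eq_iff)
qed

text \<open>\<open>lambda_max\<close> is a \<open>Max\<close> over a set, hence meaningful only once
  the set of eigenvalues is known to be finite. The maximum \<open>l\<close> of the form on the unit
  sphere bounds the form everywhere by homogeneity, and \<open>l\<close> is shown to be an
  eigenvalue.\<close>

lemma rayleigh_le_lambda_max:
  fixes B :: "real^'n^'n"
  assumes sym: "transpose B = B"
  shows "x \<bullet> (B *v x) \<le> lambda_max B * (norm x)\<^sup>2"
proof -
  define f where "f = (\<lambda>x. x \<bullet> (B *v x))"
  have cont: "continuous_on S f" for S
    unfolding f_def by (intro continuous_intros mvmult.continuous_on)
  have "sphere (0::real^'n) 1 \<noteq> {}"
    by simp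
  then obtain v where v: "v \<in> sphere 0 1" and vmax: "\<And>y. y \<in> sphere 0 1 \<Longrightarrow> f y \<le> f v"
    using continuous_attains_sup[OF compact_sphere _ cont, of 0 1] by blast
  define l where "l = f v"
  have nv: "norm v = 1" using v by simp
  have le: "f y \<le> l * (norm y)\<^sup>2" for y
  proof (cases "y = 0")
    case False
    have "f ((1 / norm y) *\<^sub>R y) \<le> l"
      unfolding l_def using False by (intro vmax) auto
    moreover have "f ((1 / norm y) *\<^sub>R y) = f y / (norm y)\<^sup>2"
      by (simp add: f_def matrix_vector_mult_scaleR power2_eq_square)
    ultimately show ?thesis
      using False by (simp add: field_simps)
  qed (simp add: f_def)
  \<comment> \<open>The quadratic form of \<open>l I - B\<close> is nonnegative and vanishes at \<open>v\<close>, so its gradient does.\<close>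
  define w where "w = l *\<^sub>R v - B *v v"
  have key: "0 \<le> 2 * s * (w \<bullet> w) + s\<^sup>2 * (l * (norm w)\<^sup>2 - f w)" for s
  proof -
    have c: "v \<bullet> (B *v w) = w \<bullet> (B *v v)"
      by (metis inner_matrix_transpose sym inner_commute)
    have "f (v + s *\<^sub>R w) = l + 2 * s * (w \<bullet> (B *v v)) + s\<^sup>2 * f w"
      by (simp add: f_def l_def inner_add_left inner_add_right matrix_vector_right_distrib
          matrix_vector_mult_scaleR c power2_eq_square algebra_simps)
    moreover have "(norm (v + s *\<^sub>R w))\<^sup>2 = 1 + 2 * s * (v \<bullet> w) + s\<^sup>2 * (norm w)\<^sup>2"
      using nv by (simp add: dot_square_norm[symmetric] inner_add_left inner_add_right
          inner_commute[of w v] power2_eq_square[of s] algebra_simps norm_eq_1)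
    moreover have "w \<bullet> (B *v v) = l * (v \<bullet> w) - w \<bullet> w"
      by (subst (4) w_def) (simp add: inner_diff_right inner_commute)
    ultimately show ?thesis
      using le[of "v + s *\<^sub>R w"] by (simp add: algebra_simps)
  qed
  have "w \<bullet> w = 0"
  proof (rule ccontr)
    assume "w \<bullet> w \<noteq> 0"
    hence pos: "w \<bullet> w > 0" by simp
    define g where "g = l * (norm w)\<^sup>2 - f w"
    have g0: "g \<ge> 0" using le[of w] by (simp add: g_def)
    \<comment> \<open>A negative step of this size lets the linear term outweigh the quadratic one;
      adding 1 to \<open>g\<close> keeps the denominator positive.\<close>
    define s where "s = - (w \<bullet> w) / (g + 1)"
    have "s < 0" using pos g0 by (simp add: s_def divide_neg_pos)
    moreover have "2 * (w \<bullet> w) + s * g > 0"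
    proof -
      have "- s * g \<le> w \<bullet> w"
        using pos g0 by (simp add: s_def divide_simps)
      thus ?thesis using pos by linarith
    qed
    ultimately have "s * (2 * (w \<bullet> w) + s * g) < 0"
      by (rule mult_neg_pos)
    with key[of s] show False
      by (simp add: g_def algebra_simps power2_eq_square)
  qed
  hence "B *v v = l *\<^sub>R v" by (simp add: w_def)
  moreover have "v \<noteq> 0" using nv by auto
  ultimately have mem: "l \<in> {l. \<exists>v. v \<noteq> 0 \<and> B *v v = l *\<^sub>R v}" by blast
  \<comment> \<open>Eigenvectors for different eigenvalues of a symmetric matrix are orthogonal,
    hence independent, so one eigenvector per eigenvalue gives an injective choice with finite
    image.\<close>
  have fin: "finite {l. \<exists>v. v \<noteq> 0 \<and> B *v v = l *\<^sub>R v}" (is "finite ?E")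
  proof -
    have "\<forall>l\<in>?E. \<exists>v. v \<noteq> 0 \<and> B *v v = l *\<^sub>R v" by blast
    then obtain g where g: "\<And>l. l \<in> ?E \<Longrightarrow> g l \<noteq> 0 \<and> B *v g l = l *\<^sub>R g l"
      using bchoice[of ?E "\<lambda>l v. v \<noteq> 0 \<and> B *v v = l *\<^sub>R v"] by blast
    have orth: "g l \<bullet> g k = 0" if "l \<in> ?E" "k \<in> ?E" "l \<noteq> k" for l k
    proof -
      have "l * (g l \<bullet> g k) = (B *v g l) \<bullet> g k" using g[OF that(1)] by simp
      also have "\<dots> = g l \<bullet> (B *v g k)" by (simp add: inner_matrix_transpose sym)
      also have "\<dots> = k * (g l \<bullet> g k)" using g[OF that(2)] by simp
      finally show ?thesis using that(3) by simp
    qed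
    have "inj_on g ?E"
      using orth g by (metis (no_types, lifting) inj_onI inner_eq_zero_iff)
    moreover have "independent (g ` ?E)"
    proof (rule pairwise_orthogonal_independent)
      show "pairwise orthogonal (g ` ?E)"
        unfolding pairwise_def orthogonal_def using orth by (metis (no_types, lifting) imageE)
      show "0 \<notin> g ` ?E" using g by (metis (no_types, lifting) imageE)
    qed
    ultimately show ?thesis
      using finite_imageD independent_imp_finite by blast
  qed
  have "l \<le> lambda_max B"
    unfolding lambda_max_def by (rule Max_ge[OF fin mem])
  hence "l * (norm x)\<^sup>2 \<le> lambda_max B * (norm x)\<^sup>2"
    by (intro mult_right_mono) auto
  with le[of x] show ?thesis by (simp add: f_def)
qed

text \<open>The skew-symmetric part of \<open>B\<close> contributes nothing to the quadratic form.
  The decay estimates see the logarithmic norm only through this bound and its sign.\<close>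

lemma inner_le_log_norm: "x \<bullet> (B *v x) \<le> log_norm B * (norm x)\<^sup>2"
  for B :: "real^'n^'n"
proof -
  let ?D = "(1/2) *\<^sub>R (B + transpose B)"
  have "transpose ?D = ?D"
    by (simp add: transpose_def vec_eq_iff)
  moreover have "x \<bullet> (?D *v x) = x \<bullet> (B *v x)"
    by (simp add: scaleR_matrix_vector_assoc[symmetric] matrix_vector_mult_add_rdistrib
        inner_add_right inner_transpose_matrix inner_commute[of _ x] del: transpose_matrix_vector)
  ultimately show ?thesis
    using rayleigh_le_lambda_max[of ?D x] by (simp add: log_norm_def)
qed

text \<open>Diagonal entries lie between 0 and \<open>c\<close>; nonnegativity of the form at
  \<open>axis i 1\<close> plus or minus \<open>axis j 1\<close> bounds the other entries by the
  diagonal. The constant is generous, since only its finiteness matters.\<close>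

lemma norm_pos_semidef_le:
  fixes D :: "real^'n^'n"
  assumes psd: "pos_semidef D" and le: "\<And>x. x \<bullet> (D *v x) \<le> c * (norm x)\<^sup>2"
  shows "norm D \<le> 2 * c * (real CARD('n))\<^sup>2"
proof -
  have comp: "axis i 1 \<bullet> (E *v axis j 1) = E $ i $ j" for E :: "real^'n^'n" and i j
    by (simp add: inner_axis' matrix_vector_mul_component inner_axis)
  have sym: "D $ j $ i = D $ i $ j" for i j
  proof -
    have "transpose D = D" using psd by (simp add: pos_semidef_def)
    from arg_cong[OF this, of "\<lambda>D. D $ i $ j"] show ?thesis by (simp add: transpose_def)
  qed
  have dg: "0 \<le> D $ i $ i" "D $ i $ i \<le> c" for i
    using psd le[of "axis i 1"] comp[of i D i] unfolding pos_semidef_def by (metis, simp)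
  have p: "0 \<le> D $ i $ i + D $ j $ j + 2 * s * (D $ i $ j)" if s: "s * s = 1" for s i j
  proof -
    have "0 \<le> (axis i 1 + s *\<^sub>R axis j 1) \<bullet> (D *v (axis i 1 + s *\<^sub>R axis j 1))"
      using psd unfolding pos_semidef_def by blast
    also have "\<dots> = D $ i $ i + (s * s) * D $ j $ j + 2 * s * (D $ i $ j)"
      by (simp add: inner_add_left inner_add_right matrix_vector_right_distrib comp
          matrix_vector_mult_scaleR sym[of i j] algebra_simps)
    finally show ?thesis using s by simp
  qed
  have entry: "\<bar>D $ i $ j\<bar> \<le> 2 * c" for i j
    using p[of 1 i j] p[of "-1" i j] dg[of i] dg[of j] by simp
  have "norm D \<le> (\<Sum>i\<in>UNIV. norm (D $ i))"
    by (simp add: norm_vec_def L2_set_le_sum)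
  also have "\<dots> \<le> (\<Sum>i\<in>(UNIV::'n set). \<Sum>j\<in>(UNIV::'n set). 2 * c)"
  proof (rule sum_mono)
    fix i
    have "norm (D $ i) \<le> (\<Sum>j\<in>UNIV. norm (D $ i $ j))"
      by (simp add: norm_vec_def L2_set_le_sum)
    also have "\<dots> \<le> (\<Sum>j\<in>(UNIV::'n set). 2 * c)"
      using entry by (intro sum_mono) simp
    finally show "norm (D $ i) \<le> (\<Sum>j\<in>(UNIV::'n set). 2 * c)" .
  qed
  finally show ?thesis by (simp add: power2_eq_square mult_ac)
qed

section \<open>Linear differential equations\<close>

text \<open>Derivatives are taken within the half line, which makes them one-sided at 0; near
  \<open>t\<close> this agrees with any interval that extends beyond \<open>t\<close>.\<close>

lemma has_vector_derivative_atLeastI: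
  fixes t :: real
  assumes "t < b" "(f has_vector_derivative f') (at t within {0..b})"
  shows "(f has_vector_derivative f') (at t within {0..})"
proof -
  have "at t within {0..} = at t within {0..b}"
    using assms(1) by (intro at_within_nhd[of _ "{..<b}"]) auto
  thus ?thesis using assms(2) by simp
qed

lemma integral_has_vector_derivative_atLeast:
  fixes f :: "real \<Rightarrow> 'a::banach"
  assumes "continuous_on {0..} f" "0 \<le> t"
  shows "((\<lambda>u. integral {0..u} f) has_vector_derivative f t) (at t within {0..})"
proof (rule has_vector_derivative_atLeastI)
  show "((\<lambda>u. integral {0..u} f) has_vector_derivative f t) (at t within {0..t+1})"
    using assms by (intro integral_has_vector_derivative continuous_on_subset[OF assms(1)]) auto
qed simp

lemma continuous_on_integral_atLeast:
  fixes f :: "real \<Rightarrow> 'a::banach"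
  assumes "continuous_on {0..} f"
  shows "continuous_on {0..} (\<lambda>u. integral {0..u} f)"
  using integral_has_vector_derivative_atLeast[OF assms]
  by (auto simp: continuous_on_eq_continuous_within intro: has_vector_derivative_continuous)

lemma continuous_on_has_vector_derivative:
  assumes "\<And>t. t \<in> S \<Longrightarrow> (f has_vector_derivative f' t) (at t within S)"
  shows "continuous_on S f"
  using assms by (auto simp: continuous_on_eq_continuous_within intro: has_vector_derivative_continuous)

lemma vector_derivative_integral:
  fixes f :: "real \<Rightarrow> 'a::banach"
  assumes "\<And>t. 0 \<le> t \<Longrightarrow> (f has_vector_derivative f' t) (at t within {0..})" "0 \<le> a" "a \<le> b"
  shows "(f' has_integral (f b - f a)) {a..b}"
  using assms(2,3) by (intro fundamental_theorem_of_calculus)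
    (auto intro!: has_vector_derivative_within_subset[OF assms(1)])

lemma nondecreasing_of_vector_derivative:
  fixes f :: "real \<Rightarrow> real"
  assumes der: "\<And>t. 0 \<le> t \<Longrightarrow> (f has_vector_derivative f' t) (at t within {0..})"
    and "0 \<le> a" "a \<le> b" and nn: "\<And>t. a \<le> t \<Longrightarrow> t \<le> b \<Longrightarrow> 0 \<le> f' t"
  shows "f a \<le> f b"
  using has_integral_nonneg[OF vector_derivative_integral[OF der assms(2,3)]] nn by auto

lemma constant_of_vector_derivative:
  fixes f :: "real \<Rightarrow> 'a::banach"
  assumes der: "\<And>t. 0 \<le> t \<Longrightarrow> (f has_vector_derivative 0) (at t within {0..})" and "0 \<le> t"
  shows "f t = f 0"
  using has_integral_unique[OF has_integral_0 vector_derivative_integral[of f "\<lambda>_. 0", OF der, of 0 t]]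
    assms(2) by simp

text \<open>The Dyson series of iterated integrals. On \<open>{0..b}\<close> its \<open>k\<close>-th
  term is at most a constant times \<open>(\<kappa> * b) ^ k / fact k\<close>, so the series
  converges uniformly there and its sum solves the integral equation.\<close>

lemma linear_ode_exists:
  fixes L :: "real \<Rightarrow> real^'n^'n"
  assumes L: "continuous_on {0..} L"
  obtains \<Phi> where "\<Phi> 0 = mat 1"
    "\<And>t. 0 \<le> t \<Longrightarrow> (\<Phi> has_vector_derivative (L t ** \<Phi> t)) (at t within {0..})"
proof -
  define T :: "nat \<Rightarrow> real \<Rightarrow> real^'n^'n" where
    "T = rec_nat (\<lambda>_. mat 1) (\<lambda>_ g t. integral {0..t} (\<lambda>s. L s ** g s))"
  have T0: "T 0 t = mat 1" and TS: "T (Suc k) t = integral {0..t} (\<lambda>s. L s ** T k s)" for k t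
    by (simp_all add: T_def)
  have Tc: "continuous_on {0..} (T k)" for k
  proof (induction k)
    case 0 show ?case by (simp add: T0[abs_def])
  next
    case (Suc k)
    show ?case unfolding TS[abs_def]
      by (intro continuous_on_integral_atLeast mmult.continuous_on L Suc)
  qed
  have bound: "norm (T k t) \<le> norm (mat 1 :: real^'n^'n) * ((\<kappa> * t) ^ k / fact k)"
    if \<kappa>: "\<And>s. s \<in> {0..b} \<Longrightarrow> norm (L s) \<le> \<kappa>" and t: "t \<in> {0..b}" for \<kappa> b k t
    using t
  proof (induction k arbitrary: t)
    case 0 show ?case by (simp add: T0)
  next
    case (Suc k)
    let ?c = "norm (mat 1 :: real^'n^'n)"
    have \<kappa>0: "0 \<le> \<kappa>" using \<kappa>[OF Suc.prems] norm_ge_zero order_trans by blast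
    have int: "((\<lambda>s. \<kappa> * (?c * ((\<kappa> * s) ^ k / fact k))) has_integral
        ?c * ((\<kappa> * t) ^ Suc k / fact (Suc k)) - ?c * ((\<kappa> * 0) ^ Suc k / fact (Suc k))) {0..t}"
    proof (rule fundamental_theorem_of_calculus)
      fix s
      have "((\<lambda>s. ?c * ((\<kappa> * s) ^ Suc k / fact (Suc k))) has_real_derivative
          ?c * ((real (Suc k) * ((\<kappa> * s) ^ k * \<kappa>)) / fact (Suc k))) (at s within {0..t})"
        by (auto intro!: derivative_eq_intros simp del: power_Suc of_nat_Suc)
      also have "?c * ((real (Suc k) * ((\<kappa> * s) ^ k * \<kappa>)) / fact (Suc k)) =
          \<kappa> * (?c * ((\<kappa> * s) ^ k / fact k))"
        by (simp add: divide_simps del: of_nat_Suc)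
      finally show "((\<lambda>s. ?c * ((\<kappa> * s) ^ Suc k / fact (Suc k))) has_vector_derivative
          \<kappa> * (?c * ((\<kappa> * s) ^ k / fact k))) (at s within {0..t})"
        by (simp only: has_real_derivative_iff_has_vector_derivative)
    qed (use Suc.prems in auto)
    have "norm (T (Suc k) t) \<le> integral {0..t} (\<lambda>s. \<kappa> * (?c * ((\<kappa> * s) ^ k / fact k)))"
      unfolding TS
    proof (rule integral_norm_bound_integral)
      show "(\<lambda>s. L s ** T k s) integrable_on {0..t}"
        by (intro integrable_continuous_interval mmult.continuous_on continuous_on_subset[OF L]
            continuous_on_subset[OF Tc]) auto
      show "(\<lambda>s. \<kappa> * (?c * ((\<kappa> * s) ^ k / fact k))) integrable_on {0..t}"
        using int by (rule has_integral_integrable)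
      fix s assume s: "s \<in> {0..t}"
      have sb: "s \<in> {0..b}" using s Suc.prems by auto
      show "norm (L s ** T k s) \<le> \<kappa> * (?c * ((\<kappa> * s) ^ k / fact k))"
        by (intro order_trans[OF norm_matrix_mult_le] mult_mono \<kappa> Suc.IH sb \<kappa>0) auto
    qed
    also have "\<dots> = ?c * ((\<kappa> * t) ^ Suc k / fact (Suc k))"
      using integral_unique[OF int] by simp
    finally show ?case .
  qed
  define S where "S = (\<lambda>n t. \<Sum>k<n. T k t)"
  define \<Phi> where "\<Phi> = (\<lambda>t. \<Sum>k. T k t)"
  have unif: "uniform_limit {0..b} S \<Phi> sequentially" for b
  proof -
    have "compact (L ` {0..b})"
      by (intro compact_continuous_image continuous_on_subset[OF L]) auto
    then obtain \<kappa> where \<kappa>: "\<And>s. s \<in> {0..b} \<Longrightarrow> norm (L s) \<le> \<kappa>"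
      using compact_imp_bounded bounded_iff by (metis imageI)
    have "uniform_limit {0..b} (\<lambda>n x. \<Sum>k<n. T k x) (\<lambda>x. \<Sum>k. T k x) sequentially"
    proof (rule Weierstrass_m_test)
      fix n t assume t: "t \<in> {0..b}"
      have k0: "0 \<le> \<kappa>" using \<kappa>[OF t] norm_ge_zero order_trans by blast
      have "norm (T n t) \<le> norm (mat 1 :: real^'n^'n) * ((\<kappa> * t) ^ n / fact n)"
        by (rule bound[OF \<kappa> t])
      also have "\<dots> \<le> norm (mat 1 :: real^'n^'n) * ((\<kappa> * b) ^ n / fact n)"
        using t k0 by (intro mult_left_mono divide_right_mono power_mono) auto
      finally show "norm (T n t) \<le> norm (mat 1 :: real^'n^'n) * ((\<kappa> * b) ^ n / fact n)" .
    next
      show "summable (\<lambda>n. norm (mat 1 :: real^'n^'n) * ((\<kappa> * b) ^ n / fact n))"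
        using summable_exp[of "\<kappa> * b"] by (intro summable_mult) (simp add: field_simps)
    qed
    thus ?thesis by (simp add: S_def \<Phi>_def)
  qed
  have Sc: "continuous_on {0..b} (S n)" for n b
    unfolding S_def by (intro continuous_on_sum continuous_on_subset[OF Tc]) auto
  have \<Phi>b: "continuous_on {0..b} \<Phi>" for b
    by (rule uniform_limit_theorem[OF _ unif]) (simp_all add: Sc)
  have \<Phi>c: "continuous_on {0..} \<Phi>"
    unfolding continuous_on_eq_continuous_within
  proof
    fix t :: real assume t: "t \<in> {0..}"
    have "at t within {0..} = at t within {0..t+1}"
      by (intro at_within_nhd[of _ "{..<t+1}"]) auto
    with \<Phi>b[of "t+1"] t show "continuous (at t within {0..}) \<Phi>"
      by (auto simp: continuous_on_eq_continuous_within)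
  qed
  \<comment> \<open>Each term of the series is the integral of \<open>L\<close> times the preceding
    one, so the integral equation holds between consecutive partial sums and passes to the uniform
    limit.\<close>
  have eq: "\<Phi> t = mat 1 + integral {0..t} (\<lambda>s. L s ** \<Phi> s)" if t: "0 \<le> t" for t
  proof -
    have Lb: "continuous_on {0..t} L" by (rule continuous_on_subset[OF L]) auto
    have ul: "uniform_limit {0..t} (\<lambda>n s. L s ** S n s) (\<lambda>s. L s ** \<Phi> s) sequentially"
      by (intro mmult.bounded_uniform_limit uniform_limit_const unif compact_imp_bounded
          compact_continuous_image Lb \<Phi>b) auto

    have lim: "(\<lambda>n. integral {0..t} (\<lambda>s. L s ** S n s)) \<longlonglongrightarrow> integral {0..t} (\<lambda>s. L s ** \<Phi> s)"
    proof -
      obtain I J where IJ: "\<And>n. ((\<lambda>s. L s ** S n s) has_integral I n) {0..t}"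
        "((\<lambda>s. L s ** \<Phi> s) has_integral J) {0..t}" "I \<longlonglongrightarrow> J"
        using uniform_limit_integral[OF ul mmult.continuous_on[OF Lb Sc] trivial_limit_sequentially]
        by blast
      thus ?thesis by (simp add: integral_unique[OF IJ(1)] integral_unique[OF IJ(2)])
    qed
    have SSuc: "mat 1 + integral {0..t} (\<lambda>s. L s ** S n s) = S (Suc n) t" for n
    proof -
      have "integral {0..t} (\<lambda>s. L s ** S n s) = (\<Sum>k<n. T (Suc k) t)"
        unfolding S_def TS mmult.sum_right
        by (intro integral_sum integrable_continuous_interval mmult.continuous_on Lb
            continuous_on_subset[OF Tc]) auto
      thus ?thesis
        by (simp add: S_def sum.lessThan_Suc_shift T0 del: sum.lessThan_Suc)
    qed
    have "(\<lambda>n. S (Suc n) t) \<longlonglongrightarrow> mat 1 + integral {0..t} (\<lambda>s. L s ** \<Phi> s)"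
      using tendsto_add[OF tendsto_const lim, of "mat 1"] unfolding SSuc .
    moreover have "(\<lambda>n. S (Suc n) t) \<longlonglongrightarrow> \<Phi> t"
      using tendsto_uniform_limitI[OF unif[of t], of t] t by (auto intro: LIMSEQ_Suc)
    ultimately show ?thesis using LIMSEQ_unique by blast
  qed
  show ?thesis
  proof (rule that)
    show "\<Phi> 0 = mat 1" using eq[of 0] by simp
    fix t :: real assume t: "0 \<le> t"
    have "((\<lambda>t. mat 1 + integral {0..t} (\<lambda>s. L s ** \<Phi> s)) has_vector_derivative 0 + L t ** \<Phi> t)
        (at t within {0..})"
      by (intro has_vector_derivative_add has_vector_derivative_const
          integral_has_vector_derivative_atLeast mmult.continuous_on L \<Phi>c t)
    thus "(\<Phi> has_vector_derivative (L t ** \<Phi> t)) (at t within {0..})"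
      using has_vector_derivative_transform[of t "{0..}" \<Phi>
          "\<lambda>t. mat 1 + integral {0..t} (\<lambda>s. L s ** \<Phi> s)" "L t ** \<Phi> t"] eq t by auto
  qed
qed

text \<open>\<open>\<Phi> t ** \<Gamma> s\<close> is the transition matrix from time
  \<open>s\<close> to time \<open>t\<close>. The inverse flow is kept with a differential equation
  of its own because the estimates differentiate this product in \<open>s\<close>.\<close>

definition fundamental_pair ::
  "(real \<Rightarrow> real^'n^'n) \<Rightarrow> (real \<Rightarrow> real^'n^'n) \<Rightarrow> (real \<Rightarrow> real^'n^'n) \<Rightarrow> bool" where
  "fundamental_pair L \<Phi> \<Gamma> \<longleftrightarrow> \<Phi> 0 = mat 1 \<and> \<Gamma> 0 = mat 1 \<and>
     (\<forall>t\<ge>0. (\<Phi> has_vector_derivative (L t ** \<Phi> t)) (at t within {0..}) \<and>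
        (\<Gamma> has_vector_derivative (- (\<Gamma> t ** L t))) (at t within {0..}) \<and>
        \<Phi> t ** \<Gamma> t = mat 1 \<and> \<Gamma> t ** \<Phi> t = mat 1)"

text \<open>The inverse flow is the transpose of the solution for \<open>- transpose (L t)\<close>;
  the product \<open>\<Gamma> t ** \<Phi> t\<close> has derivative zero, and one-sided inverses of
  square matrices are two-sided.\<close>

lemma fundamental_pair_exists:
  fixes L :: "real \<Rightarrow> real^'n^'n"
  assumes L: "continuous_on {0..} L"
  obtains \<Phi> \<Gamma> where "fundamental_pair L \<Phi> \<Gamma>"
proof -
  have "continuous_on {0..} (\<lambda>t. - transpose (L t))"
    by (intro continuous_on_minus bounded_linear.continuous_on[OF bounded_linear_transpose] L)
  then obtain \<Psi> where \<Psi>: "\<Psi> 0 = mat 1"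
    "\<And>t. 0 \<le> t \<Longrightarrow> (\<Psi> has_vector_derivative (- transpose (L t) ** \<Psi> t)) (at t within {0..})"
    using linear_ode_exists by blast
  obtain \<Phi> where \<Phi>: "\<Phi> 0 = mat 1"
    "\<And>t. 0 \<le> t \<Longrightarrow> (\<Phi> has_vector_derivative (L t ** \<Phi> t)) (at t within {0..})"
    using linear_ode_exists[OF L] by blast
  define \<Gamma> where "\<Gamma> = (\<lambda>t. transpose (\<Psi> t))"
  have \<Gamma>': "(\<Gamma> has_vector_derivative (- (\<Gamma> t ** L t))) (at t within {0..})" if t: "0 \<le> t" for t
  proof -
    have "(\<Gamma> has_vector_derivative transpose (- transpose (L t) ** \<Psi> t)) (at t within {0..})"
      unfolding \<Gamma>_def
      by (rule bounded_linear.has_vector_derivative[OF bounded_linear_transpose \<Psi>(2)[OF t]])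
    moreover have "transpose (- transpose (L t) ** \<Psi> t) = - (\<Gamma> t ** L t)"
      by (simp add: \<Gamma>_def matrix_transpose_mul mmult.minus_left
          linear_neg[OF bounded_linear.linear[OF bounded_linear_transpose]])
    ultimately show ?thesis by simp
  qed
  have inv: "\<Gamma> t ** \<Phi> t = mat 1" if t: "0 \<le> t" for t
  proof -
    have "((\<lambda>t. \<Gamma> t ** \<Phi> t) has_vector_derivative 0) (at t within {0..})" if t: "0 \<le> t" for t
      using mmult.has_vector_derivative[OF \<Gamma>'[OF t] \<Phi>(2)[OF t]]
      by (simp add: mmult.minus_left matrix_mul_assoc)
    from constant_of_vector_derivative[OF this t] show ?thesis
      using \<Phi>(1) \<Psi>(1) by (simp add: \<Gamma>_def)
  qed
  have "\<Phi> t ** \<Gamma> t = mat 1" if "0 \<le> t" for t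
    using inv[OF that] matrix_left_right_inverse by blast
  moreover have "\<Gamma> 0 = mat 1"
    using \<Psi>(1) by (simp add: \<Gamma>_def)
  ultimately have "fundamental_pair L \<Phi> \<Gamma>"
    unfolding fundamental_pair_def using \<Phi> \<Gamma>' inv by blast
  thus ?thesis by (rule that)
qed

section \<open>The backward adjoint equation and its estimates\<close>

lemma fundamental_pairD:
  assumes "fundamental_pair L \<Phi> \<Gamma>"
  shows "\<Phi> 0 = mat 1" "\<Gamma> 0 = mat 1"
    "0 \<le> t \<Longrightarrow> (\<Phi> has_vector_derivative (L t ** \<Phi> t)) (at t within {0..})"
    "0 \<le> t \<Longrightarrow> (\<Gamma> has_vector_derivative (- (\<Gamma> t ** L t))) (at t within {0..})"
    "0 \<le> t \<Longrightarrow> \<Phi> t ** \<Gamma> t = mat 1" "0 \<le> t \<Longrightarrow> \<Gamma> t ** \<Phi> t = mat 1"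
    "continuous_on {0..} \<Phi>" "continuous_on {0..} \<Gamma>"
  using assms unfolding fundamental_pair_def
  by (auto intro!: continuous_on_has_vector_derivative)

text \<open>As a function of \<open>s\<close>, the transposed transition matrix applied to
  \<open>y\<close> runs backwards from the value \<open>y\<close> at \<open>s = t\<close>. All
  bounds for transition matrices come from energy estimates for this vector equation.\<close>

lemma adjoint_flow_derivative:
  fixes y :: "real^'n"
  assumes "fundamental_pair L \<Phi> \<Gamma>" "0 \<le> s"
  shows "((\<lambda>s. transpose (\<Phi> t ** \<Gamma> s) *v y) has_vector_derivative
    - (transpose (L s) *v (transpose (\<Phi> t ** \<Gamma> s) *v y))) (at s within {0..})"
proof -
  have bl: "bounded_linear (\<lambda>G. transpose (\<Phi> t ** G) *v y)"
    by (intro bounded_linear_compose[OF mvmult.bounded_linear_left]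
        bounded_linear_compose[OF bounded_linear_transpose] mmult.bounded_linear_right)
  have "((\<lambda>s. transpose (\<Phi> t ** \<Gamma> s) *v y) has_vector_derivative
    transpose (\<Phi> t ** - (\<Gamma> s ** L s)) *v y) (at s within {0..})"
    by (rule bounded_linear.has_vector_derivative[OF bl fundamental_pairD(4)[OF assms]])
  moreover have "transpose (\<Phi> t ** - (\<Gamma> s ** L s)) *v y =
      - (transpose (L s) *v (transpose (\<Phi> t ** \<Gamma> s) *v y))"
    by (simp add: matrix_transpose_mul mmult.minus_left mmult.minus_right matrix_mul_assoc mvmult.minus_left
          linear_neg[OF bounded_linear.linear[OF bounded_linear_transpose]] matrix_vector_mul_assoc
          del: transpose_matrix_vector)
  ultimately show ?thesis by simp
qed

lemma adjoint_flow_end: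
  assumes "fundamental_pair L \<Phi> \<Gamma>" "0 \<le> t"
  shows "transpose (\<Phi> t ** \<Gamma> t) *v y = y"
  using fundamental_pairD(5)[OF assms] by (simp add: transpose_mat del: transpose_matrix_vector)

lemma quadratic_form_derivative:
  fixes q :: "real \<Rightarrow> real^'n"
  assumes q: "(q has_vector_derivative - (transpose L *v q s)) (at s within S)"
    and p: "(p has_vector_derivative p') (at s within S)"
  shows "((\<lambda>s. q s \<bullet> (p s *v q s)) has_vector_derivative
    q s \<bullet> ((p' - L ** p s - p s ** transpose L) *v q s)) (at s within S)"
proof -
  have "((\<lambda>s. q s \<bullet> (p s *v q s)) has_vector_derivative
      q s \<bullet> (p s *v (- (transpose L *v q s)) + p' *v q s) + (- (transpose L *v q s)) \<bullet> (p s *v q s))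
      (at s within S)"
    by (intro bounded_bilinear.has_vector_derivative[OF bounded_bilinear_inner]
        mvmult.has_vector_derivative q p)
  moreover have "q s \<bullet> (p s *v (- (transpose L *v q s)) + p' *v q s) +
      (- (transpose L *v q s)) \<bullet> (p s *v q s) =
      q s \<bullet> ((p' - L ** p s - p s ** transpose L) *v q s)"
    by (simp add: mvmult.minus_right mvmult.diff_left inner_add_right inner_diff_right
        matrix_vector_mul_assoc[symmetric] inner_matrix_transpose[of "q s" L]
        del: transpose_matrix_vector)
  ultimately show ?thesis by simp
qed

lemma norm_square_derivative:
  fixes q :: "real \<Rightarrow> real^'n"
  assumes q: "(q has_vector_derivative - (transpose L *v q s)) (at s within S)"
  shows "((\<lambda>s. (norm (q s))\<^sup>2) has_vector_derivative - 2 * (q s \<bullet> (L *v q s))) (at s within S)"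
proof -
  have "((\<lambda>s. q s \<bullet> (mat 1 *v q s)) has_vector_derivative
      q s \<bullet> ((0 - L ** mat 1 - mat 1 ** transpose L) *v q s)) (at s within S)"
    by (intro quadratic_form_derivative q has_vector_derivative_const)
  moreover have "q s \<bullet> ((0 - L ** mat 1 - mat 1 ** transpose L) *v q s) = - 2 * (q s \<bullet> (L *v q s))"
    by (simp add: mvmult.diff_left mvmult.minus_left inner_diff_right inner_transpose_matrix inner_commute
        del: transpose_matrix_vector)
  ultimately show ?thesis by (simp add: power2_norm_eq_inner)
qed

text \<open>\<open>\<Lambda>\<close> is an antiderivative of a bound for the numerical range of \<open>L\<close>.\<close>

lemma adjoint_flow_bound:
  fixes y :: "real^'n"
  assumes fp: "fundamental_pair L \<Phi> \<Gamma>" and st: "0 \<le> s" "s \<le> t"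
    and L: "\<And>r x. s \<le> r \<Longrightarrow> r \<le> t \<Longrightarrow> x \<bullet> (L r *v x) \<le> l r * (norm x)\<^sup>2"
    and \<Lambda>: "\<And>r. 0 \<le> r \<Longrightarrow> (\<Lambda> has_real_derivative l r) (at r within {0..})"
  shows "norm (transpose (\<Phi> t ** \<Gamma> s) *v y) \<le> exp (\<Lambda> t - \<Lambda> s) * norm y"
proof -
  define q where "q = (\<lambda>r. transpose (\<Phi> t ** \<Gamma> r) *v y)"
  \<comment> \<open>Gronwall's inequality in monotone form: the weight compensates the fastest
    decrease of the squared norm that \<open>l\<close> permits.\<close>
  have "exp (2 * \<Lambda> s) * (norm (q s))\<^sup>2 \<le> exp (2 * \<Lambda> t) * (norm (q t))\<^sup>2"
  proof (rule nondecreasing_of_vector_derivative[OF _ st])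
    fix r :: real assume r: "0 \<le> r"
    have "((\<lambda>r. exp (2 * \<Lambda> r)) has_vector_derivative exp (2 * \<Lambda> r) * (2 * l r)) (at r within {0..})"
      unfolding has_real_derivative_iff_has_vector_derivative[symmetric]
      by (auto intro!: derivative_eq_intros \<Lambda> r)
    from has_vector_derivative_mult[OF this norm_square_derivative[of q "L r" r "{0..}"]]
      adjoint_flow_derivative[OF fp r, of t y]
    show "((\<lambda>r. exp (2 * \<Lambda> r) * (norm (q r))\<^sup>2) has_vector_derivative
        exp (2 * \<Lambda> r) * (- 2 * (q r \<bullet> (L r *v q r))) + exp (2 * \<Lambda> r) * (2 * l r) * (norm (q r))\<^sup>2)
        (at r within {0..})"
      by (simp add: q_def del: transpose_matrix_vector)
  next
    fix r assume "s \<le> r" "r \<le> t"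
    from L[OF this, of "q r"]
    have "0 \<le> exp (2 * \<Lambda> r) * (2 * (l r * (norm (q r))\<^sup>2 - q r \<bullet> (L r *v q r)))"
      by (intro mult_nonneg_nonneg) auto
    thus "0 \<le> exp (2 * \<Lambda> r) * (- 2 * (q r \<bullet> (L r *v q r))) + exp (2 * \<Lambda> r) * (2 * l r) * (norm (q r))\<^sup>2"
      by (simp add: algebra_simps)
  qed
  hence "(exp (\<Lambda> s) * norm (q s))\<^sup>2 \<le> (exp (\<Lambda> t) * norm (q t))\<^sup>2"
    by (simp add: power_mult_distrib exp_double)
  hence "exp (\<Lambda> s) * norm (q s) \<le> exp (\<Lambda> t) * norm (q t)"
    by (rule power2_le_imp_le) simp
  moreover have "q t = y"
    unfolding q_def using st by (intro adjoint_flow_end[OF fp]) auto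
  ultimately show ?thesis
    by (simp add: q_def exp_diff field_simps del: transpose_matrix_vector)
qed

text \<open>Multiplying \<open>D\<close> from both sides by the inverse flows gives a constant
  matrix.\<close>

lemma two_sided_flow:
  fixes D :: "real \<Rightarrow> real^'n^'n"
  assumes fp: "fundamental_pair L \<Phi> \<Gamma>" and fp2: "fundamental_pair L2 \<Phi>2 \<Gamma>2" and t: "0 \<le> t"
    and D: "\<And>s. 0 \<le> s \<Longrightarrow>
      (D has_vector_derivative (L s ** D s + D s ** transpose (L2 s))) (at s within {0..})"
  shows "D t = \<Phi> t ** D 0 ** transpose (\<Phi>2 t)"
proof -
  define f where "f = (\<lambda>s. \<Gamma> s ** D s ** transpose (\<Gamma>2 s))"
  have "(f has_vector_derivative 0) (at s within {0..})" if s: "0 \<le> s" for s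
  proof -
    have "(f has_vector_derivative \<Gamma> s ** D s ** transpose (- (\<Gamma>2 s ** L2 s)) +
        (\<Gamma> s ** (L s ** D s + D s ** transpose (L2 s)) + - (\<Gamma> s ** L s) ** D s) ** transpose (\<Gamma>2 s))
        (at s within {0..})"
      unfolding f_def
      by (intro mmult.has_vector_derivative bounded_linear.has_vector_derivative[OF bounded_linear_transpose]
          fundamental_pairD(4)[OF fp] fundamental_pairD(4)[OF fp2] D s)
    moreover have "\<Gamma> s ** D s ** transpose (- (\<Gamma>2 s ** L2 s)) +
        (\<Gamma> s ** (L s ** D s + D s ** transpose (L2 s)) + - (\<Gamma> s ** L s) ** D s) ** transpose (\<Gamma>2 s) = 0"
      by (simp add: mmult.add_left mmult.add_right mmult.minus_left mmult.minus_right matrix_mul_assoc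
          matrix_transpose_mul linear_neg[OF bounded_linear.linear[OF bounded_linear_transpose]])
    ultimately show ?thesis by simp
  qed
  from constant_of_vector_derivative[OF this t]
  have "\<Gamma> t ** D t ** transpose (\<Gamma>2 t) = D 0"
    using fundamental_pairD(2)[OF fp] fundamental_pairD(2)[OF fp2] by (simp add: f_def)
  hence "\<Phi> t ** D 0 ** transpose (\<Phi>2 t) =
      (\<Phi> t ** \<Gamma> t) ** D t ** (transpose (\<Gamma>2 t) ** transpose (\<Phi>2 t))"
    by (metis matrix_mul_assoc)
  also have "\<dots> = D t"
    using fundamental_pairD(5)[OF fp t] fundamental_pairD(5)[OF fp2 t]
    by (simp add: matrix_transpose_mul[symmetric])
  finally show ?thesis by simp
qed

section \<open>Riccati equations\<close>

text \<open>Positive semidefiniteness is part of the notion: it supplies the symmetry used to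
  factorize differences and the sign used to bound the flow.\<close>

definition riccati_solution ::
  "real^'n^'n \<Rightarrow> real^'n^'n \<Rightarrow> real^'n^'n \<Rightarrow> real^'n^'n \<Rightarrow> (real \<Rightarrow> real^'n^'n) \<Rightarrow> bool" where
  "riccati_solution A S R P0 p \<longleftrightarrow> p 0 = P0 \<and> (\<forall>t\<ge>0. pos_semidef (p t) \<and>
     (p has_vector_derivative (A ** p t + p t ** transpose A - p t ** S ** p t + R)) (at t within {0..}))"

lemma riccati_solutionD:
  assumes "riccati_solution A S R P0 p"
  shows "p 0 = P0" "0 \<le> t \<Longrightarrow> transpose (p t) = p t" "0 \<le> t \<Longrightarrow> pos_semidef (p t)"
    "0 \<le> t \<Longrightarrow> (p has_vector_derivative (A ** p t + p t ** transpose A - p t ** S ** p t + R))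
       (at t within {0..})"
    "continuous_on {0..} p" "continuous_on {0..} (\<lambda>s. A - p s ** S)"
proof -
  show c: "continuous_on {0..} p"
    using assms unfolding riccati_solution_def
    by (intro continuous_on_has_vector_derivative) auto
  show "continuous_on {0..} (\<lambda>s. A - p s ** S)"
    by (intro continuous_intros mmult.continuous_on c)
qed (use assms in \<open>auto simp: riccati_solution_def pos_semidef_def\<close>)

lemmas mmult_distribs = mmult.add_left mmult.add_right mmult.diff_left mmult.diff_right
  mmult.minus_left mmult.minus_right matrix_mul_assoc transpose_add transpose_diff matrix_transpose_mul

text \<open>The difference \<open>D\<close> of two solutions satisfies a linear equation exactly,
  with the closed-loop matrix of the first on the left and that of the second, transposed, on the
  right. There is no quadratic remainder because the cross terms \<open>p ** S ** p2\<close>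
  cancel.\<close>

lemma riccati_difference:
  fixes p :: "real \<Rightarrow> real^'n^'n"
  assumes p: "riccati_solution A S R P0 p" and p2: "riccati_solution A S R P2 p2"
    and S: "transpose S = S"
    and fp: "fundamental_pair (\<lambda>s. A - p s ** S) \<Phi> \<Gamma>"
    and fp2: "fundamental_pair (\<lambda>s. A - p2 s ** S) \<Phi>2 \<Gamma>2" and t: "0 \<le> t"
  shows "p t - p2 t = \<Phi> t ** (P0 - P2) ** transpose (\<Phi>2 t)"
proof -
  have "(\<lambda>s. p s - p2 s) t = \<Phi> t ** (\<lambda>s. p s - p2 s) 0 ** transpose (\<Phi>2 t)"
  proof (rule two_sided_flow[OF fp fp2 t])
    fix s :: real assume s: "0 \<le> s"
    have "(A ** p s + p s ** transpose A - p s ** S ** p s + R) -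
        (A ** p2 s + p2 s ** transpose A - p2 s ** S ** p2 s + R) =
        (A - p s ** S) ** (p s - p2 s) + (p s - p2 s) ** transpose (A - p2 s ** S)"
      by (simp add: mmult_distribs S riccati_solutionD(2)[OF p2 s])
    with has_vector_derivative_diff[OF riccati_solutionD(4)[OF p s] riccati_solutionD(4)[OF p2 s]]
    show "((\<lambda>s. p s - p2 s) has_vector_derivative
        (A - p s ** S) ** (p s - p2 s) + (p s - p2 s) ** transpose (A - p2 s ** S)) (at s within {0..})"
      by simp
  qed
  thus ?thesis
    by (simp add: riccati_solutionD(1)[OF p] riccati_solutionD(1)[OF p2])
qed

text \<open>The difference formula with initial difference zero takes the place of a Lipschitz
  argument.\<close>

lemma riccati_solution_unique:
  fixes p :: "real \<Rightarrow> real^'n^'n"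
  assumes p: "riccati_solution A S R P0 p" and p2: "riccati_solution A S R P0 p2"
    and S: "transpose S = S" and t: "0 \<le> t"
  shows "p t = p2 t"
proof -
  obtain \<Phi> \<Gamma> where fp: "fundamental_pair (\<lambda>s. A - p s ** S) \<Phi> \<Gamma>"
    by (rule fundamental_pair_exists[OF riccati_solutionD(6)[OF p]])
  obtain \<Phi>2 \<Gamma>2 where fp2: "fundamental_pair (\<lambda>s. A - p2 s ** S) \<Phi>2 \<Gamma>2"
    by (rule fundamental_pair_exists[OF riccati_solutionD(6)[OF p2]])
  show ?thesis
    using riccati_difference[OF p p2 S fp fp2 t] by simp
qed

section \<open>Riccati flows in the presence of a stable steady state\<close>

locale stable_riccati =
  fixes A S R P :: "real^'n^'n" and \<mu> r :: real
  assumes S_psd: "pos_semidef S"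
    and P_psd: "pos_semidef P"
    and r_pos: "0 < r" and R_coercive: "\<And>x. r * (norm x)\<^sup>2 \<le> x \<bullet> (R *v x)"
    and P_riccati: "A ** P + P ** transpose A - P ** S ** P + R = 0"
    and \<mu>_neg: "\<mu> < 0" and \<mu>_bound: "\<And>x. x \<bullet> ((A - P ** S) *v x) \<le> \<mu> * (norm x)\<^sup>2"
begin

lemma S_sym: "transpose S = S" and P_sym: "transpose P = P"
  using S_psd P_psd by (auto simp: pos_semidef_def)

lemma steady_flow_bound:
  assumes "fundamental_pair (\<lambda>_. A - P ** S) \<Phi> \<Gamma>" "0 \<le> t"
  shows "norm (transpose (\<Phi> t) *v y) \<le> exp (\<mu> * t) * norm y"
proof -
  have "norm (transpose (\<Phi> t ** \<Gamma> 0) *v y) \<le> exp (\<mu> * t - \<mu> * 0) * norm y"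
    using \<mu>_bound assms by (intro adjoint_flow_bound[OF assms(1), where l = "\<lambda>_. \<mu>"])
      (auto intro!: derivative_eq_intros)
  thus ?thesis using fundamental_pairD(2)[OF assms(1)] by (simp del: transpose_matrix_vector)
qed

text \<open>With \<open>D = p - P\<close> and the closed-loop matrix of \<open>P\<close>, the
  equation for \<open>D\<close> has the additional term \<open>- D ** S ** D\<close>, so the form of
  \<open>D\<close> along the adjoint flow of \<open>P\<close> can only decrease in time. That flow
  is a contraction, hence \<open>p\<close> is dominated by \<open>P\<close> plus the size of the
  initial difference.\<close>

lemma riccati_bounded:
  assumes p: "riccati_solution A S R P0 p"
  obtains c where "0 \<le> c" "\<And>t x. 0 \<le> t \<Longrightarrow> x \<bullet> (p t *v x) \<le> c * (norm x)\<^sup>2"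
    "\<And>t. 0 \<le> t \<Longrightarrow> norm (p t) \<le> c"
proof -
  obtain \<Phi> \<Gamma> where fp: "fundamental_pair (\<lambda>_. A - P ** S) \<Phi> \<Gamma>"
    by (rule fundamental_pair_exists[of "\<lambda>_. A - P ** S"]) auto
  define c where "c = norm P + norm (P0 - P)"
  have quad: "y \<bullet> (p t *v y) \<le> c * (norm y)\<^sup>2" if t: "0 \<le> t" for t y
  proof -
    define q where "q = (\<lambda>s. transpose (\<Phi> t ** \<Gamma> s) *v y)"
    define f where "f = (\<lambda>s. q s \<bullet> ((p s - P) *v q s))"
    have q': "(q has_vector_derivative - (transpose (A - P ** S) *v q s)) (at s within {0..})"
      if "0 \<le> s" for s
      unfolding q_def using adjoint_flow_derivative[OF fp that] .
    have "- f 0 \<le> - f t"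
    proof (rule nondecreasing_of_vector_derivative[OF _ order_refl t])
      fix s :: real assume s: "0 \<le> s"
      define D where "D = p s - P"
      have "((\<lambda>s. p s - P) has_vector_derivative
          (A ** p s + p s ** transpose A - p s ** S ** p s + R) - 0) (at s within {0..})"
        by (intro has_vector_derivative_diff riccati_solutionD(4)[OF p s] has_vector_derivative_const)
      moreover have "(A ** p s + p s ** transpose A - p s ** S ** p s + R) - 0 =
          (A ** p s + p s ** transpose A - p s ** S ** p s + R) -
          (A ** P + P ** transpose A - P ** S ** P + R)"
        unfolding P_riccati ..
      ultimately have "(f has_vector_derivative
          q s \<bullet> (((A ** p s + p s ** transpose A - p s ** S ** p s + R) -
          (A ** P + P ** transpose A - P ** S ** P + R) - (A - P ** S) ** D
          - D ** transpose (A - P ** S)) *v q s)) (at s within {0..})"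
        unfolding f_def D_def by (intro quadratic_form_derivative q' s) simp
      also have "(A ** p s + p s ** transpose A - p s ** S ** p s + R) -
          (A ** P + P ** transpose A - P ** S ** P + R) - (A - P ** S) ** D
          - D ** transpose (A - P ** S) = - (transpose D ** S ** D)"
        by (simp add: D_def mmult_distribs S_sym P_sym riccati_solutionD(2)[OF p s])
      also have "q s \<bullet> (- (transpose D ** S ** D) *v q s) = - ((D *v q s) \<bullet> (S *v (D *v q s)))"
        by (simp add: mvmult.minus_left matrix_vector_mul_assoc[symmetric] inner_transpose_matrix
            del: transpose_matrix_vector)
      finally show "((\<lambda>s. - f s) has_vector_derivative
          ((p s - P) *v q s) \<bullet> (S *v ((p s - P) *v q s))) (at s within {0..})"
        using has_vector_derivative_minus by (fastforce simp: D_def)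
    qed (use S_psd in \<open>simp add: pos_semidef_def\<close>)
    moreover have "f t = y \<bullet> (p t *v y) - y \<bullet> (P *v y)"
      using adjoint_flow_end[OF fp t, of y]
      by (simp add: f_def q_def mvmult.diff_left inner_diff_right del: transpose_matrix_vector)
    moreover have "f 0 \<le> norm (P0 - P) * (norm y)\<^sup>2"
    proof -
      have "norm (q 0) \<le> exp (\<mu> * t) * norm y"
        using steady_flow_bound[OF fp t, of y] fundamental_pairD(2)[OF fp]
        by (simp add: q_def del: transpose_matrix_vector)
      also have "\<dots> \<le> 1 * norm y"
        using \<mu>_neg t by (intro mult_right_mono) (auto simp: mult_nonpos_nonneg)
      finally have qy: "norm (q 0) \<le> norm y" by simp
      have "f 0 \<le> norm (q 0) * norm ((P0 - P) *v q 0)"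
        unfolding f_def riccati_solutionD(1)[OF p] by (rule norm_cauchy_schwarz)
      also have "\<dots> \<le> norm (q 0) * (norm (P0 - P) * norm (q 0))"
        by (intro mult_left_mono norm_matrix_vector_le) auto
      also have "\<dots> \<le> norm y * (norm (P0 - P) * norm y)"
        using qy by (intro mult_mono) auto
      finally show ?thesis by (simp add: power2_eq_square mult_ac)
    qed
    moreover have "y \<bullet> (P *v y) \<le> norm P * (norm y)\<^sup>2"
    proof -
      have "y \<bullet> (P *v y) \<le> norm y * (norm P * norm y)"
        by (intro order_trans[OF norm_cauchy_schwarz] mult_left_mono norm_matrix_vector_le) auto
      thus ?thesis by (simp add: power2_eq_square mult_ac)
    qed
    ultimately show ?thesis by (simp add: c_def algebra_simps)
  qed
  \<comment> \<open>The second entry turns the bound for the quadratic form into one for the norm,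
    as in \<open>norm_pos_semidef_le\<close>.\<close>
  define c' where "c' = max c (2 * c * (real CARD('n))\<^sup>2)"
  show ?thesis
  proof (rule that[of c'])
    show "0 \<le> c'" by (simp add: c'_def c_def le_max_iff_disj)
    show "x \<bullet> (p t *v x) \<le> c' * (norm x)\<^sup>2" if "0 \<le> t" for t x
      using quad[OF that, of x] by (rule order_trans) (simp add: c'_def mult_right_mono)
    show "norm (p t) \<le> c'" if "0 \<le> t" for t
      using norm_pos_semidef_le[OF riccati_solutionD(3)[OF p that] quad[OF that]]
      by (simp add: c'_def)
  qed
qed

text \<open>A bound for \<open>p\<close> alone says nothing about the growth of the flow of
  \<open>A - p ** S\<close>. But the form of \<open>p\<close> along the adjoint flow increases at
  rate at least \<open>r\<close> times the squared norm of \<open>q\<close>, because its source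
  \<open>R + p ** S ** p\<close> is coercive; a large multiple of it absorbs any change of that
  squared norm.\<close>

lemma flow_bounded:
  assumes p: "riccati_solution A S R P0 p" and fp: "fundamental_pair (\<lambda>s. A - p s ** S) \<Phi> \<Gamma>"
  obtains c where "0 \<le> c" "\<And>s t y. 0 \<le> s \<Longrightarrow> s \<le> t \<Longrightarrow> norm (transpose (\<Phi> t ** \<Gamma> s) *v y) \<le> c * norm y"
proof -
  obtain cp where cp: "0 \<le> cp" "\<And>t x. 0 \<le> t \<Longrightarrow> x \<bullet> (p t *v x) \<le> cp * (norm x)\<^sup>2"
    "\<And>t. 0 \<le> t \<Longrightarrow> norm (p t) \<le> cp"
    using riccati_bounded[OF p] by blast
  define \<kappa> where "\<kappa> = 2 * (norm A + cp * norm S)"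
  have \<kappa>0: "0 \<le> \<kappa>" using cp(1) by (simp add: \<kappa>_def)
  have K: "2 * (x \<bullet> ((A - p s ** S) *v x)) \<le> \<kappa> * (norm x)\<^sup>2" if s: "0 \<le> s" for s x
  proof -
    have "norm (p s ** S) \<le> cp * norm S"
      using cp(3)[OF s] by (intro order_trans[OF norm_matrix_mult_le] mult_right_mono) auto
    hence n: "norm (A - p s ** S) \<le> norm A + cp * norm S"
      using norm_triangle_ineq4[of A "p s ** S"] by linarith
    have "x \<bullet> ((A - p s ** S) *v x) \<le> norm x * (norm (A - p s ** S) * norm x)"
      by (intro order_trans[OF norm_cauchy_schwarz] mult_left_mono norm_matrix_vector_le) auto
    also have "\<dots> \<le> norm x * ((norm A + cp * norm S) * norm x)"
      using n by (intro mult_left_mono mult_right_mono) auto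
    also have "\<dots> = \<kappa> / 2 * (norm x)\<^sup>2" by (simp add: \<kappa>_def power2_eq_square)
    finally show ?thesis by simp
  qed
  define c where "c = \<kappa> * cp / r + 1"
  have c1: "1 \<le> c" using \<kappa>0 cp(1) r_pos by (simp add: c_def)
  show ?thesis
  proof (rule that[of c])
    show "0 \<le> c" using c1 by simp
    fix s t :: real and y assume st: "0 \<le> s" "s \<le> t"
    define q where "q = (\<lambda>s. transpose (\<Phi> t ** \<Gamma> s) *v y)"
    \<comment> \<open>The factor \<open>\<kappa> / r\<close> is just large enough for the growth of
      the first summand to cover the possible decrease of the second.\<close>
    define h where "h = (\<lambda>s. \<kappa> / r * (q s \<bullet> (p s *v q s)) + (norm (q s))\<^sup>2)"
    have q': "(q has_vector_derivative - (transpose (A - p s ** S) *v q s)) (at s within {0..})"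
      if "0 \<le> s" for s
      unfolding q_def using adjoint_flow_derivative[OF fp that] .
    have "h s \<le> h t"
    proof (rule nondecreasing_of_vector_derivative[OF _ st])
      fix u :: real assume u: "0 \<le> u"
      have "((\<lambda>u. q u \<bullet> (p u *v q u)) has_vector_derivative
          q u \<bullet> (((A ** p u + p u ** transpose A - p u ** S ** p u + R) - (A - p u ** S) ** p u
            - p u ** transpose (A - p u ** S)) *v q u)) (at u within {0..})"
        by (intro quadratic_form_derivative q' u riccati_solutionD(4)[OF p])
      also have "(A ** p u + p u ** transpose A - p u ** S ** p u + R) - (A - p u ** S) ** p u
            - p u ** transpose (A - p u ** S) = R + transpose (p u) ** S ** p u"
        by (simp add: mmult_distribs S_sym riccati_solutionD(2)[OF p u])
      also have "q u \<bullet> ((R + transpose (p u) ** S ** p u) *v q u) =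
          q u \<bullet> (R *v q u) + (p u *v q u) \<bullet> (S *v (p u *v q u))"
        by (simp add: mvmult.add_left inner_add_right matrix_vector_mul_assoc[symmetric]
            inner_transpose_matrix del: transpose_matrix_vector)
      finally have "((\<lambda>u. q u \<bullet> (p u *v q u)) has_vector_derivative
          q u \<bullet> (R *v q u) + (p u *v q u) \<bullet> (S *v (p u *v q u))) (at u within {0..})" .
      thus "(h has_vector_derivative \<kappa> / r * (q u \<bullet> (R *v q u) + (p u *v q u) \<bullet> (S *v (p u *v q u)))
          + - 2 * (q u \<bullet> ((A - p u ** S) *v q u))) (at u within {0..})"
        unfolding h_def
        by (intro has_vector_derivative_add norm_square_derivative q' u
            bounded_linear.has_vector_derivative[OF bounded_linear_mult_right])
    next
      fix u assume "s \<le> u" "u \<le> t"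
      with st have u: "0 \<le> u" by simp
      have "r * (norm (q u))\<^sup>2 \<le> q u \<bullet> (R *v q u) + (p u *v q u) \<bullet> (S *v (p u *v q u))"
        using R_coercive[of "q u"] S_psd unfolding pos_semidef_def by (meson add_increasing2)
      hence "\<kappa> / r * (r * (norm (q u))\<^sup>2) \<le>
          \<kappa> / r * (q u \<bullet> (R *v q u) + (p u *v q u) \<bullet> (S *v (p u *v q u)))"
        using \<kappa>0 r_pos by (intro mult_left_mono) auto
      with K[OF u, of "q u"] r_pos
      show "0 \<le> \<kappa> / r * (q u \<bullet> (R *v q u) + (p u *v q u) \<bullet> (S *v (p u *v q u)))
          + - 2 * (q u \<bullet> ((A - p u ** S) *v q u))" by simp
    qed
    moreover have "(norm (q s))\<^sup>2 \<le> h s"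
      using riccati_solutionD(3)[OF p st(1)] \<kappa>0 r_pos by (simp add: h_def pos_semidef_def)
    moreover have "h t \<le> c * (norm y)\<^sup>2"
    proof -
      have "q t = y" unfolding q_def using st by (intro adjoint_flow_end[OF fp]) auto
      moreover have "\<kappa> / r * (y \<bullet> (p t *v y)) \<le> \<kappa> / r * (cp * (norm y)\<^sup>2)"
        using \<kappa>0 r_pos st by (intro mult_left_mono cp) auto
      ultimately show ?thesis by (simp add: h_def c_def algebra_simps)
    qed
    ultimately have "(norm (q s))\<^sup>2 \<le> c * (norm y)\<^sup>2" by linarith
    \<comment> \<open>Since \<open>1 \<le> c\<close>, passing to the square of \<open>c\<close>
      avoids a root in the constant.\<close>
    also have "\<dots> \<le> (c * norm y)\<^sup>2"
      using self_le_power[OF c1, of 2] by (simp add: power_mult_distrib mult_right_mono)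
    finally have "norm (q s) \<le> c * norm y"
      by (rule power2_le_imp_le) (use c1 in simp)
    thus "norm (transpose (\<Phi> t ** \<Gamma> s) *v y) \<le> c * norm y" by (simp only: q_def)
  qed
qed

text \<open>The constant path \<open>P\<close> is itself a Riccati solution, so the difference
  formula applies with its flow on one side. That side supplies the whole decay, and boundedness of
  the flow of \<open>p\<close> is enough on the other.\<close>

lemma riccati_converges:
  assumes p: "riccati_solution A S R P0 p" and fp: "fundamental_pair (\<lambda>s. A - p s ** S) \<Phi> \<Gamma>"
  obtains c where "0 \<le> c" "\<And>t. 0 \<le> t \<Longrightarrow> norm (p t - P) \<le> c * exp (\<mu> * t)"
proof -
  have P: "riccati_solution A S R P (\<lambda>_. P)"
    unfolding riccati_solution_def P_riccati using P_psd by auto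
  obtain \<Psi> \<Gamma>' where fpP: "fundamental_pair (\<lambda>_. A - P ** S) \<Psi> \<Gamma>'"
    by (rule fundamental_pair_exists[of "\<lambda>_. A - P ** S"]) auto
  obtain c where c: "0 \<le> c" "\<And>s t y. 0 \<le> s \<Longrightarrow> s \<le> t \<Longrightarrow> norm (transpose (\<Phi> t ** \<Gamma> s) *v y) \<le> c * norm y"
    using flow_bounded[OF p fp] by blast
  let ?d = "real CARD('n)"
  show ?thesis
  proof (rule that[of "c * ?d * norm (P0 - P) * ?d"])
    show "0 \<le> c * ?d * norm (P0 - P) * ?d" using c by simp
    fix t :: real assume t: "0 \<le> t"
    have "norm (transpose (\<Phi> t)) \<le> c * ?d"
      using c(2)[OF order_refl t] fundamental_pairD(2)[OF fp]
      by (intro norm_matrix_le_of_operator_bound) (simp del: transpose_matrix_vector)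
    hence a: "norm (\<Phi> t) \<le> c * ?d" by (simp add: norm_transpose)
    have b: "norm (transpose (\<Psi> t)) \<le> exp (\<mu> * t) * ?d"
      by (intro norm_matrix_le_of_operator_bound steady_flow_bound[OF fpP t])
    have "norm (p t - P) \<le> norm (\<Phi> t) * norm (P0 - P) * norm (transpose (\<Psi> t))"
      unfolding riccati_difference[OF p P S_sym fp fpP t]
      by (intro order_trans[OF norm_matrix_mult_le] mult_right_mono norm_matrix_mult_le) auto
    also have "\<dots> \<le> c * ?d * norm (P0 - P) * (exp (\<mu> * t) * ?d)"
      using c(1) by (intro mult_mono a b) auto
    finally show "norm (p t - P) \<le> c * ?d * norm (P0 - P) * ?d * exp (\<mu> * t)"
      by (simp add: mult_ac)
  qed
qed

text \<open>As \<open>p\<close> converges exponentially, the numerical range of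
  \<open>A - p ** S\<close> is at most \<open>\<mu>\<close> plus the integrable perturbation
  \<open>\<kappa> * exp (\<mu> * s)\<close>. Its total integral costs the factor
  \<open>exp (- \<kappa> / \<mu>)\<close> and leaves the rate \<open>\<mu>\<close> intact.\<close>

lemma flow_decay:
  assumes p: "riccati_solution A S R P0 p" and fp: "fundamental_pair (\<lambda>s. A - p s ** S) \<Phi> \<Gamma>"
  obtains c where "0 \<le> c" "\<And>s t. 0 \<le> s \<Longrightarrow> s \<le> t \<Longrightarrow> norm (\<Phi> t ** \<Gamma> s) \<le> c * exp (\<mu> * (t - s))"
proof -
  obtain c where c: "0 \<le> c" "\<And>t. 0 \<le> t \<Longrightarrow> norm (p t - P) \<le> c * exp (\<mu> * t)"
    using riccati_converges[OF p fp] by blast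
  define \<kappa> where "\<kappa> = c * norm S"
  have \<kappa>0: "0 \<le> \<kappa>" using c(1) by (simp add: \<kappa>_def)
  define l where "l = (\<lambda>s. \<mu> + \<kappa> * exp (\<mu> * s))"
  define \<Lambda> where "\<Lambda> = (\<lambda>s. \<mu> * s + \<kappa> * exp (\<mu> * s) / \<mu>)"
  have K: "x \<bullet> ((A - p s ** S) *v x) \<le> l s * (norm x)\<^sup>2" if s: "0 \<le> s" for s x
  proof -
    have "(A - p s ** S) = (A - P ** S) - (p s - P) ** S"
      by (simp add: mmult_distribs)
    hence "x \<bullet> ((A - p s ** S) *v x) = x \<bullet> ((A - P ** S) *v x) - x \<bullet> (((p s - P) ** S) *v x)"
      by (metis mvmult.diff_left inner_diff_right)
    moreover have "- (x \<bullet> (((p s - P) ** S) *v x)) \<le> \<kappa> * exp (\<mu> * s) * (norm x)\<^sup>2"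
    proof -
      have "- (x \<bullet> (((p s - P) ** S) *v x)) \<le> norm x * (norm ((p s - P) ** S) * norm x)"
        using order_trans[OF Cauchy_Schwarz_ineq2 mult_left_mono[OF norm_matrix_vector_le norm_ge_zero]]
          abs_le_iff by blast
      also have "\<dots> \<le> norm x * ((c * exp (\<mu> * s) * norm S) * norm x)"
        by (intro mult_left_mono mult_right_mono order_trans[OF norm_matrix_mult_le] c s) auto
      finally show ?thesis by (simp add: \<kappa>_def power2_eq_square mult_ac)
    qed
    ultimately show ?thesis using \<mu>_bound[of x] by (simp add: l_def algebra_simps)
  qed
  have \<Lambda>': "(\<Lambda> has_real_derivative l s) (at s within {0..})" for s
    unfolding \<Lambda>_def l_def using \<mu>_neg by (auto intro!: derivative_eq_intros)
  show ?thesis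
  proof (rule that[of "exp (- \<kappa> / \<mu>) * real CARD('n)"])
    fix s t :: real assume st: "0 \<le> s" "s \<le> t"
    have "norm (transpose (\<Phi> t ** \<Gamma> s) *v y) \<le> exp (\<mu> * (t - s) - \<kappa> / \<mu>) * norm y" for y
    proof -
      have "norm (transpose (\<Phi> t ** \<Gamma> s) *v y) \<le> exp (\<Lambda> t - \<Lambda> s) * norm y"
        using st by (intro adjoint_flow_bound[OF fp _ _ K \<Lambda>']) auto
      also have "\<dots> \<le> exp (\<mu> * (t - s) - \<kappa> / \<mu>) * norm y"
      proof -
        have "exp (\<mu> * s) \<le> 1" using st \<mu>_neg by (simp add: mult_nonpos_nonneg)
        hence "\<kappa> * exp (\<mu> * s) - \<kappa> * exp (\<mu> * t) \<le> \<kappa> * 1 - \<kappa> * 0"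
          using \<kappa>0 by (intro diff_mono mult_left_mono) auto
        hence "(\<kappa> * exp (\<mu> * s) - \<kappa> * exp (\<mu> * t)) / (- \<mu>) \<le> \<kappa> / (- \<mu>)"
          using \<mu>_neg by (intro divide_right_mono) auto
        thus ?thesis
          by (intro mult_right_mono) (auto simp: \<Lambda>_def diff_divide_distrib algebra_simps)
      qed
      finally show ?thesis .
    qed
    hence "norm (transpose (\<Phi> t ** \<Gamma> s)) \<le> exp (\<mu> * (t - s) - \<kappa> / \<mu>) * real CARD('n)"
      by (rule norm_matrix_le_of_operator_bound)
    also have "exp (\<mu> * (t - s) - \<kappa> / \<mu>) = exp (- \<kappa> / \<mu>) * exp (\<mu> * (t - s))"
      by (simp only: exp_add[symmetric]) simp
    finally show "norm (\<Phi> t ** \<Gamma> s) \<le> exp (- \<kappa> / \<mu>) * real CARD('n) * exp (\<mu> * (t - s))"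
      by (simp add: norm_transpose mult_ac)
  qed simp
qed

text \<open>A Duhamel formula for the difference of two transition matrices. The additional decay in
  \<open>s\<close>, visible as \<open>t + s\<close> in place of \<open>t - s\<close>, comes from the
  difference of the Riccati solutions; it keeps the squared kernels, integrated over
  \<open>s\<close>, of order \<open>exp (2 * \<mu> * t)\<close>.\<close>

lemma flow_difference:
  fixes G :: "real^'m^'n"
  assumes p: "riccati_solution A S R P0 p" and fp: "fundamental_pair (\<lambda>s. A - p s ** S) \<Phi> \<Gamma>"
    and p2: "riccati_solution A S R P2 p2" and fp2: "fundamental_pair (\<lambda>s. A - p2 s ** S) \<Phi>2 \<Gamma>2"
  obtains c where "0 < c" "\<And>t. 0 \<le> t \<Longrightarrow> norm (\<Phi> t) \<le> c * exp (\<mu> * t)"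
    "\<And>t. 0 \<le> t \<Longrightarrow> norm (\<Phi> t - \<Phi>2 t) \<le> c * exp (\<mu> * t) * norm (P0 - P2)"
    "\<And>s t. 0 \<le> s \<Longrightarrow> s \<le> t \<Longrightarrow>
       norm (\<Phi> t ** \<Gamma> s - \<Phi>2 t ** \<Gamma>2 s) \<le> c * exp (\<mu> * (t + s)) * norm (P0 - P2)"
    "\<And>s t. 0 \<le> s \<Longrightarrow> s \<le> t \<Longrightarrow>
       norm (\<Phi> t ** \<Gamma> s ** (p s ** G) - \<Phi>2 t ** \<Gamma>2 s ** (p2 s ** G))
         \<le> c * exp (\<mu> * (t + s)) * norm (P0 - P2)"
proof -
  let ?\<delta> = "norm (P0 - P2)"
  obtain c1 where c1: "0 \<le> c1" "\<And>s t. 0 \<le> s \<Longrightarrow> s \<le> t \<Longrightarrow> norm (\<Phi> t ** \<Gamma> s) \<le> c1 * exp (\<mu> * (t - s))"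
    using flow_decay[OF p fp] by blast
  obtain c2 where c2: "0 \<le> c2" "\<And>s t. 0 \<le> s \<Longrightarrow> s \<le> t \<Longrightarrow> norm (\<Phi>2 t ** \<Gamma>2 s) \<le> c2 * exp (\<mu> * (t - s))"
    using flow_decay[OF p2 fp2] by blast
  obtain cp where cp: "0 \<le> cp" "\<And>t. 0 \<le> t \<Longrightarrow> norm (p2 t) \<le> cp"
    using riccati_bounded[OF p2] by metis
  have \<Phi>0: "norm (\<Phi> t) \<le> c1 * exp (\<mu> * t)" "norm (\<Phi>2 t) \<le> c2 * exp (\<mu> * t)" if "0 \<le> t" for t
    using c1(2)[of 0 t] c2(2)[of 0 t] that fundamental_pairD(2)[OF fp] fundamental_pairD(2)[OF fp2]
    by auto
  have D: "norm (p t - p2 t) \<le> c1 * c2 * exp (2 * \<mu> * t) * ?\<delta>" if t: "0 \<le> t" for t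
  proof -
    have "norm (p t - p2 t) \<le> norm (\<Phi> t) * ?\<delta> * norm (transpose (\<Phi>2 t))"
      unfolding riccati_difference[OF p p2 S_sym fp fp2 t]
      by (intro order_trans[OF norm_matrix_mult_le] mult_right_mono norm_matrix_mult_le) auto
    also have "\<dots> \<le> (c1 * exp (\<mu> * t)) * ?\<delta> * (c2 * exp (\<mu> * t))"
      unfolding norm_transpose using c1(1) c2(1) by (intro mult_mono \<Phi>0 t) auto
    finally show ?thesis
      by (simp add: mult_ac exp_add[symmetric])
  qed
  \<comment> \<open>The denominator is what the integral of \<open>exp (2 * \<mu> * u)\<close> over
    all \<open>u \<ge> s\<close> leaves; the numerator bounds the first flow, the Riccati difference
    times \<open>S\<close>, and the second flow.\<close>
  define c3 where "c3 = c1 * (c1 * c2 * norm S) * c2 / (- 2 * \<mu>)"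
  have c3: "0 \<le> c3"
    unfolding c3_def using c1(1) c2(1) \<mu>_neg by (intro divide_nonneg_nonneg) auto
  have F: "norm (\<Phi> t ** \<Gamma> s - \<Phi>2 t ** \<Gamma>2 s) \<le> c3 * exp (\<mu> * (t + s)) * ?\<delta>"
    if st: "0 \<le> s" "s \<le> t" for s t
  proof -
    \<comment> \<open>Interpolates between the transition matrices from \<open>s\<close> to
      \<open>t\<close>: at \<open>u = s\<close> it is that of the first flow, at
      \<open>u = t\<close> that of the second.\<close>
    define f where "f = (\<lambda>u. \<Phi> t ** \<Gamma> u ** (\<Phi>2 u ** \<Gamma>2 s))"
    define f' where "f' = (\<lambda>u. \<Phi> t ** \<Gamma> u ** ((p u - p2 u) ** S) ** (\<Phi>2 u ** \<Gamma>2 s))"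
    have "(f has_vector_derivative f' u) (at u within {0..})" if u: "0 \<le> u" for u
    proof -
      have "(f has_vector_derivative \<Phi> t ** \<Gamma> u ** (\<Phi>2 u ** 0 + ((A - p2 u ** S) ** \<Phi>2 u) ** \<Gamma>2 s)
          + (\<Phi> t ** (- (\<Gamma> u ** (A - p u ** S))) + 0 ** \<Gamma> u) ** (\<Phi>2 u ** \<Gamma>2 s)) (at u within {0..})"
        unfolding f_def by (intro mmult.has_vector_derivative has_vector_derivative_const
          fundamental_pairD(4)[OF fp] fundamental_pairD(3)[OF fp2] u)
      moreover have "\<Phi> t ** \<Gamma> u ** (\<Phi>2 u ** 0 + ((A - p2 u ** S) ** \<Phi>2 u) ** \<Gamma>2 s)
          + (\<Phi> t ** (- (\<Gamma> u ** (A - p u ** S))) + 0 ** \<Gamma> u) ** (\<Phi>2 u ** \<Gamma>2 s) = f' u"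
        by (simp add: f'_def mmult_distribs)
      ultimately show ?thesis by simp
    qed
    hence int: "(f' has_integral (f t - f s)) {s..t}"
      using st by (rule vector_derivative_integral)
    have ft: "f t - f s = - (\<Phi> t ** \<Gamma> s - \<Phi>2 t ** \<Gamma>2 s)"
      using fundamental_pairD(5)[OF fp, of t] fundamental_pairD(5)[OF fp2, of s] st
      by (simp add: f_def)
    define C where "C = c1 * (c1 * c2 * norm S) * c2 * ?\<delta> * exp (\<mu> * (t - s))"
    have C0: "0 \<le> C" using c1 c2 by (simp add: C_def)
    have le: "norm (f' u) \<le> C * exp (2 * \<mu> * u)" if u: "u \<in> {s..t}" for u
    proof -
      have u0: "0 \<le> u" using u st by simp
      have "norm (f' u) \<le> norm (\<Phi> t ** \<Gamma> u) * (norm (p u - p2 u) * norm S) * norm (\<Phi>2 u ** \<Gamma>2 s)"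
        unfolding f'_def
        by (rule order_trans[OF norm_matrix_mult_le], intro mult_mono order_refl norm_ge_zero mult_nonneg_nonneg,
            rule order_trans[OF norm_matrix_mult_le], intro mult_mono order_refl norm_ge_zero
              norm_matrix_mult_le mult_nonneg_nonneg)
      also have "\<dots> \<le> (c1 * exp (\<mu> * (t - u))) * ((c1 * c2 * exp (2 * \<mu> * u) * ?\<delta>) * norm S) *
          (c2 * exp (\<mu> * (u - s)))"
        using u st u0 c1(1) c2(1) by (intro mult_mono D c1 c2 mult_nonneg_nonneg) auto
      also have "\<dots> = c1 * (c1 * c2 * norm S) * c2 * ?\<delta> *
          (exp (\<mu> * (t - u)) * exp (\<mu> * (u - s))) * exp (2 * \<mu> * u)"
        by (simp add: mult_ac)
      also have "exp (\<mu> * (t - u)) * exp (\<mu> * (u - s)) = exp (\<mu> * (t - s))"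
        by (simp add: exp_add[symmetric] algebra_simps)
      finally show ?thesis by (simp add: C_def mult_ac)
    qed
    have ig: "((\<lambda>u. C * exp (2 * \<mu> * u)) has_integral
        (C * exp (2 * \<mu> * t) / (2 * \<mu>) - C * exp (2 * \<mu> * s) / (2 * \<mu>))) {s..t}"
      using \<mu>_neg st by (intro fundamental_theorem_of_calculus)
        (auto intro!: derivative_eq_intros simp: has_real_derivative_iff_has_vector_derivative[symmetric])
    have "norm (f t - f s) \<le> C * exp (2 * \<mu> * t) / (2 * \<mu>) - C * exp (2 * \<mu> * s) / (2 * \<mu>)"
      using integral_norm_bound_integral[OF has_integral_integrable[OF int] has_integral_integrable[OF ig] le]
      by (simp only: integral_unique[OF int] integral_unique[OF ig])
    also have "\<dots> \<le> C * exp (2 * \<mu> * s) / (- 2 * \<mu>)"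
      using C0 \<mu>_neg by (simp add: divide_nonneg_neg)
    also have "\<dots> = c3 * ?\<delta> * (exp (\<mu> * (t - s)) * exp (2 * \<mu> * s))"
      by (simp add: C_def c3_def)
    also have "exp (\<mu> * (t - s)) * exp (2 * \<mu> * s) = exp (\<mu> * (t + s))"
      by (simp add: exp_add[symmetric] algebra_simps)
    finally show ?thesis
      unfolding ft norm_minus_cancel by (simp add: mult_ac)
  qed
  have F0: "norm (\<Phi> t - \<Phi>2 t) \<le> c3 * exp (\<mu> * t) * ?\<delta>" if "0 \<le> t" for t
    using F[of 0 t] that fundamental_pairD(2)[OF fp] fundamental_pairD(2)[OF fp2] by simp
  define c4 where "c4 = c3 * (cp * norm G) + c1 * (c1 * c2 * norm G)"
  have c4: "0 \<le> c4" using c1 c2 c3 cp by (simp add: c4_def)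
  have H: "norm (\<Phi> t ** \<Gamma> s ** (p s ** G) - \<Phi>2 t ** \<Gamma>2 s ** (p2 s ** G)) \<le> c4 * exp (\<mu> * (t + s)) * ?\<delta>"
    if st: "0 \<le> s" "s \<le> t" for s t
  proof -
    have "\<Phi> t ** \<Gamma> s ** (p s ** G) - \<Phi>2 t ** \<Gamma>2 s ** (p2 s ** G) =
        (\<Phi> t ** \<Gamma> s - \<Phi>2 t ** \<Gamma>2 s) ** (p2 s ** G) + \<Phi> t ** \<Gamma> s ** ((p s - p2 s) ** G)"
      by (simp add: mmult_distribs)
    also have "norm \<dots> \<le> (c3 * exp (\<mu> * (t + s)) * ?\<delta>) * (cp * norm G) +
        (c1 * exp (\<mu> * (t - s))) * ((c1 * c2 * exp (2 * \<mu> * s) * ?\<delta>) * norm G)"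
      using c1(1) c2(1) c3 cp(1) st
      by (intro order_trans[OF norm_triangle_ineq] add_mono order_trans[OF norm_matrix_mult_le]
          mult_mono F D c1 cp) auto
    also have "\<dots> = c3 * (cp * norm G) * exp (\<mu> * (t + s)) * ?\<delta> +
        c1 * (c1 * c2 * norm G) * (exp (\<mu> * (t - s)) * exp (2 * \<mu> * s)) * ?\<delta>"
      by (simp add: mult_ac)
    also have "exp (\<mu> * (t - s)) * exp (2 * \<mu> * s) = exp (\<mu> * (t + s))"
      by (simp add: exp_add[symmetric] algebra_simps)
    finally show ?thesis by (simp add: c4_def algebra_simps)
  qed
  define c where "c = c1 + c3 + c4 + 1"
  have up: "x * exp z * ?\<delta> \<le> c * exp z * ?\<delta>" if "x \<le> c" for x z
    using that by (intro mult_right_mono) auto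
  show ?thesis
  proof (rule that[of c])
    show "0 < c" using c1 c3 c4 by (simp add: c_def)
    have le: "c1 \<le> c" "c3 \<le> c" "c4 \<le> c" using c1 c3 c4 by (auto simp: c_def)
    show "norm (\<Phi> t) \<le> c * exp (\<mu> * t)" if "0 \<le> t" for t
      by (rule order_trans[OF \<Phi>0(1)[OF that]]) (simp add: le)
    show "norm (\<Phi> t - \<Phi>2 t) \<le> c * exp (\<mu> * t) * ?\<delta>" if "0 \<le> t" for t
      by (rule order_trans[OF F0[OF that] up[OF le(2)]])
    show "norm (\<Phi> t ** \<Gamma> s - \<Phi>2 t ** \<Gamma>2 s) \<le> c * exp (\<mu> * (t + s)) * ?\<delta>"
      if "0 \<le> s" "s \<le> t" for s t
      by (rule order_trans[OF F[OF that] up[OF le(2)]])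
    show "norm (\<Phi> t ** \<Gamma> s ** (p s ** G) - \<Phi>2 t ** \<Gamma>2 s ** (p2 s ** G)) \<le> c * exp (\<mu> * (t + s)) * ?\<delta>"
      if "0 \<le> s" "s \<le> t" for s t
      by (rule order_trans[OF H[OF that] up[OF le(3)]])
  qed
qed

end

section \<open>Characteristic functions\<close>

lemma char_distr_eq_cis:
  assumes "X \<in> borel_measurable M"
  shows "char (distr M borel X) t = (\<integral>\<omega>. cis (t * X \<omega>) \<partial>M)"
  using assms by (simp add: char_def integral_distr cis_conv_exp)

lemma borel_measurable_cis [measurable (raw)]:
  "f \<in> borel_measurable M \<Longrightarrow> (\<lambda>x. cis (f x)) \<in> borel_measurable M"
  by (rule borel_measurable_continuous_on) (auto intro!: continuous_intros)

lemma (in finite_measure) integrable_cis: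
  "f \<in> borel_measurable M \<Longrightarrow> integrable M (\<lambda>x. cis (f x))"
  by (rule integrable_const_bound[of _ 1]) auto

lemma distr_eqI_cis:
  fixes f :: "'a \<Rightarrow> real" and g :: "'b \<Rightarrow> real"
  assumes "prob_space M" "prob_space N" and [measurable]: "f \<in> borel_measurable M" "g \<in> borel_measurable N"
    and "\<And>s. (\<integral>x. cis (s * f x) \<partial>M) = (\<integral>x. cis (s * g x) \<partial>N)"
  shows "distr M borel f = distr N borel g"
proof (rule Levy_uniqueness)
  show "char (distr M borel f) = char (distr N borel g)"
    by (rule ext) (simp add: char_distr_eq_cis assms)
qed (auto intro!: prob_space.real_distribution_distr assms)

text \<open>The weight is bounded away from zero, so that it can be normalized to a probability density.\<close>

lemma weighted_char_unique:
  fixes \<mu> \<nu> :: "'a measure" and w f :: "'a \<Rightarrow> real"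
  assumes "prob_space \<mu>" "prob_space \<nu>" and sets: "sets \<nu> = sets \<mu>"
    and w[measurable]: "w \<in> borel_measurable \<mu>" and w_bounds: "\<And>x. 1 \<le> w x" "\<And>x. w x \<le> 3"
    and f[measurable]: "f \<in> borel_measurable \<mu>"
    and eq: "\<And>s. (\<integral>x. w x *\<^sub>R cis (s * f x) \<partial>\<mu>) = (\<integral>x. w x *\<^sub>R cis (s * f x) \<partial>\<nu>)"
    and B[measurable]: "B \<in> sets borel"
  shows "(\<integral>x. w x * indicator B (f x) \<partial>\<mu>) = (\<integral>x. w x * indicator B (f x) \<partial>\<nu>)"
proof -
  interpret \<mu>: prob_space \<mu> by fact
  interpret \<nu>: prob_space \<nu> by fact
  have w\<nu>[measurable]: "w \<in> borel_measurable \<nu>" and f\<nu>[measurable]: "f \<in> borel_measurable \<nu>"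
    using sets by (simp_all cong: measurable_cong_sets)
  have "norm (w x) \<le> 3" for x
    using w_bounds(1)[of x] w_bounds(2)[of x] by simp
  hence wi: "integrable \<mu> w" "integrable \<nu> w"
    by (auto intro!: \<mu>.integrable_const_bound[of _ 3] \<nu>.integrable_const_bound[of _ 3])
  define c where "c = (\<integral>x. w x \<partial>\<mu>)"
  have "complex_of_real (\<integral>x. w x \<partial>\<mu>) = complex_of_real (\<integral>x. w x \<partial>\<nu>)"
    using eq[of 0] by (simp add: scaleR_conv_of_real del: of_real_eq_iff integral_complex_of_real)
      (simp only: integral_complex_of_real)
  hence c\<nu>: "c = (\<integral>x. w x \<partial>\<nu>)" by (simp add: c_def)
  have "1 \<le> c"
    unfolding c_def using \<mu>.integral_ge_const[OF wi(1), of 1] w_bounds(1) by simp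
  hence cpos: "0 < c" by simp
  have w0: "0 \<le> w x / c" for x using w_bounds(1)[of x] cpos by simp
  have ps: "prob_space (density \<mu> (\<lambda>x. ennreal (w x / c)))" "prob_space (density \<nu> (\<lambda>x. ennreal (w x / c)))"
    using w0 wi cpos
    by (auto intro!: prob_spaceI simp: emeasure_density nn_integral_eq_integral c_def[symmetric] c\<nu>[symmetric])
  have "distr (density \<mu> (\<lambda>x. ennreal (w x / c))) borel f = distr (density \<nu> (\<lambda>x. ennreal (w x / c))) borel f"
  proof (rule distr_eqI_cis[OF ps])
    fix s
    have "(\<integral>x. (w x / c) *\<^sub>R cis (s * f x) \<partial>\<mu>) = (\<integral>x. (w x / c) *\<^sub>R cis (s * f x) \<partial>\<nu>)"
      using arg_cong[OF eq[of s], of "\<lambda>z. (1 / c) *\<^sub>R z"] by (simp flip: integral_scaleR_right)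
    thus "(\<integral>x. cis (s * f x) \<partial>density \<mu> (\<lambda>x. ennreal (w x / c))) =
        (\<integral>x. cis (s * f x) \<partial>density \<nu> (\<lambda>x. ennreal (w x / c)))"
      by (simp add: integral_density w0)
  qed auto
  moreover have "integral\<^sup>L (distr (density \<mu> (\<lambda>x. ennreal (w x / c))) borel f) (indicator B) =
      (\<integral>x. w x * indicator B (f x) \<partial>\<mu>) / c"
    using w0 by (subst integral_distr) (auto simp: integral_density simp flip: integral_divide_zero)
  moreover have "integral\<^sup>L (distr (density \<nu> (\<lambda>x. ennreal (w x / c))) borel f) (indicator B) =
      (\<integral>x. w x * indicator B (f x) \<partial>\<nu>) / c"
    using w0 by (subst integral_distr) (auto simp: integral_density simp flip: integral_divide_zero)
  ultimately show ?thesis using cpos by simp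
qed

text \<open>Reduction to the one-dimensional uniqueness theorem, one coordinate at a time. In the
  induction \<open>J\<close> collects the coordinates on which indicator functions are already
  allowed, while \<open>cis (u \<bullet> x)\<close> takes care of the others; at the end
  \<open>u = 0\<close> gives the measure of boxes.\<close>

theorem char_multivariate_unique:
  fixes \<mu> \<nu> :: "'a::euclidean_space measure"
  assumes "prob_space \<mu>" "prob_space \<nu>" and sets[measurable_cong]: "sets \<mu> = sets borel" "sets \<nu> = sets borel"
    and eq: "\<And>u. (\<integral>x. cis (u \<bullet> x) \<partial>\<mu>) = (\<integral>x. cis (u \<bullet> x) \<partial>\<nu>)"
  shows "\<mu> = \<nu>"
proof -
  interpret \<mu>: prob_space \<mu> by fact
  interpret \<nu>: prob_space \<nu> by fact
  have [measurable]: "(\<lambda>x. \<Prod>b\<in>J. indicator (A b) (x \<bullet> b) :: real) \<in> borel_measurable borel"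
    if "\<And>b. A b \<in> sets borel" for J :: "'a set" and A :: "'a \<Rightarrow> real set"
    by (intro borel_measurable_prod measurable_compose[OF _ borel_measurable_indicator[OF that]]) simp
  have main: "(\<integral>x. (\<Prod>b\<in>J. indicator (A b) (x \<bullet> b)) *\<^sub>R cis (u \<bullet> x) \<partial>\<mu>) =
      (\<integral>x. (\<Prod>b\<in>J. indicator (A b) (x \<bullet> b)) *\<^sub>R cis (u \<bullet> x) \<partial>\<nu>)"
    if "finite J" and A: "\<And>b. A b \<in> sets borel" for J u and A :: "'a \<Rightarrow> real set"
    using that(1)
  proof (induction J arbitrary: u)
    case empty
    show ?case using eq by simp
  next
    case (insert b J)
    define g where "g = (\<lambda>x. \<Prod>b\<in>J. indicator (A b) (x \<bullet> b) :: real)"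
    have g[measurable]: "g \<in> borel_measurable borel"
      unfolding g_def using A by measurable
    have g01: "0 \<le> g x" "g x \<le> 1" for x
      unfolding g_def by (auto intro!: prod_nonneg prod_le_1 simp: indicator_def)
    have IH: "(\<integral>x. g x *\<^sub>R cis (v \<bullet> x) \<partial>\<mu>) = (\<integral>x. g x *\<^sub>R cis (v \<bullet> x) \<partial>\<nu>)" for v
      using insert.IH[of v] by (simp add: g_def)
    have gi: "integrable \<mu> (\<lambda>x. g x *\<^sub>R cis (v \<bullet> x))" "integrable \<nu> (\<lambda>x. g x *\<^sub>R cis (v \<bullet> x))" for v
      using g01 by (auto intro!: \<mu>.integrable_const_bound[of _ 1] \<nu>.integrable_const_bound[of _ 1])
    have ci: "integrable \<mu> (\<lambda>x. cis (v \<bullet> x))" "integrable \<nu> (\<lambda>x. cis (v \<bullet> x))" for v :: 'a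
      by (auto intro!: \<mu>.integrable_cis \<nu>.integrable_cis)
    \<comment> \<open>The signed function \<open>g x * h (u \<bullet> x)\<close> cannot serve as a
      density. Adding 2 puts it between 1 and 3, and the contribution of the constant is subtracted
      afterwards. The premise on \<open>h\<close> asks for an expansion into characters, to which
      the induction hypothesis applies.\<close>
    have gB: "(\<integral>x. g x * h (u \<bullet> x) * indicator (A b) (x \<bullet> b) \<partial>\<mu>) =
        (\<integral>x. g x * h (u \<bullet> x) * indicator (A b) (x \<bullet> b) \<partial>\<nu>)"
      if h: "\<And>s. \<exists>\<alpha> \<beta>. \<forall>x. g x *\<^sub>R (h (u \<bullet> x) *\<^sub>R cis (s * (x \<bullet> b))) =
            \<alpha> * (g x *\<^sub>R cis ((s *\<^sub>R b + u) \<bullet> x)) + \<beta> * (g x *\<^sub>R cis ((s *\<^sub>R b - u) \<bullet> x))"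
        and h1: "\<And>y. \<bar>h y\<bar> \<le> 1" and [measurable]: "h \<in> borel_measurable borel" for h :: "real \<Rightarrow> real"
    proof -
      have gh: "\<bar>g x * h y\<bar> \<le> 1" for x y
        using g01[of x] h1[of y] by (simp add: abs_mult mult_le_one)
      have bnd: "\<bar>g x * h (u \<bullet> x) * indicator (A b) (x \<bullet> b)\<bar> \<le> 1" for x
        using gh[of x "u \<bullet> x"] by (auto simp: indicator_def)
      have i1: "integrable \<mu> (\<lambda>x. g x * h (u \<bullet> x) * indicator (A b) (x \<bullet> b))"
        "integrable \<nu> (\<lambda>x. g x * h (u \<bullet> x) * indicator (A b) (x \<bullet> b))"
        "integrable \<mu> (\<lambda>x. indicator (A b) (x \<bullet> b) :: real)"
        "integrable \<nu> (\<lambda>x. indicator (A b) (x \<bullet> b) :: real)"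
        using bnd A by (auto intro!: \<mu>.integrable_const_bound[of _ 1] \<nu>.integrable_const_bound[of _ 1]
            simp: indicator_def)
      have "(\<integral>x. (2 + g x * h (u \<bullet> x)) * indicator (A b) (x \<bullet> b) \<partial>\<mu>) =
          (\<integral>x. (2 + g x * h (u \<bullet> x)) * indicator (A b) (x \<bullet> b) \<partial>\<nu>)"
      proof (rule weighted_char_unique[OF assms(1,2)])
        fix s
        obtain \<alpha> \<beta> where ab: "\<And>x. g x *\<^sub>R (h (u \<bullet> x) *\<^sub>R cis (s * (x \<bullet> b))) =
            \<alpha> * (g x *\<^sub>R cis ((s *\<^sub>R b + u) \<bullet> x)) + \<beta> * (g x *\<^sub>R cis ((s *\<^sub>R b - u) \<bullet> x))"
          using h[of s] by blast
        have *: "(2 + g x * h (u \<bullet> x)) *\<^sub>R cis (s * (x \<bullet> b)) = 2 * cis ((s *\<^sub>R b) \<bullet> x) +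
            (\<alpha> * (g x *\<^sub>R cis ((s *\<^sub>R b + u) \<bullet> x)) + \<beta> * (g x *\<^sub>R cis ((s *\<^sub>R b - u) \<bullet> x)))" for x
          unfolding ab[symmetric] by (simp add: scaleR_conv_of_real inner_commute algebra_simps)
        have lin: "(\<integral>x. 2 * f1 x + (\<alpha> * f2 x + \<beta> * f3 x) \<partial>N) =
            2 * (\<integral>x. f1 x \<partial>N) + (\<alpha> * (\<integral>x. f2 x \<partial>N) + \<beta> * (\<integral>x. f3 x \<partial>N))"
          if "integrable N f1" "integrable N f2" "integrable N f3"
          for f1 f2 f3 :: "'a \<Rightarrow> complex" and N
          using that by simp
        show "(\<integral>x. (2 + g x * h (u \<bullet> x)) *\<^sub>R cis (s * (x \<bullet> b)) \<partial>\<mu>) =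
            (\<integral>x. (2 + g x * h (u \<bullet> x)) *\<^sub>R cis (s * (x \<bullet> b)) \<partial>\<nu>)"
          unfolding * lin[OF ci(1) gi(1) gi(1)] lin[OF ci(2) gi(2) gi(2)] IH eq ..
      next
        show "1 \<le> 2 + g x * h (u \<bullet> x)" "2 + g x * h (u \<bullet> x) \<le> 3" for x
          using gh[of x "u \<bullet> x"] by (auto simp: abs_le_iff)
      qed (use A sets in auto)
      moreover have "(\<integral>x. 1 * indicator (A b) (x \<bullet> b) \<partial>\<mu>) = (\<integral>x. 1 * indicator (A b) (x \<bullet> b) \<partial>\<nu> :: real)"
      proof (rule weighted_char_unique[OF assms(1,2)])
        show "(\<integral>x. 1 *\<^sub>R cis (s * (x \<bullet> b)) \<partial>\<mu>) = (\<integral>x. 1 *\<^sub>R cis (s * (x \<bullet> b)) \<partial>\<nu>)" for s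
          using eq[of "s *\<^sub>R b"] by (simp add: inner_commute)
      qed (use A sets in auto)
      ultimately show ?thesis
        using i1 by (simp add: distrib_right)
    qed
    have cosB: "(\<integral>x. g x * cos (u \<bullet> x) * indicator (A b) (x \<bullet> b) \<partial>\<mu>) =
        (\<integral>x. g x * cos (u \<bullet> x) * indicator (A b) (x \<bullet> b) \<partial>\<nu>)"
    proof (rule gB)
      fix s
      show "\<exists>\<alpha> \<beta>. \<forall>x. g x *\<^sub>R (cos (u \<bullet> x) *\<^sub>R cis (s * (x \<bullet> b))) =
            \<alpha> * (g x *\<^sub>R cis ((s *\<^sub>R b + u) \<bullet> x)) + \<beta> * (g x *\<^sub>R cis ((s *\<^sub>R b - u) \<bullet> x))"
        by (rule exI[of _ "1/2"], rule exI[of _ "1/2"])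
          (auto simp: complex_eq_iff inner_add_left inner_diff_left cos_add sin_add cos_diff sin_diff
            inner_commute[of b] field_simps)
    qed auto
    have sinB: "(\<integral>x. g x * sin (u \<bullet> x) * indicator (A b) (x \<bullet> b) \<partial>\<mu>) =
        (\<integral>x. g x * sin (u \<bullet> x) * indicator (A b) (x \<bullet> b) \<partial>\<nu>)"
    proof (rule gB)
      fix s
      show "\<exists>\<alpha> \<beta>. \<forall>x. g x *\<^sub>R (sin (u \<bullet> x) *\<^sub>R cis (s * (x \<bullet> b))) =
            \<alpha> * (g x *\<^sub>R cis ((s *\<^sub>R b + u) \<bullet> x)) + \<beta> * (g x *\<^sub>R cis ((s *\<^sub>R b - u) \<bullet> x))"
        \<comment> \<open>Euler's formula for the sine, with \<open>- \<i> / 2\<close> standing for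
          \<open>1 / (2 * \<i>)\<close>.\<close>
        by (rule exI[of _ "- \<i> / 2"], rule exI[of _ "\<i> / 2"])
          (auto simp: complex_eq_iff inner_add_left inner_diff_left cos_add sin_add cos_diff sin_diff
            inner_commute[of b] field_simps)
    qed auto
    have "\<bar>g x * h (u \<bullet> x) * indicator (A b) (x \<bullet> b)\<bar> \<le> 1" if "\<And>y. \<bar>h y\<bar> \<le> 1" for x and h :: "real \<Rightarrow> real"
      using g01[of x] that[of "u \<bullet> x"] by (auto simp: abs_mult indicator_def mult_le_one)
    hence i2: "integrable N (\<lambda>x. g x * cos (u \<bullet> x) * indicator (A b) (x \<bullet> b))"
      "integrable N (\<lambda>x. g x * sin (u \<bullet> x) * indicator (A b) (x \<bullet> b))"
      if "prob_space N" "sets N = sets borel" for N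
    proof -
      interpret N: prob_space N by fact
      note that(2)[measurable_cong]
      show "integrable N (\<lambda>x. g x * cos (u \<bullet> x) * indicator (A b) (x \<bullet> b))"
        "integrable N (\<lambda>x. g x * sin (u \<bullet> x) * indicator (A b) (x \<bullet> b))"
        using \<open>\<And>x h. (\<And>y. \<bar>h y\<bar> \<le> 1) \<Longrightarrow> \<bar>g x * h (u \<bullet> x) * indicator (A b) (x \<bullet> b)\<bar> \<le> 1\<close> A
        by (auto intro!: N.integrable_const_bound[of _ 1])
    qed
    have split: "(\<Prod>b\<in>insert b J. indicator (A b) (x \<bullet> b)) *\<^sub>R cis (u \<bullet> x) =
        complex_of_real (g x * cos (u \<bullet> x) * indicator (A b) (x \<bullet> b)) +
        \<i> * complex_of_real (g x * sin (u \<bullet> x) * indicator (A b) (x \<bullet> b))" for x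
    proof -
      have "(\<Prod>b\<in>J. indicator (A b) (x \<bullet> b)) = g x" by (simp add: g_def)
      thus ?thesis using insert.hyps by (simp add: complex_eq_iff mult_ac)
    qed
    show ?case
      unfolding split using i2[OF assms(1) sets(1)] i2[OF assms(2) sets(2)]
      by (subst (1 2) Bochner_Integration.integral_add)
         (auto simp only: integral_mult_right_zero integral_complex_of_real cosB sinB
            intro!: integrable_mult_right integrable_of_real)
  qed
  show ?thesis
  proof (rule measure_eqI_generator_eq)
    let ?E = "range (\<lambda>(a, b). box a b::'a set)"
    show "Int_stable ?E"
      by (auto simp: Int_stable_def box_Int_box)
    show "?E \<subseteq> Pow UNIV" "sets \<mu> = sigma_sets UNIV ?E" "sets \<nu> = sigma_sets UNIV ?E"
      by (simp_all add: borel_eq_box sets)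
    let ?A = "\<lambda>n::nat. box (- (real n *\<^sub>R One)) (real n *\<^sub>R One) :: 'a set"
    show "range ?A \<subseteq> ?E" "(\<Union>i. ?A i) = UNIV"
      unfolding UN_box_eq_UNIV by auto
    show "emeasure \<mu> (?A i) \<noteq> \<infinity>" for i by simp
    fix X assume "X \<in> ?E"
    then obtain l r where X: "X = box l r" by auto
    have ind: "(\<Prod>b\<in>Basis. indicator {l \<bullet> b<..<r \<bullet> b} (x \<bullet> b)) *\<^sub>R cis (0 \<bullet> x) = complex_of_real (indicator X x)"
      for x :: 'a
      by (auto simp: X mem_box indicator_def prod_zero_iff)
    have "complex_of_real (measure \<mu> X) = complex_of_real (measure \<nu> X)"
      using main[OF finite_Basis, of "\<lambda>b. {l \<bullet> b<..<r \<bullet> b}" 0]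
      unfolding ind integral_complex_of_real by (simp add: X)
    thus "emeasure \<mu> X = emeasure \<nu> X"
      by (simp add: \<mu>.emeasure_eq_measure \<nu>.emeasure_eq_measure)
  qed
qed

section \<open>Independence and conditional laws\<close>

lemma (in prob_space) indep_var_of_indep_set:
  assumes indep: "indep_set (sets F) (sets G)" and sp: "space F = space M" "space G = space M"
    and X: "X \<in> measurable F S" and Y: "Y \<in> measurable G T"
  shows "indep_var S X T Y"
proof -
  have ev: "sets F \<subseteq> events" "sets G \<subseteq> events"
    using indep_setD_ev1[OF indep] indep_setD_ev2[OF indep] by auto
  have sub: "subalgebra M F" "subalgebra M G"
    using sp ev by (auto simp: subalgebra_def)
  have "{X -` A \<inter> space M | A. A \<in> sets S} \<subseteq> sets F" "{Y -` A \<inter> space M | A. A \<in> sets T} \<subseteq> sets G"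
    using measurable_sets[OF X] measurable_sets[OF Y] sp by auto
  moreover have "sigma_sets (space M) \<A> \<subseteq> sets N" if "\<A> \<subseteq> sets N" "space N = space M" for \<A> N
    using sets.sigma_sets_subset[OF that(1)] that(2) by simp
  ultimately have ss: "sigma_sets (space M) {X -` A \<inter> space M | A. A \<in> sets S} \<subseteq> sets F"
    "sigma_sets (space M) {Y -` A \<inter> space M | A. A \<in> sets T} \<subseteq> sets G"
    using sp by blast+
  show ?thesis
    unfolding indep_var_eq
  proof (intro conjI measurable_from_subalg[OF sub(1) X] measurable_from_subalg[OF sub(2) Y])
    show "indep_set (sigma_sets (space M) {X -` A \<inter> space M | A. A \<in> sets S})
        (sigma_sets (space M) {Y -` A \<inter> space M | A. A \<in> sets T})"
      using indep ss unfolding indep_sets2_eq by (meson subsetD subset_trans)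
  qed
qed

lemma (in prob_space) integral_cis_add:
  assumes "indep_var borel X borel (Y :: 'a \<Rightarrow> real)"
  shows "(\<integral>\<omega>. cis (X \<omega> + Y \<omega>) \<partial>M) = (\<integral>\<omega>. cis (X \<omega>) \<partial>M) * (\<integral>\<omega>. cis (Y \<omega>) \<partial>M)"
  using char_distr_add[OF assms, of 1] indep_var_rv1[OF assms] indep_var_rv2[OF assms]
  by (simp add: char_distr_eq_cis)

text \<open>Under independence the diagonal map into the product of the two sigma-algebras has the
  product law, so an integral over one point becomes a double integral. Joint measurability is asked
  for with respect to the product of the small sigma-algebras, because these are the independent
  ones.\<close>

lemma (in prob_space) integral_freeze:
  fixes f :: "'a \<times> 'a \<Rightarrow> complex"
  assumes indep: "indep_set (sets F) (sets G)" and sp: "space F = space M" "space G = space M"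
    and f[measurable]: "f \<in> borel_measurable (F \<Otimes>\<^sub>M G)" and bound: "\<And>z. norm (f z) \<le> 1"
  shows "(\<integral>\<omega>. f (\<omega>, \<omega>) \<partial>M) = (\<integral>\<omega>. (\<integral>\<omega>'. f (\<omega>, \<omega>') \<partial>M) \<partial>M)"
proof -
  have ind: "indep_var F (\<lambda>x. x) G (\<lambda>x. x)"
    by (rule indep_var_of_indep_set[OF indep sp]) auto
  note rv = indep_var_rv1[OF ind] indep_var_rv2[OF ind]
  note [measurable] = rv
  have eq: "distr M F (\<lambda>x. x) \<Otimes>\<^sub>M distr M G (\<lambda>x. x) = distr M (F \<Otimes>\<^sub>M G) (\<lambda>x. (x, x))"
    using ind by (simp add: indep_var_distribution_eq)
  interpret F: prob_space "distr M F (\<lambda>x. x)" by (rule prob_space_distr) fact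
  interpret G: prob_space "distr M G (\<lambda>x. x)" by (rule prob_space_distr) fact
  interpret FG: pair_prob_space "distr M F (\<lambda>x. x)" "distr M G (\<lambda>x. x)" ..
  have [measurable_cong]: "sets (distr M F (\<lambda>x. x) \<Otimes>\<^sub>M distr M G (\<lambda>x. x)) = sets (F \<Otimes>\<^sub>M G)"
    by (intro sets_pair_measure_cong) auto
  have int: "integrable (distr M F (\<lambda>x. x) \<Otimes>\<^sub>M distr M G (\<lambda>x. x)) f"
    by (rule FG.integrable_const_bound[of _ 1]) (use bound in auto)
  have "(\<integral>\<omega>. f (\<omega>, \<omega>) \<partial>M) = integral\<^sup>L (distr M (F \<Otimes>\<^sub>M G) (\<lambda>x. (x, x))) f"
    by (simp add: integral_distr)
  also have "\<dots> = (\<integral>x. (\<integral>y. f (x, y) \<partial>distr M G (\<lambda>x. x)) \<partial>distr M F (\<lambda>x. x))"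
    unfolding eq[symmetric] by (rule FG.integral_fst'[OF int, symmetric])
  also have "\<dots> = (\<integral>x. (\<integral>y. f (x, y) \<partial>distr M G (\<lambda>x. x)) \<partial>M)"
    by (intro integral_distr rv G.borel_measurable_lebesgue_integral) simp
  also have "\<dots> = (\<integral>\<omega>. (\<integral>\<omega>'. f (\<omega>, \<omega>') \<partial>M) \<partial>M)"
  proof (rule Bochner_Integration.integral_cong[OF refl])
    fix x assume "x \<in> space M"
    hence "x \<in> space F" using sp by simp
    hence "(\<lambda>y. f (x, y)) \<in> borel_measurable G" by measurable
    thus "(\<integral>y. f (x, y) \<partial>distr M G (\<lambda>x. x)) = (\<integral>\<omega>'. f (x, \<omega>') \<partial>M)"
      by (intro integral_distr rv)
  qed
  finally show ?thesis .
qed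

text \<open>The hypotheses make \<open>h\<close> a conditional expectation of \<open>k\<close>, and
  this is its contraction property in mean. For a real function the test set is the one where it is
  nonnegative; treating real and imaginary part separately costs the factor 2.\<close>

lemma (in prob_space) norm_integral_le_of_cond_eq:
  fixes h k :: "'a \<Rightarrow> complex"
  assumes sub: "subalgebra M F" and h[measurable]: "h \<in> borel_measurable F"
    and hi: "integrable M h" and ki: "integrable M k"
    and eq: "\<And>D. D \<in> sets F \<Longrightarrow> (\<integral>\<omega>. indicator D \<omega> *\<^sub>R h \<omega> \<partial>M) = (\<integral>\<omega>. indicator D \<omega> *\<^sub>R k \<omega> \<partial>M)"
  shows "(\<integral>\<omega>. norm (h \<omega>) \<partial>M) \<le> 2 * (\<integral>\<omega>. norm (k \<omega>) \<partial>M)"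
proof -
  have part: "(\<integral>\<omega>. \<bar>L (h \<omega>)\<bar> \<partial>M) \<le> (\<integral>\<omega>. norm (k \<omega>) \<partial>M)"
    if L: "bounded_linear L" "\<And>z. \<bar>L z\<bar> \<le> norm z" for L :: "complex \<Rightarrow> real"
  proof -
    have Lm[measurable]: "L \<in> borel_measurable borel"
      using bounded_linear.continuous_on[OF L(1) continuous_on_id] borel_measurable_continuous_onI by blast
    define D where "D = {\<omega>\<in>space F. 0 \<le> L (h \<omega>)}"
    have D: "D \<in> sets F" "space F - D \<in> sets F" unfolding D_def by measurable
    have spF: "space F = space M" using sub by (simp add: subalgebra_def)
    have DM: "D \<in> events" "space M - D \<in> events"
      using D sub spF by (auto simp: subalgebra_def)
    have Li: "integrable M (\<lambda>\<omega>. L (h \<omega>))" "integrable M (\<lambda>\<omega>. L (k \<omega>))"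
      using integrable_bounded_linear[OF L(1)] hi ki by auto
    have *: "(\<integral>\<omega>. indicator E \<omega> *\<^sub>R L (h \<omega>) \<partial>M) = (\<integral>\<omega>. indicator E \<omega> *\<^sub>R L (k \<omega>) \<partial>M)"
      if E: "E \<in> sets F" "E \<in> events" for E
    proof -
      have "L (\<integral>\<omega>. indicator E \<omega> *\<^sub>R h \<omega> \<partial>M) = L (\<integral>\<omega>. indicator E \<omega> *\<^sub>R k \<omega> \<partial>M)"
        using eq[OF E(1)] by simp
      thus ?thesis
        using integral_bounded_linear[OF L(1) integrable_mult_indicator[OF E(2) hi]]
          integral_bounded_linear[OF L(1) integrable_mult_indicator[OF E(2) ki]]
        by (simp add: linear_scale[OF bounded_linear.linear[OF L(1)]])
    qed
    have "(\<integral>\<omega>. \<bar>L (h \<omega>)\<bar> \<partial>M) =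
        (\<integral>\<omega>. indicator D \<omega> *\<^sub>R L (h \<omega>) - indicator (space M - D) \<omega> *\<^sub>R L (h \<omega>) \<partial>M)"
      by (intro Bochner_Integration.integral_cong) (auto simp: D_def spF indicator_def)
    also have "\<dots> = (\<integral>\<omega>. indicator D \<omega> *\<^sub>R L (h \<omega>) \<partial>M) - (\<integral>\<omega>. indicator (space M - D) \<omega> *\<^sub>R L (h \<omega>) \<partial>M)"
      by (intro Bochner_Integration.integral_diff integrable_mult_indicator DM Li)
    also have "\<dots> = (\<integral>\<omega>. indicator D \<omega> *\<^sub>R L (k \<omega>) \<partial>M) - (\<integral>\<omega>. indicator (space M - D) \<omega> *\<^sub>R L (k \<omega>) \<partial>M)"
      using *[OF D(1) DM(1)] *[OF D(2)[unfolded spF] DM(2)] by simp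
    also have "\<dots> = (\<integral>\<omega>. indicator D \<omega> *\<^sub>R L (k \<omega>) - indicator (space M - D) \<omega> *\<^sub>R L (k \<omega>) \<partial>M)"
      by (intro Bochner_Integration.integral_diff[symmetric] integrable_mult_indicator DM Li)
    also have "\<dots> \<le> (\<integral>\<omega>. norm (k \<omega>) \<partial>M)"
    proof (intro integral_mono Bochner_Integration.integrable_diff integrable_mult_indicator DM Li integrable_norm ki)
      fix \<omega>
      show "indicator D \<omega> *\<^sub>R L (k \<omega>) - indicator (space M - D) \<omega> *\<^sub>R L (k \<omega>) \<le> norm (k \<omega>)"
        using L(2)[of "k \<omega>"] by (auto simp: indicator_def abs_le_iff)
    qed
    finally show ?thesis .
  qed
  have "(\<integral>\<omega>. norm (h \<omega>) \<partial>M) \<le> (\<integral>\<omega>. \<bar>Re (h \<omega>)\<bar> + \<bar>Im (h \<omega>)\<bar> \<partial>M)"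
    using hi by (intro integral_mono integrable_norm Bochner_Integration.integrable_add)
      (auto simp: cmod_le intro!: integrable_norm[of _ "\<lambda>x. Re (h x)", unfolded real_norm_def]
        integrable_norm[of _ "\<lambda>x. Im (h x)", unfolded real_norm_def])
  also have "\<dots> = (\<integral>\<omega>. \<bar>Re (h \<omega>)\<bar> \<partial>M) + (\<integral>\<omega>. \<bar>Im (h \<omega>)\<bar> \<partial>M)"
    using hi by (intro Bochner_Integration.integral_add) auto
  finally show ?thesis
    using part[OF bounded_linear_Re abs_Re_le_cmod] part[OF bounded_linear_Im abs_Im_le_cmod] by linarith
qed

text \<open>\<open>is_conditional_law\<close> gives an identity for each Borel set, with an
  exceptional set that may depend on it. Read as the equality of two measures on the state space,
  after restriction to the event \<open>D\<close>, it extends to all nonnegative Borel functions at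
  once.\<close>

lemma (in prob_space) conditional_law_nn_integral:
  fixes X :: "'a \<Rightarrow> 'b::topological_space"
  assumes sub: "subalgebra M F" and X[measurable]: "X \<in> borel_measurable M"
    and \<eta>: "is_conditional_law M F X \<eta>" and D: "D \<in> sets F"
    and f[measurable]: "f \<in> borel_measurable borel"
  shows "(\<integral>\<^sup>+\<omega>. indicator D \<omega> * f (X \<omega>) \<partial>M) = (\<integral>\<^sup>+\<omega>. indicator D \<omega> * (\<integral>\<^sup>+x. f x \<partial>\<eta> \<omega>) \<partial>M)"
proof -
  have DM[measurable]: "D \<in> events" using D sub by (auto simp: subalgebra_def)
  have \<eta>p: "\<eta> \<in> measurable M (prob_algebra borel)"
    using \<eta> measurable_from_subalg[OF sub] by (auto simp: is_conditional_law_def)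
  have \<eta>s[measurable]: "\<eta> \<in> measurable M (subprob_algebra borel)"
    using \<eta>p by (rule measurable_prob_algebraD)
  have \<eta>prob: "prob_space (\<eta> \<omega>)" if "\<omega> \<in> space M" for \<omega>
    using measurable_space[OF \<eta>p that] by (simp add: space_prob_algebra)
  let ?MD = "density M (indicator D)"
  interpret sigma_finite_subalgebra M F
    by (rule finite_measure_subalgebra_is_sigma_finite)
      (simp add: finite_measure_subalgebra_def finite_measure_subalgebra_axioms_def sub finite_measure_axioms)
  have "distr ?MD borel X = ?MD \<bind> \<eta>"
  proof (rule measure_eqI)
    have "space ?MD \<noteq> {}" using not_empty by simp
    thus sb: "sets (distr ?MD borel X) = sets (?MD \<bind> \<eta>)"
      by (subst sets_bind[where N = borel]) (auto intro!: sets_kernel[OF \<eta>s])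
    fix B assume "B \<in> sets (distr ?MD borel X)"
    hence B[measurable]: "B \<in> sets borel" by simp
    have mB: "(\<lambda>\<omega>. measure (\<eta> \<omega>) B) \<in> borel_measurable M" by measurable
    have mi: "integrable M (\<lambda>\<omega>. indicator D \<omega> * measure (\<eta> \<omega>) B)"
      using \<eta>prob by (intro integrable_const_bound[of _ 1])
        (auto simp: indicator_def abs_if prob_space.prob_le_1 intro!: AE_I2)
    have "emeasure (?MD \<bind> \<eta>) B = (\<integral>\<^sup>+\<omega>. emeasure (\<eta> \<omega>) B \<partial>?MD)"
      using \<open>space ?MD \<noteq> {}\<close> by (intro emeasure_bind[where N = borel]) auto
    also have "\<dots> = (\<integral>\<^sup>+\<omega>. indicator D \<omega> * emeasure (\<eta> \<omega>) B \<partial>M)"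
      by (intro nn_integral_density) auto
    also have "\<dots> = (\<integral>\<^sup>+\<omega>. ennreal (indicator D \<omega> * measure (\<eta> \<omega>) B) \<partial>M)"
      using \<eta>prob by (intro nn_integral_cong)
        (auto simp: indicator_def finite_measure.emeasure_eq_measure prob_space.finite_measure)
    also have "\<dots> = ennreal (\<integral>\<omega>. indicator D \<omega> * measure (\<eta> \<omega>) B \<partial>M)"
      by (intro nn_integral_eq_integral mi) auto
    also have "(\<integral>\<omega>. indicator D \<omega> * measure (\<eta> \<omega>) B \<partial>M) =
        (\<integral>\<omega>. indicator D \<omega> * real_cond_exp M F (\<lambda>\<omega>. indicator B (X \<omega>)) \<omega> \<partial>M)"
    proof (rule integral_cong_AE)
      show "AE \<omega> in M. indicator D \<omega> * measure (\<eta> \<omega>) B =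
          indicator D \<omega> * real_cond_exp M F (\<lambda>\<omega>. indicator B (X \<omega>)) \<omega>"
        using \<eta> B by (auto simp: is_conditional_law_def)
    qed (use mB in auto)
    also have "\<dots> = (\<integral>\<omega>. indicator D \<omega> * indicator B (X \<omega>) \<partial>M)"
    proof -
      have "integrable M (\<lambda>\<omega>. indicator B (X \<omega>) :: real)"
        by (intro integrable_const_bound[of _ 1]) auto
      from real_cond_exp_intA[OF this D] show ?thesis
        by (simp add: set_lebesgue_integral_def)
    qed
    also have "ennreal \<dots> = (\<integral>\<^sup>+\<omega>. ennreal (indicator D \<omega> * indicator B (X \<omega>)) \<partial>M)"
      by (intro nn_integral_eq_integral[symmetric] integrable_const_bound[of _ 1]) (auto simp: indicator_def)
    also have "\<dots> = (\<integral>\<^sup>+\<omega>. indicator D \<omega> * indicator (X -` B \<inter> space M) \<omega> \<partial>M)"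
      by (intro nn_integral_cong) (auto simp: indicator_def)
    also have "\<dots> = emeasure ?MD (X -` B \<inter> space M)"
      by (simp add: emeasure_density)
    also have "\<dots> = emeasure (distr ?MD borel X) B"
      by (subst emeasure_distr) auto
    finally show "emeasure (distr ?MD borel X) B = emeasure (?MD \<bind> \<eta>) B" by simp
  qed
  moreover have "(\<integral>\<^sup>+x. f x \<partial>distr ?MD borel X) = (\<integral>\<^sup>+\<omega>. indicator D \<omega> * f (X \<omega>) \<partial>M)"
    by (simp add: nn_integral_distr nn_integral_density)
  moreover have "(\<integral>\<^sup>+x. f x \<partial>(?MD \<bind> \<eta>)) = (\<integral>\<^sup>+\<omega>. indicator D \<omega> * (\<integral>\<^sup>+x. f x \<partial>\<eta> \<omega>) \<partial>M)"
    by (subst nn_integral_bind[where B = borel]) (auto simp: nn_integral_density)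
  ultimately show ?thesis by simp
qed

text \<open>The characteristic function of the conditional law acts as conditional expectation of
  \<open>cis (u \<bullet> X)\<close>. The identity is tested on events, the form in which
  \<open>norm_integral_le_of_cond_eq\<close> takes it.\<close>

lemma (in prob_space) conditional_law_integral_cis:
  fixes X :: "'a \<Rightarrow> 'b::euclidean_space"
  assumes sub: "subalgebra M F" and X[measurable]: "X \<in> borel_measurable M"
    and \<eta>: "is_conditional_law M F X \<eta>"
  shows "(\<lambda>\<omega>. \<integral>x. cis (u \<bullet> x) \<partial>\<eta> \<omega>) \<in> borel_measurable F"
    and "D \<in> sets F \<Longrightarrow> (\<integral>\<omega>. indicator D \<omega> *\<^sub>R cis (u \<bullet> X \<omega>) \<partial>M) =
      (\<integral>\<omega>. indicator D \<omega> *\<^sub>R (\<integral>x. cis (u \<bullet> x) \<partial>\<eta> \<omega>) \<partial>M)"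
    and "\<omega> \<in> space M \<Longrightarrow> norm (\<integral>x. cis (u \<bullet> x) \<partial>\<eta> \<omega>) \<le> 1"
proof -
  have "\<eta> \<in> measurable F (prob_algebra borel)" using \<eta> by (simp add: is_conditional_law_def)
  hence \<eta>F: "\<eta> \<in> measurable F (subprob_algebra borel)" by (rule measurable_prob_algebraD)
  have \<eta>p: "\<eta> \<in> measurable M (prob_algebra borel)"
    using \<eta> measurable_from_subalg[OF sub] by (auto simp: is_conditional_law_def)
  have \<eta>s[measurable]: "\<eta> \<in> measurable M (subprob_algebra borel)"
    using \<eta>p by (rule measurable_prob_algebraD)
  have \<eta>prob: "prob_space (\<eta> \<omega>)" "sets (\<eta> \<omega>) = sets borel" if "\<omega> \<in> space M" for \<omega>
    using measurable_space[OF \<eta>p that] by (auto simp: space_prob_algebra)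
  show "(\<lambda>\<omega>. \<integral>x. cis (u \<bullet> x) \<partial>\<eta> \<omega>) \<in> borel_measurable F"
    by (rule measurable_compose[OF \<eta>F integral_measurable_subprob_algebra]) simp
  have nle: "norm (\<integral>x. cis (u \<bullet> x) \<partial>\<eta> \<omega>) \<le> 1" if w: "\<omega> \<in> space M" for \<omega>
  proof -
    interpret \<eta>\<omega>: prob_space "\<eta> \<omega>" by (rule \<eta>prob[OF w])
    have "norm (\<integral>x. cis (u \<bullet> x) \<partial>\<eta> \<omega>) \<le> (\<integral>x. norm (cis (u \<bullet> x)) \<partial>\<eta> \<omega>)"
      by (rule integral_norm_bound)
    thus ?thesis by (simp add: \<eta>\<omega>.prob_space)
  qed
  thus "\<omega> \<in> space M \<Longrightarrow> norm (\<integral>x. cis (u \<bullet> x) \<partial>\<eta> \<omega>) \<le> 1" by blast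
  assume D: "D \<in> sets F"
  have DM[measurable]: "D \<in> events" using D sub by (auto simp: subalgebra_def)
  have unit: "(\<integral>\<omega>. indicator D \<omega> * f (X \<omega>) \<partial>M) = (\<integral>\<omega>. indicator D \<omega> * (\<integral>x. f x \<partial>\<eta> \<omega>) \<partial>M)"
    if [measurable]: "f \<in> borel_measurable borel" and f: "\<And>x. 0 \<le> f x" "\<And>x. f x \<le> 1" for f :: "'b \<Rightarrow> real"
  proof -
    have fi: "integrable (\<eta> \<omega>) f" and fb: "0 \<le> (\<integral>x. f x \<partial>\<eta> \<omega>)" "(\<integral>x. f x \<partial>\<eta> \<omega>) \<le> 1"
      if w: "\<omega> \<in> space M" for \<omega>
    proof -
      interpret \<eta>\<omega>: prob_space "\<eta> \<omega>" by (rule \<eta>prob[OF w])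
      have "f \<in> borel_measurable (\<eta> \<omega>)"
        using \<eta>prob(2)[OF w] by (simp cong: measurable_cong_sets)
      thus i: "integrable (\<eta> \<omega>) f"
        using f by (intro \<eta>\<omega>.integrable_const_bound[of _ 1]) auto
      show "0 \<le> (\<integral>x. f x \<partial>\<eta> \<omega>)" using f by simp
      show "(\<integral>x. f x \<partial>\<eta> \<omega>) \<le> 1" using \<eta>\<omega>.integral_le_const[OF i, of 1] f by simp
    qed
    have [measurable]: "(\<lambda>\<omega>. \<integral>x. f x \<partial>\<eta> \<omega>) \<in> borel_measurable M"
      by (rule measurable_compose[OF \<eta>s integral_measurable_subprob_algebra]) simp
    have "ennreal (\<integral>\<omega>. indicator D \<omega> * f (X \<omega>) \<partial>M) = (\<integral>\<^sup>+\<omega>. indicator D \<omega> * ennreal (f (X \<omega>)) \<partial>M)"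
      using f by (subst nn_integral_eq_integral[symmetric])
        (auto intro!: integrable_const_bound[of _ 1] nn_integral_cong simp: indicator_def)
    also have "\<dots> = (\<integral>\<^sup>+\<omega>. indicator D \<omega> * (\<integral>\<^sup>+x. ennreal (f x) \<partial>\<eta> \<omega>) \<partial>M)"
      by (intro conditional_law_nn_integral[OF sub X \<eta> D]) simp
    also have "\<dots> = (\<integral>\<^sup>+\<omega>. ennreal (indicator D \<omega> * (\<integral>x. f x \<partial>\<eta> \<omega>)) \<partial>M)"
      using fi f by (intro nn_integral_cong) (auto simp: indicator_def nn_integral_eq_integral)
    also have "\<dots> = ennreal (\<integral>\<omega>. indicator D \<omega> * (\<integral>x. f x \<partial>\<eta> \<omega>) \<partial>M)"
      using fb by (intro nn_integral_eq_integral integrable_const_bound[of _ 1])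
        (auto simp: indicator_def intro!: AE_I2)
    finally show ?thesis
    proof (rule ennreal_inj[THEN iffD1, rotated 2])
      show "0 \<le> (\<integral>\<omega>. indicator D \<omega> * f (X \<omega>) \<partial>M)" using f by simp
      show "0 \<le> (\<integral>\<omega>. indicator D \<omega> * (\<integral>x. f x \<partial>\<eta> \<omega>) \<partial>M)"
        using fb by (intro integral_nonneg_AE AE_I2) auto
    qed
  qed
  \<comment> \<open>Signed integrands bounded by 1 are moved into the unit interval by
    \<open>(1 + h) / 2\<close>.\<close>
  have real: "(\<integral>\<omega>. indicator D \<omega> * h (u \<bullet> X \<omega>) \<partial>M) = (\<integral>\<omega>. indicator D \<omega> * (\<integral>x. h (u \<bullet> x) \<partial>\<eta> \<omega>) \<partial>M)"
    if [measurable]: "h \<in> borel_measurable borel" and h: "\<And>y. \<bar>h y\<bar> \<le> 1" for h :: "real \<Rightarrow> real"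
  proof -
    have hm: "(\<lambda>\<omega>. \<integral>x. h (u \<bullet> x) \<partial>\<eta> \<omega>) \<in> borel_measurable M"
      by (rule measurable_compose[OF \<eta>s integral_measurable_subprob_algebra]) simp
    have ih: "(\<integral>x. (1 + h (u \<bullet> x)) / 2 \<partial>\<eta> \<omega>) = (1 + (\<integral>x. h (u \<bullet> x) \<partial>\<eta> \<omega>)) / 2"
      and bh: "\<bar>\<integral>x. h (u \<bullet> x) \<partial>\<eta> \<omega>\<bar> \<le> 1" if w: "\<omega> \<in> space M" for \<omega>
    proof -
      interpret \<eta>\<omega>: prob_space "\<eta> \<omega>" by (rule \<eta>prob[OF w])
      have "(\<lambda>x. h (u \<bullet> x)) \<in> borel_measurable (\<eta> \<omega>)"
        using \<eta>prob(2)[OF w] by (simp cong: measurable_cong_sets)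
      hence i: "integrable (\<eta> \<omega>) (\<lambda>x. h (u \<bullet> x))"
        using h by (intro \<eta>\<omega>.integrable_const_bound[of _ 1]) auto
      show "(\<integral>x. (1 + h (u \<bullet> x)) / 2 \<partial>\<eta> \<omega>) = (1 + (\<integral>x. h (u \<bullet> x) \<partial>\<eta> \<omega>)) / 2"
        using i by (simp add: \<eta>\<omega>.prob_space)
      have "\<bar>\<integral>x. h (u \<bullet> x) \<partial>\<eta> \<omega>\<bar> \<le> (\<integral>x. \<bar>h (u \<bullet> x)\<bar> \<partial>\<eta> \<omega>)" by simp
      also have "\<dots> \<le> 1" using \<eta>\<omega>.integral_le_const[OF integrable_abs[OF i], of 1] h by simp
      finally show "\<bar>\<integral>x. h (u \<bullet> x) \<partial>\<eta> \<omega>\<bar> \<le> 1" .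
    qed
    have i1: "integrable M (\<lambda>\<omega>. indicator D \<omega> * h (u \<bullet> X \<omega>))"
      "integrable M (indicator D :: 'a \<Rightarrow> real)"
      using h by (auto intro!: integrable_const_bound[of _ 1] simp: indicator_def)
    have i2: "integrable M (\<lambda>\<omega>. indicator D \<omega> * (\<integral>x. h (u \<bullet> x) \<partial>\<eta> \<omega>))"
      using bh hm by (intro integrable_const_bound[of _ 1]) (auto simp: indicator_def intro!: AE_I2)
    have "(\<integral>\<omega>. indicator D \<omega> * ((1 + h (u \<bullet> X \<omega>)) / 2) \<partial>M) =
        (\<integral>\<omega>. indicator D \<omega> * (\<integral>x. (1 + h (u \<bullet> x)) / 2 \<partial>\<eta> \<omega>) \<partial>M)"
    proof (rule unit)
      show "0 \<le> (1 + h (u \<bullet> x)) / 2" "(1 + h (u \<bullet> x)) / 2 \<le> 1" for x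
        using h[of "u \<bullet> x"] by (auto simp: abs_le_iff)
    qed simp
    also have "\<dots> = (\<integral>\<omega>. indicator D \<omega> * ((1 + (\<integral>x. h (u \<bullet> x) \<partial>\<eta> \<omega>)) / 2) \<partial>M)"
      by (intro Bochner_Integration.integral_cong refl) (simp only: ih)
    finally have "(\<integral>\<omega>. (indicator D \<omega> + indicator D \<omega> * h (u \<bullet> X \<omega>)) / 2 \<partial>M) =
        (\<integral>\<omega>. (indicator D \<omega> + indicator D \<omega> * (\<integral>x. h (u \<bullet> x) \<partial>\<eta> \<omega>)) / 2 \<partial>M)"
      by (simp add: distrib_left)
    thus ?thesis using i1 i2 by simp
  qed

  have RI: "(\<integral>x. cis (u \<bullet> x) \<partial>\<eta> \<omega>) = Complex (\<integral>x. cos (u \<bullet> x) \<partial>\<eta> \<omega>) (\<integral>x. sin (u \<bullet> x) \<partial>\<eta> \<omega>)"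
    if w: "\<omega> \<in> space M" for \<omega>
  proof -
    interpret \<eta>\<omega>: prob_space "\<eta> \<omega>" by (rule \<eta>prob[OF w])
    have "(\<lambda>x. u \<bullet> x) \<in> borel_measurable (\<eta> \<omega>)"
      by (simp add: measurable_cong_sets[OF \<eta>prob(2)[OF w] refl])
    hence "integrable (\<eta> \<omega>) (\<lambda>x. cis (u \<bullet> x))" by (intro \<eta>\<omega>.integrable_cis)
    thus ?thesis by (simp add: complex_eq_iff flip: integral_Re integral_Im)
  qed
  have m[measurable]: "(\<lambda>\<omega>. \<integral>x. cis (u \<bullet> x) \<partial>\<eta> \<omega>) \<in> borel_measurable M"
    by (rule measurable_compose[OF \<eta>s integral_measurable_subprob_algebra]) simp
  have i3: "integrable M (\<lambda>\<omega>. indicator D \<omega> *\<^sub>R (\<integral>x. cis (u \<bullet> x) \<partial>\<eta> \<omega>))"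
    using nle by (intro integrable_const_bound[of _ 1]) (auto simp: indicator_def intro!: AE_I2)
  have i4: "integrable M (\<lambda>\<omega>. indicator D \<omega> *\<^sub>R cis (u \<bullet> X \<omega>))"
    by (intro integrable_const_bound[of _ 1]) (auto simp: indicator_def)
  show "(\<integral>\<omega>. indicator D \<omega> *\<^sub>R cis (u \<bullet> X \<omega>) \<partial>M) =
      (\<integral>\<omega>. indicator D \<omega> *\<^sub>R (\<integral>x. cis (u \<bullet> x) \<partial>\<eta> \<omega>) \<partial>M)"
  proof (rule complex_eqI)
    have "Re (\<integral>\<omega>. indicator D \<omega> *\<^sub>R (\<integral>x. cis (u \<bullet> x) \<partial>\<eta> \<omega>) \<partial>M) =
        (\<integral>\<omega>. indicator D \<omega> * (\<integral>x. cos (u \<bullet> x) \<partial>\<eta> \<omega>) \<partial>M)"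
      unfolding integral_Re[OF i3, symmetric] by (intro Bochner_Integration.integral_cong) (auto simp: RI)
    thus "Re (\<integral>\<omega>. indicator D \<omega> *\<^sub>R cis (u \<bullet> X \<omega>) \<partial>M) =
        Re (\<integral>\<omega>. indicator D \<omega> *\<^sub>R (\<integral>x. cis (u \<bullet> x) \<partial>\<eta> \<omega>) \<partial>M)"
      using real[of cos] by (simp add: integral_Re[OF i4, symmetric])
    have "Im (\<integral>\<omega>. indicator D \<omega> *\<^sub>R (\<integral>x. cis (u \<bullet> x) \<partial>\<eta> \<omega>) \<partial>M) =
        (\<integral>\<omega>. indicator D \<omega> * (\<integral>x. sin (u \<bullet> x) \<partial>\<eta> \<omega>) \<partial>M)"
      unfolding integral_Im[OF i3, symmetric] by (intro Bochner_Integration.integral_cong) (auto simp: RI)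
    thus "Im (\<integral>\<omega>. indicator D \<omega> *\<^sub>R cis (u \<bullet> X \<omega>) \<partial>M) =
        Im (\<integral>\<omega>. indicator D \<omega> *\<^sub>R (\<integral>x. cis (u \<bullet> x) \<partial>\<eta> \<omega>) \<partial>M)"
      using real[of sin] by (simp add: integral_Im[OF i4, symmetric])
  qed
qed

section \<open>Riemann sums\<close>

lemma sum_integral_partition:
  fixes f :: "real \<Rightarrow> 'a::banach"
  assumes "f integrable_on {\<tau> 0..\<tau> N}" "\<And>i. i < N \<Longrightarrow> \<tau> i \<le> \<tau> (Suc i)"
  shows "(\<Sum>i<N. integral {\<tau> i..\<tau> (Suc i)} f) = integral {\<tau> 0..\<tau> N} f"
  using assms
proof (induction N)
  case (Suc N)
  have mono: "\<tau> 0 \<le> \<tau> n" if "n \<le> N" for n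
    using that Suc.prems(2) by (induction n) (auto intro: order_trans)
  have "f integrable_on {\<tau> 0..\<tau> N}"
    by (rule integrable_subinterval_real[OF Suc.prems(1)]) (use Suc.prems(2)[of N] in auto)
  with Suc have "(\<Sum>i<N. integral {\<tau> i..\<tau> (Suc i)} f) = integral {\<tau> 0..\<tau> N} f" by simp
  moreover have "integral {\<tau> 0..\<tau> N} f + integral {\<tau> N..\<tau> (Suc N)} f = integral {\<tau> 0..\<tau> (Suc N)} f"
    using Suc.prems mono by (intro Henstock_Kurzweil_Integration.integral_combine) auto
  ultimately show ?case by simp
qed simp

lemma partition_mono:
  fixes \<tau> :: "nat \<Rightarrow> real"
  assumes "\<And>i. i < N \<Longrightarrow> \<tau> i \<le> \<tau> (Suc i)" "i \<le> j" "j \<le> N"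
  shows "\<tau> i \<le> \<tau> j"
  using assms(2,3) by (induction j rule: dec_induct) (auto intro: order_trans[OF _ assms(1)])

lemma block_sum_bound:
  fixes f :: "real \<Rightarrow> 'a::banach"
  assumes "f integrable_on {\<tau> 0..\<tau> N}" "\<And>i. i < N \<Longrightarrow> \<tau> i \<le> \<tau> (Suc i)"
    and le: "\<And>i. i < N \<Longrightarrow> norm (x i - integral {\<tau> i..\<tau> (Suc i)} f) \<le> e * (\<tau> (Suc i) - \<tau> i)"
  shows "norm ((\<Sum>i<N. x i) - integral {\<tau> 0..\<tau> N} f) \<le> e * (\<tau> N - \<tau> 0)"
proof -
  have "(\<Sum>i<N. x i) - integral {\<tau> 0..\<tau> N} f = (\<Sum>i<N. x i - integral {\<tau> i..\<tau> (Suc i)} f)"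
    by (simp add: sum_subtractf sum_integral_partition[OF assms(1,2)])
  also have "norm \<dots> \<le> (\<Sum>i<N. e * (\<tau> (Suc i) - \<tau> i))"
    by (intro sum_norm_le le) auto
  also have "\<dots> = e * (\<tau> N - \<tau> 0)"
    by (simp add: sum_distrib_left[symmetric] sum_lessThan_telescope)
  finally show ?thesis .
qed

lemma block_bound:
  fixes f :: "real \<Rightarrow> 'a::banach"
  assumes f: "f integrable_on {a..b}" and ab: "a \<le> b" and le: "\<And>s. a \<le> s \<Longrightarrow> s \<le> b \<Longrightarrow> norm (x - f s) \<le> e"
  shows "norm ((b - a) *\<^sub>R x - integral {a..b} f) \<le> e * (b - a)"
proof -
  have "integral {a..b} (\<lambda>s. x - f s) = integral {a..b} (\<lambda>s. x) - integral {a..b} f"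
    using f by (intro Henstock_Kurzweil_Integration.integral_diff) auto
  hence "(b - a) *\<^sub>R x - integral {a..b} f = integral {a..b} (\<lambda>s. x - f s)"
    using ab by simp
  also have "norm \<dots> \<le> integral {a..b} (\<lambda>s. e)"
    using f le by (intro integral_norm_bound_integral integrable_diff) auto
  also have "\<dots> = e * (b - a)" using ab by simp
  finally show ?thesis .
qed

lemma riemann_sum_limit:
  fixes f :: "real \<Rightarrow> 'a::banach"
  assumes f: "continuous_on {0..T} f" and "0 < e"
  obtains d where "0 < d" "\<And>\<tau> \<sigma> N. \<tau> 0 = 0 \<Longrightarrow> \<tau> N = T \<Longrightarrow>
      (\<And>i. i < N \<Longrightarrow> \<tau> i \<le> \<tau> (Suc i) \<and> \<tau> (Suc i) - \<tau> i < d \<and> \<tau> i \<le> \<sigma> i \<and> \<sigma> i \<le> \<tau> (Suc i)) \<Longrightarrow>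
      norm ((\<Sum>i<N. (\<tau> (Suc i) - \<tau> i) *\<^sub>R f (\<sigma> i)) - integral {0..T} f) \<le> e * T"
proof -
  have uc: "uniformly_continuous_on {0..T} f"
    using f by (intro compact_uniformly_continuous) auto
  obtain d where d: "0 < d" "\<And>x y. x \<in> {0..T} \<Longrightarrow> y \<in> {0..T} \<Longrightarrow> dist y x < d \<Longrightarrow> dist (f y) (f x) < e"
    by (rule uniformly_continuous_onE[OF uc \<open>0 < e\<close>]) (rule that, assumption, blast)
  show ?thesis
  proof (rule that[OF d(1)])
    fix \<tau> \<sigma> :: "nat \<Rightarrow> real" and N
    assume \<tau>: "\<tau> 0 = 0" "\<tau> N = T" and
      st: "\<And>i. i < N \<Longrightarrow> \<tau> i \<le> \<tau> (Suc i) \<and> \<tau> (Suc i) - \<tau> i < d \<and> \<tau> i \<le> \<sigma> i \<and> \<sigma> i \<le> \<tau> (Suc i)"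
    have fi: "f integrable_on {0..T}" using f by (rule integrable_continuous_interval)
    have "norm ((\<Sum>i<N. (\<tau> (Suc i) - \<tau> i) *\<^sub>R f (\<sigma> i)) - integral {\<tau> 0..\<tau> N} f) \<le> e * (\<tau> N - \<tau> 0)"
    proof (rule block_sum_bound)
      fix i assume i: "i < N"
      have st': "\<tau> i \<le> \<tau> (Suc i)" if "i < N" for i using st[OF that] by simp
      have r: "0 \<le> \<tau> i" "\<tau> (Suc i) \<le> T"
        using partition_mono[where N = N and \<tau> = \<tau>, OF st', of 0 i] partition_mono[where N = N and \<tau> = \<tau>, OF st', of "Suc i" N] i \<tau> by auto
      show "norm ((\<tau> (Suc i) - \<tau> i) *\<^sub>R f (\<sigma> i) - integral {\<tau> i..\<tau> (Suc i)} f) \<le> e * (\<tau> (Suc i) - \<tau> i)"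
      proof (rule block_bound)
        show "f integrable_on {\<tau> i..\<tau> (Suc i)}"
          using fi by (rule integrable_subinterval_real) (use r in auto)
        fix s assume s: "\<tau> i \<le> s" "s \<le> \<tau> (Suc i)"
        have "\<bar>\<sigma> i - s\<bar> < d" using s st[OF i] by linarith
        thus "norm (f (\<sigma> i) - f s) \<le> e"
          using d(2)[of s "\<sigma> i"] s st[OF i] r by (auto simp: dist_norm)
      qed (use st i in auto)
    qed (use st \<tau> fi in auto)
    thus "norm ((\<Sum>i<N. (\<tau> (Suc i) - \<tau> i) *\<^sub>R f (\<sigma> i)) - integral {0..T} f) \<le> e * T"
      using \<tau> by simp
  qed
qed

lemma riemann_sum_uniform:
  fixes f :: "real \<Rightarrow> 'a::banach"
  assumes f: "continuous_on {0..T} f" and T: "0 \<le> T"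
  shows "(\<lambda>N. \<Sum>i<N. (T / real N) *\<^sub>R f (real i * T / real N)) \<longlonglongrightarrow> integral {0..T} f"
proof (rule LIMSEQ_I)
  fix r :: real assume r: "0 < r"
  define e where "e = r / (T + 1) / 2"
  have e: "0 < e" "e * T < r" using r T by (auto simp: e_def field_simps add_strict_increasing)
  obtain d where d: "0 < d" "\<And>\<tau> \<sigma> N. \<tau> 0 = 0 \<Longrightarrow> \<tau> N = T \<Longrightarrow>
      (\<And>i. i < N \<Longrightarrow> \<tau> i \<le> \<tau> (Suc i) \<and> \<tau> (Suc i) - \<tau> i < d \<and> \<tau> i \<le> \<sigma> i \<and> \<sigma> i \<le> \<tau> (Suc i)) \<Longrightarrow>
      norm ((\<Sum>i<N. (\<tau> (Suc i) - \<tau> i) *\<^sub>R f (\<sigma> i)) - integral {0..T} f) \<le> e * T"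
    using riemann_sum_limit[OF f e(1)] by blast
  obtain n0 :: nat where n0: "T / d < real n0" using reals_Archimedean2 by blast
  show "\<exists>no. \<forall>N\<ge>no. norm ((\<Sum>i<N. (T / real N) *\<^sub>R f (real i * T / real N)) - integral {0..T} f) < r"
  proof (intro exI[of _ "Suc n0"] allI impI)
    fix N assume N: "Suc n0 \<le> N"
    have step: "real (Suc i) * T / N - real i * T / N = T / N" for i
      using N by (simp add: field_simps)
    have "T / real N < d"
    proof -
      have "T / d < real N" using n0 N by linarith
      thus ?thesis using d(1) N by (simp add: field_simps)
    qed
    hence "norm ((\<Sum>i<N. (real (Suc i) * T / N - real i * T / N) *\<^sub>R f (real i * T / N)) - integral {0..T} f) \<le> e * T"
      using N T step by (intro d(2)[of "\<lambda>i. real i * T / N" N "\<lambda>i. real i * T / N"])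
        (auto simp: divide_right_mono mult_right_mono simp del: of_nat_Suc)
    thus "norm ((\<Sum>i<N. (T / real N) *\<^sub>R f (real i * T / real N)) - integral {0..T} f) < r"
      unfolding step using e(2) by simp
  qed
qed

text \<open>Continuous paths make the path integral a limit of Riemann sums, so measurability at
  each fixed time suffices.\<close>

lemma borel_measurable_integral_process:
  fixes Z :: "real \<Rightarrow> 'w \<Rightarrow> 'a::euclidean_space"
  assumes "0 \<le> T" and Z: "\<And>s. 0 \<le> s \<Longrightarrow> s \<le> T \<Longrightarrow> Z s \<in> borel_measurable N"
    and cont: "\<And>\<omega>. \<omega> \<in> space N \<Longrightarrow> continuous_on {0..T} (\<lambda>s. Z s \<omega>)"
  shows "(\<lambda>\<omega>. integral {0..T} (\<lambda>s. Z s \<omega>)) \<in> borel_measurable N"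
proof (rule borel_measurable_LIMSEQ_metric)
  fix \<omega> assume "\<omega> \<in> space N"
  from riemann_sum_uniform[OF cont[OF this] assms(1)]
  show "(\<lambda>n. \<Sum>i<n. (T / real n) *\<^sub>R Z (real i * T / real n) \<omega>) \<longlonglongrightarrow> integral {0..T} (\<lambda>s. Z s \<omega>)" .
next
  fix n :: nat
  show "(\<lambda>\<omega>. \<Sum>i<n. (T / real n) *\<^sub>R Z (real i * T / real n) \<omega>) \<in> borel_measurable N"
    using assms(1) by (intro borel_measurable_sum borel_measurable_scaleR borel_measurable_const Z)
      (auto simp: divide_le_eq mult.commute[of T] mult_right_mono)
qed

text \<open>Summation by parts makes the Riemann sums of a differentiable integrand converge against
  every continuous integrator.\<close>

lemma riemann_stieltjes_limit:
  fixes f :: "real \<Rightarrow> real^'m^'n" and z :: "real \<Rightarrow> real^'m"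
  assumes f: "\<And>t. 0 \<le> t \<Longrightarrow> t \<le> T \<Longrightarrow> (f has_vector_derivative f' t) (at t within {0..T})"
    and f': "continuous_on {0..T} f'" and z: "continuous_on {0..T} z" and T: "0 \<le> T" and e: "0 < e"
  obtains d where "0 < d" "\<And>\<tau> N. \<tau> 0 = 0 \<Longrightarrow> \<tau> N = T \<Longrightarrow>
      (\<And>i. i < N \<Longrightarrow> \<tau> i \<le> \<tau> (Suc i) \<and> \<tau> (Suc i) - \<tau> i < d) \<Longrightarrow>
      norm ((\<Sum>i<N. f (\<tau> i) *v (z (\<tau> (Suc i)) - z (\<tau> i))) -
        (f T *v z T - f 0 *v z 0 - integral {0..T} (\<lambda>s. f' s *v z s))) \<le> e"
proof -
  have "compact (f' ` {0..T})" using f' by (intro compact_continuous_image) auto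
  then obtain b0 where "\<And>s. s \<in> {0..T} \<Longrightarrow> norm (f' s) \<le> b0"
    using compact_imp_bounded bounded_iff by (metis imageI)
  then obtain b where b: "0 < b" "\<And>s. s \<in> {0..T} \<Longrightarrow> norm (f' s) \<le> b"
    by (meson max.cobounded1 max.strict_coboundedI2 order_trans zero_less_one)
  \<comment> \<open>\<open>T + 1\<close> in place of \<open>T\<close> keeps the quotient meaningful
    for \<open>T = 0\<close>.\<close>
  define e' where "e' = e / b / (T + 1)"
  have "b * e' = e / (T + 1)" using b by (simp add: e'_def)
  hence e': "0 < e'" "b * e' * T \<le> e"
    using b e T by (simp_all add: e'_def pos_divide_le_eq add_pos_nonneg)
  have uc: "uniformly_continuous_on {0..T} z"
    using z by (intro compact_uniformly_continuous) auto
  obtain d where d: "0 < d" "\<And>x y. x \<in> {0..T} \<Longrightarrow> y \<in> {0..T} \<Longrightarrow> dist y x < d \<Longrightarrow> dist (z y) (z x) < e'"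
    by (rule uniformly_continuous_onE[OF uc e'(1)]) (rule that, assumption, blast)
  have fz: "continuous_on {0..T} (\<lambda>s. f' s *v z s)"
    by (intro mvmult.continuous_on f' z)
  show ?thesis
  proof (rule that[OF d(1)])
    fix \<tau> :: "nat \<Rightarrow> real" and N
    assume \<tau>: "\<tau> 0 = 0" "\<tau> N = T" and st: "\<And>i. i < N \<Longrightarrow> \<tau> i \<le> \<tau> (Suc i) \<and> \<tau> (Suc i) - \<tau> i < d"
    have st': "\<tau> i \<le> \<tau> (Suc i)" if "i < N" for i using st[OF that] by simp
    have r: "0 \<le> \<tau> i" "\<tau> (Suc i) \<le> T" if "i < N" for i
      using partition_mono[where N = N and \<tau> = \<tau>, OF st', of 0 i] partition_mono[where N = N and \<tau> = \<tau>, OF st', of "Suc i" N] that \<tau> by auto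
    have abel: "(\<Sum>i<N. f (\<tau> i) *v (z (\<tau> (Suc i)) - z (\<tau> i))) =
        f T *v z T - f 0 *v z 0 - (\<Sum>i<N. (f (\<tau> (Suc i)) - f (\<tau> i)) *v z (\<tau> (Suc i)))"
    proof -
      have "(\<Sum>i<N. f (\<tau> i) *v (z (\<tau> (Suc i)) - z (\<tau> i))) +
          (\<Sum>i<N. (f (\<tau> (Suc i)) - f (\<tau> i)) *v z (\<tau> (Suc i))) =
          (\<Sum>i<N. f (\<tau> (Suc i)) *v z (\<tau> (Suc i)) - f (\<tau> i) *v z (\<tau> i))"
        by (simp add: sum.distrib[symmetric] mvmult.diff_left mvmult.diff_right)
      also have "\<dots> = f T *v z T - f 0 *v z 0"
        using sum_lessThan_telescope[of "\<lambda>i. f (\<tau> i) *v z (\<tau> i)" N] \<tau> by simp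
      finally show ?thesis by (simp add: algebra_simps)
    qed
    have "norm ((\<Sum>i<N. (f (\<tau> (Suc i)) - f (\<tau> i)) *v z (\<tau> (Suc i))) -
        integral {\<tau> 0..\<tau> N} (\<lambda>s. f' s *v z s)) \<le> b * e' * (\<tau> N - \<tau> 0)"
    proof (rule block_sum_bound)
      show "(\<lambda>s. f' s *v z s) integrable_on {\<tau> 0..\<tau> N}"
        using fz \<tau> by (auto intro: integrable_continuous_interval)
      fix i assume i: "i < N"
      let ?a = "\<tau> i" and ?b = "\<tau> (Suc i)"
      have sub: "{?a..?b} \<subseteq> {0..T}" using r[OF i] by auto
      have ab: "?a \<le> ?b" using st i by auto
      have "(f' has_integral (f ?b - f ?a)) {?a..?b}"
        using sub ab by (intro fundamental_theorem_of_calculus)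
          (auto intro!: has_vector_derivative_within_subset[OF f])
      from has_integral_linear[OF this mvmult.bounded_linear_left[of "z ?b"]]
      have "((\<lambda>s. f' s *v z ?b) has_integral (f ?b - f ?a) *v z ?b) {?a..?b}"
        by (simp add: o_def)
      moreover have "((\<lambda>s. f' s *v z s) has_integral integral {?a..?b} (\<lambda>s. f' s *v z s)) {?a..?b}"
        by (intro integrable_integral integrable_continuous_interval continuous_on_subset[OF fz sub])
      ultimately have hi: "((\<lambda>s. f' s *v z ?b - f' s *v z s) has_integral
          ((f ?b - f ?a) *v z ?b - integral {?a..?b} (\<lambda>s. f' s *v z s))) {?a..?b}"
        by (rule has_integral_diff)
      have le: "norm (f' s *v z ?b - f' s *v z s) \<le> b * e'" if "s \<in> {?a..?b}" for s
      proof -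
        have "\<bar>?b - s\<bar> < d" using that st[OF i] by auto
        hence "norm (z ?b - z s) \<le> e'"
          using d(2)[of s ?b] that sub ab by (auto simp: dist_norm)
        hence "norm (f' s) * norm (z ?b - z s) \<le> b * e'"
          using b that sub by (intro mult_mono) auto
        thus ?thesis
          using norm_matrix_vector_le[of "f' s" "z ?b - z s"] by (simp add: mvmult.diff_right)
      qed
      have "norm ((f ?b - f ?a) *v z ?b - integral {?a..?b} (\<lambda>s. f' s *v z s)) \<le>
          b * e' * Henstock_Kurzweil_Integration.content {?a..?b}"
        by (rule has_integral_bound_real[OF _ finite.emptyI hi]) (use le b e'(1) in auto)
      thus "norm ((f ?b - f ?a) *v z ?b - integral {?a..?b} (\<lambda>s. f' s *v z s)) \<le> b * e' * (?b - ?a)"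
        using b e'(1) ab by simp
    qed (use st in auto)
    hence "norm ((\<Sum>i<N. (f (\<tau> (Suc i)) - f (\<tau> i)) *v z (\<tau> (Suc i))) -
        integral {0..T} (\<lambda>s. f' s *v z s)) \<le> e"
      using e'(2) \<tau> by simp
    thus "norm ((\<Sum>i<N. f (\<tau> i) *v (z (\<tau> (Suc i)) - z (\<tau> i))) -
        (f T *v z T - f 0 *v z 0 - integral {0..T} (\<lambda>s. f' s *v z s))) \<le> e"
      unfolding abel by (simp add: norm_minus_commute algebra_simps)
  qed
qed

section \<open>Gaussian laws\<close>

lemma prob_space_normal_law: "0 \<le> \<sigma> \<Longrightarrow> prob_space (normal_law m \<sigma>)"
  by (auto simp: normal_law_def intro!: prob_space_return prob_space_normal_density)

lemma sets_normal_law [simp, measurable_cong]: "sets (normal_law m \<sigma>) = sets borel"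
  by (simp add: normal_law_def)

lemma normal_law_cis:
  assumes "0 \<le> \<sigma>"
  shows "(\<integral>x. cis (t * x) \<partial>normal_law 0 \<sigma>) = complex_of_real (exp (- (\<sigma> * t)\<^sup>2 / 2))"
proof (cases "\<sigma> = 0")
  case True
  thus ?thesis by (simp add: normal_law_def integral_return)
next
  case False
  hence \<sigma>: "0 < \<sigma>" using assms by simp
  let ?N = "density lborel (normal_density 0 \<sigma>)"
  interpret N: prob_space ?N using \<sigma> by (rule prob_space_normal_density)
  have d1: "distr ?N lborel (\<lambda>x. x) = ?N"
    by (rule distr_id2) simp
  have "distributed ?N lborel (\<lambda>x. x) (normal_density 0 \<sigma>)"
    unfolding distributed_def d1 by simp
  hence "distributed ?N lborel (\<lambda>x. (x - 0) / \<sigma>) std_normal_density"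
    using N.normal_standard_normal_convert[OF \<sigma>, of "\<lambda>x. x" 0] by simp
  hence "distr ?N lborel (\<lambda>x. x / \<sigma>) = std_normal_distribution"
    by (simp add: distributed_distr_eq_density)
  hence s: "std_normal_distribution = distr ?N borel (\<lambda>x. x / \<sigma>)"
    by (metis distr_cong sets_lborel)
  have "complex_of_real (exp (- (\<sigma> * t)\<^sup>2 / 2)) = char std_normal_distribution (\<sigma> * t)"
    by (simp add: char_std_normal_distribution)
  also have "\<dots> = (\<integral>x. cis (\<sigma> * t * (x / \<sigma>)) \<partial>?N)"
    unfolding s by (subst char_distr_eq_cis) auto
  also have "\<dots> = (\<integral>x. cis (t * x) \<partial>?N)"
    using \<sigma> by simp
  finally show ?thesis using False by (simp add: normal_law_def)
qed

text \<open>The exact moment is \<open>fact (2 * n) / (2 ^ n * fact n)\<close> times the power of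
  \<open>\<sigma>\<close>; the denominator is dropped.\<close>

lemma normal_law_moment:
  assumes "0 \<le> \<sigma>"
  shows "(\<integral>\<^sup>+x. ennreal (x ^ (2 * n)) \<partial>normal_law 0 \<sigma>) \<le> ennreal (fact (2 * n) * \<sigma> ^ (2 * n))"
proof (cases "\<sigma> = 0")
  case True
  thus ?thesis by (cases n) (auto simp: normal_law_def nn_integral_return)
next
  case False
  hence \<sigma>: "0 < \<sigma>" using assms by simp
  have "(\<integral>\<^sup>+x. ennreal (x ^ (2 * n)) \<partial>normal_law 0 \<sigma>) =
      (\<integral>\<^sup>+x. ennreal (normal_density 0 \<sigma> x * (x - 0) ^ (2 * n)) \<partial>lborel)"
    using False by (simp add: normal_law_def nn_integral_density ennreal_mult'[symmetric] normal_density_nonneg)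
  also have "\<dots> = ennreal (fact (2 * n) / ((2 / \<sigma>\<^sup>2) ^ n * fact n))"
    using normal_moment_even[OF \<sigma>, of 0 n]
    by (subst nn_integral_eq_integral)
      (auto simp: has_bochner_integral_iff normal_density_nonneg power_mult)
  also have "fact (2 * n) / ((2 / \<sigma>\<^sup>2) ^ n * fact n) = fact (2 * n) * \<sigma> ^ (2 * n) / (2 ^ n * fact n)"
  proof -
    have "(2 / \<sigma>\<^sup>2) ^ n = 2 ^ n / \<sigma> ^ (2 * n)" by (simp add: power_divide power_mult)
    thus ?thesis using \<sigma> by (simp only:) (simp add: field_simps)
  qed
  also have "\<dots> \<le> fact (2 * n) * \<sigma> ^ (2 * n)"
  proof -
    have "(1::real) \<le> 2 ^ n * fact n"
      using mult_mono[of 1 "2 ^ n :: real" 1 "fact n"] by simp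
    hence "fact (2 * n) * \<sigma> ^ (2 * n) / (2 ^ n * fact n) \<le> fact (2 * n) * \<sigma> ^ (2 * n) / 1"
      using \<sigma> by (intro divide_left_mono) auto
    thus ?thesis by simp
  qed
  finally show ?thesis by (simp add: ennreal_leI)
qed

lemma borel_measurable_component [measurable (raw)]:
  fixes Z :: "'a \<Rightarrow> real^'n"
  assumes "Z \<in> borel_measurable M"
  shows "(\<lambda>\<omega>. Z \<omega> $ i) \<in> borel_measurable M"
  by (rule borel_measurable_continuous_on[OF _ assms]) (intro continuous_intros)

lemma norm_power_le_sum_components:
  fixes x :: "real^'n"
  shows "norm x ^ (2 * n) \<le> real CARD('n) ^ (2 * n) * (\<Sum>i\<in>UNIV. (x $ i) ^ (2 * n))"
proof -
  obtain k where k: "\<And>i. \<bar>x $ i\<bar> \<le> \<bar>x $ k\<bar>"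
    using Max_in[of "range (\<lambda>i. \<bar>x $ i\<bar>)"] Max_ge[of "range (\<lambda>i. \<bar>x $ i\<bar>)"]
    by (metis (mono_tags, lifting) finite finite_imageI image_iff image_is_empty UNIV_not_empty rangeI)
  have "norm x \<le> (\<Sum>i\<in>UNIV. \<bar>x $ i\<bar>)" by (rule norm_le_l1_cart)
  also have "\<dots> \<le> real CARD('n) * \<bar>x $ k\<bar>"
    using sum_bounded_above[of UNIV "\<lambda>i. \<bar>x $ i\<bar>" "\<bar>x $ k\<bar>"] k by simp
  finally have "norm x ^ (2 * n) \<le> (real CARD('n) * \<bar>x $ k\<bar>) ^ (2 * n)"
    by (intro power_mono) auto
  also have "\<dots> = real CARD('n) ^ (2 * n) * (x $ k) ^ (2 * n)"
    by (simp add: power_mult_distrib power_even_abs)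
  also have "\<dots> \<le> real CARD('n) ^ (2 * n) * (\<Sum>i\<in>UNIV. (x $ i) ^ (2 * n))"
    by (intro mult_left_mono member_le_sum) auto
  finally show ?thesis .
qed

text \<open>Only the laws of the coordinates enter, each centred normal with variance
  \<open>v\<close> at a unit vector. Here \<open>v\<close> is the variance form as it is read off
  from the characteristic function.\<close>

lemma (in prob_space) gaussian_moment_bound:
  fixes Z :: "'a \<Rightarrow> real^'n"
  assumes Z[measurable]: "Z \<in> borel_measurable M"
    and char: "\<And>u. (\<integral>\<omega>. cis (u \<bullet> Z \<omega>) \<partial>M) = complex_of_real (exp (- v u / 2))"
    and v: "\<And>u. 0 \<le> v u" "\<And>u t. v (t *\<^sub>R u) = t\<^sup>2 * v u" "\<And>u. norm u = 1 \<Longrightarrow> v u \<le> s\<^sup>2"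
    and s: "0 \<le> s"
  shows "(\<integral>\<^sup>+\<omega>. ennreal (norm (Z \<omega>) ^ (2 * n)) \<partial>M) \<le>
    ennreal (real CARD('n) ^ (2 * n) * (real CARD('n) * fact (2 * n)) * s ^ (2 * n))"
proof -
  have comp: "(\<integral>\<^sup>+\<omega>. ennreal ((Z \<omega> $ i) ^ (2 * n)) \<partial>M) \<le> ennreal (fact (2 * n) * s ^ (2 * n))" for i
  proof -
    let ?e = "axis i 1 :: real^'n"
    let ?\<sigma> = "sqrt (v ?e)"
    have "distr M borel (\<lambda>\<omega>. Z \<omega> $ i) = distr (normal_law 0 ?\<sigma>) borel (\<lambda>x. x)"
    proof (rule distr_eqI_cis)
      show "prob_space M" by unfold_locales
      show "prob_space (normal_law 0 ?\<sigma>)" using v(1) by (intro prob_space_normal_law) simp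
      fix t
      have "(\<integral>\<omega>. cis (t * Z \<omega> $ i) \<partial>M) = (\<integral>\<omega>. cis ((t *\<^sub>R ?e) \<bullet> Z \<omega>) \<partial>M)"
        by (simp add: inner_axis')
      also have "\<dots> = complex_of_real (exp (- (t\<^sup>2 * v ?e) / 2))"
        unfolding char v(2) ..
      also have "t\<^sup>2 * v ?e = (?\<sigma> * t)\<^sup>2"
        using v(1) by (simp add: power_mult_distrib)
      also have "complex_of_real (exp (- (?\<sigma> * t)\<^sup>2 / 2)) = (\<integral>x. cis (t * x) \<partial>normal_law 0 ?\<sigma>)"
        using v(1) by (intro normal_law_cis[symmetric]) simp
      finally show "(\<integral>\<omega>. cis (t * Z \<omega> $ i) \<partial>M) = (\<integral>x. cis (t * x) \<partial>normal_law 0 ?\<sigma>)" .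
    qed (simp_all add: borel_measurable_component)
    hence "(\<integral>\<^sup>+\<omega>. ennreal ((Z \<omega> $ i) ^ (2 * n)) \<partial>M) =
        (\<integral>\<^sup>+x. ennreal (x ^ (2 * n)) \<partial>distr (normal_law 0 ?\<sigma>) borel (\<lambda>x. x))"
      by (subst nn_integral_distr[symmetric, of "\<lambda>\<omega>. Z \<omega> $ i" M borel "\<lambda>x. ennreal (x ^ (2 * n))"])
        (auto simp: borel_measurable_component)
    also have "\<dots> = (\<integral>\<^sup>+x. ennreal (x ^ (2 * n)) \<partial>normal_law 0 ?\<sigma>)"
      by (simp add: nn_integral_distr)
    also have "\<dots> \<le> ennreal (fact (2 * n) * ?\<sigma> ^ (2 * n))"
      using v(1) by (intro normal_law_moment) simp
    also have "\<dots> \<le> ennreal (fact (2 * n) * s ^ (2 * n))"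
    proof (intro ennreal_leI mult_left_mono power_mono)
      show "?\<sigma> \<le> s" using v(3)[of ?e] s real_le_lsqrt by (simp add: real_sqrt_le_iff' norm_axis_1)
    qed (use v(1) in auto)
    finally show ?thesis .
  qed
  have "(\<integral>\<^sup>+\<omega>. ennreal (norm (Z \<omega>) ^ (2 * n)) \<partial>M) \<le>
      (\<integral>\<^sup>+\<omega>. ennreal (real CARD('n) ^ (2 * n)) * (\<Sum>i\<in>UNIV. ennreal ((Z \<omega> $ i) ^ (2 * n))) \<partial>M)"
    by (intro nn_integral_mono)
      (simp add: sum_ennreal ennreal_mult'[symmetric] sum_nonneg ennreal_leI norm_power_le_sum_components)
  also have "\<dots> = ennreal (real CARD('n) ^ (2 * n)) * (\<Sum>i\<in>UNIV. \<integral>\<^sup>+\<omega>. ennreal ((Z \<omega> $ i) ^ (2 * n)) \<partial>M)"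
    by (subst nn_integral_cmult, simp del: sum_ennreal, subst nn_integral_sum) simp_all
  also have "\<dots> \<le> ennreal (real CARD('n) ^ (2 * n)) * (\<Sum>i\<in>(UNIV::'n set). ennreal (fact (2 * n) * s ^ (2 * n)))"
    by (intro mult_left_mono sum_mono comp) auto
  also have "\<dots> = ennreal (real CARD('n) ^ (2 * n) * (real CARD('n) * (fact (2 * n) * s ^ (2 * n))))"
    using s by (simp add: ennreal_mult' ennreal_of_nat_eq_real_of_nat)
  finally show ?thesis by (simp add: mult_ac)
qed

text \<open>The mean need not vanish, so powers of \<open>x\<close> are expanded around
  \<open>m\<close> and central moments are summed.\<close>

lemma (in prob_space) gaussian_vector_moment_finite:
  fixes X :: "'a \<Rightarrow> real^'n"
  assumes "gaussian_vector M X"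
  obtains c where "0 \<le> c" "(\<integral>\<^sup>+\<omega>. ennreal (norm (X \<omega>) ^ (2 * n)) \<partial>M) \<le> ennreal c"
proof -
  have X[measurable]: "X \<in> borel_measurable M"
    and law: "\<And>u. \<exists>m. \<exists>\<sigma>\<ge>0. distr M borel (\<lambda>\<omega>. u \<bullet> X \<omega>) = normal_law m \<sigma>"
    using assms by (auto simp: gaussian_vector_def)
  have comp: "(\<integral>\<^sup>+\<omega>. ennreal ((X \<omega> $ i) ^ (2 * n)) \<partial>M) < \<infinity>" for i
  proof -
    obtain m \<sigma> where \<sigma>: "0 \<le> \<sigma>" and eq: "distr M borel (\<lambda>\<omega>. X \<omega> $ i) = normal_law m \<sigma>"
      using law[of "axis i 1"] by (auto simp: inner_axis')
    have "(\<integral>\<^sup>+\<omega>. ennreal ((X \<omega> $ i) ^ (2 * n)) \<partial>M) = (\<integral>\<^sup>+x. ennreal (x ^ (2 * n)) \<partial>normal_law m \<sigma>)"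
      unfolding eq[symmetric] by (simp add: nn_integral_distr borel_measurable_component)
    also have "\<dots> < \<infinity>"
    proof (cases "\<sigma> = 0")
      case True
      thus ?thesis by (simp add: normal_law_def nn_integral_return)
    next
      case False
      hence \<sigma>: "0 < \<sigma>" using \<sigma> by simp
      have "integrable lborel (\<lambda>x. normal_density m \<sigma> x * (\<Sum>k\<le>2 * n. of_nat (2 * n choose k) * (x - m) ^ k * m ^ (2 * n - k)))"
        unfolding sum_distrib_left
      proof (rule Bochner_Integration.integrable_sum)
        fix k
        have "integrable lborel (\<lambda>x. normal_density m \<sigma> x * (x - m) ^ k * (of_nat (2 * n choose k) * m ^ (2 * n - k)))"
          by (intro integrable_mult_left integrable_normal_moment[OF \<sigma>])
        thus "integrable lborel (\<lambda>x. normal_density m \<sigma> x * (of_nat (2 * n choose k) * (x - m) ^ k * m ^ (2 * n - k)))"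
          by (simp add: mult_ac)
      qed
      hence "integrable lborel (\<lambda>x. normal_density m \<sigma> x * x ^ (2 * n))"
        by (simp add: binomial_ring[of "_ - m" m, symmetric])
      hence "(\<integral>\<^sup>+x. ennreal (normal_density m \<sigma> x * x ^ (2 * n)) \<partial>lborel) < \<infinity>"
        by (subst nn_integral_eq_integral) (auto simp: normal_density_nonneg power_mult)
      thus ?thesis
        using False by (simp add: normal_law_def nn_integral_density ennreal_mult'[symmetric] normal_density_nonneg)
    qed
    finally show ?thesis .
  qed
  have "(\<integral>\<^sup>+\<omega>. ennreal (norm (X \<omega>) ^ (2 * n)) \<partial>M) \<le>
      (\<integral>\<^sup>+\<omega>. ennreal (real CARD('n) ^ (2 * n)) * (\<Sum>i\<in>UNIV. ennreal ((X \<omega> $ i) ^ (2 * n))) \<partial>M)"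
    by (intro nn_integral_mono)
      (simp add: sum_ennreal ennreal_mult'[symmetric] sum_nonneg ennreal_leI norm_power_le_sum_components)
  also have "\<dots> = ennreal (real CARD('n) ^ (2 * n)) * (\<Sum>i\<in>UNIV. \<integral>\<^sup>+\<omega>. ennreal ((X \<omega> $ i) ^ (2 * n)) \<partial>M)"
    by (subst nn_integral_cmult, simp del: sum_ennreal, subst nn_integral_sum) simp_all
  also have "\<dots> < \<infinity>"
    using comp by (auto simp: ennreal_mult_less_top)
  finally have "(\<integral>\<^sup>+\<omega>. ennreal (norm (X \<omega>) ^ (2 * n)) \<partial>M) < \<infinity>" .
  thus ?thesis
    by (intro that[of "enn2real (\<integral>\<^sup>+\<omega>. ennreal (norm (X \<omega>) ^ (2 * n)) \<partial>M)"]) (auto simp: less_top)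
qed

section \<open>Brownian motion\<close>

lemma space_process_sigma [simp]: "space (process_sigma M T Z) = space M"
  unfolding process_sigma_def by (rule space_measure_of) auto

lemma borel_measurable_PairD:
  fixes f :: "'w \<Rightarrow> 'a::second_countable_topology" and g :: "'w \<Rightarrow> 'b::second_countable_topology"
  assumes "(\<lambda>\<omega>. (f \<omega>, g \<omega>)) \<in> borel_measurable N"
  shows "f \<in> borel_measurable N" "g \<in> borel_measurable N"
proof -
  have m: "(\<lambda>\<omega>. (f \<omega>, g \<omega>)) \<in> N \<rightarrow>\<^sub>M (borel \<Otimes>\<^sub>M borel)"
    using assms unfolding borel_prod .
  show "f \<in> borel_measurable N" "g \<in> borel_measurable N"
    using measurable_compose[OF m measurable_fst] measurable_compose[OF m measurable_snd] by simp_all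
qed

lemma process_sigma_measurable:
  assumes "t \<in> T"
  shows "Z t \<in> borel_measurable (process_sigma M T Z)"
proof (rule measurableI)
  fix B :: "'b set" assume "B \<in> sets borel"
  thus "Z t -` B \<inter> space (process_sigma M T Z) \<in> sets (process_sigma M T Z)"
    using assms unfolding space_process_sigma unfolding process_sigma_def
    by (subst sets_measure_of) (auto intro!: sigma_sets.Basic)
qed simp

lemma sets_process_sigma_subset:
  assumes "\<And>t. t \<in> T \<Longrightarrow> Z t \<in> borel_measurable N" "space N = space M"
  shows "sets (process_sigma M T Z) \<subseteq> sets N"
  unfolding process_sigma_def
proof (subst sets_measure_of)
  show "sigma_sets (space M) (\<Union>s\<in>T. {Z s -` B \<inter> space M |B. B \<in> sets borel}) \<subseteq> sets N"
    unfolding assms(2)[symmetric]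
    by (intro sets.sigma_sets_subset) (auto intro: measurable_sets[OF assms(1)])
qed auto

lemma subalgebra_process_sigma:
  "(\<And>t. t \<in> T \<Longrightarrow> Z t \<in> borel_measurable M) \<Longrightarrow> subalgebra M (process_sigma M T Z)"
  by (simp add: subalgebra_def sets_process_sigma_subset)

text \<open>The last increment is split off: it is independent of the path up to
  \<open>\<tau> N\<close>, which determines all earlier increments. The vectors \<open>w i\<close>
  make this the joint characteristic function.\<close>

lemma (in prob_space) brownian_increments_cis:
  fixes B :: "real \<Rightarrow> 'a \<Rightarrow> 'b::euclidean_space"
  assumes B: "brownian_motion M B" and \<tau>: "0 \<le> \<tau> 0" "\<And>i. i < N \<Longrightarrow> \<tau> i \<le> \<tau> (Suc i)"
  shows "(\<integral>\<omega>. cis (\<Sum>i<N. w i \<bullet> (B (\<tau> (Suc i)) \<omega> - B (\<tau> i) \<omega>)) \<partial>M) =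
    complex_of_real (exp (- (\<Sum>i<N. (\<tau> (Suc i) - \<tau> i) * (norm (w i))\<^sup>2) / 2))"
  using \<tau>(2)
proof (induction N)
  case 0
  show ?case by (simp add: prob_space)
next
  case (Suc N)
  have pos: "0 \<le> \<tau> i" if "i \<le> N" for i
    using partition_mono[of N \<tau> 0 i] Suc.prems that \<tau>(1) by fastforce
  have step: "0 \<le> \<tau> N" "\<tau> N \<le> \<tau> (Suc N)" using pos Suc.prems by auto
  have Bm: "B t \<in> borel_measurable M" if "0 \<le> t" for t
    using B that by (simp add: brownian_motion_def continuous_process_def)
  let ?past = "\<lambda>\<omega>. \<Sum>i<N. w i \<bullet> (B (\<tau> (Suc i)) \<omega> - B (\<tau> i) \<omega>)"
  let ?inc = "\<lambda>\<omega>. w N \<bullet> (B (\<tau> (Suc N)) \<omega> - B (\<tau> N) \<omega>)"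
  have "indep_var borel ?past borel ?inc"
  proof (rule indep_var_of_indep_set)
    show "indep_set (sets (process_sigma M {0..\<tau> N} B))
          (sets (vimage_algebra (space M) (\<lambda>\<omega>. B (\<tau> (Suc N)) \<omega> - B (\<tau> N) \<omega>) borel))"
      using B step unfolding brownian_motion_def by blast
    have "\<tau> i \<in> {0..\<tau> N}" if "i \<le> N" for i
      using pos[OF that] partition_mono[of N \<tau> i N] Suc.prems that by auto
    thus "?past \<in> borel_measurable (process_sigma M {0..\<tau> N} B)"
      by (intro borel_measurable_sum borel_measurable_inner borel_measurable_diff
          borel_measurable_const process_sigma_measurable) auto
    have "(\<lambda>\<omega>. B (\<tau> (Suc N)) \<omega> - B (\<tau> N) \<omega>) \<in>
        borel_measurable (vimage_algebra (space M) (\<lambda>\<omega>. B (\<tau> (Suc N)) \<omega> - B (\<tau> N) \<omega>) borel)"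
      by (rule measurable_vimage_algebra1) auto
    thus "?inc \<in> borel_measurable (vimage_algebra (space M) (\<lambda>\<omega>. B (\<tau> (Suc N)) \<omega> - B (\<tau> N) \<omega>) borel)"
      by (intro borel_measurable_inner borel_measurable_const)
  qed auto
  hence "(\<integral>\<omega>. cis (?past \<omega> + ?inc \<omega>) \<partial>M) = (\<integral>\<omega>. cis (?past \<omega>) \<partial>M) * (\<integral>\<omega>. cis (?inc \<omega>) \<partial>M)"
    by (rule integral_cis_add)
  moreover have "(\<integral>\<omega>. cis (?inc \<omega>) \<partial>M) =
      complex_of_real (exp (- ((\<tau> (Suc N) - \<tau> N) * (norm (w N))\<^sup>2) / 2))"
  proof -
    have im: "?inc \<in> borel_measurable M"
      using step by (intro borel_measurable_inner borel_measurable_diff borel_measurable_const Bm) auto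
    have "distr M borel ?inc = normal_law 0 (norm (w N) * sqrt (\<tau> (Suc N) - \<tau> N))"
      using B step unfolding brownian_motion_def by blast
    moreover have "(\<integral>\<omega>. cis (?inc \<omega>) \<partial>M) = (\<integral>x. cis (1 * x) \<partial>distr M borel ?inc)"
      using im by (subst integral_distr) auto
    ultimately show ?thesis
      using step by (simp add: normal_law_cis[of _ 1, simplified] power_mult_distrib mult.commute)
  qed
  ultimately show ?case
    using Suc.IH Suc.prems
    by (simp add: exp_add[symmetric] add_divide_distrib diff_divide_distrib of_real_mult[symmetric] del: of_real_mult)
qed

section \<open>Variance from the characteristic function\<close>

text \<open>The modulus removes the mean, which is a mere phase factor. For the centred variable at
  \<open>1 / r\<close> the real part differs from 1 by half the variance over the square of
  \<open>r\<close>, to leading order, and the imaginary part is of smaller order than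
  \<open>1 / r\<close>; both limits follow from the second moment by dominated convergence.\<close>

lemma (in prob_space) variance_of_char:
  fixes Y :: "'a \<Rightarrow> real"
  assumes Y[measurable]: "Y \<in> borel_measurable M" and Y2: "integrable M (\<lambda>x. (Y x)\<^sup>2)"
  shows "(\<lambda>k. (real (Suc k))\<^sup>2 * (1 - (norm (\<integral>x. cis (Y x / real (Suc k)) \<partial>M))\<^sup>2))
    \<longlonglongrightarrow> (\<integral>x. (Y x - (\<integral>x. Y x \<partial>M))\<^sup>2 \<partial>M)"
proof -
  have Yi: "integrable M Y" by (rule square_integrable_imp_integrable[OF Y Y2])
  define m where "m = (\<integral>x. Y x \<partial>M)"
  define Z where "Z = (\<lambda>x. Y x - m)"
  have Z[measurable]: "Z \<in> borel_measurable M" by (simp add: Z_def)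
  have Zi: "integrable M Z" using Yi by (simp add: Z_def)
  have Z0: "(\<integral>x. Z x \<partial>M) = 0" using Yi by (simp add: Z_def m_def prob_space)
  have Z2: "integrable M (\<lambda>x. (Z x)\<^sup>2)"
    using Y2 Yi by (simp add: Z_def power2_diff)
  define r where "r = (\<lambda>k. real (Suc k))"
  have r: "0 < r k" for k by (simp add: r_def)
  have rlim: "(\<lambda>k. y / r k) \<longlonglongrightarrow> 0" for y
    unfolding r_def using LIMSEQ_Suc[OF lim_const_over_n[of y]] by simp
  define C where "C = (\<lambda>k. \<integral>x. cos (Z x / r k) \<partial>M)"
  define S where "S = (\<lambda>k. \<integral>x. sin (Z x / r k) \<partial>M)"
  have ci: "integrable M (\<lambda>x. cos (Z x / r k))" "integrable M (\<lambda>x. sin (Z x / r k))" for k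
    by (auto intro!: integrable_const_bound[of _ 1])
  have norm_eq: "(norm (\<integral>x. cis (Y x / r k) \<partial>M))\<^sup>2 = (C k)\<^sup>2 + (S k)\<^sup>2" for k
  proof -
    have "(\<integral>x. cis (Y x / r k) \<partial>M) = (\<integral>x. cis (m / r k) * cis (Z x / r k) \<partial>M)"
      by (simp add: Z_def cis_mult add_divide_distrib[symmetric])
    also have "\<dots> = cis (m / r k) * (\<integral>x. cis (Z x / r k) \<partial>M)" by simp
    also have "(\<integral>x. cis (Z x / r k) \<partial>M) = Complex (C k) (S k)"
    proof -
      have "integrable M (\<lambda>x. cis (Z x / r k))" by (intro integrable_cis) simp
      thus ?thesis by (simp add: complex_eq_iff C_def S_def flip: integral_Re integral_Im)
    qed
    finally have "norm (\<integral>x. cis (Y x / r k) \<partial>M) = norm (Complex (C k) (S k))"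
      by (simp only: norm_mult norm_cis mult_1_left)
    thus ?thesis by (simp add: cmod_def)
  qed
  have half: "\<bar>1 - cos y\<bar> \<le> y\<^sup>2 / 2" for y :: real
  proof -
    have "1 - cos y = 2 * (sin (y / 2))\<^sup>2"
      using cos_double_sin[of "y / 2"] by simp
    also have "(sin (y / 2))\<^sup>2 \<le> (y / 2)\<^sup>2"
      using abs_sin_x_le_abs_x[of "y / 2"] by (simp only: abs_le_square_iff)
    finally show ?thesis by (simp add: power_divide)
  qed
  have sinlim: "(\<lambda>k. r k * sin (y / r k)) \<longlonglongrightarrow> y" for y :: real
  proof (cases "y = 0")
    case False
    have "((\<lambda>x::real. sin x / x) \<longlongrightarrow> 1) (at 0)"
      using DERIV_sin[of "0::real"] by (simp add: DERIV_def)
    moreover have "filterlim (\<lambda>k. y / r k) (at 0) sequentially"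
      using rlim[of y] False r by (auto simp: filterlim_at less_imp_neq[symmetric])
    ultimately have "(\<lambda>k. sin (y / r k) / (y / r k)) \<longlonglongrightarrow> 1"
      by (rule filterlim_compose)
    from tendsto_mult[OF tendsto_const[of y] this] show ?thesis
      using False r by (simp add: field_simps)
  qed simp
  have sq: "(\<lambda>k. (r k)\<^sup>2 * (1 - cos (y / r k))) \<longlonglongrightarrow> y\<^sup>2 / 2" for y :: real
  proof -
    have "(\<lambda>k. 2 * (r k * sin (y / 2 / r k))\<^sup>2) \<longlonglongrightarrow> 2 * (y / 2)\<^sup>2"
      by (intro tendsto_intros sinlim)
    moreover have "2 * (r k * sin (y / 2 / r k))\<^sup>2 = (r k)\<^sup>2 * (1 - cos (y / r k))" for k
      using cos_double_sin[of "y / 2 / r k"] by (simp add: power_mult_distrib)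
    ultimately show ?thesis by (simp add: power_divide)
  qed
  have Clim: "(\<lambda>k. (r k)\<^sup>2 * (1 - C k)) \<longlonglongrightarrow> (\<integral>x. (Z x)\<^sup>2 \<partial>M) / 2"
  proof -
    have lim: "(\<lambda>k. \<integral>x. (r k)\<^sup>2 * (1 - cos (Z x / r k)) \<partial>M) \<longlonglongrightarrow> (\<integral>x. (Z x)\<^sup>2 / 2 \<partial>M)"
    proof (rule integral_dominated_convergence[where w = "\<lambda>x. (Z x)\<^sup>2 / 2"])
      show "AE x in M. norm ((r k)\<^sup>2 * (1 - cos (Z x / r k))) \<le> (Z x)\<^sup>2 / 2" for k
      proof (rule AE_I2)
        fix x
        have "(r k)\<^sup>2 * \<bar>1 - cos (Z x / r k)\<bar> \<le> (r k)\<^sup>2 * ((Z x / r k)\<^sup>2 / 2)"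
          by (intro mult_left_mono half) auto
        thus "norm ((r k)\<^sup>2 * (1 - cos (Z x / r k))) \<le> (Z x)\<^sup>2 / 2"
          using r[of k] by (simp add: abs_mult power_divide)
      qed
    qed (use Z2 sq in auto)
    have eq: "(\<integral>x. (r k)\<^sup>2 * (1 - cos (Z x / r k)) \<partial>M) = (r k)\<^sup>2 * (1 - C k)" for k
      using ci[of k] by (simp add: C_def prob_space)
    from lim[unfolded eq] show ?thesis by simp
  qed
  have Slim: "(\<lambda>k. r k * S k) \<longlonglongrightarrow> 0"
  proof -
    have "(\<lambda>k. \<integral>x. r k * sin (Z x / r k) \<partial>M) \<longlonglongrightarrow> (\<integral>x. Z x \<partial>M)"
    proof (rule integral_dominated_convergence[where w = "\<lambda>x. \<bar>Z x\<bar>"])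
      show "AE x in M. norm (r k * sin (Z x / r k)) \<le> \<bar>Z x\<bar>" for k
      proof (rule AE_I2)
        fix x
        have "r k * \<bar>sin (Z x / r k)\<bar> \<le> r k * \<bar>Z x / r k\<bar>"
          using r[of k] by (intro mult_left_mono abs_sin_x_le_abs_x) auto
        thus "norm (r k * sin (Z x / r k)) \<le> \<bar>Z x\<bar>"
          using r[of k] by (simp add: abs_mult)
      qed
    qed (use Zi sinlim in auto)
    thus ?thesis by (simp add: S_def Z0)
  qed
  have C1: "C \<longlonglongrightarrow> 1"
  proof -
    have "(\<lambda>k. 1 - ((r k)\<^sup>2 * (1 - C k)) * (1 / r k)\<^sup>2) \<longlonglongrightarrow> 1 - (\<integral>x. (Z x)\<^sup>2 \<partial>M) / 2 * 0\<^sup>2"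
      by (intro tendsto_intros Clim rlim)
    thus ?thesis using r by (simp add: power_divide less_imp_neq[symmetric])
  qed
  have "(\<lambda>k. (r k)\<^sup>2 * (1 - C k) * (1 + C k) - (r k * S k)\<^sup>2) \<longlonglongrightarrow>
      (\<integral>x. (Z x)\<^sup>2 \<partial>M) / 2 * (1 + 1) - 0\<^sup>2"
    by (intro tendsto_intros Clim C1 Slim)
  moreover have "(r k)\<^sup>2 * (1 - C k) * (1 + C k) - (r k * S k)\<^sup>2 =
      (r k)\<^sup>2 * (1 - (norm (\<integral>x. cis (Y x / r k) \<partial>M))\<^sup>2)" for k
    unfolding norm_eq by (simp add: power2_eq_square algebra_simps)
  ultimately show ?thesis
    by (simp add: r_def Z_def m_def)
qed

section \<open>Adjoint Euler scheme\<close>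

text \<open>\<open>euler_adjoint K d u m i\<close> approximates at the \<open>(m - i)\<close>-th grid point the solution of the
  adjoint equation with terminal value \<open>u\<close> at the \<open>m\<close>-th one.\<close>

primrec euler_adjoint :: "(nat \<Rightarrow> real^'n^'n) \<Rightarrow> real \<Rightarrow> real^'n \<Rightarrow> nat \<Rightarrow> nat \<Rightarrow> real^'n" where
  "euler_adjoint K d u m 0 = u"
| "euler_adjoint K d u m (Suc i) =
    euler_adjoint K d u m i + d *\<^sub>R (transpose (K (m - Suc i)) *v euler_adjoint K d u m i)"

lemma euler_adjoint_step:
  assumes "j < m"
  shows "euler_adjoint K d u m (m - j) = euler_adjoint K d u m (m - Suc j) +
    d *\<^sub>R (transpose (K j) *v euler_adjoint K d u m (m - Suc j))"
proof -
  have "m - j = Suc (m - Suc j)" "m - Suc (m - Suc j) = j" using assms by auto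
  thus ?thesis by (metis euler_adjoint.simps(2))
qed

lemma one_plus_power_le_exp:
  fixes x :: real
  assumes "0 \<le> x" shows "(1 + x) ^ i \<le> exp (real i * x)"
  using assms by (metis add_nonneg_nonneg exp_ge_add_one_self exp_of_nat_mult power_mono zero_le_one)

lemma euler_adjoint_bound:
  fixes T :: real
  assumes K: "\<And>j. j < m \<Longrightarrow> norm (K j) \<le> \<kappa>" and d: "0 \<le> d" "d * real m \<le> T" and \<kappa>: "0 \<le> \<kappa>" and i: "i \<le> m"
  shows "norm (euler_adjoint K d u m i) \<le> exp (\<kappa> * T) * norm u"
proof -
  have "norm (euler_adjoint K d u m i) \<le> (1 + d * \<kappa>) ^ i * norm u"
    using i
  proof (induction i)
    case (Suc i)
    let ?v = "euler_adjoint K d u m i"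
    have "norm (transpose (K (m - Suc i)) *v ?v) \<le> \<kappa> * norm ?v"
      using K[of "m - Suc i"] Suc.prems
      by (intro order_trans[OF norm_matrix_vector_le] mult_right_mono) (auto simp: norm_transpose)
    hence "norm (euler_adjoint K d u m (Suc i)) \<le> norm ?v + d * (\<kappa> * norm ?v)"
      unfolding euler_adjoint.simps
      by (intro order_trans[OF norm_triangle_ineq] add_left_mono)
        (simp add: d mult_left_mono del: transpose_matrix_vector)
    also have "\<dots> = (1 + d * \<kappa>) * norm ?v" by (simp add: algebra_simps)
    also have "\<dots> \<le> (1 + d * \<kappa>) * ((1 + d * \<kappa>) ^ i * norm u)"
      using Suc d \<kappa> by (intro mult_left_mono) auto
    finally show ?case by (simp add: mult_ac)
  qed simp
  also have "\<dots> \<le> exp (\<kappa> * T) * norm u"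
  proof (rule mult_right_mono)
    have "real i * d \<le> T"
      using i d mult_right_mono[of "real i" "real m" d] by (simp add: mult.commute)
    hence "real i * (d * \<kappa>) \<le> \<kappa> * T"
      using \<kappa> mult_right_mono[of "real i * d" T \<kappa>] by (simp add: mult_ac)
    thus "(1 + d * \<kappa>) ^ i \<le> exp (\<kappa> * T)"
      using one_plus_power_le_exp[of "d * \<kappa>" i] d \<kappa> by (meson exp_le_cancel_iff mult_nonneg_nonneg order_trans)
  qed simp
  finally show ?thesis .
qed

definition grid :: "real \<Rightarrow> nat \<Rightarrow> nat \<Rightarrow> real" where
  "grid T m k = real k * T / real m"

lemma grid_simps: "grid T m 0 = 0" "0 < m \<Longrightarrow> grid T m m = T"
  "grid T m (Suc k) - grid T m k = T / real m"
  "0 < N \<Longrightarrow> grid T (m * N) (j * N) = grid T m j"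
  by (auto simp: grid_def distrib_right add_divide_distrib)

lemma grid_bounds: "0 \<le> T \<Longrightarrow> 0 \<le> grid T m k" "0 \<le> T \<Longrightarrow> k \<le> m \<Longrightarrow> grid T m k \<le> T"
  "0 \<le> T \<Longrightarrow> k \<le> l \<Longrightarrow> grid T m k \<le> grid T m l"
  by (auto simp: grid_def divide_le_eq mult.commute[of T] intro!: mult_right_mono divide_right_mono)

lemma uniform_continuity_modulus:
  fixes f :: "real \<Rightarrow> 'a::metric_space"
  assumes "continuous_on {0..T} f" "0 < e"
  obtains m0 where "\<And>m s t. m0 \<le> m \<Longrightarrow> 0 < m \<Longrightarrow> s \<in> {0..T} \<Longrightarrow> t \<in> {0..T} \<Longrightarrow> \<bar>s - t\<bar> \<le> T / real m \<Longrightarrow>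
    dist (f s) (f t) \<le> e"
proof -
  have uc: "uniformly_continuous_on {0..T} f"
    using assms(1) by (intro compact_uniformly_continuous) auto
  obtain d where d: "0 < d" "\<And>x y. x \<in> {0..T} \<Longrightarrow> y \<in> {0..T} \<Longrightarrow> dist y x < d \<Longrightarrow> dist (f y) (f x) < e"
    by (rule uniformly_continuous_onE[OF uc \<open>0 < e\<close>]) (rule that, assumption, blast)
  obtain m0 :: nat where m0: "T / d < real m0" using reals_Archimedean2 by blast
  show ?thesis
  proof (rule that[of m0])
    fix m s t assume m: "m0 \<le> m" "0 < m" and st: "s \<in> {0..T}" "t \<in> {0..T}" "\<bar>s - t\<bar> \<le> T / real m"
    have "T / d < real m" using m0 m(1) by linarith
    hence "T / real m < d" using d(1) m(2) by (simp add: field_simps)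
    hence "dist s t < d" using st(3) by (simp add: dist_real_def)
    from d(2)[OF st(2,1) this] show "dist (f s) (f t) \<le> e" by simp
  qed
qed

lemma continuous_bounded_on:
  fixes f :: "real \<Rightarrow> 'a::real_normed_vector"
  assumes "continuous_on {0..T} f"
  obtains b where "0 < b" "\<And>s. s \<in> {0..T} \<Longrightarrow> norm (f s) \<le> b"
proof -
  have "compact (f ` {0..T})" using assms by (intro compact_continuous_image) auto
  then obtain b where "\<And>s. s \<in> {0..T} \<Longrightarrow> norm (f s) \<le> b"
    using compact_imp_bounded bounded_iff by (metis imageI)
  hence "\<And>s. s \<in> {0..T} \<Longrightarrow> norm (f s) \<le> max b 1" by (meson max.coboundedI1)
  thus ?thesis by (intro that[of "max b 1"]) auto
qed

text \<open>The two usual ingredients of an Euler scheme: a local error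
  \<open>2 * \<epsilon> * d\<close> per step, from the moduli of continuity of \<open>K\<close> and
  \<open>q\<close>, and the amplification \<open>1 + d * \<kappa>\<close> of errors already made. As
  \<open>K\<close> is merely continuous, convergence comes without a rate.\<close>

lemma euler_adjoint_converges:
  fixes K :: "real \<Rightarrow> real^'n^'n"
  assumes T: "0 < T" and K: "continuous_on {0..T} K" and e: "0 < e"
    and q: "\<And>s. 0 \<le> s \<Longrightarrow> (q has_vector_derivative - (transpose (K s) *v q s)) (at s within {0..})"
  obtains m0 where "\<And>m j. m0 \<le> m \<Longrightarrow> 0 < m \<Longrightarrow> j \<le> m \<Longrightarrow>
    norm (q (grid T m j) - euler_adjoint (\<lambda>j. K (grid T m j)) (T / m) (q T) m (m - j)) \<le> e"
proof -
  obtain \<kappa> where \<kappa>: "0 < \<kappa>" "\<And>s. s \<in> {0..T} \<Longrightarrow> norm (K s) \<le> \<kappa>"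
    using continuous_bounded_on[OF K] by blast
  have qc: "continuous_on {0..} q"
    by (rule continuous_on_has_vector_derivative[OF q]) simp
  hence qT: "continuous_on {0..T} q" by (rule continuous_on_subset) auto
  obtain b where b: "0 < b" "\<And>s. s \<in> {0..T} \<Longrightarrow> norm (q s) \<le> b"
    using continuous_bounded_on[OF qT] by blast
  \<comment> \<open>Chosen so that \<open>m\<close> local errors, each amplified by at most
    \<open>exp (\<kappa> * T)\<close>, add up to \<open>e\<close>.\<close>
  define \<epsilon> where "\<epsilon> = e / (2 * T * exp (\<kappa> * T))"
  have \<epsilon>: "0 < \<epsilon>" using e T by (simp add: \<epsilon>_def)
  obtain m1 where m1: "\<And>m s t. m1 \<le> m \<Longrightarrow> 0 < m \<Longrightarrow> s \<in> {0..T} \<Longrightarrow> t \<in> {0..T} \<Longrightarrow>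
      \<bar>s - t\<bar> \<le> T / real m \<Longrightarrow> dist (K s) (K t) \<le> \<epsilon> / b"
    using uniform_continuity_modulus[OF K, of "\<epsilon> / b"] \<epsilon> b(1) by (metis divide_pos_pos)
  obtain m2 where m2: "\<And>m s t. m2 \<le> m \<Longrightarrow> 0 < m \<Longrightarrow> s \<in> {0..T} \<Longrightarrow> t \<in> {0..T} \<Longrightarrow>
      \<bar>s - t\<bar> \<le> T / real m \<Longrightarrow> dist (q s) (q t) \<le> \<epsilon> / \<kappa>"
    using uniform_continuity_modulus[OF qT, of "\<epsilon> / \<kappa>"] \<epsilon> \<kappa>(1) by (metis divide_pos_pos)
  show ?thesis
  proof (rule that[of "max m1 m2"])
    fix m j assume m: "max m1 m2 \<le> m" "0 < m" and j: "j \<le> m"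
    define d where "d = T / real m"
    have d: "0 < d" "d * real m = T" using T m by (auto simp: d_def)
    let ?K = "\<lambda>j. K (grid T m j)"
    let ?v = "euler_adjoint ?K d (q T) m"
    \<comment> \<open>\<open>i\<close> counts steps backwards from the terminal time, so grid index
      \<open>m - i\<close> is paired with iterate \<open>i\<close>.\<close>
    have *: "norm (q (grid T m (m - i)) - ?v i) \<le> real i * (2 * \<epsilon> * d) * (1 + d * \<kappa>) ^ i" if "i \<le> m" for i
      using that
    proof (induction i)
      case 0
      show ?case using m by (simp add: grid_simps)
    next
      case (Suc i)
      define k where "k = m - Suc i"
      have k: "m - i = Suc k" "k < m" using Suc.prems by (auto simp: k_def)
      let ?a = "grid T m k" and ?b = "grid T m (Suc k)"
      have ab: "?b - ?a = d" "0 \<le> ?a" "?a \<le> ?b" "?b \<le> T"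
        using grid_bounds[of T] T k by (auto simp: grid_simps d_def)
      have sub: "{?a..?b} \<subseteq> {0..T}" using ab by auto
      have Kq: "continuous_on {0..T} (\<lambda>s. transpose (K s) *v q s)"
        by (intro mvmult.continuous_on bounded_linear.continuous_on[OF bounded_linear_transpose] K qT)
      have "((\<lambda>s. - (transpose (K s) *v q s)) has_integral (q ?b - q ?a)) {?a..?b}"
        by (rule vector_derivative_integral[OF q ab(2,3)])
      from integral_unique[OF has_integral_neg[OF this]]
      have int: "integral {?a..?b} (\<lambda>s. transpose (K s) *v q s) = q ?a - q ?b"
        by (simp del: transpose_matrix_vector)
      have loc: "norm (d *\<^sub>R (transpose (K ?a) *v q ?b) - (q ?a - q ?b)) \<le> 2 * \<epsilon> * d"
        unfolding int[symmetric] unfolding ab(1)[symmetric]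
      proof (rule block_bound)
        show "(\<lambda>s. transpose (K s) *v q s) integrable_on {?a..?b}"
          by (intro integrable_continuous_interval continuous_on_subset[OF Kq sub])
        fix s assume s: "?a \<le> s" "s \<le> ?b"
        have sT: "s \<in> {0..T}" "?a \<in> {0..T}" "?b \<in> {0..T}" using s sub ab by auto
        have "\<bar>?a - s\<bar> \<le> T / real m" "\<bar>?b - s\<bar> \<le> T / real m"
          using s ab(1) by (auto simp: d_def)
        hence c: "norm (K ?a - K s) \<le> \<epsilon> / b" "norm (q ?b - q s) \<le> \<epsilon> / \<kappa>"
          using m1[of m ?a s] m2[of m ?b s] m sT by (auto simp: dist_norm)
        have "transpose (K ?a) *v q ?b - transpose (K s) *v q s =
            transpose (K ?a) *v (q ?b - q s) + transpose (K ?a - K s) *v q s"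
          by (simp add: mvmult.diff_right mvmult.diff_left transpose_diff del: transpose_matrix_vector)
        also have "norm \<dots> \<le> norm (K ?a) * norm (q ?b - q s) + norm (K ?a - K s) * norm (q s)"
          by (intro order_trans[OF norm_triangle_ineq] add_mono)
            (metis norm_matrix_vector_le norm_transpose)+
        also have "\<dots> \<le> \<kappa> * (\<epsilon> / \<kappa>) + (\<epsilon> / b) * b"
          using c \<kappa> b sT \<epsilon> by (intro add_mono mult_mono) auto
        also have "\<dots> = 2 * \<epsilon>" using \<kappa>(1) b(1) by simp
        finally show "norm (transpose (K ?a) *v q ?b - transpose (K s) *v q s) \<le> 2 * \<epsilon>" .
      qed (use ab in auto)
      define D where "D = q ?b - ?v i"
      have IH: "norm D \<le> real i * (2 * \<epsilon> * d) * (1 + d * \<kappa>) ^ i"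
        using Suc.IH Suc.prems by (simp add: D_def k(1))
      have "q ?a - ?v (Suc i) = D + d *\<^sub>R (transpose (K ?a) *v D) -
          (d *\<^sub>R (transpose (K ?a) *v q ?b) - (q ?a - q ?b))"
        by (simp add: D_def k_def[symmetric] mvmult.diff_right scaleR_diff_right del: transpose_matrix_vector)
      also have "norm \<dots> \<le> norm D + d * (\<kappa> * norm D) + 2 * \<epsilon> * d"
      proof (rule order_trans[OF norm_triangle_ineq4], rule add_mono[OF _ loc],
          rule order_trans[OF norm_triangle_ineq], rule add_left_mono)
        have "norm (transpose (K ?a) *v D) \<le> norm (K ?a) * norm D"
          by (metis norm_matrix_vector_le norm_transpose)
        also have "\<dots> \<le> \<kappa> * norm D" using \<kappa>(2)[of ?a] ab by (intro mult_right_mono) auto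
        finally show "norm (d *\<^sub>R (transpose (K ?a) *v D)) \<le> d * (\<kappa> * norm D)"
          using d(1) by (simp add: mult_left_mono del: transpose_matrix_vector)
      qed
      also have "\<dots> = (1 + d * \<kappa>) * norm D + 2 * \<epsilon> * d" by (simp add: algebra_simps)
      also have "\<dots> \<le> (1 + d * \<kappa>) * (real i * (2 * \<epsilon> * d) * (1 + d * \<kappa>) ^ i) +
          2 * \<epsilon> * d * (1 + d * \<kappa>) ^ Suc i"
      proof (intro add_mono mult_left_mono IH)
        have "1 \<le> (1 + d * \<kappa>) ^ Suc i" using d(1) \<kappa>(1) by (intro one_le_power) auto
        from mult_left_mono[OF this, of "2 * \<epsilon> * d"]
        show "2 * \<epsilon> * d \<le> 2 * \<epsilon> * d * (1 + d * \<kappa>) ^ Suc i"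
          using \<epsilon> d(1) by simp
      qed (use d \<kappa> in auto)
      also have "\<dots> = real (Suc i) * (2 * \<epsilon> * d) * (1 + d * \<kappa>) ^ Suc i"
        by (simp add: algebra_simps)
      finally show ?case by (simp add: k_def)
    qed
    have "norm (q (grid T m j) - ?v (m - j)) \<le> real (m - j) * (2 * \<epsilon> * d) * (1 + d * \<kappa>) ^ (m - j)"
      using *[of "m - j"] j by simp
    also have "\<dots> \<le> real m * (2 * \<epsilon> * d) * exp (\<kappa> * T)"
    proof (intro mult_mono)
      have "(1 + d * \<kappa>) ^ (m - j) \<le> exp (real (m - j) * (d * \<kappa>))"
        using d \<kappa> by (intro one_plus_power_le_exp) auto
      also have "real (m - j) * (d * \<kappa>) \<le> real m * (d * \<kappa>)"
        using d \<kappa> by (intro mult_right_mono) auto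
      also have "real m * (d * \<kappa>) = \<kappa> * T" using d by (simp add: mult_ac)
      finally show "(1 + d * \<kappa>) ^ (m - j) \<le> exp (\<kappa> * T)" by simp
    qed (use \<epsilon> d \<kappa> in auto)
    also have "\<dots> = (d * real m) * 2 * \<epsilon> * exp (\<kappa> * T)" by (simp add: mult_ac)
    also have "\<dots> = e" unfolding d(2) using T by (simp add: \<epsilon>_def)
    finally show "norm (q (grid T m j) - euler_adjoint ?K (T / m) (q T) m (m - j)) \<le> e"
      by (simp add: d_def)
  qed
qed

text \<open>\<open>k div N\<close> is the coarse block that contains the \<open>k\<close>-th fine
  interval.\<close>

lemma grid_block:
  assumes T: "0 \<le> T" and N: "0 < N" and k: "k < m * N" and s: "grid T (m * N) k \<le> s" "s \<le> grid T (m * N) (Suc k)"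
  shows "k div N < m" "grid T m (k div N) \<le> s" "s \<le> grid T m (Suc (k div N))" "0 \<le> s" "s \<le> T"
proof -
  show kd: "k div N < m" using k N by (simp add: less_mult_imp_div_less mult.commute)
  have "grid T m (k div N) = grid T (m * N) (k div N * N)" using N by (simp add: grid_simps)
  also have "\<dots> \<le> grid T (m * N) k" using T by (intro grid_bounds) (auto simp: div_times_less_eq_dividend)
  finally show "grid T m (k div N) \<le> s" using s by simp
  have "Suc k \<le> Suc (k div N) * N"
    using N by (metis Suc_leI dividend_less_div_times mult.commute mult_Suc)
  hence "grid T (m * N) (Suc k) \<le> grid T (m * N) (Suc (k div N) * N)" using T by (intro grid_bounds) auto
  also have "\<dots> = grid T m (Suc (k div N))" by (rule grid_simps(4)[OF N])
  finally show "s \<le> grid T m (Suc (k div N))" using s by simp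
  show "0 \<le> s" using grid_bounds(1)[OF T, of "m * N" k] s by simp
  show "s \<le> T" using grid_bounds(2)[OF T, of "Suc k" "m * N"] k s by simp
qed

text \<open>Coarse grid for the adjoint vectors, fine grid for the sums: on the fine grid the error
  \<open>I - F\<close> of the approximation of the stochastic integral is controlled only at coarse points.\<close>

lemma euler_scheme_error:
  fixes H :: "real \<Rightarrow> real^'m^'n" and x I g :: "real \<Rightarrow> real^'n" and z Z :: "real \<Rightarrow> real^'m"
    and u :: "real^'n"
  assumes T: "0 < T" and m: "0 < m" and N: "0 < N"
    and x: "continuous_on {0..T} x"
    and x_eq: "\<And>t. t \<in> {0..T} \<Longrightarrow> x t = x 0 + integral {0..t} (\<lambda>s. A *v x s + a) + g t + I t"
    and Z_eq: "\<And>t. t \<in> {0..T} \<Longrightarrow> Z t = z t - integral {0..t} (\<lambda>s. C *v x s + c)"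
  defines "\<tau> \<equiv> grid T (m * N)" and "\<sigma> \<equiv> \<lambda>k. grid T m (k div N)"
  defines "v \<equiv> \<lambda>j. euler_adjoint (\<lambda>j. A - H (grid T m j) ** C) (T / real m) u m (m - j)"
  defines "F \<equiv> \<lambda>j. \<Sum>k<j*N. H (\<tau> k) *v (Z (\<tau> (Suc k)) - Z (\<tau> k))"
  assumes b: "\<And>j. j \<le> m \<Longrightarrow> norm (v j) \<le> b"
    and osc1: "\<And>s t. s \<in> {0..T} \<Longrightarrow> t \<in> {0..T} \<Longrightarrow> \<bar>s - t\<bar> \<le> T / real m \<Longrightarrow>
      norm ((A *v x s + a) - (A *v x t + a)) \<le> \<epsilon>"
    and osc2: "\<And>s t r. s \<in> {0..T} \<Longrightarrow> t \<in> {0..T} \<Longrightarrow> r \<in> {0..T} \<Longrightarrow> \<bar>s - t\<bar> \<le> T / real m \<Longrightarrow>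
      \<bar>s - r\<bar> \<le> T / real m \<Longrightarrow> norm (H s *v (C *v x s + c) - H r *v (C *v x t + c)) \<le> \<epsilon>"
  shows "\<bar>u \<bullet> x T - (v 0 \<bullet> x 0 + (\<Sum>k<m*N. v (Suc (k div N)) \<bullet> ((T / real (m * N)) *\<^sub>R (a - H (\<sigma> k) *v c)
      + (g (\<tau> (Suc k)) - g (\<tau> k)) + H (\<tau> k) *v (z (\<tau> (Suc k)) - z (\<tau> k)))))\<bar>
    \<le> b * (2 * \<epsilon> * T + 2 * (\<Sum>j\<le>m. norm (I (grid T m j) - F j)))"
proof -
  define \<delta> where "\<delta> = T / real (m * N)"
  define d where "d = T / real m"
  have \<delta>: "0 < \<delta>" "real N * \<delta> = d" "real m * d = T" using T m N by (auto simp: \<delta>_def d_def)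
  define \<phi> where "\<phi> = (\<lambda>s. A *v x s + a)"
  define \<psi> where "\<psi> = (\<lambda>s. C *v x s + c)"
  have \<phi>c: "continuous_on {0..T} \<phi>" and \<psi>c: "continuous_on {0..T} \<psi>"
    unfolding \<phi>_def \<psi>_def by (intro continuous_intros mvmult.continuous_on x)+
  have x_eq': "x t = x 0 + integral {0..t} \<phi> + g t + I t" if "t \<in> {0..T}" for t
    using x_eq[OF that] by (simp only: \<phi>_def)
  have Z_eq': "Z t = z t - integral {0..t} \<psi>" if "t \<in> {0..T}" for t
    using Z_eq[OF that] by (simp only: \<psi>_def)
  have b0: "0 \<le> b" using b[of 0] norm_ge_zero order_trans by blast

  have \<tau>: "0 \<le> \<tau> k" "\<tau> k \<le> \<tau> (Suc k)" "\<tau> (Suc k) - \<tau> k = \<delta>" for k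
    using grid_bounds[of T] T by (auto simp: \<tau>_def grid_simps \<delta>_def)
  have \<tau>T: "\<tau> k \<le> T" if "k \<le> m * N" for k
    using grid_bounds(2)[of T k "m * N"] T that by (simp add: \<tau>_def)
  \<comment> \<open>The deterministic remainder of one fine step: integrals of the drift and of the
    gain drift, compared with their integrands frozen at the coarse point
    \<open>\<sigma> k\<close>.\<close>
  define r where "r = (\<lambda>k. (integral {\<tau> k..\<tau> (Suc k)} \<phi> - \<delta> *\<^sub>R \<phi> (\<sigma> k)) -
      (H (\<tau> k) *v integral {\<tau> k..\<tau> (Suc k)} \<psi> - \<delta> *\<^sub>R (H (\<sigma> k) *v \<psi> (\<sigma> k))))"
  define nn where "nn = (\<lambda>k. \<delta> *\<^sub>R (a - H (\<sigma> k) *v c) + (g (\<tau> (Suc k)) - g (\<tau> k))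
      + H (\<tau> k) *v (z (\<tau> (Suc k)) - z (\<tau> k)))"
  define E where "E = (\<lambda>j. I (grid T m j) - F j)"
  have inc: "integral {0..\<tau> (Suc k)} f - integral {0..\<tau> k} f = integral {\<tau> k..\<tau> (Suc k)} f"
    if "continuous_on {0..T} f" "k < m * N" for f :: "real \<Rightarrow> 'b::euclidean_space" and k
  proof -
    have "f integrable_on {0..\<tau> (Suc k)}"
      using that \<tau>T[of "Suc k"] by (intro integrable_continuous_interval continuous_on_subset[OF that(1)]) auto
    from Henstock_Kurzweil_Integration.integral_combine[OF \<tau>(1) \<tau>(2) this] show ?thesis by (simp add: algebra_simps)
  qed
  have \<sigma>_near: "\<sigma> k \<in> {0..T}" "\<bar>s - \<sigma> k\<bar> \<le> d" "s \<in> {0..T}"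
    if k: "k < m * N" and s: "s \<in> {\<tau> k..\<tau> (Suc k)}" for k s
  proof -
    have "0 \<le> T" "grid T (m * N) k \<le> s" "s \<le> grid T (m * N) (Suc k)" using T s by (auto simp: \<tau>_def)
    note gb = grid_block[OF this(1) N k this(2,3)]
    have s0: "0 \<le> \<sigma> k" using T by (simp add: \<sigma>_def grid_bounds)
    show "\<sigma> k \<in> {0..T}" "s \<in> {0..T}" using s0 gb by (auto simp: \<sigma>_def)
    show "\<bar>s - \<sigma> k\<bar> \<le> d" using gb(2,3) grid_simps(3)[of T m "k div N"] by (simp add: \<sigma>_def d_def)
  qed
  have r: "norm (r k) \<le> 2 * \<epsilon> * \<delta>" if k: "k < m * N" for k
  proof -
    have sub: "{\<tau> k..\<tau> (Suc k)} \<subseteq> {0..T}" using \<sigma>_near(3)[OF k] by blast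
    have tk: "\<tau> k \<in> {\<tau> k..\<tau> (Suc k)}" using \<tau> by auto
    have "norm ((\<tau> (Suc k) - \<tau> k) *\<^sub>R \<phi> (\<sigma> k) - integral {\<tau> k..\<tau> (Suc k)} \<phi>) \<le> \<epsilon> * (\<tau> (Suc k) - \<tau> k)"
    proof (rule block_bound)
      show "\<phi> integrable_on {\<tau> k..\<tau> (Suc k)}"
        by (intro integrable_continuous_interval continuous_on_subset[OF \<phi>c sub])
      show "norm (\<phi> (\<sigma> k) - \<phi> s) \<le> \<epsilon>" if "\<tau> k \<le> s" "s \<le> \<tau> (Suc k)" for s
        using osc1[of "\<sigma> k" s] \<sigma>_near[OF k, of s] that by (simp add: \<phi>_def d_def abs_minus_commute)
    qed (use \<tau> in auto)
    moreover have "norm ((\<tau> (Suc k) - \<tau> k) *\<^sub>R (H (\<sigma> k) *v \<psi> (\<sigma> k)) -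
        integral {\<tau> k..\<tau> (Suc k)} (\<lambda>s. H (\<tau> k) *v \<psi> s)) \<le> \<epsilon> * (\<tau> (Suc k) - \<tau> k)"
    proof (rule block_bound)
      show "(\<lambda>s. H (\<tau> k) *v \<psi> s) integrable_on {\<tau> k..\<tau> (Suc k)}"
        by (intro integrable_continuous_interval mvmult.continuous_on continuous_on_const
            continuous_on_subset[OF \<psi>c sub])
      show "norm (H (\<sigma> k) *v \<psi> (\<sigma> k) - H (\<tau> k) *v \<psi> s) \<le> \<epsilon>" if "\<tau> k \<le> s" "s \<le> \<tau> (Suc k)" for s
        using osc2[of "\<sigma> k" s "\<tau> k"] \<sigma>_near[OF k, of s] \<sigma>_near[OF k tk] that
        by (simp add: \<psi>_def d_def abs_minus_commute)
    qed (use \<tau> in auto)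
    moreover have "integral {\<tau> k..\<tau> (Suc k)} (\<lambda>s. H (\<tau> k) *v \<psi> s) = H (\<tau> k) *v integral {\<tau> k..\<tau> (Suc k)} \<psi>"
      using integral_linear[OF integrable_continuous_interval[OF continuous_on_subset[OF \<psi>c sub]]
          mvmult.bounded_linear_right[of "H (\<tau> k)"]] by (simp add: o_def)
    ultimately have "norm (integral {\<tau> k..\<tau> (Suc k)} \<phi> - \<delta> *\<^sub>R \<phi> (\<sigma> k)) \<le> \<epsilon> * \<delta>"
      "norm (H (\<tau> k) *v integral {\<tau> k..\<tau> (Suc k)} \<psi> - \<delta> *\<^sub>R (H (\<sigma> k) *v \<psi> (\<sigma> k))) \<le> \<epsilon> * \<delta>"
      unfolding \<tau>(3) by (simp_all add: norm_minus_commute)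
    thus ?thesis
      unfolding r_def by (intro order_trans[OF norm_triangle_ineq4]) simp
  qed
  have div_block: "k div N = j" if "k \<in> {j*N..<j*N+N}" for k j
    by (rule div_nat_eqI) (use that in \<open>auto simp: mult.commute\<close>)
  \<comment> \<open>Over one coarse block the fine increments add up to an Euler step for
    \<open>x\<close> with the closed-loop matrix at the left end, the terms \<open>nn\<close> that
    are kept, the remainders \<open>r\<close> and an increment of \<open>E\<close> between coarse
    points.\<close>
  have block: "x (grid T m (Suc j)) - x (grid T m j) - d *\<^sub>R ((A - H (grid T m j) ** C) *v x (grid T m j)) =
      (\<Sum>k=j*N..<j*N+N. nn k + r k) + (E (Suc j) - E j)" if j: "j < m" for j
  proof -
    let ?K = "{j*N..<j*N+N}"
    have jN: "j * N + N \<le> m * N" using j by (metis Suc_leI mult_Suc add.commute mult_le_mono1)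
    have kj: "k div N = j" "k < m * N" if "k \<in> ?K" for k
      using that jN div_block by auto
    have inc_k: "x (\<tau> (Suc k)) - x (\<tau> k) - \<delta> *\<^sub>R ((A - H (grid T m j) ** C) *v x (grid T m j)) =
        nn k + r k + ((I (\<tau> (Suc k)) - I (\<tau> k)) - H (\<tau> k) *v (Z (\<tau> (Suc k)) - Z (\<tau> k)))"
      if k: "k \<in> ?K" for k
    proof -
      have tin: "\<tau> k \<in> {0..T}" "\<tau> (Suc k) \<in> {0..T}" using \<tau> \<tau>T kj(2)[OF k] by (auto intro: less_imp_le)
      have \<sigma>k: "\<sigma> k = grid T m j" by (simp add: \<sigma>_def kj(1)[OF k])
      have "x (\<tau> (Suc k)) - x (\<tau> k) = integral {\<tau> k..\<tau> (Suc k)} \<phi> +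
          (g (\<tau> (Suc k)) - g (\<tau> k)) + (I (\<tau> (Suc k)) - I (\<tau> k))"
        unfolding inc[OF \<phi>c kj(2)[OF k], symmetric] x_eq'[OF tin(1)] x_eq'[OF tin(2)]
        by (simp add: algebra_simps)
      moreover have "Z (\<tau> (Suc k)) - Z (\<tau> k) = (z (\<tau> (Suc k)) - z (\<tau> k)) - integral {\<tau> k..\<tau> (Suc k)} \<psi>"
        unfolding inc[OF \<psi>c kj(2)[OF k], symmetric] Z_eq'[OF tin(1)] Z_eq'[OF tin(2)]
        by (simp add: algebra_simps)
      ultimately show ?thesis
        by (simp add: nn_def r_def \<sigma>k mvmult.diff_right mvmult.diff_left
            mvmult.add_right matrix_vector_mul_assoc[symmetric] scaleR_diff_right scaleR_add_right
            \<phi>_def[THEN fun_cong, of "grid T m j"] \<psi>_def[THEN fun_cong, of "grid T m j"])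
    qed
    have tel: "(\<Sum>k=j*N..<j*N+N. f (\<tau> (Suc k)) - f (\<tau> k)) = f (grid T m (Suc j)) - f (grid T m j)"
      for f :: "real \<Rightarrow> real^'n"
    proof -
      have "(\<Sum>k=j*N..<j*N+N. f (\<tau> (Suc k)) - f (\<tau> k)) = f (\<tau> (j*N+N)) - f (\<tau> (j*N))"
        by (rule sum_Suc_diff') simp
      thus ?thesis using grid_simps(4)[OF N, of T m j] grid_simps(4)[OF N, of T m "Suc j"]
        by (simp add: \<tau>_def add.commute)
    qed
    have Fj: "(\<Sum>k=j*N..<j*N+N. H (\<tau> k) *v (Z (\<tau> (Suc k)) - Z (\<tau> k))) = F (Suc j) - F j"
    proof -
      have "F (Suc j) = F j + (\<Sum>k=j*N..<j*N+N. H (\<tau> k) *v (Z (\<tau> (Suc k)) - Z (\<tau> k)))"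
        unfolding F_def lessThan_atLeast0
        by (subst sum.atLeastLessThan_concat) (auto simp: add.commute)
      thus ?thesis by simp
    qed
    have "(\<Sum>k=j*N..<j*N+N. nn k + r k) + (E (Suc j) - E j) =
        (\<Sum>k=j*N..<j*N+N. nn k + r k + ((I (\<tau> (Suc k)) - I (\<tau> k)) - H (\<tau> k) *v (Z (\<tau> (Suc k)) - Z (\<tau> k))))"
      unfolding E_def sum.distrib[of "\<lambda>k. nn k + r k"] sum_subtractf[of "\<lambda>k. I (\<tau> (Suc k)) - I (\<tau> k)"] tel Fj
      by (simp add: algebra_simps)
    also have "\<dots> = (\<Sum>k=j*N..<j*N+N. (x (\<tau> (Suc k)) - x (\<tau> k)) -
        \<delta> *\<^sub>R ((A - H (grid T m j) ** C) *v x (grid T m j)))"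
      by (intro sum.cong refl inc_k[symmetric])
    also have "\<dots> = x (grid T m (Suc j)) - x (grid T m j) - (real N * \<delta>) *\<^sub>R ((A - H (grid T m j) ** C) *v x (grid T m j))"
      unfolding sum_subtractf[of "\<lambda>k. x (\<tau> (Suc k)) - x (\<tau> k)"] tel by (simp add: sum_constant_scaleR del: sum_constant)
    finally show ?thesis unfolding \<delta>(2) by simp
  qed
  \<comment> \<open>Passing from \<open>v (Suc j)\<close> to \<open>v j\<close> transposes the
    linear part of the Euler step for \<open>x\<close>, which thereby cancels. This is the purpose
    of the adjoint vectors.\<close>
  have vstep: "v (Suc j) \<bullet> x (grid T m (Suc j)) - v j \<bullet> x (grid T m j) =
      v (Suc j) \<bullet> (x (grid T m (Suc j)) - x (grid T m j) - d *\<^sub>R ((A - H (grid T m j) ** C) *v x (grid T m j)))"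
    if j: "j < m" for j
  proof -
    have vj: "v j = v (Suc j) + d *\<^sub>R (transpose (A - H (grid T m j) ** C) *v v (Suc j))"
      unfolding v_def d_def by (rule euler_adjoint_step[OF j])
    have "v j \<bullet> y = v (Suc j) \<bullet> y + d * (v (Suc j) \<bullet> ((A - H (grid T m j) ** C) *v y))" for y
      unfolding vj by (simp only: inner_add_left inner_scaleR_left inner_matrix_transpose)
    thus ?thesis
      by (simp add: inner_diff_right)
  qed
  have group: "(\<Sum>j<m. \<Sum>k=j*N..<j*N+N. f k) = (\<Sum>k<m*N. f k)" for f :: "nat \<Rightarrow> real"
    by (rule sum.nat_group)
  have vm: "v m = u" by (simp add: v_def)
  have "u \<bullet> x T - v 0 \<bullet> x 0 = (\<Sum>j<m. v (Suc j) \<bullet> x (grid T m (Suc j)) - v j \<bullet> x (grid T m j))"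
    by (subst sum_lessThan_telescope) (simp add: vm grid_simps m)
  also have "\<dots> = (\<Sum>j<m. (\<Sum>k=j*N..<j*N+N. v (Suc (k div N)) \<bullet> nn k + v (Suc (k div N)) \<bullet> r k) +
      v (Suc j) \<bullet> (E (Suc j) - E j))"
  proof (rule sum.cong[OF refl])
    fix j assume "j \<in> {..<m}"
    hence j: "j < m" by simp
    have "(\<Sum>k=j*N..<j*N+N. v (Suc (k div N)) \<bullet> nn k + v (Suc (k div N)) \<bullet> r k) =
        (\<Sum>k=j*N..<j*N+N. v (Suc j) \<bullet> (nn k + r k))"
      by (intro sum.cong refl) (simp add: div_block inner_add_right)
    thus "v (Suc j) \<bullet> x (grid T m (Suc j)) - v j \<bullet> x (grid T m j) =
        (\<Sum>k=j*N..<j*N+N. v (Suc (k div N)) \<bullet> nn k + v (Suc (k div N)) \<bullet> r k) + v (Suc j) \<bullet> (E (Suc j) - E j)"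
      unfolding vstep[OF j] block[OF j] by (simp add: inner_sum_right inner_add_right)
  qed
  also have "\<dots> = (\<Sum>k<m*N. v (Suc (k div N)) \<bullet> nn k) + (\<Sum>k<m*N. v (Suc (k div N)) \<bullet> r k) +
      (\<Sum>j<m. v (Suc j) \<bullet> (E (Suc j) - E j))"
    by (simp only: sum.distrib group)
  finally have main: "u \<bullet> x T - (v 0 \<bullet> x 0 + (\<Sum>k<m*N. v (Suc (k div N)) \<bullet> nn k)) =
      (\<Sum>k<m*N. v (Suc (k div N)) \<bullet> r k) + (\<Sum>j<m. v (Suc j) \<bullet> (E (Suc j) - E j))"
    by simp
  have "\<bar>\<Sum>k<m*N. v (Suc (k div N)) \<bullet> r k\<bar> \<le> (\<Sum>k<m*N. b * (2 * \<epsilon> * \<delta>))"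
  proof (intro order_trans[OF sum_abs] sum_mono)
    fix k assume "k \<in> {..<m*N}"
    hence k: "k < m * N" by simp
    hence "k div N < m" using N by (simp add: less_mult_imp_div_less mult.commute)
    hence "norm (v (Suc (k div N))) * norm (r k) \<le> b * (2 * \<epsilon> * \<delta>)"
      using b[of "Suc (k div N)"] r[OF k] b0 by (intro mult_mono) auto
    thus "\<bar>v (Suc (k div N)) \<bullet> r k\<bar> \<le> b * (2 * \<epsilon> * \<delta>)"
      using Cauchy_Schwarz_ineq2 order_trans by blast
  qed
  also have "\<dots> = b * (2 * \<epsilon> * T)" using T m N by (simp add: \<delta>_def)
  finally have 1: "\<bar>\<Sum>k<m*N. v (Suc (k div N)) \<bullet> r k\<bar> \<le> b * (2 * \<epsilon> * T)" .
  \<comment> \<open>The weights vary with \<open>j\<close>, so the increments of \<open>E\<close> do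
    not telescope. The crude bound by the sum of all errors is harmless because the fine grid can be
    refined while \<open>m\<close> stays fixed.\<close>
  have "\<bar>\<Sum>j<m. v (Suc j) \<bullet> (E (Suc j) - E j)\<bar> \<le> (\<Sum>j<m. b * (norm (E (Suc j)) + norm (E j)))"
  proof (intro order_trans[OF sum_abs] sum_mono)
    fix j assume j: "j \<in> {..<m}"
    have "norm (v (Suc j)) * norm (E (Suc j) - E j) \<le> b * (norm (E (Suc j)) + norm (E j))"
      using b[of "Suc j"] j b0 by (intro mult_mono norm_triangle_ineq4) auto
    thus "\<bar>v (Suc j) \<bullet> (E (Suc j) - E j)\<bar> \<le> b * (norm (E (Suc j)) + norm (E j))"
      using Cauchy_Schwarz_ineq2 order_trans by blast
  qed
  also have "\<dots> = b * ((\<Sum>j<m. norm (E (Suc j))) + (\<Sum>j<m. norm (E j)))"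
    by (simp add: sum_distrib_left sum.distrib distrib_left)
  also have "\<dots> \<le> b * ((\<Sum>j\<le>m. norm (E j)) + (\<Sum>j\<le>m. norm (E j)))"
  proof (intro mult_left_mono add_mono b0)
    show "(\<Sum>j<m. norm (E (Suc j))) \<le> (\<Sum>j\<le>m. norm (E j))"
      by (simp add: sum.atMost_shift)
    show "(\<Sum>j<m. norm (E j)) \<le> (\<Sum>j\<le>m. norm (E j))"
      by (intro sum_mono2) auto
  qed
  finally have 2: "\<bar>\<Sum>j<m. v (Suc j) \<bullet> (E (Suc j) - E j)\<bar> \<le> b * (2 * (\<Sum>j\<le>m. norm (E j)))" by simp
  have "\<bar>u \<bullet> x T - (v 0 \<bullet> x 0 + (\<Sum>k<m*N. v (Suc (k div N)) \<bullet> nn k))\<bar> \<le>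
      b * (2 * \<epsilon> * T) + b * (2 * (\<Sum>j\<le>m. norm (E j)))"
    unfolding main using 1 2 by linarith
  thus ?thesis by (simp add: nn_def \<delta>_def E_def distrib_left)
qed

section \<open>Convergence of the discrete sums along one path\<close>

lemma jointly_uniform_modulus:
  fixes f :: "real \<Rightarrow> 'a::euclidean_space" and g :: "real \<Rightarrow> 'b::euclidean_space" and h :: "'a \<times> 'b \<Rightarrow> 'c::metric_space"
  assumes f: "continuous_on {0..T} f" and g: "continuous_on {0..T} g" and h: "continuous_on UNIV h" and e: "0 < e"
  obtains d where "0 < d" "\<And>s t x y. s \<in> {0..T} \<Longrightarrow> t \<in> {0..T} \<Longrightarrow> norm (x - f s) < d \<Longrightarrow> norm (y - g t) < d \<Longrightarrow>
    dist (h (x, y)) (h (f s, g t)) \<le> e"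
proof -
  obtain b where b: "\<And>s. s \<in> {0..T} \<Longrightarrow> norm (f s) \<le> b" using continuous_bounded_on[OF f] by blast
  obtain b' where b': "\<And>s. s \<in> {0..T} \<Longrightarrow> norm (g s) \<le> b'" using continuous_bounded_on[OF g] by blast
  define S where "S = cball (0::'a) (b + 1) \<times> cball (0::'b) (b' + 1)"
  have uc: "uniformly_continuous_on S h"
    unfolding S_def by (intro compact_uniformly_continuous continuous_on_subset[OF h] compact_Times compact_cball) auto
  obtain d where d: "0 < d" "\<And>x y. x \<in> S \<Longrightarrow> y \<in> S \<Longrightarrow> dist y x < d \<Longrightarrow> dist (h y) (h x) < e"
    by (rule uniformly_continuous_onE[OF uc e]) (rule that, assumption, blast)
  show ?thesis
  proof (rule that[of "min 1 (d / 2)"])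
    fix s t x y assume st: "s \<in> {0..T}" "t \<in> {0..T}" and x: "norm (x - f s) < min 1 (d / 2)" and y: "norm (y - g t) < min 1 (d / 2)"
    have "norm x \<le> b + 1" "norm y \<le> b' + 1"
      using x y b[OF st(1)] b'[OF st(2)] norm_triangle_sub[of x "f s"] norm_triangle_sub[of y "g t"] by auto
    hence "(x, y) \<in> S" "(f s, g t) \<in> S" using b[OF st(1)] b'[OF st(2)] by (auto simp: S_def)
    moreover have "dist (x, y) (f s, g t) < d"
    proof -
      have "dist (x, y) (f s, g t) \<le> norm (x - f s) + norm (y - g t)"
        by (simp add: dist_norm norm_Pair_le)
      thus ?thesis using x y by simp
    qed
    ultimately show "dist (h (x, y)) (h (f s, g t)) \<le> e" using d(2) by (meson less_imp_le)
  qed (use d in auto)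
qed

text \<open>Indexed forwards in time, with value \<open>u\<close> at \<open>j = m\<close>; truncated
  subtraction gives the value \<open>u\<close> beyond \<open>m\<close> as well.\<close>

definition adjoint_grid ::
  "real^'n^'n \<Rightarrow> real^'n^'m \<Rightarrow> (real \<Rightarrow> real^'m^'n) \<Rightarrow> real \<Rightarrow> real^'n \<Rightarrow> nat \<Rightarrow> nat \<Rightarrow> real^'n" where
  "adjoint_grid A C H T u m j = euler_adjoint (\<lambda>j. A - H (grid T m j) ** C) (T / real m) u m (m - j)"

lemma adjoint_grid_bounded:
  fixes H :: "real \<Rightarrow> real^'m^'n" and C :: "real^'n^'m" and A :: "real^'n^'n"
  assumes T: "0 < T" and H: "continuous_on {0..T} H"
  obtains b where "\<And>m j. 0 < m \<Longrightarrow> norm (adjoint_grid A C H T u m j) \<le> b"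
proof -
  have "continuous_on {0..T} (\<lambda>s. A - H s ** C)"
    by (intro continuous_intros mmult.continuous_on H)
  then obtain \<kappa> where \<kappa>: "0 < \<kappa>" "\<And>s. s \<in> {0..T} \<Longrightarrow> norm (A - H s ** C) \<le> \<kappa>"
    using continuous_bounded_on by blast
  show ?thesis
  proof (rule that[of "exp (\<kappa> * T) * norm u"])
    fix m j :: nat assume "0 < m"
    thus "norm (adjoint_grid A C H T u m j) \<le> exp (\<kappa> * T) * norm u"
      unfolding adjoint_grid_def using T \<kappa>
      by (intro euler_adjoint_bound) (auto intro!: \<kappa>(2) grid_bounds)
  qed
qed

text \<open>A statement about a single path. The refinement \<open>N m\<close> of the coarse grid
  may depend on \<open>m\<close> in any way that makes the errors at all coarse points sum to a null
  sequence; this is compatible with the limit because the bound for the adjoint vectors is uniform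
  in \<open>m\<close>.\<close>

lemma euler_scheme_converges:
  fixes H :: "real \<Rightarrow> real^'m^'n" and x I g :: "real \<Rightarrow> real^'n" and z Z :: "real \<Rightarrow> real^'m"
    and u :: "real^'n"
  assumes T: "0 < T" and N: "\<And>m. 0 < N m"
    and x: "continuous_on {0..T} x" and H: "continuous_on {0..T} H"
    and x_eq: "\<And>t. t \<in> {0..T} \<Longrightarrow> x t = x 0 + integral {0..t} (\<lambda>s. A *v x s + a) + g t + I t"
    and Z_eq: "\<And>t. t \<in> {0..T} \<Longrightarrow> Z t = z t - integral {0..t} (\<lambda>s. C *v x s + c)"
    and err: "(\<lambda>m. \<Sum>j\<le>Suc m. norm (I (grid T (Suc m) j) - (\<Sum>k<j * N m. H (grid T (Suc m * N m) k) *v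
      (Z (grid T (Suc m * N m) (Suc k)) - Z (grid T (Suc m * N m) k))))) \<longlonglongrightarrow> 0"
  shows "(\<lambda>m. adjoint_grid A C H T u (Suc m) 0 \<bullet> x 0 + (\<Sum>k<Suc m * N m.
      adjoint_grid A C H T u (Suc m) (Suc (k div N m)) \<bullet>
       ((T / real (Suc m * N m)) *\<^sub>R (a - H (grid T (Suc m) (k div N m)) *v c)
      + (g (grid T (Suc m * N m) (Suc k)) - g (grid T (Suc m * N m) k))
      + H (grid T (Suc m * N m) k) *v (z (grid T (Suc m * N m) (Suc k)) - z (grid T (Suc m * N m) k))))) \<longlonglongrightarrow> u \<bullet> x T"
    (is "?\<xi> \<longlonglongrightarrow> _")
proof (rule LIMSEQ_I)
  fix e :: real assume e: "0 < e"
  obtain b0 where b0: "\<And>m j. 0 < m \<Longrightarrow> norm (adjoint_grid A C H T u m j) \<le> b0"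
    using adjoint_grid_bounded[OF T H] by blast
  define b where "b = max b0 1"
  have b: "0 < b" "\<And>m j. 0 < m \<Longrightarrow> norm (adjoint_grid A C H T u m j) \<le> b"
    using b0 unfolding b_def by (auto intro: max.coboundedI1)
  define \<epsilon> where "\<epsilon> = e / (8 * b * T)"
  have \<epsilon>: "0 < \<epsilon>" "b * (2 * \<epsilon> * T) = e / 4" using e b T by (auto simp: \<epsilon>_def)
  have \<phi>: "continuous_on {0..T} (\<lambda>s. A *v x s + a)" and \<psi>: "continuous_on {0..T} (\<lambda>s. C *v x s + c)"
    by (intro continuous_intros mvmult.continuous_on x)+
  obtain m1 where m1: "\<And>m s t. m1 \<le> m \<Longrightarrow> 0 < m \<Longrightarrow> s \<in> {0..T} \<Longrightarrow> t \<in> {0..T} \<Longrightarrow>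
      \<bar>s - t\<bar> \<le> T / real m \<Longrightarrow> dist (A *v x s + a) (A *v x t + a) \<le> \<epsilon>"
    using uniform_continuity_modulus[OF \<phi> \<epsilon>(1)] by blast
  have "continuous_on UNIV (\<lambda>p :: (real^'m^'n) \<times> (real^'m). fst p *v snd p)"
    by (intro mvmult.continuous_on continuous_intros)
  then obtain d where d: "0 < d" "\<And>s t h y. s \<in> {0..T} \<Longrightarrow> t \<in> {0..T} \<Longrightarrow> norm (h - H s) < d \<Longrightarrow>
      norm (y - (C *v x t + c)) < d \<Longrightarrow> dist (fst (h, y) *v snd (h, y)) (fst (H s, C *v x t + c) *v snd (H s, C *v x t + c)) \<le> \<epsilon>"
    using jointly_uniform_modulus[OF H \<psi> _ \<epsilon>(1)] by blast
  obtain m2 where m2: "\<And>m s t. m2 \<le> m \<Longrightarrow> 0 < m \<Longrightarrow> s \<in> {0..T} \<Longrightarrow> t \<in> {0..T} \<Longrightarrow>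
      \<bar>s - t\<bar> \<le> T / real m \<Longrightarrow> dist (H s) (H t) \<le> d / 2"
    using uniform_continuity_modulus[OF H, of "d / 2"] d(1) by (metis half_gt_zero)
  obtain m3 where m3: "\<And>m s t. m3 \<le> m \<Longrightarrow> 0 < m \<Longrightarrow> s \<in> {0..T} \<Longrightarrow> t \<in> {0..T} \<Longrightarrow>
      \<bar>s - t\<bar> \<le> T / real m \<Longrightarrow> dist (C *v x s + c) (C *v x t + c) \<le> d / 2"
    using uniform_continuity_modulus[OF \<psi>, of "d / 2"] d(1) by (metis half_gt_zero)
  obtain m4 where m4: "\<And>m. m4 \<le> m \<Longrightarrow> norm ((\<Sum>j\<le>Suc m. norm (I (grid T (Suc m) j) - (\<Sum>k<j * N m. H (grid T (Suc m * N m) k) *v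
      (Z (grid T (Suc m * N m) (Suc k)) - Z (grid T (Suc m * N m) k))))) - 0) < e / (4 * b)"
    using LIMSEQ_D[OF err, of "e / (4 * b)"] e b by auto
  show "\<exists>no. \<forall>m\<ge>no. norm (?\<xi> m - u \<bullet> x T) < e"
  proof (intro exI[of _ "m1 + m2 + m3 + m4"] allI impI)
    fix m assume m: "m1 + m2 + m3 + m4 \<le> m"
    let ?E = "\<Sum>j\<le>Suc m. norm (I (grid T (Suc m) j) - (\<Sum>k<j * N m. H (grid T (Suc m * N m) k) *v
      (Z (grid T (Suc m * N m) (Suc k)) - Z (grid T (Suc m * N m) k))))"
    have "\<bar>u \<bullet> x T - ?\<xi> m\<bar> \<le> b * (2 * \<epsilon> * T + 2 * ?E)"
      unfolding adjoint_grid_def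
    proof (rule euler_scheme_error[OF T _ N x x_eq Z_eq])
      show "norm (euler_adjoint (\<lambda>j. A - H (grid T (Suc m) j) ** C) (T / real (Suc m)) u (Suc m) (Suc m - j)) \<le> b" for j
        using b(2)[of "Suc m" j] by (simp only: adjoint_grid_def)
      show "norm ((A *v x s + a) - (A *v x t + a)) \<le> \<epsilon>"
        if "s \<in> {0..T}" "t \<in> {0..T}" "\<bar>s - t\<bar> \<le> T / real (Suc m)" for s t
        using m1[of "Suc m" s t] that m by (simp add: dist_norm)
      show "norm (H s *v (C *v x s + c) - H r *v (C *v x t + c)) \<le> \<epsilon>"
        if "s \<in> {0..T}" "t \<in> {0..T}" "r \<in> {0..T}" "\<bar>s - t\<bar> \<le> T / real (Suc m)" "\<bar>s - r\<bar> \<le> T / real (Suc m)" for s t r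
      proof -
        have "norm (H s - H r) < d" "norm ((C *v x s + c) - (C *v x t + c)) < d"
          using m2[of "Suc m" s r] m3[of "Suc m" s t] that m d(1) by (auto simp: dist_norm)
        from d(2)[OF that(3,2) this] show ?thesis by (simp add: dist_norm)
      qed
    qed simp
    also have "\<dots> = e / 4 + 2 * b * ?E" using \<epsilon>(2) by (simp add: distrib_left)
    also have "\<dots> < e"
    proof -
      have "?E < e / (4 * b)" using m4[of m] m by simp
      hence "2 * b * ?E < 2 * b * (e / (4 * b))" using b(1) by (intro mult_strict_left_mono) auto
      also have "\<dots> = e / 2" using b(1) by simp
      finally show ?thesis using e by simp
    qed
    finally show "norm (?\<xi> m - u \<bullet> x T) < e" by (simp add: abs_minus_commute)
  qed
qed

text \<open>Each summand combines the gain at a fine point with the adjoint vector at the right end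
  of the surrounding coarse block. Both are close to their values at any \<open>s\<close> in the
  fine interval, so the sum behaves like a Riemann sum of the continuous function
  \<open>h (H s, q s)\<close>.\<close>

lemma adjoint_sum_converges:
  fixes H :: "real \<Rightarrow> real^'m^'n" and h :: "(real^'m^'n) \<times> (real^'n) \<Rightarrow> real"
  assumes T: "0 < T" and N: "\<And>m. 0 < N m" and H: "continuous_on {0..T} H" and h: "continuous_on UNIV h"
    and q: "\<And>s. 0 \<le> s \<Longrightarrow> (q has_vector_derivative - (transpose (A - H s ** C) *v q s)) (at s within {0..})"
    and qT: "q T = u"
  shows "(\<lambda>m. adjoint_grid A C H T u (Suc m) 0) \<longlonglongrightarrow> q 0"
    and "(\<lambda>m. \<Sum>k<Suc m * N m. T / real (Suc m * N m) *
      h (H (grid T (Suc m * N m) k), adjoint_grid A C H T u (Suc m) (Suc (k div N m))))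
      \<longlonglongrightarrow> integral {0..T} (\<lambda>s. h (H s, q s))"
proof -
  have K: "continuous_on {0..T} (\<lambda>s. A - H s ** C)"
    by (intro continuous_intros mmult.continuous_on H)
  have ex: "\<exists>m0. \<forall>m j. m0 \<le> m \<longrightarrow> 0 < m \<longrightarrow> j \<le> m \<longrightarrow> norm (q (grid T m j) - adjoint_grid A C H T u m j) \<le> e"
    if "0 < e" for e
    using euler_adjoint_converges[OF T K that q] unfolding adjoint_grid_def qT by metis
  show "(\<lambda>m. adjoint_grid A C H T u (Suc m) 0) \<longlonglongrightarrow> q 0"
  proof (rule LIMSEQ_I)
    fix e :: real assume e: "0 < e"
    obtain m0 where "\<And>m j. m0 \<le> m \<Longrightarrow> 0 < m \<Longrightarrow> j \<le> m \<Longrightarrow> norm (q (grid T m j) - adjoint_grid A C H T u m j) \<le> e / 2"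
      using ex[of "e / 2"] e by auto
    hence "norm (q 0 - adjoint_grid A C H T u (Suc m) 0) \<le> e / 2" if "m0 \<le> m" for m
      using that grid_simps(1)[of T "Suc m"] by (metis le_SucI zero_le zero_less_Suc)
    thus "\<exists>no. \<forall>m\<ge>no. norm (adjoint_grid A C H T u (Suc m) 0 - q 0) < e"
      using e by (intro exI[of _ m0]) (force simp: norm_minus_commute)
  qed
  have qc: "continuous_on {0..T} q"
    by (rule continuous_on_subset[OF continuous_on_has_vector_derivative[of "{0..}", OF q]]) auto
  have hc: "continuous_on {0..T} (\<lambda>s. h (H s, q s))"
    by (rule continuous_on_compose2[OF h continuous_on_Pair[OF H qc]]) auto
  show "(\<lambda>m. \<Sum>k<Suc m * N m. T / real (Suc m * N m) *
      h (H (grid T (Suc m * N m) k), adjoint_grid A C H T u (Suc m) (Suc (k div N m))))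
      \<longlonglongrightarrow> integral {0..T} (\<lambda>s. h (H s, q s))"
  proof (rule LIMSEQ_I)
    fix e :: real assume e: "0 < e"
    define \<epsilon> where "\<epsilon> = e / (2 * T)"
    have \<epsilon>: "0 < \<epsilon>" "\<epsilon> * T < e" using e T by (auto simp: \<epsilon>_def)
    obtain d where d: "0 < d" "\<And>s t x y. s \<in> {0..T} \<Longrightarrow> t \<in> {0..T} \<Longrightarrow> norm (x - H s) < d \<Longrightarrow> norm (y - q t) < d \<Longrightarrow>
      dist (h (x, y)) (h (H s, q t)) \<le> \<epsilon>"
      using jointly_uniform_modulus[OF H qc h \<epsilon>(1)] by blast
    obtain m1 where m1: "\<And>m s t. m1 \<le> m \<Longrightarrow> 0 < m \<Longrightarrow> s \<in> {0..T} \<Longrightarrow> t \<in> {0..T} \<Longrightarrow>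
        \<bar>s - t\<bar> \<le> T / real m \<Longrightarrow> dist (H s) (H t) \<le> d / 2"
      using uniform_continuity_modulus[OF H, of "d / 2"] d(1) by (metis half_gt_zero)
    obtain m2 where m2: "\<And>m s t. m2 \<le> m \<Longrightarrow> 0 < m \<Longrightarrow> s \<in> {0..T} \<Longrightarrow> t \<in> {0..T} \<Longrightarrow>
        \<bar>s - t\<bar> \<le> T / real m \<Longrightarrow> dist (q s) (q t) \<le> d / 4"
      using uniform_continuity_modulus[OF qc, of "d / 4"] d(1) by (metis divide_pos_pos zero_less_numeral)
    obtain m3 where m3: "\<And>m j. m3 \<le> m \<Longrightarrow> 0 < m \<Longrightarrow> j \<le> m \<Longrightarrow> norm (q (grid T m j) - adjoint_grid A C H T u m j) \<le> d / 4"
      using ex[of "d / 4"] d(1) by auto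
    show "\<exists>no. \<forall>m\<ge>no. norm ((\<Sum>k<Suc m * N m. T / real (Suc m * N m) *
      h (H (grid T (Suc m * N m) k), adjoint_grid A C H T u (Suc m) (Suc (k div N m))))
      - integral {0..T} (\<lambda>s. h (H s, q s))) < e"
    proof (intro exI[of _ "m1 + m2 + m3"] allI impI)
      fix m assume m: "m1 + m2 + m3 \<le> m"
      define n where "n = Suc m"
      have n: "0 < n" "m1 \<le> n" "m2 \<le> n" "m3 \<le> n" using m by (auto simp: n_def)
      define M where "M = N m"
      have M: "0 < M" using N by (simp add: M_def)
      let ?\<tau> = "grid T (n * M)"
      have \<tau>0: "?\<tau> 0 = 0" "?\<tau> (n * M) = T" using n M by (auto simp: grid_simps)
      have \<tau>: "?\<tau> k \<le> ?\<tau> (Suc k)" "?\<tau> (Suc k) - ?\<tau> k = T / real (n * M)" for k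
        using grid_bounds(3)[of T k "Suc k" "n * M"] T by (auto simp only: grid_simps)
      have "norm ((\<Sum>k<n * M. T / real (n * M) * h (H (?\<tau> k), adjoint_grid A C H T u n (Suc (k div M))))
          - integral {?\<tau> 0..?\<tau> (n * M)} (\<lambda>s. h (H s, q s))) \<le> \<epsilon> * (?\<tau> (n * M) - ?\<tau> 0)"
      proof (rule block_sum_bound)
        show "(\<lambda>s. h (H s, q s)) integrable_on {?\<tau> 0..?\<tau> (n * M)}"
          unfolding \<tau>0 by (rule integrable_continuous_interval[OF hc])
        fix k assume k: "k < n * M"
        have T0: "0 \<le> T" using T by simp
        note blk = grid_block[OF T0 M k]
        have "norm ((?\<tau> (Suc k) - ?\<tau> k) *\<^sub>R h (H (?\<tau> k), adjoint_grid A C H T u n (Suc (k div M)))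
            - integral {?\<tau> k..?\<tau> (Suc k)} (\<lambda>s. h (H s, q s))) \<le> \<epsilon> * (?\<tau> (Suc k) - ?\<tau> k)"
        proof (rule block_bound)
          have "{?\<tau> k..?\<tau> (Suc k)} \<subseteq> {0..T}" using blk(4,5) by auto
          thus "(\<lambda>s. h (H s, q s)) integrable_on {?\<tau> k..?\<tau> (Suc k)}"
            by (intro integrable_continuous_interval continuous_on_subset[OF hc])
          fix s assume s: "?\<tau> k \<le> s" "s \<le> ?\<tau> (Suc k)"
          have sT: "s \<in> {0..T}" "?\<tau> k \<in> {0..T}"
            using blk(4,5)[OF s] blk(4,5)[OF order_refl \<tau>(1)] by auto
          have le: "T / real (n * M) \<le> T / real n"
            using T n M by (intro divide_left_mono) auto
          have "\<bar>?\<tau> k - s\<bar> \<le> T / real n" using s \<tau>(2)[of k] le by linarith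
          hence 1: "norm (H (?\<tau> k) - H s) < d"
            using m1[OF n(2,1) sT(2,1)] d(1) by (simp add: dist_norm)
          let ?t = "grid T n (Suc (k div M))"
          have kd: "Suc (k div M) \<le> n" using blk(1)[OF s] by simp
          have tT: "?t \<in> {0..T}" using grid_bounds(1,2)[OF T0] kd by auto
          have "\<bar>?t - s\<bar> \<le> T / real n"
            using blk(2,3)[OF s] grid_simps(3)[of T n "k div M"] by linarith
          hence "norm (q ?t - q s) \<le> d / 4" using m2[OF n(3,1) tT sT(1)] by (simp add: dist_norm)
          moreover have "norm (q ?t - adjoint_grid A C H T u n (Suc (k div M))) \<le> d / 4"
            by (rule m3[OF n(4,1) kd])
          ultimately have 2: "norm (adjoint_grid A C H T u n (Suc (k div M)) - q s) < d"
            using d(1) norm_triangle_le[of "adjoint_grid A C H T u n (Suc (k div M)) - q ?t" "q ?t - q s" "d / 4 + d / 4"]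
            by (simp add: norm_minus_commute)
          from d(2)[OF sT(1,1) 1 2]
          show "norm (h (H (?\<tau> k), adjoint_grid A C H T u n (Suc (k div M))) - h (H s, q s)) \<le> \<epsilon>"
            by (simp add: dist_norm)
        qed (use \<tau> integrable_continuous_interval in auto)
        thus "norm (T / real (n * M) * h (H (?\<tau> k), adjoint_grid A C H T u n (Suc (k div M)))
            - integral {?\<tau> k..?\<tau> (Suc k)} (\<lambda>s. h (H s, q s))) \<le> \<epsilon> * (?\<tau> (Suc k) - ?\<tau> k)"
          unfolding \<tau>(2) by simp
      qed (use \<tau> in auto)
      thus "norm ((\<Sum>k<Suc m * N m. T / real (Suc m * N m) *
          h (H (grid T (Suc m * N m) k), adjoint_grid A C H T u (Suc m) (Suc (k div N m))))
          - integral {0..T} (\<lambda>s. h (H s, q s))) < e"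
        unfolding \<tau>0 using \<epsilon>(2) by (simp add: n_def M_def)
    qed
  qed
qed

section \<open>Approximation of stochastic integrals\<close>

lemma borel_measurable_matrix_vector_mult [measurable (raw)]:
  fixes H :: "'a \<Rightarrow> real^'m^'n"
  assumes "H \<in> borel_measurable M" "z \<in> borel_measurable M"
  shows "(\<lambda>\<omega>. H \<omega> *v z \<omega>) \<in> borel_measurable M"
  by (rule borel_measurable_continuous_Pair[OF assms]) (intro mvmult.continuous_on continuous_intros)

lemma borel_measurable_matrix_matrix_mult [measurable (raw)]:
  fixes H :: "'a \<Rightarrow> real^'m^'n" and G :: "'a \<Rightarrow> real^'k^'m"
  assumes "H \<in> borel_measurable M" "G \<in> borel_measurable M"
  shows "(\<lambda>\<omega>. H \<omega> ** G \<omega>) \<in> borel_measurable M"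
  by (rule borel_measurable_continuous_Pair[OF assms]) (intro mmult.continuous_on continuous_intros)

lemma borel_measurable_transpose [measurable (raw)]:
  fixes H :: "'a \<Rightarrow> real^'m^'n"
  assumes "H \<in> borel_measurable M"
  shows "(\<lambda>\<omega>. transpose (H \<omega>)) \<in> borel_measurable M"
  by (rule borel_measurable_continuous_on[OF _ assms])
    (intro bounded_linear.continuous_on[OF bounded_linear_transpose] continuous_intros)

lemma borel_measurable_matrixI:
  fixes f :: "'a \<Rightarrow> real^'m^'n"
  assumes "\<And>i j. (\<lambda>x. f x $ i $ j) \<in> borel_measurable M"
  shows "f \<in> borel_measurable M"
  unfolding borel_measurable_euclidean_space[of f]
  using assms by (auto simp: Basis_vec_def inner_axis)

text \<open>The integrand contains the mean of the measure against which it is integrated, so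
  measurability of the integral of a fixed function does not suffice. The measure is carried along
  as a parameter, by transporting it to pairs whose first component is the measure itself.\<close>

lemma borel_measurable_covariance_matrix:
  "(covariance_matrix :: (real^'n) measure \<Rightarrow> _) \<in> borel_measurable (subprob_algebra borel)"
proof (rule borel_measurable_matrixI)
  fix i j :: 'n
  let ?S = "subprob_algebra (borel :: (real^'n) measure)"
  have m: "(\<lambda>\<nu>. mean_vector \<nu> $ i) \<in> borel_measurable ?S" for i
    unfolding mean_vector_def by (simp add: integral_measurable_subprob_algebra)
  let ?f = "\<lambda>p. (snd p $ i - mean_vector (fst p) $ i) * (snd p $ j - mean_vector (fst p) $ j)"
  have f: "?f \<in> borel_measurable (?S \<Otimes>\<^sub>M borel)"
    by (intro borel_measurable_times borel_measurable_diff measurable_compose[OF measurable_fst m]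
        borel_measurable_component measurable_snd)
  have d: "(\<lambda>\<nu>. distr \<nu> (?S \<Otimes>\<^sub>M borel) (\<lambda>y. (\<nu>, y))) \<in> measurable ?S (subprob_algebra (?S \<Otimes>\<^sub>M borel))"
    by (rule measurable_distr2[where M = borel]) auto
  have "(\<lambda>\<nu>. integral\<^sup>L (distr \<nu> (?S \<Otimes>\<^sub>M borel) (\<lambda>y. (\<nu>, y))) ?f) \<in> borel_measurable ?S"
    by (rule measurable_compose[OF d integral_measurable_subprob_algebra[OF f]])
  also have "?this \<longleftrightarrow> (\<lambda>\<nu>. covariance_matrix \<nu> $ i $ j) \<in> borel_measurable ?S"
  proof (rule measurable_cong)
    fix \<nu> assume n: "\<nu> \<in> space ?S"
    hence s: "sets \<nu> = sets borel" by (simp add: space_subprob_algebra)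
    have "(\<lambda>y. (\<nu>, y)) \<in> measurable \<nu> (?S \<Otimes>\<^sub>M borel)"
      by (intro measurable_Pair measurable_const[OF n] measurable_ident_sets[OF s])
    from integral_distr[OF this f]
    show "integral\<^sup>L (distr \<nu> (?S \<Otimes>\<^sub>M borel) (\<lambda>y. (\<nu>, y))) ?f = covariance_matrix \<nu> $ i $ j"
      by (simp add: covariance_matrix_def)
  qed
  finally show "(\<lambda>\<nu>. covariance_matrix \<nu> $ i $ j) \<in> borel_measurable ?S" .
qed

text \<open>Convergence in probability becomes almost sure convergence: for each coarse grid one
  refinement \<open>N m\<close> makes the errors at all coarse points small outside an event of
  small probability, and the Borel-Cantelli lemma does the rest.\<close>

lemma (in prob_space) ito_sum_selection:
  fixes H :: "real \<Rightarrow> 'a \<Rightarrow> real^'m^'n"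
  assumes ito: "has_ito_integral M H Z I" and T: "0 < T"
  obtains N where "\<And>m. 0 < N m"
    "AE \<omega> in M. (\<lambda>m. \<Sum>j\<le>Suc m. norm (I (grid T (Suc m) j) \<omega> - (\<Sum>k<j * N m. H (grid T (Suc m * N m) k) \<omega> *v
      (Z (grid T (Suc m * N m) (Suc k)) \<omega> - Z (grid T (Suc m * N m) k) \<omega>)))) \<longlonglongrightarrow> 0"
proof -
  have T0: "0 \<le> T" using T by simp
  have meas: "H t \<in> borel_measurable M" "Z t \<in> borel_measurable M" "I t \<in> borel_measurable M" if "0 \<le> t" for t
    using ito that by (auto simp: has_ito_integral_def continuous_process_def)
  \<comment> \<open>The coarse grid has \<open>m + 2\<close> points, with indices 0 to
    \<open>Suc m\<close>. Dividing by this number makes both the sum of the thresholds and the bound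
    for the total probability equal to \<open>(1/2) ^ m\<close>, which is summable.\<close>
  define e :: "nat \<Rightarrow> real" where "e = (\<lambda>m. (1/2) ^ m / real (m + 2))"
  have e: "0 < e m" for m by (simp add: e_def)
  let ?S = "\<lambda>m N j \<omega>. norm (I (grid T (Suc m) j) \<omega> - (\<Sum>k<j * N. H (grid T (Suc m * N) k) \<omega> *v
      (Z (grid T (Suc m * N) (Suc k)) \<omega> - Z (grid T (Suc m * N) k) \<omega>)))"
  have "\<forall>m. \<exists>N>0. \<forall>j\<le>Suc m. measure M {\<omega>\<in>space M. ?S m N j \<omega> > e m} < e m"
  proof
    fix m
    have "\<forall>j. \<exists>d>0. \<forall>N \<tau>. \<tau> 0 = 0 \<and> \<tau> N = grid T (Suc m) j \<and> (\<forall>i<N. \<tau> i \<le> \<tau> (Suc i) \<and> \<tau> (Suc i) - \<tau> i < d) \<longrightarrow>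
        measure M {\<omega>\<in>space M. norm (I (grid T (Suc m) j) \<omega> - (\<Sum>i<N. H (\<tau> i) \<omega> *v (Z (\<tau> (Suc i)) \<omega> - Z (\<tau> i) \<omega>))) > e m} < e m"
    proof
      fix j
      have conv: "\<forall>t\<ge>0. \<forall>e>0. \<exists>d>0. \<forall>N \<tau>. \<tau> 0 = 0 \<and> \<tau> N = t \<and> (\<forall>i<N. \<tau> i \<le> \<tau> (Suc i) \<and> \<tau> (Suc i) - \<tau> i < d) \<longrightarrow>
          measure M {\<omega>\<in>space M. norm (I t \<omega> - (\<Sum>i<N. H (\<tau> i) \<omega> *v (Z (\<tau> (Suc i)) \<omega> - Z (\<tau> i) \<omega>))) > e} < e"
        using ito[unfolded has_ito_integral_def, THEN conjunct2, THEN conjunct2, THEN conjunct2, THEN conjunct2] .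
      show "\<exists>d>0. \<forall>N \<tau>. \<tau> 0 = 0 \<and> \<tau> N = grid T (Suc m) j \<and> (\<forall>i<N. \<tau> i \<le> \<tau> (Suc i) \<and> \<tau> (Suc i) - \<tau> i < d) \<longrightarrow>
          measure M {\<omega>\<in>space M. norm (I (grid T (Suc m) j) \<omega> - (\<Sum>i<N. H (\<tau> i) \<omega> *v (Z (\<tau> (Suc i)) \<omega> - Z (\<tau> i) \<omega>))) > e m} < e m"
        by (rule conv[THEN spec, THEN mp, OF grid_bounds(1)[OF T0], THEN spec, THEN mp, OF e])
    qed
    from choice[OF this] obtain d where d': "\<forall>j. d j > 0 \<and> (\<forall>N \<tau>. \<tau> 0 = 0 \<and> \<tau> N = grid T (Suc m) j \<and>
        (\<forall>i<N. \<tau> i \<le> \<tau> (Suc i) \<and> \<tau> (Suc i) - \<tau> i < d j) \<longrightarrow>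
        measure M {\<omega>\<in>space M. norm (I (grid T (Suc m) j) \<omega> - (\<Sum>i<N. H (\<tau> i) \<omega> *v (Z (\<tau> (Suc i)) \<omega> - Z (\<tau> i) \<omega>))) > e m} < e m)"
      by (rule exE)
    have d: "0 < d j" for j using d' by (rule allE[of _ j]) (erule conjunct1)
    define D where "D = Min (d ` {..Suc m})"
    have D: "0 < D" "\<And>j. j \<le> Suc m \<Longrightarrow> D \<le> d j" using d by (auto simp: D_def)
    obtain N :: nat where N: "T / D < real N" using reals_Archimedean2 by blast
    have "0 < T / D" using T D(1) by simp
    hence N0: "0 < N" using N by (cases N) auto
    have "T < D * real N" using N D(1) by (simp add: field_simps)
    also have "\<dots> \<le> D * real (Suc m * N)" using D(1) by (intro mult_left_mono) auto
    finally have "T < D * real (Suc m * N)" .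
    moreover have "0 < Suc m * N" using N0 by simp
    hence "0 < real (Suc m * N)" by (simp only: of_nat_0_less_iff)
    ultimately have small: "T / real (Suc m * N) < D" by (simp only: pos_divide_less_eq)
    show "\<exists>N>0. \<forall>j\<le>Suc m. measure M {\<omega>\<in>space M. ?S m N j \<omega> > e m} < e m"
    proof (intro exI[of _ N] conjI allI impI N0)
      fix j assume j: "j \<le> Suc m"
      show "measure M {\<omega>\<in>space M. ?S m N j \<omega> > e m} < e m"
      proof (rule d'[THEN spec, of j, THEN conjunct2, THEN spec, of "j * N", THEN spec,
            of "grid T (Suc m * N)", THEN mp], intro conjI allI impI)
        show "grid T (Suc m * N) 0 = 0" by (rule grid_simps)
        show "grid T (Suc m * N) (j * N) = grid T (Suc m) j" by (rule grid_simps(4)[OF N0])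
        show "grid T (Suc m * N) i \<le> grid T (Suc m * N) (Suc i)" for i
          using grid_bounds(3)[OF T0, of i "Suc i" "Suc m * N"] by simp
        show "grid T (Suc m * N) (Suc i) - grid T (Suc m * N) i < d j" for i
          using small D(2)[OF j] unfolding grid_simps(3) by linarith
      qed
    qed
  qed
  from choice[OF this] obtain N where
    N': "\<forall>m. 0 < N m \<and> (\<forall>j\<le>Suc m. measure M {\<omega>\<in>space M. ?S m (N m) j \<omega> > e m} < e m)"
    by (rule exE)
  have N1: "0 < N m" for m
    by (rule N'[THEN spec, THEN conjunct1])
  have N2: "measure M {\<omega>\<in>space M. ?S m (N m) j \<omega> > e m} < e m" if "j \<le> Suc m" for m j
    by (rule N'[THEN spec, THEN conjunct2, THEN spec, THEN mp, OF that])
  have gm: "H (grid T n k) \<in> borel_measurable M" "Z (grid T n k) \<in> borel_measurable M"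
    "I (grid T n k) \<in> borel_measurable M" for n k
    by (intro meas grid_bounds(1)[OF T0])+
  have Sm: "?S m (N m) j \<in> borel_measurable M" for m j
    by (intro measurable_compose[OF _ borel_measurable_norm] borel_measurable_diff borel_measurable_sum
        borel_measurable_matrix_vector_mult gm)
  define E where "E = (\<lambda>m. \<Union>j\<in>{..Suc m}. {\<omega>\<in>space M. ?S m (N m) j \<omega> > e m})"
  have Es: "{\<omega>\<in>space M. ?S m (N m) j \<omega> > e m} \<in> sets M" for m j
    using borel_measurable_less[OF borel_measurable_const Sm] by simp
  have Em: "E m \<in> sets M" for m unfolding E_def by (intro sets.finite_UN Es) auto
  have Ele: "measure M (E m) \<le> (1/2) ^ m" for m
  proof -
    have "measure M (E m) \<le> (\<Sum>j\<in>{..Suc m}. measure M {\<omega>\<in>space M. ?S m (N m) j \<omega> > e m})"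
      unfolding E_def by (intro finite_measure_subadditive_finite) (use Es in auto)
    also have "\<dots> \<le> (\<Sum>j\<in>{..Suc m}. e m)" using N2 by (intro sum_mono) (simp add: less_imp_le)
    also have "\<dots> = (1/2) ^ m" by (simp add: e_def)
    finally show ?thesis .
  qed
  have "AE \<omega> in M. eventually (\<lambda>m. \<omega> \<in> space M - E m) sequentially"
  proof (rule borel_cantelli_AE1[OF Em])
    show "summable (\<lambda>m. measure M (E m))"
      by (rule summable_comparison_test'[of "\<lambda>m. (1/2::real) ^ m" 0]) (use Ele in \<open>auto simp: summable_geometric\<close>)
  qed (simp add: less_top[symmetric])
  hence "AE \<omega> in M. (\<lambda>m. \<Sum>j\<le>Suc m. ?S m (N m) j \<omega>) \<longlonglongrightarrow> 0"
  proof (rule AE_mp, intro AE_I2 impI)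
    fix \<omega> assume ev: "eventually (\<lambda>m. \<omega> \<in> space M - E m) sequentially"
    show "(\<lambda>m. \<Sum>j\<le>Suc m. ?S m (N m) j \<omega>) \<longlonglongrightarrow> 0"
    proof (rule tendsto_sandwich)
      show "eventually (\<lambda>m. 0 \<le> (\<Sum>j\<le>Suc m. ?S m (N m) j \<omega>)) sequentially"
        by (intro always_eventually allI sum_nonneg) auto
      show "eventually (\<lambda>m. (\<Sum>j\<le>Suc m. ?S m (N m) j \<omega>) \<le> (1/2) ^ m) sequentially"
        using ev
      proof eventually_elim
        case (elim m)
        have "(\<Sum>j\<le>Suc m. ?S m (N m) j \<omega>) \<le> (\<Sum>j\<le>Suc m. e m)"
          using elim by (intro sum_mono) (auto simp: E_def not_less)
        also have "\<dots> = (1/2) ^ m" by (simp add: e_def)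
        finally show ?case .
      qed
      show "(\<lambda>m. (1/2::real) ^ m) \<longlonglongrightarrow> 0" by (intro LIMSEQ_realpow_zero) auto
    qed simp
  qed
  thus ?thesis using N1 by (intro that) auto
qed

section \<open>The conditional covariance of a Kalman-Bucy diffusion\<close>

lemma matrix_inv_inverse:
  assumes "invertible B"
  shows "B ** matrix_inv B = mat 1" "matrix_inv B ** B = mat 1"
  using someI_ex[OF assms[unfolded invertible_def]] unfolding matrix_inv_def by auto

lemma transpose_matrix_inv_symmetric:
  fixes B :: "real^'n^'n"
  assumes "invertible B" "transpose B = B"
  shows "transpose (matrix_inv B) = matrix_inv B"
proof -
  have "transpose (matrix_inv B) ** B = mat 1"
    using arg_cong[OF matrix_inv_inverse(1)[OF assms(1)], of transpose]
    by (simp add: matrix_transpose_mul assms(2))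
  hence "transpose (matrix_inv B) ** (B ** matrix_inv B) = matrix_inv B"
    by (simp add: matrix_mul_assoc)
  thus ?thesis by (simp add: matrix_inv_inverse(1)[OF assms(1)])
qed

text \<open>The matrix is \<open>transpose N ** N\<close> with
  \<open>N = matrix_inv R2h ** C\<close>, once the inverse of the square of \<open>R2h\<close> is
  recognized as the square of its inverse.\<close>

lemma information_matrix_psd:
  assumes "transpose R2h = R2h" and inv: "invertible R2h"
  shows "pos_semidef (information_matrix C R2h)"
proof -
  let ?N = "matrix_inv R2h ** C"
  have i2: "invertible (R2h ** R2h)" by (intro invertible_mult inv)
  have "(R2h ** R2h) ** (matrix_inv R2h ** matrix_inv R2h) = R2h ** (R2h ** matrix_inv R2h) ** matrix_inv R2h"
    by (simp only: matrix_mul_assoc)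
  hence "matrix_inv (R2h ** R2h) = matrix_inv (R2h ** R2h) ** ((R2h ** R2h) ** (matrix_inv R2h ** matrix_inv R2h))"
    unfolding matrix_inv_inverse(1)[OF inv] matrix_mul_rid by (simp only: matrix_mul_rid)
  also have "\<dots> = (matrix_inv (R2h ** R2h) ** (R2h ** R2h)) ** (matrix_inv R2h ** matrix_inv R2h)"
    by (rule matrix_mul_assoc)
  also have "\<dots> = matrix_inv R2h ** matrix_inv R2h"
    by (simp only: matrix_inv_inverse(2)[OF i2] matrix_mul_lid)
  finally have S: "information_matrix C R2h = transpose ?N ** ?N"
    by (simp add: information_matrix_def matrix_transpose_mul transpose_matrix_inv_symmetric[OF inv assms(1)] matrix_mul_assoc)
  have "x \<bullet> ((transpose ?N ** ?N) *v x) = (?N *v x) \<bullet> (?N *v x)" for x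
    by (simp add: matrix_vector_mul_assoc[symmetric] inner_transpose_matrix del: transpose_matrix_vector)
  thus ?thesis
    unfolding S pos_semidef_def by (simp add: matrix_transpose_mul)
qed

text \<open>Square integrability guarantees that the integrals in the covariance matrix are genuine
  ones and not the default value 0.\<close>

lemma (in prob_space) covariance_quadratic_form:
  fixes Z :: "'a \<Rightarrow> real^'n"
  assumes Z[measurable]: "Z \<in> borel_measurable M" and Z2: "integrable M (\<lambda>\<omega>. (norm (Z \<omega>))\<^sup>2)"
  shows "u \<bullet> (covariance_matrix (distr M borel Z) *v u) =
      (\<integral>\<omega>. (u \<bullet> Z \<omega> - (\<integral>\<omega>. u \<bullet> Z \<omega> \<partial>M))\<^sup>2 \<partial>M)"
    and "integrable M (\<lambda>\<omega>. (u \<bullet> Z \<omega>)\<^sup>2)"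
proof -
  show "integrable M (\<lambda>\<omega>. (u \<bullet> Z \<omega>)\<^sup>2)"
  proof (rule Bochner_Integration.integrable_bound[OF integrable_mult_right[OF Z2, of "(norm u)\<^sup>2"]])
    show "AE \<omega> in M. norm ((u \<bullet> Z \<omega>)\<^sup>2) \<le> norm ((norm u)\<^sup>2 * (norm (Z \<omega>))\<^sup>2)"
      using Cauchy_Schwarz_ineq2[of u] by (auto simp: power_mult_distrib[symmetric] abs_le_square_iff[symmetric])
  qed simp
  have comp2: "integrable M (\<lambda>\<omega>. (Z \<omega> $ i)\<^sup>2)" for i
    by (rule Bochner_Integration.integrable_bound[OF Z2])
      (auto simp: abs_le_square_iff[symmetric] component_le_norm_cart)
  have comp: "integrable M (\<lambda>\<omega>. Z \<omega> $ i)" for i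
    by (rule square_integrable_imp_integrable[OF _ comp2]) simp
  define m where "m = (\<lambda>i. \<integral>\<omega>. Z \<omega> $ i \<partial>M)"
  have mean: "mean_vector (distr M borel Z) $ i = m i" for i
    by (simp add: mean_vector_def m_def integral_distr)
  have cov: "covariance_matrix (distr M borel Z) $ i $ j = (\<integral>\<omega>. (Z \<omega> $ i - m i) * (Z \<omega> $ j - m j) \<partial>M)" for i j
    by (simp add: covariance_matrix_def mean integral_distr)
  have prod_i: "integrable M (\<lambda>\<omega>. (Z \<omega> $ i - m i) * (Z \<omega> $ j - m j))" for i j
  proof -
    have sq: "integrable M (\<lambda>\<omega>. (Z \<omega> $ i - m i)\<^sup>2)" for i
      using comp comp2 by (simp add: power2_diff)
    show ?thesis
    proof (rule Bochner_Integration.integrable_bound[OF Bochner_Integration.integrable_add[OF sq[of i] sq[of j]]])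
      show "AE \<omega> in M. norm ((Z \<omega> $ i - m i) * (Z \<omega> $ j - m j)) \<le> norm ((Z \<omega> $ i - m i)\<^sup>2 + (Z \<omega> $ j - m j)\<^sup>2)"
      proof (rule AE_I2)
        fix \<omega>
        let ?a = "Z \<omega> $ i - m i" and ?b = "Z \<omega> $ j - m j"
        have "0 \<le> (\<bar>?a\<bar> - \<bar>?b\<bar>)\<^sup>2" "0 \<le> \<bar>?a\<bar> * \<bar>?b\<bar>" by auto
        thus "norm (?a * ?b) \<le> norm (?a\<^sup>2 + ?b\<^sup>2)"
          by (simp add: power2_diff abs_mult)
      qed
    qed simp
  qed
  have mu: "(\<integral>\<omega>. u \<bullet> Z \<omega> \<partial>M) = (\<Sum>i\<in>UNIV. u $ i * m i)"
  proof -
    have "(\<integral>\<omega>. u \<bullet> Z \<omega> \<partial>M) = (\<integral>\<omega>. (\<Sum>i\<in>UNIV. u $ i * Z \<omega> $ i) \<partial>M)"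
      by (simp add: inner_vec_def)
    also have "\<dots> = (\<Sum>i\<in>UNIV. \<integral>\<omega>. u $ i * Z \<omega> $ i \<partial>M)"
      by (rule Bochner_Integration.integral_sum) (intro integrable_mult_right comp)
    also have "\<dots> = (\<Sum>i\<in>UNIV. u $ i * m i)" by (simp only: m_def integral_mult_right_zero)
    finally show ?thesis .
  qed
  have "(\<integral>\<omega>. (u \<bullet> Z \<omega> - (\<integral>\<omega>. u \<bullet> Z \<omega> \<partial>M))\<^sup>2 \<partial>M) =
      (\<integral>\<omega>. (\<Sum>i\<in>UNIV. \<Sum>j\<in>UNIV. u $ i * u $ j * ((Z \<omega> $ i - m i) * (Z \<omega> $ j - m j))) \<partial>M)"
  proof (rule Bochner_Integration.integral_cong[OF refl])
    fix \<omega>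
    have "u \<bullet> Z \<omega> - (\<integral>\<omega>. u \<bullet> Z \<omega> \<partial>M) = (\<Sum>i\<in>UNIV. u $ i * (Z \<omega> $ i - m i))"
      unfolding mu by (simp add: inner_vec_def sum_subtractf right_diff_distrib)
    thus "(u \<bullet> Z \<omega> - (\<integral>\<omega>. u \<bullet> Z \<omega> \<partial>M))\<^sup>2 =
        (\<Sum>i\<in>UNIV. \<Sum>j\<in>UNIV. u $ i * u $ j * ((Z \<omega> $ i - m i) * (Z \<omega> $ j - m j)))"
      by (simp add: power2_eq_square sum_product mult_ac)
  qed
  also have "\<dots> = (\<Sum>i\<in>UNIV. \<Sum>j\<in>UNIV. u $ i * u $ j * covariance_matrix (distr M borel Z) $ i $ j)"
    using prod_i by (simp add: cov)
  also have "\<dots> = u \<bullet> (covariance_matrix (distr M borel Z) *v u)"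
    by (simp add: inner_vec_def matrix_vector_mult_def sum_distrib_left mult_ac)
  finally show "u \<bullet> (covariance_matrix (distr M borel Z) *v u) =
      (\<integral>\<omega>. (u \<bullet> Z \<omega> - (\<integral>\<omega>. u \<bullet> Z \<omega> \<partial>M))\<^sup>2 \<partial>M)" ..
qed

lemma transpose_covariance_matrix: "transpose (covariance_matrix \<nu>) = covariance_matrix \<nu>"
  by (simp add: transpose_def covariance_matrix_def vec_eq_iff mult.commute)

lemma (in prob_space) pos_semidef_covariance:
  fixes Z :: "'a \<Rightarrow> real^'n"
  assumes "Z \<in> borel_measurable M" "integrable M (\<lambda>\<omega>. (norm (Z \<omega>))\<^sup>2)"
  shows "pos_semidef (covariance_matrix (distr M borel Z))"
  unfolding pos_semidef_def by (simp add: transpose_covariance_matrix covariance_quadratic_form(1)[OF assms])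

lemma (in prob_space) tendsto_integral_cis:
  fixes X :: "'a \<Rightarrow> 'b::euclidean_space"
  assumes X[measurable]: "X \<in> borel_measurable M" and v: "v \<longlonglongrightarrow> w"
  shows "(\<lambda>n. \<integral>\<omega>. cis (v n \<bullet> X \<omega>) \<partial>M) \<longlonglongrightarrow> (\<integral>\<omega>. cis (w \<bullet> X \<omega>) \<partial>M)"
proof (rule integral_dominated_convergence[where w = "\<lambda>_. 1"])
  show "AE \<omega> in M. (\<lambda>n. cis (v n \<bullet> X \<omega>)) \<longlonglongrightarrow> cis (w \<bullet> X \<omega>)"
    by (intro AE_I2 tendsto_cis tendsto_inner v tendsto_const)
qed auto

lemma (in prob_space) borel_measurable_integral_cis:
  fixes X :: "'a \<Rightarrow> 'b::euclidean_space"
  assumes X: "X \<in> borel_measurable M" and v: "v \<in> borel_measurable F"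
  shows "(\<lambda>\<omega>. \<integral>\<omega>'. cis (v \<omega> \<bullet> X \<omega>') \<partial>M) \<in> borel_measurable F"
proof (rule borel_measurable_continuous_on[OF _ v, of "\<lambda>w. \<integral>\<omega>'. cis (w \<bullet> X \<omega>') \<partial>M"])
  show "continuous_on UNIV (\<lambda>w. \<integral>\<omega>'. cis (w \<bullet> X \<omega>') \<partial>M)"
    by (rule continuous_on_sequentiallyI) (rule tendsto_integral_cis[OF X])
qed

section \<open>The conditional characteristic function given the observation\<close>

locale kalman_bucy = prob_space M for M :: "'w measure" +
  fixes A R1h :: "real^'n^'n" and a :: "real^'n" and C :: "real^'n^'m" and c :: "real^'m"
    and R2h :: "real^'m^'m"
    and W X :: "real \<Rightarrow> 'w \<Rightarrow> real^'n" and V Y :: "real \<Rightarrow> 'w \<Rightarrow> real^'m"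
    and Wb Xb :: "real \<Rightarrow> 'w \<Rightarrow> real^'n" and Vb :: "real \<Rightarrow> 'w \<Rightarrow> real^'m"
    and \<eta> :: "real \<Rightarrow> 'w \<Rightarrow> (real^'n) measure"
  assumes model: "filtering_model M A a C c R1h R2h W V X Y"
    and diffusion: "kalman_bucy_diffusion M A a C c R1h R2h X Y Wb Vb Xb \<eta>"
begin

definition gain :: "real \<Rightarrow> 'w \<Rightarrow> real^'m^'n" where
  "gain t \<omega> = covariance_matrix (\<eta> t \<omega>) ** transpose C ** matrix_inv (R2h ** R2h)"

text \<open>The initial state is attached to every time point, so that a single process generates
  noise and initial state together.\<close>

definition noise_sigma :: "'w measure" where
  "noise_sigma = process_sigma M {0..} (\<lambda>t \<omega>. (Wb t \<omega>, Vb t \<omega>, Xb 0 \<omega>))"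

lemma bm: "brownian_motion M (\<lambda>t \<omega>. (Wb t \<omega>, Vb t \<omega>))"
  and Xb_cont: "continuous_process M Xb"
  and Xb_square: "\<And>t. 0 \<le> t \<Longrightarrow> integrable M (\<lambda>\<omega>. (norm (Xb t \<omega>))\<^sup>2)"
  and indep_init: "indep_set (sets (process_sigma M {0} Xb)) (sets (process_sigma M {0..} (\<lambda>t \<omega>. (Wb t \<omega>, Vb t \<omega>))))"
  and indep_signal: "indep_set (sets noise_sigma) (sets (process_sigma M {0..} (\<lambda>t \<omega>. (X t \<omega>, Y t \<omega>))))"
  and cond_law: "\<And>t. 0 \<le> t \<Longrightarrow> is_conditional_law M (process_sigma M {0..t} Y) (Xb t) (\<eta> t)"
  using diffusion unfolding kalman_bucy_diffusion_def noise_sigma_def by blast+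

lemma Y_cont: "continuous_process M Y" and X_cont: "continuous_process M X"
  and R1h_sym: "transpose R1h = R1h" and R2h_sym: "transpose R2h = R2h"
  and R1h_inv: "invertible R1h" and R2h_inv: "invertible R2h"
  using model unfolding filtering_model_def by blast+

lemma Y_measurable: "0 \<le> t \<Longrightarrow> Y t \<in> borel_measurable M"
  and X_measurable: "0 \<le> t \<Longrightarrow> X t \<in> borel_measurable M"
  and Xb_measurable: "0 \<le> t \<Longrightarrow> Xb t \<in> borel_measurable M"
  and Xb_path: "\<omega> \<in> space M \<Longrightarrow> continuous_on {0..} (\<lambda>t. Xb t \<omega>)"
  using Y_cont X_cont Xb_cont by (auto simp: continuous_process_def)

lemma noise_measurable:
  assumes "0 \<le> t"
  shows "Wb t \<in> borel_measurable noise_sigma" "Vb t \<in> borel_measurable noise_sigma"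
    "Xb 0 \<in> borel_measurable noise_sigma"
proof -
  have m: "(\<lambda>\<omega>. (Wb t \<omega>, Vb t \<omega>, Xb 0 \<omega>)) \<in> borel_measurable noise_sigma"
    unfolding noise_sigma_def using assms
    by (intro process_sigma_measurable[where Z = "\<lambda>t \<omega>. (Wb t \<omega>, Vb t \<omega>, Xb 0 \<omega>)"]) auto
  show "Wb t \<in> borel_measurable noise_sigma" "Vb t \<in> borel_measurable noise_sigma"
    "Xb 0 \<in> borel_measurable noise_sigma"
    using borel_measurable_PairD[OF m] borel_measurable_PairD[OF borel_measurable_PairD(2)[OF m]] by simp_all
qed

lemma space_noise_sigma [simp]: "space noise_sigma = space M"
  by (simp add: noise_sigma_def)

lemma subalgebra_observation: "subalgebra M (process_sigma M {0..t} Y)"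
  by (rule subalgebra_process_sigma) (auto intro: Y_measurable)

lemma subalgebra_noise: "subalgebra M noise_sigma"
  using indep_setD_ev1[OF indep_signal] by (simp add: subalgebra_def)

lemma indep_observation: "indep_set (sets (process_sigma M {0..t} Y)) (sets noise_sigma)"
proof -
  let ?XY = "process_sigma M {0..} (\<lambda>t \<omega>. (X t \<omega>, Y t \<omega>))"
  have "(\<lambda>\<omega>. (X s \<omega>, Y s \<omega>)) \<in> borel_measurable ?XY" if "0 \<le> s" for s
    using that by (intro process_sigma_measurable[where Z = "\<lambda>t \<omega>. (X t \<omega>, Y t \<omega>)"]) auto
  hence "Y s \<in> borel_measurable ?XY" if "0 \<le> s" for s
    using borel_measurable_PairD(2) that by blast
  hence "sets (process_sigma M {0..t} Y) \<subseteq> sets ?XY"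
    by (intro sets_process_sigma_subset) auto
  hence sub: "x \<in> sets ?XY" if "x \<in> sets (process_sigma M {0..t} Y)" for x
    using that by blast
  show ?thesis
  proof (rule indep_setI)
    show "sets (process_sigma M {0..t} Y) \<subseteq> events" "sets noise_sigma \<subseteq> events"
      using subalgebra_observation subalgebra_noise by (auto simp: subalgebra_def)
    fix x y assume "x \<in> sets (process_sigma M {0..t} Y)" "y \<in> sets noise_sigma"
    thus "prob (x \<inter> y) = prob x * prob y"
      using indep_setD[OF indep_signal _ sub, of y x] by (simp only: Int_commute mult.commute)
  qed
qed

lemma gain_measurable:
  assumes "0 \<le> s" "s \<le> t"
  shows "gain s \<in> borel_measurable (process_sigma M {0..t} Y)"
proof -
  have "\<eta> s \<in> measurable (process_sigma M {0..s} Y) (subprob_algebra borel)"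
    using cond_law[OF assms(1)] measurable_prob_algebraD by (auto simp: is_conditional_law_def)
  hence "(\<lambda>\<omega>. covariance_matrix (\<eta> s \<omega>)) \<in> borel_measurable (process_sigma M {0..s} Y)"
    by (rule measurable_compose[OF _ borel_measurable_covariance_matrix])
  moreover have "subalgebra (process_sigma M {0..t} Y) (process_sigma M {0..s} Y)"
    unfolding subalgebra_def
  proof
    show "sets (process_sigma M {0..s} Y) \<subseteq> sets (process_sigma M {0..t} Y)"
      by (rule sets_process_sigma_subset) (use assms in \<open>auto intro: process_sigma_measurable\<close>)
  qed simp
  ultimately have "(\<lambda>\<omega>. covariance_matrix (\<eta> s \<omega>)) \<in> borel_measurable (process_sigma M {0..t} Y)"
    using measurable_from_subalg by blast
  thus ?thesis
    unfolding gain_def[abs_def] by (intro borel_measurable_matrix_matrix_mult borel_measurable_const)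
qed

text \<open>Even the vectors at early grid points depend on the gain at later ones, so the
  observation up to \<open>T\<close> is the right sigma-algebra; in general they are not
  adapted.\<close>

lemma adjoint_grid_measurable:
  assumes T: "0 \<le> T" and m: "0 < m"
  shows "(\<lambda>\<omega>. adjoint_grid A C (\<lambda>t. gain t \<omega>) T u m j) \<in> borel_measurable (process_sigma M {0..T} Y)"
proof -
  have "(\<lambda>\<omega>. euler_adjoint (\<lambda>j. A - gain (grid T m j) \<omega> ** C) (T / real m) u m i)
      \<in> borel_measurable (process_sigma M {0..T} Y)" if "i \<le> m" for i
    using that
  proof (induction i)
    case (Suc i)
    thus ?case
      unfolding euler_adjoint.simps
      by (intro borel_measurable_add borel_measurable_scaleR borel_measurable_const borel_measurable_transpose
          borel_measurable_matrix_vector_mult borel_measurable_matrix_matrix_mult borel_measurable_diff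
          gain_measurable grid_bounds T) auto
  qed simp
  thus ?thesis unfolding adjoint_grid_def by simp
qed

text \<open>An approximation of \<open>u \<bullet> Xb T\<close>. The linear drift
  \<open>A - gain ** C\<close> has been absorbed into the adjoint vectors; the initial state, the
  affine drift, both noises and the observation are left, with increments weighted by the adjoint
  vector at the end of their coarse block.\<close>

definition euler_sum :: "real \<Rightarrow> real^'n \<Rightarrow> nat \<Rightarrow> nat \<Rightarrow> 'w \<Rightarrow> real" where
  "euler_sum T u m N \<omega> = adjoint_grid A C (\<lambda>t. gain t \<omega>) T u m 0 \<bullet> Xb 0 \<omega> + (\<Sum>k<m * N.
      adjoint_grid A C (\<lambda>t. gain t \<omega>) T u m (Suc (k div N)) \<bullet>
       ((T / real (m * N)) *\<^sub>R (a - gain (grid T m (k div N)) \<omega> *v c)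
      + (R1h *v Wb (grid T (m * N) (Suc k)) \<omega> - R1h *v Wb (grid T (m * N) k) \<omega>)
      + gain (grid T (m * N) k) \<omega> *v
          ((Y (grid T (m * N) (Suc k)) \<omega> - R2h *v Vb (grid T (m * N) (Suc k)) \<omega>) -
           (Y (grid T (m * N) k) \<omega> - R2h *v Vb (grid T (m * N) k) \<omega>))))"

text \<open>For a gain \<open>H\<close> and a vector \<open>q\<close> this is the quadratic form of
  \<open>R1 + H R2 H'\<close> at \<open>q\<close>: the rate at which the noises of the diffusion
  produce variance in direction \<open>q\<close>.\<close>

definition noise_form :: "(real^'m^'n) \<times> (real^'n) \<Rightarrow> real" where
  "noise_form p = (norm (transpose R1h *v snd p))\<^sup>2 + (norm (transpose (fst p ** R2h) *v snd p))\<^sup>2"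

lemma continuous_noise_form: "continuous_on UNIV noise_form"
  unfolding noise_form_def
  by (intro continuous_intros mvmult.continuous_on mmult.continuous_on
      bounded_linear.continuous_on[OF bounded_linear_transpose])

text \<open>The value at 1 of the conditional characteristic function of \<open>euler_sum\<close>
  given the observation: a phase determined by the observation, the characteristic function of the
  initial state at the transported vector, and the Gaussian factor of the noise increments.\<close>

definition char_sum :: "real \<Rightarrow> real^'n \<Rightarrow> nat \<Rightarrow> nat \<Rightarrow> 'w \<Rightarrow> complex" where
  "char_sum T u m N \<omega> =
    cis (\<Sum>k<m * N. adjoint_grid A C (\<lambda>t. gain t \<omega>) T u m (Suc (k div N)) \<bullet>
       ((T / real (m * N)) *\<^sub>R (a - gain (grid T m (k div N)) \<omega> *v c)
        + gain (grid T (m * N) k) \<omega> *v (Y (grid T (m * N) (Suc k)) \<omega> - Y (grid T (m * N) k) \<omega>))) *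
    (\<integral>\<omega>'. cis (adjoint_grid A C (\<lambda>t. gain t \<omega>) T u m 0 \<bullet> Xb 0 \<omega>') \<partial>M) *
    complex_of_real (exp (- (\<Sum>k<m * N. T / real (m * N) * noise_form (gain (grid T (m * N) k) \<omega>,
        adjoint_grid A C (\<lambda>t. gain t \<omega>) T u m (Suc (k div N)))) / 2))"

text \<open>With the observation frozen, \<open>euler_sum\<close> is affine in the initial state and
  the Brownian increments, which are independent of the observation and of each other. The phase has
  modulus one, so two factors are left in the modulus.\<close>

lemma euler_sum_cond_char:
  assumes T: "0 < T" and m: "0 < m" and N: "0 < N"
  shows "char_sum T u m N \<in> borel_measurable (process_sigma M {0..T} Y)"
    and "euler_sum T u m N \<in> borel_measurable M"
    and "D \<in> sets (process_sigma M {0..T} Y) \<Longrightarrow>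
      (\<integral>\<omega>. indicator D \<omega> *\<^sub>R cis (euler_sum T u m N \<omega>) \<partial>M) = (\<integral>\<omega>. indicator D \<omega> *\<^sub>R char_sum T u m N \<omega> \<partial>M)"
    and "norm (char_sum T u m N \<omega>) = norm (\<integral>\<omega>'. cis (adjoint_grid A C (\<lambda>t. gain t \<omega>) T u m 0 \<bullet> Xb 0 \<omega>') \<partial>M) *
      exp (- (\<Sum>k<m * N. T / real (m * N) * noise_form (gain (grid T (m * N) k) \<omega>,
        adjoint_grid A C (\<lambda>t. gain t \<omega>) T u m (Suc (k div N)))) / 2)"
    and "norm (char_sum T u m N \<omega>) \<le> 1"
proof -
  let ?F = "process_sigma M {0..T} Y"
  have T0: "0 \<le> T" using T by simp
  define \<tau> where "\<tau> = grid T (m * N)"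
  have \<tau>0: "0 \<le> \<tau> k" "\<tau> k \<le> \<tau> (Suc k)" "\<tau> (Suc k) - \<tau> k = T / real (m * N)" for k
    using grid_bounds[OF T0] by (auto simp: \<tau>_def grid_simps)
  have \<tau>T: "\<tau> k \<le> T" if "k \<le> m * N" for k using grid_bounds(2)[OF T0 that] by (simp add: \<tau>_def)
  define \<nu> where "\<nu> = (\<lambda>j \<omega>. adjoint_grid A C (\<lambda>t. gain t \<omega>) T u m j)"
  define \<gamma> where "\<gamma> = (\<lambda>\<omega>. \<Sum>k<m * N. \<nu> (Suc (k div N)) \<omega> \<bullet>
       ((T / real (m * N)) *\<^sub>R (a - gain (grid T m (k div N)) \<omega> *v c)
        + gain (\<tau> k) \<omega> *v (Y (\<tau> (Suc k)) \<omega> - Y (\<tau> k) \<omega>)))"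
  \<comment> \<open>The minus sign reflects that the diffusion subtracts its own observation noise;
    it disappears in the squared norm.\<close>
  define w where "w = (\<lambda>k \<omega>. (transpose R1h *v \<nu> (Suc (k div N)) \<omega>,
      - (transpose (gain (\<tau> k) \<omega> ** R2h) *v \<nu> (Suc (k div N)) \<omega>)))"
  define \<Delta> where "\<Delta> = (\<lambda>k \<omega>. (Wb (\<tau> (Suc k)) \<omega>, Vb (\<tau> (Suc k)) \<omega>) - (Wb (\<tau> k) \<omega>, Vb (\<tau> k) \<omega>))"
  have \<nu>m: "\<nu> j \<in> borel_measurable ?F" for j
    unfolding \<nu>_def by (rule adjoint_grid_measurable[OF T0 m])
  have gm: "gain (\<tau> k) \<in> borel_measurable ?F" if "k < m * N" for k
    using \<tau>0 \<tau>T[of k] that by (intro gain_measurable) auto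
  have gm': "gain (grid T m j) \<in> borel_measurable ?F" if "j \<le> m" for j
    using that by (intro gain_measurable grid_bounds T0)
  have ym: "Y (\<tau> k) \<in> borel_measurable ?F" if "k \<le> m * N" for k
    using \<tau>0 \<tau>T[OF that] by (intro process_sigma_measurable) auto
  have kd: "k div N \<le> m" if "k < m * N" for k
    using that N by (simp add: less_mult_imp_div_less mult.commute less_imp_le)
  have \<gamma>m: "\<gamma> \<in> borel_measurable ?F"
    unfolding \<gamma>_def
    by (intro borel_measurable_sum borel_measurable_inner \<nu>m borel_measurable_add borel_measurable_scaleR
        borel_measurable_const borel_measurable_diff borel_measurable_matrix_vector_mult gm gm' ym kd) auto
  have wm: "w k \<in> borel_measurable ?F" if "k < m * N" for k
    unfolding w_def
    by (intro borel_measurable_Pair borel_measurable_uminus borel_measurable_matrix_vector_mult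
        borel_measurable_transpose borel_measurable_matrix_matrix_mult borel_measurable_const \<nu>m gm that)
  have \<Delta>m: "\<Delta> k \<in> borel_measurable noise_sigma" for k
    unfolding \<Delta>_def using \<tau>0
    by (intro borel_measurable_diff borel_measurable_Pair noise_measurable) auto
  have Xm: "Xb 0 \<in> borel_measurable noise_sigma" by (rule noise_measurable(3)[of 0]) simp
  have e_eq: "euler_sum T u m N \<omega> = \<gamma> \<omega> + (\<nu> 0 \<omega> \<bullet> Xb 0 \<omega> + (\<Sum>k<m * N. w k \<omega> \<bullet> \<Delta> k \<omega>))" for \<omega>
  proof -
    have "\<nu> (Suc (k div N)) \<omega> \<bullet> ((T / real (m * N)) *\<^sub>R (a - gain (grid T m (k div N)) \<omega> *v c)
        + (R1h *v Wb (\<tau> (Suc k)) \<omega> - R1h *v Wb (\<tau> k) \<omega>)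
        + gain (\<tau> k) \<omega> *v ((Y (\<tau> (Suc k)) \<omega> - R2h *v Vb (\<tau> (Suc k)) \<omega>) - (Y (\<tau> k) \<omega> - R2h *v Vb (\<tau> k) \<omega>))) =
        \<nu> (Suc (k div N)) \<omega> \<bullet> ((T / real (m * N)) *\<^sub>R (a - gain (grid T m (k div N)) \<omega> *v c)
        + gain (\<tau> k) \<omega> *v (Y (\<tau> (Suc k)) \<omega> - Y (\<tau> k) \<omega>)) + w k \<omega> \<bullet> \<Delta> k \<omega>" for k
      by (simp add: w_def \<Delta>_def inner_Pair inner_matrix_transpose[symmetric] mvmult.diff_right
          inner_diff_right inner_add_right matrix_vector_mul_assoc[symmetric] algebra_simps
          del: transpose_matrix_vector)
    hence "(\<Sum>k<m * N. \<nu> (Suc (k div N)) \<omega> \<bullet> ((T / real (m * N)) *\<^sub>R (a - gain (grid T m (k div N)) \<omega> *v c)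
        + (R1h *v Wb (\<tau> (Suc k)) \<omega> - R1h *v Wb (\<tau> k) \<omega>)
        + gain (\<tau> k) \<omega> *v ((Y (\<tau> (Suc k)) \<omega> - R2h *v Vb (\<tau> (Suc k)) \<omega>) - (Y (\<tau> k) \<omega> - R2h *v Vb (\<tau> k) \<omega>)))) =
        \<gamma> \<omega> + (\<Sum>k<m * N. w k \<omega> \<bullet> \<Delta> k \<omega>)"
      by (simp only: \<gamma>_def sum.distrib)
    moreover have "euler_sum T u m N \<omega> = \<nu> 0 \<omega> \<bullet> Xb 0 \<omega> + (\<Sum>k<m * N. \<nu> (Suc (k div N)) \<omega> \<bullet>
        ((T / real (m * N)) *\<^sub>R (a - gain (grid T m (k div N)) \<omega> *v c)
        + (R1h *v Wb (\<tau> (Suc k)) \<omega> - R1h *v Wb (\<tau> k) \<omega>)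
        + gain (\<tau> k) \<omega> *v ((Y (\<tau> (Suc k)) \<omega> - R2h *v Vb (\<tau> (Suc k)) \<omega>) - (Y (\<tau> k) \<omega> - R2h *v Vb (\<tau> k) \<omega>))))"
      unfolding euler_sum_def \<nu>_def \<tau>_def by (rule refl)
    ultimately show ?thesis by simp
  qed
  have w_norm: "(norm (w k \<omega>))\<^sup>2 = noise_form (gain (\<tau> k) \<omega>, \<nu> (Suc (k div N)) \<omega>)" for k \<omega>
    by (simp add: w_def noise_form_def norm_Pair del: transpose_matrix_vector)
  have c_eq: "char_sum T u m N \<omega> = cis (\<gamma> \<omega>) * (\<integral>\<omega>'. cis (\<nu> 0 \<omega> \<bullet> Xb 0 \<omega>') \<partial>M) *
      complex_of_real (exp (- (\<Sum>k<m * N. (\<tau> (Suc k) - \<tau> k) * (norm (w k \<omega>))\<^sup>2) / 2))" for \<omega>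
    unfolding char_sum_def w_norm \<tau>0(3) by (simp only: \<gamma>_def \<tau>_def \<nu>_def)
  have sm: "(\<lambda>\<omega>. \<Sum>k<m * N. (\<tau> (Suc k) - \<tau> k) * (norm (w k \<omega>))\<^sup>2) \<in> borel_measurable ?F"
    by (intro borel_measurable_sum borel_measurable_times borel_measurable_const borel_measurable_power
        measurable_compose[OF _ borel_measurable_norm] wm) auto
  have fm: "(\<lambda>\<omega>. \<integral>\<omega>'. cis (\<nu> 0 \<omega> \<bullet> Xb 0 \<omega>') \<partial>M) \<in> borel_measurable ?F"
    by (intro borel_measurable_integral_cis \<nu>m Xb_measurable) simp
  show cm: "char_sum T u m N \<in> borel_measurable ?F"
    unfolding c_eq[abs_def] using \<gamma>m sm fm by measurable
  note subF = measurable_from_subalg[OF subalgebra_observation]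
  note subB = measurable_from_subalg[OF subalgebra_noise]
  show em: "euler_sum T u m N \<in> borel_measurable M"
    unfolding e_eq[abs_def]
    by (intro borel_measurable_add borel_measurable_sum borel_measurable_inner subF[OF \<gamma>m] subF[OF \<nu>m]
        subB[OF Xm] subF[OF wm] subB[OF \<Delta>m]) auto
  show "norm (char_sum T u m N \<omega>) = norm (\<integral>\<omega>'. cis (adjoint_grid A C (\<lambda>t. gain t \<omega>) T u m 0 \<bullet> Xb 0 \<omega>') \<partial>M) *
      exp (- (\<Sum>k<m * N. T / real (m * N) * noise_form (gain (grid T (m * N) k) \<omega>,
        adjoint_grid A C (\<lambda>t. gain t \<omega>) T u m (Suc (k div N)))) / 2)" for \<omega>
    unfolding char_sum_def by (simp only: norm_mult norm_cis mult_1_left norm_of_real abs_exp_cancel)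
  show "norm (char_sum T u m N \<omega>) \<le> 1" for \<omega>
  proof -
    have "norm (\<integral>\<omega>'. cis (\<nu> 0 \<omega> \<bullet> Xb 0 \<omega>') \<partial>M) \<le> (\<integral>\<omega>'. norm (cis (\<nu> 0 \<omega> \<bullet> Xb 0 \<omega>')) \<partial>M)"
      by (rule integral_norm_bound)
    hence "norm (\<integral>\<omega>'. cis (\<nu> 0 \<omega> \<bullet> Xb 0 \<omega>') \<partial>M) \<le> 1" by (simp add: prob_space)
    moreover have "exp (- (\<Sum>k<m * N. (\<tau> (Suc k) - \<tau> k) * (norm (w k \<omega>))\<^sup>2) / 2) \<le> 1"
      using \<tau>0(2) by (simp add: sum_nonneg)
    ultimately show ?thesis
      unfolding c_eq norm_mult norm_cis by (simp add: mult_le_one)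
  qed
  assume D: "D \<in> sets ?F"
  \<comment> \<open>The first component of the pair carries everything that is determined by the
    observation, the second the noise and the initial state, as freezing requires.\<close>
  let ?f = "\<lambda>p. indicator D (fst p) *\<^sub>R cis (\<gamma> (fst p) + (\<nu> 0 (fst p) \<bullet> Xb 0 (snd p) + (\<Sum>k<m * N. w k (fst p) \<bullet> \<Delta> k (snd p))))"
  have fm: "?f \<in> borel_measurable (?F \<Otimes>\<^sub>M noise_sigma)"
    by (intro borel_measurable_scaleR borel_measurable_cis borel_measurable_add borel_measurable_sum borel_measurable_inner
        measurable_compose[OF measurable_fst] measurable_compose[OF measurable_snd] \<gamma>m \<nu>m Xm wm \<Delta>m
        borel_measurable_indicator D) auto
  have "(\<integral>\<omega>. ?f (\<omega>, \<omega>) \<partial>M) = (\<integral>\<omega>. (\<integral>\<omega>'. ?f (\<omega>, \<omega>') \<partial>M) \<partial>M)"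
    by (rule integral_freeze[OF indep_observation _ _ fm]) (auto simp: indicator_def)
  also have "(\<lambda>\<omega>. \<integral>\<omega>'. ?f (\<omega>, \<omega>') \<partial>M) = (\<lambda>\<omega>. indicator D \<omega> *\<^sub>R char_sum T u m N \<omega>)"
  proof
    fix \<omega>
    have ind: "indep_var borel (\<lambda>\<omega>'. \<nu> 0 \<omega> \<bullet> Xb 0 \<omega>') borel (\<lambda>\<omega>'. \<Sum>k<m * N. w k \<omega> \<bullet> \<Delta> k \<omega>')"
    proof (rule indep_var_of_indep_set[OF indep_init])
      show "(\<lambda>\<omega>'. \<nu> 0 \<omega> \<bullet> Xb 0 \<omega>') \<in> borel_measurable (process_sigma M {0} Xb)"
        by (intro borel_measurable_inner borel_measurable_const process_sigma_measurable) simp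
      have "(\<lambda>\<omega>. (Wb t \<omega>, Vb t \<omega>)) \<in> borel_measurable (process_sigma M {0..} (\<lambda>t \<omega>. (Wb t \<omega>, Vb t \<omega>)))"
        if "0 \<le> t" for t
        using that by (intro process_sigma_measurable[where Z = "\<lambda>t \<omega>. (Wb t \<omega>, Vb t \<omega>)"]) auto
      thus "(\<lambda>\<omega>'. \<Sum>k<m * N. w k \<omega> \<bullet> \<Delta> k \<omega>') \<in> borel_measurable (process_sigma M {0..} (\<lambda>t \<omega>. (Wb t \<omega>, Vb t \<omega>)))"
        unfolding \<Delta>_def using \<tau>0(1)
        by (intro borel_measurable_sum borel_measurable_inner borel_measurable_const borel_measurable_diff) auto
    qed simp_all
    have bi: "(\<integral>\<omega>'. cis (\<Sum>k<m * N. w k \<omega> \<bullet> \<Delta> k \<omega>') \<partial>M) =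
        complex_of_real (exp (- (\<Sum>k<m * N. (\<tau> (Suc k) - \<tau> k) * (norm (w k \<omega>))\<^sup>2) / 2))"
      unfolding \<Delta>_def by (rule brownian_increments_cis[OF bm]) (use \<tau>0 in auto)
    have "(\<integral>\<omega>'. ?f (\<omega>, \<omega>') \<partial>M) = (\<integral>\<omega>'. (indicator D \<omega> *\<^sub>R cis (\<gamma> \<omega>)) *
        cis (\<nu> 0 \<omega> \<bullet> Xb 0 \<omega>' + (\<Sum>k<m * N. w k \<omega> \<bullet> \<Delta> k \<omega>')) \<partial>M)"
      by (simp add: cis_mult[symmetric])
    also have "\<dots> = (indicator D \<omega> *\<^sub>R cis (\<gamma> \<omega>)) *
        (\<integral>\<omega>'. cis (\<nu> 0 \<omega> \<bullet> Xb 0 \<omega>' + (\<Sum>k<m * N. w k \<omega> \<bullet> \<Delta> k \<omega>')) \<partial>M)"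
      by (rule integral_mult_right_zero)
    finally have split: "(\<integral>\<omega>'. ?f (\<omega>, \<omega>') \<partial>M) = (indicator D \<omega> *\<^sub>R cis (\<gamma> \<omega>)) *
        (\<integral>\<omega>'. cis (\<nu> 0 \<omega> \<bullet> Xb 0 \<omega>' + (\<Sum>k<m * N. w k \<omega> \<bullet> \<Delta> k \<omega>')) \<partial>M)" .
    show "(\<integral>\<omega>'. ?f (\<omega>, \<omega>') \<partial>M) = indicator D \<omega> *\<^sub>R char_sum T u m N \<omega>"
      unfolding split integral_cis_add[OF ind] bi c_eq by (simp only: mult_scaleR_left mult.assoc)
  qed
  finally show "(\<integral>\<omega>. indicator D \<omega> *\<^sub>R cis (euler_sum T u m N \<omega>) \<partial>M) = (\<integral>\<omega>. indicator D \<omega> *\<^sub>R char_sum T u m N \<omega> \<partial>M)"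
    by (simp add: e_eq)
qed

lemma gain_continuous: "AE \<omega> in M. continuous_on {0..} (\<lambda>t. gain t \<omega>)"
  using diffusion unfolding kalman_bucy_diffusion_def has_ito_integral_def gain_def by blast

lemma euler_sum_converges:
  assumes T: "0 < T"
  obtains N where "\<And>m. 0 < N m" "AE \<omega> in M. (\<lambda>m. euler_sum T u (Suc m) (N m) \<omega>) \<longlonglongrightarrow> u \<bullet> Xb T \<omega>"
proof -
  obtain I where ito: "has_ito_integral M gain
      (\<lambda>t \<omega>. Y t \<omega> - (integral {0..t} (\<lambda>s. C *v Xb s \<omega> + c) + R2h *v Vb t \<omega>)) I"
    and eq: "AE \<omega> in M. \<forall>t\<ge>0. Xb t \<omega> = Xb 0 \<omega> + integral {0..t} (\<lambda>s. A *v Xb s \<omega> + a) + R1h *v Wb t \<omega> + I t \<omega>"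
    using diffusion unfolding kalman_bucy_diffusion_def gain_def[abs_def] by blast
  obtain N where N: "\<And>m. 0 < N m"
    and sel: "AE \<omega> in M. (\<lambda>m. \<Sum>j\<le>Suc m. norm (I (grid T (Suc m) j) \<omega> - (\<Sum>k<j * N m. gain (grid T (Suc m * N m) k) \<omega> *v
      ((Y (grid T (Suc m * N m) (Suc k)) \<omega> - (integral {0..grid T (Suc m * N m) (Suc k)} (\<lambda>s. C *v Xb s \<omega> + c) + R2h *v Vb (grid T (Suc m * N m) (Suc k)) \<omega>)) -
       (Y (grid T (Suc m * N m) k) \<omega> - (integral {0..grid T (Suc m * N m) k} (\<lambda>s. C *v Xb s \<omega> + c) + R2h *v Vb (grid T (Suc m * N m) k) \<omega>)))))) \<longlonglongrightarrow> 0"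
    by (rule ito_sum_selection[OF ito T]) (rule that[rotated], assumption, blast)
  have "AE \<omega> in M. (\<lambda>m. euler_sum T u (Suc m) (N m) \<omega>) \<longlonglongrightarrow> u \<bullet> Xb T \<omega>"
    using gain_continuous eq sel AE_space
  proof eventually_elim
    case (elim \<omega>)
    show ?case
      unfolding euler_sum_def
    proof (rule euler_scheme_converges[OF T N, where x = "\<lambda>t. Xb t \<omega>" and H = "\<lambda>t. gain t \<omega>"
          and g = "\<lambda>t. R1h *v Wb t \<omega>" and I = "\<lambda>t. I t \<omega>" and z = "\<lambda>t. Y t \<omega> - R2h *v Vb t \<omega>"
          and Z = "\<lambda>t. Y t \<omega> - (integral {0..t} (\<lambda>s. C *v Xb s \<omega> + c) + R2h *v Vb t \<omega>)"])
      show "(\<lambda>m. \<Sum>j\<le>Suc m. norm (I (grid T (Suc m) j) \<omega> - (\<Sum>k<j * N m. gain (grid T (Suc m * N m) k) \<omega> *v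
      ((Y (grid T (Suc m * N m) (Suc k)) \<omega> - (integral {0..grid T (Suc m * N m) (Suc k)} (\<lambda>s. C *v Xb s \<omega> + c) + R2h *v Vb (grid T (Suc m * N m) (Suc k)) \<omega>)) -
       (Y (grid T (Suc m * N m) k) \<omega> - (integral {0..grid T (Suc m * N m) k} (\<lambda>s. C *v Xb s \<omega> + c) + R2h *v Vb (grid T (Suc m * N m) k) \<omega>)))))) \<longlonglongrightarrow> 0"
        by (rule elim(3))
      show "continuous_on {0..T} (\<lambda>t. Xb t \<omega>)"
        by (rule continuous_on_subset[OF Xb_path[OF elim(4)]]) auto
      show "continuous_on {0..T} (\<lambda>t. gain t \<omega>)"
        by (rule continuous_on_subset[OF elim(1)]) auto
      show "Xb t \<omega> = Xb 0 \<omega> + integral {0..t} (\<lambda>s. A *v Xb s \<omega> + a) + R1h *v Wb t \<omega> + I t \<omega>"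
        if "t \<in> {0..T}" for t
        by (rule elim(2)[THEN spec, THEN mp]) (use that in simp)
      show "Y t \<omega> - (integral {0..t} (\<lambda>s. C *v Xb s \<omega> + c) + R2h *v Vb t \<omega>) =
          Y t \<omega> - R2h *v Vb t \<omega> - integral {0..t} (\<lambda>s. C *v Xb s \<omega> + c)" for t
        by (rule diff_add_eq_diff_diff_swap)
    qed
  qed
  thus ?thesis using N that by blast
qed

text \<open>Conditioning is a contraction, so the true conditional characteristic function
  \<open>\<zeta>\<close> is the limit in mean of \<open>\<psi> m\<close>; along almost every path
  the modulus of \<open>\<psi> m\<close> has an explicit limit, and both limits must agree. The
  exceptional set is fixed before the fundamental pair is quantified, so the pair may be chosen path
  by path.\<close>

lemma cond_char_modulus:
  assumes T: "0 < T"
  shows "AE \<omega> in M. \<forall>\<Phi> \<Gamma>. fundamental_pair (\<lambda>s. A - gain s \<omega> ** C) \<Phi> \<Gamma> \<longrightarrow>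
    norm (\<integral>x. cis (u \<bullet> x) \<partial>\<eta> T \<omega>) = norm (\<integral>\<omega>'. cis ((transpose (\<Phi> T) *v u) \<bullet> Xb 0 \<omega>') \<partial>M) *
      exp (- integral {0..T} (\<lambda>s. noise_form (gain s \<omega>, transpose (\<Phi> T ** \<Gamma> s) *v u)) / 2)"
proof -
  let ?F = "process_sigma M {0..T} Y"
  have T0: "0 \<le> T" using T by simp
  obtain N where N: "\<And>m. 0 < N m" and lim: "AE \<omega> in M. (\<lambda>m. euler_sum T u (Suc m) (N m) \<omega>) \<longlonglongrightarrow> u \<bullet> Xb T \<omega>"
    by (rule euler_sum_converges[OF T, where u = u]) (rule that[rotated], assumption, blast)
  define \<zeta> where "\<zeta> = (\<lambda>\<omega>. \<integral>x. cis (u \<bullet> x) \<partial>\<eta> T \<omega>)"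
  define \<psi> where "\<psi> = (\<lambda>m. char_sum T u (Suc m) (N m))"
  note sub = subalgebra_observation[of T]
  note law = conditional_law_integral_cis[OF sub Xb_measurable[OF T0] cond_law[OF T0]]
  have \<zeta>F: "\<zeta> \<in> borel_measurable ?F" unfolding \<zeta>_def by (rule law(1))
  have \<psi>F: "\<psi> m \<in> borel_measurable ?F" for m
    unfolding \<psi>_def by (rule euler_sum_cond_char(1)[OF T zero_less_Suc N])
  have [measurable]: "\<zeta> \<in> borel_measurable M" "\<psi> m \<in> borel_measurable M" for m
    using measurable_from_subalg[OF sub] \<zeta>F \<psi>F by blast+
  have em[measurable]: "euler_sum T u (Suc m) (N m) \<in> borel_measurable M" for m
    by (rule euler_sum_cond_char(2)[OF T zero_less_Suc N])
  have [measurable]: "Xb T \<in> borel_measurable M" by (rule Xb_measurable[OF T0])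
  have \<zeta>1: "norm (\<zeta> \<omega>) \<le> 1" if "\<omega> \<in> space M" for \<omega> unfolding \<zeta>_def by (rule law(3)[OF that])
  have \<psi>1: "norm (\<psi> m \<omega>) \<le> 1" for m \<omega>
    unfolding \<psi>_def by (rule euler_sum_cond_char(5)[OF T zero_less_Suc N])
  have \<zeta>i: "integrable M \<zeta>" by (rule integrable_const_bound[of _ 1]) (use \<zeta>1 in auto)
  have \<psi>i: "integrable M (\<psi> m)" for m by (rule integrable_const_bound[of _ 1]) (use \<psi>1 in auto)
  let ?k = "\<lambda>m \<omega>. cis (u \<bullet> Xb T \<omega>) - cis (euler_sum T u (Suc m) (N m) \<omega>)"
  have ki: "integrable M (\<lambda>\<omega>. cis (u \<bullet> Xb T \<omega>))" "integrable M (\<lambda>\<omega>. cis (euler_sum T u (Suc m) (N m) \<omega>))" for m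
    by (auto intro!: integrable_cis)
  have kle: "(\<integral>\<omega>. norm (\<zeta> \<omega> - \<psi> m \<omega>) \<partial>M) \<le> 2 * (\<integral>\<omega>. norm (?k m \<omega>) \<partial>M)" for m
  proof -
    have h: "(\<lambda>\<omega>. \<zeta> \<omega> - \<psi> m \<omega>) \<in> borel_measurable ?F"
      by (intro borel_measurable_diff \<zeta>F \<psi>F)
    have hi: "integrable M (\<lambda>\<omega>. \<zeta> \<omega> - \<psi> m \<omega>)"
      by (intro Bochner_Integration.integrable_diff \<zeta>i \<psi>i)
    have kki: "integrable M (?k m)"
      by (intro Bochner_Integration.integrable_diff ki)
    have eq: "(\<integral>\<omega>. indicator D \<omega> *\<^sub>R (\<zeta> \<omega> - \<psi> m \<omega>) \<partial>M) = (\<integral>\<omega>. indicator D \<omega> *\<^sub>R ?k m \<omega> \<partial>M)"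
      if D: "D \<in> sets ?F" for D
    proof -
      have DM: "D \<in> events" using D sub by (auto simp: subalgebra_def)
      note ii = integrable_mult_indicator[OF DM]
      show ?thesis
        unfolding scaleR_diff_right Bochner_Integration.integral_diff[OF ii[OF \<zeta>i] ii[OF \<psi>i]]
          Bochner_Integration.integral_diff[OF ii[OF ki(1)] ii[OF ki(2)]]
        using law(2)[OF D, of u] euler_sum_cond_char(3)[OF T zero_less_Suc[of m] N[of m] D, of u]
        by (simp only: \<zeta>_def \<psi>_def)
    qed
    show ?thesis by (rule norm_integral_le_of_cond_eq[OF sub h hi kki eq])
  qed
  have klim: "(\<lambda>m. \<integral>\<omega>. norm (?k m \<omega>) \<partial>M) \<longlonglongrightarrow> (\<integral>\<omega>. 0 \<partial>M)"
  proof (rule integral_dominated_convergence[where w = "\<lambda>_. 2"])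
    show "AE \<omega> in M. (\<lambda>m. norm (?k m \<omega>)) \<longlonglongrightarrow> 0"
      using lim
    proof eventually_elim
      case (elim \<omega>)
      have "(\<lambda>m. norm (?k m \<omega>)) \<longlonglongrightarrow> norm (cis (u \<bullet> Xb T \<omega>) - cis (u \<bullet> Xb T \<omega>))"
        by (intro tendsto_intros tendsto_cis elim)
      thus ?case by simp
    qed
    show "AE \<omega> in M. norm (norm (?k m \<omega>)) \<le> 2" for m
    proof (rule AE_I2)
      fix \<omega>
      have "norm (?k m \<omega>) \<le> norm (cis (u \<bullet> Xb T \<omega>)) + norm (cis (euler_sum T u (Suc m) (N m) \<omega>))"
        by (rule norm_triangle_ineq4)
      thus "norm (norm (?k m \<omega>)) \<le> 2" by simp
    qed
  qed auto
  have conv: "(\<lambda>m. \<integral>\<omega>. norm (\<zeta> \<omega> - \<psi> m \<omega>) \<partial>M) \<longlonglongrightarrow> 0"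
  proof (rule tendsto_sandwich[where f = "\<lambda>_. 0" and h = "\<lambda>m. 2 * (\<integral>\<omega>. norm (?k m \<omega>) \<partial>M)"])
    show "(\<lambda>m. 2 * (\<integral>\<omega>. norm (?k m \<omega>) \<partial>M)) \<longlonglongrightarrow> 0"
      using tendsto_mult[OF tendsto_const klim, of 2] by simp
    show "\<forall>\<^sub>F m in sequentially. (\<integral>\<omega>. norm (\<zeta> \<omega> - \<psi> m \<omega>) \<partial>M) \<le> 2 * (\<integral>\<omega>. norm (?k m \<omega>) \<partial>M)"
      by (intro always_eventually allI kle)
  qed (simp_all add: always_eventually)
  have modulus: "AE \<omega> in M. \<forall>\<Phi> \<Gamma>. fundamental_pair (\<lambda>s. A - gain s \<omega> ** C) \<Phi> \<Gamma> \<longrightarrow>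
      (\<lambda>m. norm (\<psi> m \<omega>)) \<longlonglongrightarrow> norm (\<integral>\<omega>'. cis ((transpose (\<Phi> T) *v u) \<bullet> Xb 0 \<omega>') \<partial>M) *
      exp (- integral {0..T} (\<lambda>s. noise_form (gain s \<omega>, transpose (\<Phi> T ** \<Gamma> s) *v u)) / 2)"
    using gain_continuous
  proof eventually_elim
    case (elim \<omega>)
    have gT: "continuous_on {0..T} (\<lambda>t. gain t \<omega>)"
      by (rule continuous_on_subset[OF elim]) auto
    show ?case
    proof (intro allI impI)
      fix \<Phi> \<Gamma> assume fp: "fundamental_pair (\<lambda>s. A - gain s \<omega> ** C) \<Phi> \<Gamma>"
      define q where "q = (\<lambda>s. transpose (\<Phi> T ** \<Gamma> s) *v u)"
      have q': "(q has_vector_derivative - (transpose (A - gain s \<omega> ** C) *v q s)) (at s within {0..})"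
        if "0 \<le> s" for s
        unfolding q_def by (rule adjoint_flow_derivative[OF fp that])
      have qT: "q T = u" unfolding q_def by (rule adjoint_flow_end[OF fp T0])
      have q0: "q 0 = transpose (\<Phi> T) *v u"
        using fundamental_pairD(2)[OF fp] by (simp add: q_def del: transpose_matrix_vector)
      note as = adjoint_sum_converges[OF T N gT continuous_noise_form q' qT]
      have "(\<lambda>m. norm (\<integral>\<omega>'. cis (adjoint_grid A C (\<lambda>t. gain t \<omega>) T u (Suc m) 0 \<bullet> Xb 0 \<omega>') \<partial>M) *
          exp (- (\<Sum>k<Suc m * N m. T / real (Suc m * N m) * noise_form (gain (grid T (Suc m * N m) k) \<omega>,
          adjoint_grid A C (\<lambda>t. gain t \<omega>) T u (Suc m) (Suc (k div N m)))) / 2)) \<longlonglongrightarrow>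
          norm (\<integral>\<omega>'. cis (q 0 \<bullet> Xb 0 \<omega>') \<partial>M) * exp (- integral {0..T} (\<lambda>s. noise_form (gain s \<omega>, q s)) / 2)"
        by (intro tendsto_intros tendsto_integral_cis[OF Xb_measurable[OF order_refl]] as) auto
      thus "(\<lambda>m. norm (\<psi> m \<omega>)) \<longlonglongrightarrow> norm (\<integral>\<omega>'. cis ((transpose (\<Phi> T) *v u) \<bullet> Xb 0 \<omega>') \<partial>M) *
          exp (- integral {0..T} (\<lambda>s. noise_form (gain s \<omega>, transpose (\<Phi> T ** \<Gamma> s) *v u)) / 2)"
        unfolding \<psi>_def euler_sum_cond_char(4)[OF T zero_less_Suc N] q0 by (simp only: q_def)
    qed
  qed
  \<comment> \<open>A measurable stand-in for the pathwise limit, whose explicit form involves a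
    flow chosen separately for each path.\<close>
  define lm where "lm = (\<lambda>\<omega>. lim (\<lambda>m. norm (\<psi> m \<omega>)))"
  have lmm[measurable]: "lm \<in> borel_measurable M" unfolding lm_def by measurable
  have lmlim: "AE \<omega> in M. (\<lambda>m. norm (\<psi> m \<omega>)) \<longlonglongrightarrow> lm \<omega>"
    using modulus gain_continuous
  proof eventually_elim
    case (elim \<omega>)
    have "continuous_on {0..} (\<lambda>s. A - gain s \<omega> ** C)"
      by (intro continuous_intros mmult.continuous_on elim(2))
    then obtain \<Phi> \<Gamma> where "fundamental_pair (\<lambda>s. A - gain s \<omega> ** C) \<Phi> \<Gamma>"
      using fundamental_pair_exists by blast
    with elim(1) have "convergent (\<lambda>m. norm (\<psi> m \<omega>))"
      unfolding convergent_def by blast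
    thus ?case unfolding lm_def by (simp add: convergent_LIMSEQ_iff)
  qed
  have lm1: "AE \<omega> in M. \<bar>norm (\<zeta> \<omega>) - lm \<omega>\<bar> \<le> 2"
    using lmlim AE_space
  proof eventually_elim
    case (elim \<omega>)
    have "lm \<omega> \<le> 1" using LIMSEQ_le_const2[OF elim(1)] \<psi>1 by blast
    moreover have "0 \<le> lm \<omega>" using LIMSEQ_le_const[OF elim(1)] by (metis norm_ge_zero)
    ultimately show ?case using \<zeta>1[OF elim(2)] norm_ge_zero[of "\<zeta> \<omega>"] by linarith
  qed
  have "(\<lambda>m. \<integral>\<omega>. \<bar>norm (\<zeta> \<omega>) - norm (\<psi> m \<omega>)\<bar> \<partial>M) \<longlonglongrightarrow> (\<integral>\<omega>. \<bar>norm (\<zeta> \<omega>) - lm \<omega>\<bar> \<partial>M)"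
  proof (rule integral_dominated_convergence[where w = "\<lambda>_. 2"])
    show "AE \<omega> in M. (\<lambda>m. \<bar>norm (\<zeta> \<omega>) - norm (\<psi> m \<omega>)\<bar>) \<longlonglongrightarrow> \<bar>norm (\<zeta> \<omega>) - lm \<omega>\<bar>"
      using lmlim by eventually_elim (intro tendsto_intros)
    show "AE \<omega> in M. norm \<bar>norm (\<zeta> \<omega>) - norm (\<psi> m \<omega>)\<bar> \<le> 2" for m
    proof (rule AE_I2)
      fix \<omega> assume "\<omega> \<in> space M"
      from \<zeta>1[OF this] \<psi>1[of m \<omega>] show "norm \<bar>norm (\<zeta> \<omega>) - norm (\<psi> m \<omega>)\<bar> \<le> 2"
        using norm_ge_zero[of "\<zeta> \<omega>"] norm_ge_zero[of "\<psi> m \<omega>"]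
        unfolding real_norm_def abs_idempotent by linarith
    qed
  qed auto
  moreover have "(\<lambda>m. \<integral>\<omega>. \<bar>norm (\<zeta> \<omega>) - norm (\<psi> m \<omega>)\<bar> \<partial>M) \<longlonglongrightarrow> 0"
  proof (rule tendsto_sandwich[where f = "\<lambda>_. 0" and h = "\<lambda>m. \<integral>\<omega>. norm (\<zeta> \<omega> - \<psi> m \<omega>) \<partial>M"])
    have "(\<integral>\<omega>. \<bar>norm (\<zeta> \<omega>) - norm (\<psi> m \<omega>)\<bar> \<partial>M) \<le> (\<integral>\<omega>. norm (\<zeta> \<omega> - \<psi> m \<omega>) \<partial>M)" for m
      using \<zeta>i \<psi>i[of m] by (intro integral_mono norm_triangle_ineq3) auto
    thus "\<forall>\<^sub>F m in sequentially. (\<integral>\<omega>. \<bar>norm (\<zeta> \<omega>) - norm (\<psi> m \<omega>)\<bar> \<partial>M) \<le> (\<integral>\<omega>. norm (\<zeta> \<omega> - \<psi> m \<omega>) \<partial>M)"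
      by (intro always_eventually allI)
  qed (simp_all add: always_eventually conv)
  ultimately have "(\<integral>\<omega>. \<bar>norm (\<zeta> \<omega>) - lm \<omega>\<bar> \<partial>M) = 0"
    using LIMSEQ_unique by blast
  moreover have "integrable M (\<lambda>\<omega>. \<bar>norm (\<zeta> \<omega>) - lm \<omega>\<bar>)"
    by (rule integrable_const_bound[of _ 2]) (use lm1 in auto)
  ultimately have "AE \<omega> in M. \<bar>norm (\<zeta> \<omega>) - lm \<omega>\<bar> = 0"
    by (subst (asm) integral_nonneg_eq_0_iff_AE) auto
  with modulus lmlim show ?thesis
  proof eventually_elim
    case (elim \<omega>)
    thus ?case unfolding \<zeta>_def using LIMSEQ_unique by fastforce
  qed
qed

section \<open>From the characteristic function to the Riccati equation\<close>

lemma conditional_second_moment: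
  assumes T: "0 \<le> T"
  shows "AE \<omega> in M. integrable (\<eta> T \<omega>) (\<lambda>x. (norm x)\<^sup>2)"
proof -
  note sub = subalgebra_observation[of T]
  have "\<eta> T \<in> measurable (process_sigma M {0..T} Y) (prob_algebra borel)"
    using cond_law[OF T] by (simp add: is_conditional_law_def)
  hence \<eta>p: "\<eta> T \<in> measurable M (prob_algebra borel)"
    by (rule measurable_from_subalg[OF sub])
  hence \<eta>s: "\<eta> T \<in> measurable M (subprob_algebra borel)"
    by (rule measurable_prob_algebraD)
  have m: "(\<lambda>\<omega>. \<integral>\<^sup>+x. ennreal ((norm x)\<^sup>2) \<partial>\<eta> T \<omega>) \<in> borel_measurable M"
    by (rule measurable_compose[OF \<eta>s nn_integral_measurable_subprob_algebra]) simp
  have sp: "space M \<in> sets (process_sigma M {0..T} Y)"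
    using sets.top[of "process_sigma M {0..T} Y"] by simp
  have "(\<integral>\<^sup>+\<omega>. indicator (space M) \<omega> * ennreal ((norm (Xb T \<omega>))\<^sup>2) \<partial>M) =
      (\<integral>\<^sup>+\<omega>. indicator (space M) \<omega> * (\<integral>\<^sup>+x. ennreal ((norm x)\<^sup>2) \<partial>\<eta> T \<omega>) \<partial>M)"
    by (rule conditional_law_nn_integral[OF sub Xb_measurable[OF T] cond_law[OF T] sp]) simp
  also have "\<dots> = (\<integral>\<^sup>+\<omega>. (\<integral>\<^sup>+x. ennreal ((norm x)\<^sup>2) \<partial>\<eta> T \<omega>) \<partial>M)"
    by (intro nn_integral_cong) simp
  also have "(\<integral>\<^sup>+\<omega>. indicator (space M) \<omega> * ennreal ((norm (Xb T \<omega>))\<^sup>2) \<partial>M) = (\<integral>\<^sup>+\<omega>. ennreal ((norm (Xb T \<omega>))\<^sup>2) \<partial>M)"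
    by (intro nn_integral_cong) simp
  finally have eq: "(\<integral>\<^sup>+\<omega>. ennreal ((norm (Xb T \<omega>))\<^sup>2) \<partial>M) = (\<integral>\<^sup>+\<omega>. (\<integral>\<^sup>+x. ennreal ((norm x)\<^sup>2) \<partial>\<eta> T \<omega>) \<partial>M)" .
  have "(\<integral>\<^sup>+\<omega>. (\<integral>\<^sup>+x. ennreal ((norm x)\<^sup>2) \<partial>\<eta> T \<omega>) \<partial>M) \<noteq> \<infinity>"
    unfolding eq[symmetric] using nn_integral_eq_integral[OF Xb_square[OF T]] by simp
  from nn_integral_PInf_AE[OF m this] AE_space show ?thesis
  proof eventually_elim
    case (elim \<omega>)
    have "sets (\<eta> T \<omega>) = sets borel"
      using measurable_space[OF \<eta>p elim(2)] by (simp add: space_prob_algebra)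
    hence "(\<lambda>x. (norm x)\<^sup>2) \<in> borel_measurable (\<eta> T \<omega>)"
      by (simp cong: measurable_cong_sets)
    thus ?case using elim(1) by (simp add: integrable_iff_bounded less_top)
  qed
qed

lemma tendsto_exp_difference_quotient:
  "(\<lambda>k. (real (Suc k))\<^sup>2 * (1 - exp (- (J / (real (Suc k))\<^sup>2)))) \<longlonglongrightarrow> J"
proof -
  have "((\<lambda>h. exp (- J * h)) has_real_derivative - J) (at 0)"
    by (auto intro!: derivative_eq_intros)
  hence d: "((\<lambda>h. (exp (- J * h) - 1) / h) \<longlongrightarrow> - J) (at 0)"
    by (simp add: DERIV_def)
  have "(\<lambda>k. 1 / (real (Suc k))\<^sup>2) \<longlonglongrightarrow> 0\<^sup>2"
    using tendsto_power[OF LIMSEQ_Suc[OF lim_1_over_n], of 2] by (simp add: power_divide)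
  hence "filterlim (\<lambda>k. 1 / (real (Suc k))\<^sup>2) (at 0) sequentially"
    by (auto simp: filterlim_at)
  from filterlim_compose[OF d this]
  have "(\<lambda>k. - ((exp (- J * (1 / (real (Suc k))\<^sup>2)) - 1) / (1 / (real (Suc k))\<^sup>2))) \<longlonglongrightarrow> - (- J)"
    by (rule tendsto_minus)
  thus ?thesis by (simp add: algebra_simps)
qed

text \<open>The modulus identity is used at \<open>u / k\<close> for all positive integers
  \<open>k\<close> at once. Since \<open>noise_form\<close> is quadratic in the vector, the exponent
  is divided by the square of \<open>k\<close>, and \<open>variance_of_char\<close> identifies the
  limits: under the conditional law on one side, under the law of \<open>Xb 0\<close> on the
  other.\<close>

lemma cond_variance:
  assumes T: "0 < T"
  shows "AE \<omega> in M. \<forall>\<Phi> \<Gamma>. fundamental_pair (\<lambda>s. A - gain s \<omega> ** C) \<Phi> \<Gamma> \<longrightarrow>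
    u \<bullet> (covariance_matrix (\<eta> T \<omega>) *v u) =
      (transpose (\<Phi> T) *v u) \<bullet> (covariance_matrix (distr M borel (Xb 0)) *v (transpose (\<Phi> T) *v u)) +
      integral {0..T} (\<lambda>s. noise_form (gain s \<omega>, transpose (\<Phi> T ** \<Gamma> s) *v u))"
proof -
  have T0: "0 \<le> T" using T by simp
  have "\<eta> T \<in> measurable (process_sigma M {0..T} Y) (prob_algebra borel)"
    using cond_law[OF T0] by (simp add: is_conditional_law_def)
  hence \<eta>p: "\<eta> T \<in> measurable M (prob_algebra borel)"
    by (rule measurable_from_subalg[OF subalgebra_observation])
  have "AE \<omega> in M. \<forall>k. \<forall>\<Phi> \<Gamma>. fundamental_pair (\<lambda>s. A - gain s \<omega> ** C) \<Phi> \<Gamma> \<longrightarrow>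
    norm (\<integral>x. cis (((1 / real (Suc k)) *\<^sub>R u) \<bullet> x) \<partial>\<eta> T \<omega>) =
      norm (\<integral>\<omega>'. cis ((transpose (\<Phi> T) *v ((1 / real (Suc k)) *\<^sub>R u)) \<bullet> Xb 0 \<omega>') \<partial>M) *
      exp (- integral {0..T} (\<lambda>s. noise_form (gain s \<omega>, transpose (\<Phi> T ** \<Gamma> s) *v ((1 / real (Suc k)) *\<^sub>R u))) / 2)"
    unfolding AE_all_countable by (intro allI cond_char_modulus[OF T])
  with conditional_second_moment[OF T0] AE_space show ?thesis
  proof eventually_elim
    case (elim \<omega>)
    have \<eta>1: "prob_space (\<eta> T \<omega>)" and sets\<eta>: "sets (\<eta> T \<omega>) = sets borel"
      using measurable_space[OF \<eta>p elim(2)] by (auto simp: space_prob_algebra)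
    interpret E: prob_space "\<eta> T \<omega>" by (rule \<eta>1)
    have id: "(\<lambda>x. x) \<in> borel_measurable (\<eta> T \<omega>)" by (rule measurable_ident_sets[OF sets\<eta>])
    have dist: "distr (\<eta> T \<omega>) borel (\<lambda>x. x) = \<eta> T \<omega>" by (rule distr_id2[OF sets\<eta>[symmetric]])
    note covE = E.covariance_quadratic_form[OF id elim(1), of u, unfolded dist]
    show ?case
    proof (intro allI impI)
      fix \<Phi> \<Gamma> assume fp: "fundamental_pair (\<lambda>s. A - gain s \<omega> ** C) \<Phi> \<Gamma>"
      define q0 where "q0 = transpose (\<Phi> T) *v u"
      define J where "J = integral {0..T} (\<lambda>s. noise_form (gain s \<omega>, transpose (\<Phi> T ** \<Gamma> s) *v u))"
      define r where "r = (\<lambda>k. real (Suc k))"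
      have r: "0 < r k" for k by (simp add: r_def)
      define \<alpha> where "\<alpha> = (\<lambda>k. norm (\<integral>\<omega>'. cis (q0 \<bullet> Xb 0 \<omega>' / r k) \<partial>M))"
      have "norm (\<integral>x. cis (u \<bullet> x / r k) \<partial>\<eta> T \<omega>) = \<alpha> k * exp (- (J / (r k)\<^sup>2) / 2)" for k
      proof -
        have sc: "B *v ((1 / r k) *\<^sub>R u) = (1 / r k) *\<^sub>R (B *v u)" for B :: "real^'n^'n"
          by (rule matrix_vector_mult_scaleR)
        have "noise_form (g, (1 / r k) *\<^sub>R y) = noise_form (g, y) / (r k)\<^sup>2" for g y
          using r[of k] by (simp add: noise_form_def matrix_vector_mult_scaleR power_divide add_divide_distrib
              del: transpose_matrix_vector)
        hence "integral {0..T} (\<lambda>s. noise_form (gain s \<omega>, transpose (\<Phi> T ** \<Gamma> s) *v ((1 / r k) *\<^sub>R u))) = J / (r k)\<^sup>2"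
          unfolding sc J_def by simp
        thus ?thesis
          using elim(3)[THEN spec, of k, THEN spec, of \<Phi>, THEN spec, of \<Gamma>, THEN mp, OF fp]
          unfolding r_def[symmetric, THEN fun_cong] unfolding \<alpha>_def q0_def[symmetric] sc inner_scaleR_left
          by (simp add: sc r_def)
      qed
      hence char_eq: "(norm (\<integral>x. cis (u \<bullet> x / r k) \<partial>\<eta> T \<omega>))\<^sup>2 = (\<alpha> k)\<^sup>2 * exp (- (J / (r k)\<^sup>2))" for k
        by (simp add: power_mult_distrib exp_double[symmetric])
      have um: "(\<lambda>x. u \<bullet> x) \<in> borel_measurable (\<eta> T \<omega>)"
        by (intro borel_measurable_inner borel_measurable_const id)
      have lim1: "(\<lambda>k. (r k)\<^sup>2 * (1 - (norm (\<integral>x. cis (u \<bullet> x / r k) \<partial>\<eta> T \<omega>))\<^sup>2)) \<longlonglongrightarrow>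
          u \<bullet> (covariance_matrix (\<eta> T \<omega>) *v u)"
        unfolding covE(1) r_def by (rule E.variance_of_char[OF um covE(2)])
      have X0: "Xb 0 \<in> borel_measurable M" "integrable M (\<lambda>\<omega>. (norm (Xb 0 \<omega>))\<^sup>2)"
        by (simp_all add: Xb_measurable Xb_square)
      note covX = covariance_quadratic_form[OF X0, of q0]
      have "(\<lambda>\<omega>. q0 \<bullet> Xb 0 \<omega>) \<in> borel_measurable M" using X0 by simp
      from variance_of_char[OF this covX(2)]
      have lim2: "(\<lambda>k. (r k)\<^sup>2 * (1 - (\<alpha> k)\<^sup>2)) \<longlonglongrightarrow> q0 \<bullet> (covariance_matrix (distr M borel (Xb 0)) *v q0)"
        unfolding covX(1) \<alpha>_def r_def .
      have lim3: "(\<lambda>k. (r k)\<^sup>2 * (1 - exp (- (J / (r k)\<^sup>2)))) \<longlonglongrightarrow> J"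
        unfolding r_def by (rule tendsto_exp_difference_quotient)
      have "(\<lambda>k. J * (1 / r k)\<^sup>2) \<longlonglongrightarrow> J * 0\<^sup>2"
        unfolding r_def by (intro tendsto_intros LIMSEQ_Suc[OF lim_1_over_n])
      hence lim4: "(\<lambda>k. exp (- (J / (r k)\<^sup>2))) \<longlonglongrightarrow> exp (- 0)"
        by (intro tendsto_exp tendsto_minus) (simp add: power_divide)
      \<comment> \<open>One minus a product is split as \<open>(1 - x) * y + (1 - y)\<close>, which
        leaves factors with known limits.\<close>
      have "(\<lambda>k. (r k)\<^sup>2 * (1 - (\<alpha> k)\<^sup>2) * exp (- (J / (r k)\<^sup>2)) + (r k)\<^sup>2 * (1 - exp (- (J / (r k)\<^sup>2)))) \<longlonglongrightarrow>
          q0 \<bullet> (covariance_matrix (distr M borel (Xb 0)) *v q0) * exp (- 0) + J"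
        by (intro tendsto_add tendsto_mult lim2 lim3 lim4)
      moreover have "(r k)\<^sup>2 * (1 - (\<alpha> k)\<^sup>2) * exp (- (J / (r k)\<^sup>2)) + (r k)\<^sup>2 * (1 - exp (- (J / (r k)\<^sup>2))) =
          (r k)\<^sup>2 * (1 - (norm (\<integral>x. cis (u \<bullet> x / r k) \<partial>\<eta> T \<omega>))\<^sup>2)" for k
        unfolding char_eq by (simp add: algebra_simps)
      ultimately have "(\<lambda>k. (r k)\<^sup>2 * (1 - (norm (\<integral>x. cis (u \<bullet> x / r k) \<partial>\<eta> T \<omega>))\<^sup>2)) \<longlonglongrightarrow>
          q0 \<bullet> (covariance_matrix (distr M borel (Xb 0)) *v q0) + J"
        by simp
      from LIMSEQ_unique[OF lim1 this]
      show "u \<bullet> (covariance_matrix (\<eta> T \<omega>) *v u) =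
          (transpose (\<Phi> T) *v u) \<bullet> (covariance_matrix (distr M borel (Xb 0)) *v (transpose (\<Phi> T) *v u)) +
          integral {0..T} (\<lambda>s. noise_form (gain s \<omega>, transpose (\<Phi> T ** \<Gamma> s) *v u))"
        by (simp only: q0_def J_def)
    qed
  qed
qed

text \<open>Along one path the gain is taken as given and \<open>p\<close> is defined as the
  solution of the linear Lyapunov equation that it drives. The variance identity says that
  \<open>p\<close> is the conditional covariance, so the gain is \<open>p ** G\<close>; inserting
  this turns the Lyapunov equation into the Riccati equation. Existence of a Riccati solution comes
  as a by-product.\<close>

lemma gain_riccati_path:
  "AE \<omega> in M. \<exists>p. riccati_solution A (information_matrix C R2h) (R1h ** R1h) (covariance_matrix (distr M borel (Xb 0))) p \<and>
    (\<forall>t\<ge>0. gain t \<omega> = p t ** (transpose C ** matrix_inv (R2h ** R2h)))"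
proof -
  define P0 where "P0 = covariance_matrix (distr M borel (Xb 0))"
  define S where "S = information_matrix C R2h"
  define R2 where "R2 = R2h ** R2h"
  define G where "G = transpose C ** matrix_inv R2"
  have R2: "invertible R2" "transpose R2 = R2"
    by (simp_all add: R2_def invertible_mult R2h_inv matrix_transpose_mul R2h_sym)
  have GC: "G ** C = S" by (simp add: G_def S_def information_matrix_def R2_def)
  have GRG: "G ** R2 ** transpose G = S"
    by (simp add: G_def S_def information_matrix_def R2_def[symmetric] matrix_transpose_mul
        transpose_matrix_inv_symmetric[OF R2] matrix_mul_assoc[symmetric] matrix_inv_inverse(1)[OF R2(1)])
      (simp add: matrix_mul_assoc matrix_inv_inverse(2)[OF R2(1)])
  have S_sym: "transpose S = S"
    unfolding GRG[symmetric] by (simp add: matrix_transpose_mul R2(2) matrix_mul_assoc)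
  have P0: "pos_semidef P0"
    unfolding P0_def by (rule pos_semidef_covariance) (simp_all add: Xb_measurable Xb_square)
  have gain_G: "gain t \<omega> = covariance_matrix (\<eta> t \<omega>) ** G" for t \<omega>
    by (simp add: gain_def G_def R2_def matrix_mul_assoc)
  \<comment> \<open>Countably many times and finitely many test vectors keep the exceptional set
    null; the remaining times are reached by continuity.\<close>
  have "countable ((\<rat> :: real set) \<inter> {0<..})" using countable_rat by (rule countable_subset[rotated]) auto
  hence "AE \<omega> in M. \<forall>T\<in>\<rat> \<inter> {0<..}. \<forall>i j. \<forall>\<Phi> \<Gamma>. fundamental_pair (\<lambda>s. A - gain s \<omega> ** C) \<Phi> \<Gamma> \<longrightarrow>
    (axis i 1 + axis j 1) \<bullet> (covariance_matrix (\<eta> T \<omega>) *v (axis i 1 + axis j 1)) =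
      (transpose (\<Phi> T) *v (axis i 1 + axis j 1)) \<bullet> (P0 *v (transpose (\<Phi> T) *v (axis i 1 + axis j 1))) +
      integral {0..T} (\<lambda>s. noise_form (gain s \<omega>, transpose (\<Phi> T ** \<Gamma> s) *v (axis i 1 + axis j 1)))"
    by (subst AE_ball_countable)
      (auto simp: AE_all_countable P0_def simp del: transpose_matrix_vector intro!: cond_variance)
  with gain_continuous show ?thesis
  proof eventually_elim
    case (elim \<omega>)
    define g where "g = (\<lambda>t. gain t \<omega>)"
    have g: "continuous_on {0..} g" using elim(1) by (simp add: g_def)
    have L: "continuous_on {0..} (\<lambda>s. A - g s ** C)"
      by (intro continuous_intros mmult.continuous_on g)
    obtain \<Phi> \<Gamma> where fp: "fundamental_pair (\<lambda>s. A - g s ** C) \<Phi> \<Gamma>"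
      by (rule fundamental_pair_exists[OF L])
    have qf: "z \<bullet> ((B ** transpose B) *v z) = (transpose B *v z) \<bullet> (transpose B *v z)"
      for z and B :: "real^'k^'n"
      by (simp add: matrix_vector_mul_assoc[symmetric] inner_matrix_transpose del: transpose_matrix_vector)
    define \<Xi> where "\<Xi> = (\<lambda>s. R1h ** R1h + g s ** R2 ** transpose (g s))"
    define f where "f = (\<lambda>s. \<Gamma> s ** \<Xi> s ** transpose (\<Gamma> s))"
    define N where "N = (\<lambda>t. P0 + integral {0..t} f)"
    \<comment> \<open>Variation of constants for the Lyapunov equation: \<open>N\<close> accumulates
      the noise covariance \<open>\<Xi>\<close> pulled back to time 0, and the flow carries it
      forward.\<close>
    define p where "p = (\<lambda>t. \<Phi> t ** N t ** transpose (\<Phi> t))"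
    have fc: "continuous_on {0..} f"
      unfolding f_def \<Xi>_def
      by (intro mmult.continuous_on continuous_intros g fundamental_pairD(8)[OF fp]
          bounded_linear.continuous_on[OF bounded_linear_transpose])
    have f_int: "f integrable_on {0..t}" for t
      by (intro integrable_continuous_interval continuous_on_subset[OF fc]) auto
    have f_sym: "transpose (f s) = f s" for s
      by (simp add: f_def \<Xi>_def matrix_transpose_mul transpose_add R1h_sym R2(2) matrix_mul_assoc)
    have N_sym: "transpose (N t) = N t" for t
    proof -
      have "transpose (integral {0..t} f) = integral {0..t} (transpose \<circ> f)"
        by (rule integral_linear[OF f_int bounded_linear_transpose, symmetric])
      moreover have "transpose \<circ> f = f" using f_sym by (simp add: fun_eq_iff)
      ultimately show ?thesis
        using P0 by (simp add: N_def transpose_add pos_semidef_def)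
    qed
    have p_sym: "transpose (p t) = p t" for t
      by (simp add: p_def matrix_transpose_mul N_sym matrix_mul_assoc)
    have p_quad: "u \<bullet> (p t *v u) = (transpose (\<Phi> t) *v u) \<bullet> (P0 *v (transpose (\<Phi> t) *v u)) +
        integral {0..t} (\<lambda>s. noise_form (g s, transpose (\<Phi> t ** \<Gamma> s) *v u))" for u t
    proof -
      define y where "y = transpose (\<Phi> t) *v u"
      have "u \<bullet> (p t *v u) = y \<bullet> (N t *v y)"
        by (simp add: p_def y_def matrix_vector_mul_assoc[symmetric] inner_matrix_transpose[of u "\<Phi> t"]
            del: transpose_matrix_vector)
      also have "\<dots> = y \<bullet> (P0 *v y) + y \<bullet> (integral {0..t} f *v y)"
        by (simp add: N_def mvmult.add_left inner_add_right)
      also have "y \<bullet> (integral {0..t} f *v y) = integral {0..t} ((\<lambda>B. y \<bullet> (B *v y)) \<circ> f)"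
        by (rule integral_linear[OF f_int, symmetric])
          (intro bounded_linear_compose[OF bounded_linear_inner_right] mvmult.bounded_linear_left)
      also have "(\<lambda>B. y \<bullet> (B *v y)) \<circ> f = (\<lambda>s. noise_form (g s, transpose (\<Phi> t ** \<Gamma> s) *v u))"
      proof
        fix s
        define z where "z = transpose (\<Gamma> s) *v y"
        have "((\<lambda>B. y \<bullet> (B *v y)) \<circ> f) s = z \<bullet> (\<Xi> s *v z)"
          by (simp add: f_def z_def matrix_vector_mul_assoc[symmetric] inner_matrix_transpose[of y "\<Gamma> s"]
              del: transpose_matrix_vector)
        also have "\<dots> = (transpose R1h *v z) \<bullet> (transpose R1h *v z) +
            (transpose (g s ** R2h) *v z) \<bullet> (transpose (g s ** R2h) *v z)"
        proof -
          have "\<Xi> s = R1h ** transpose R1h + (g s ** R2h) ** transpose (g s ** R2h)"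
            by (simp add: \<Xi>_def R1h_sym R2_def matrix_transpose_mul R2h_sym matrix_mul_assoc)
          thus ?thesis
            by (simp only: mvmult.add_left inner_add_right qf)
        qed
        also have "\<dots> = noise_form (g s, z)"
          by (simp add: noise_form_def dot_square_norm del: transpose_matrix_vector)
        also have "z = transpose (\<Phi> t ** \<Gamma> s) *v u"
          by (simp add: z_def y_def matrix_transpose_mul matrix_vector_mul_assoc[symmetric]
              del: transpose_matrix_vector)
        finally show "((\<lambda>B. y \<bullet> (B *v y)) \<circ> f) s = noise_form (g s, transpose (\<Phi> t ** \<Gamma> s) *v u)" .
      qed
      finally show ?thesis by (simp only: y_def)
    qed
    have p_cov: "g t = p t ** G" if t: "t \<in> \<rat> \<inter> {0<..}" for t
    proof -
      have "covariance_matrix (\<eta> t \<omega>) = p t"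
      proof (rule symmetric_eqI_inner[OF transpose_covariance_matrix p_sym])
        fix i j :: 'n
        show "(axis i 1 + axis j 1) \<bullet> (covariance_matrix (\<eta> t \<omega>) *v (axis i 1 + axis j 1)) =
            (axis i 1 + axis j 1) \<bullet> (p t *v (axis i 1 + axis j 1))"
          unfolding p_quad using elim(2)[THEN bspec, OF t, THEN spec, of i, THEN spec, of j, THEN spec, of \<Phi>,
              THEN spec, of \<Gamma>, THEN mp] fp unfolding g_def by blast
      qed
      thus ?thesis by (simp add: g_def gain_G)
    qed
    have N': "(N has_vector_derivative f t) (at t within {0..})" if "0 \<le> t" for t
      unfolding N_def using has_vector_derivative_add[OF has_vector_derivative_const
          integral_has_vector_derivative_atLeast[OF fc that], of P0] by simp
    have p': "(p has_vector_derivative ((A - g t ** C) ** p t + p t ** transpose (A - g t ** C) + \<Xi> t)) (at t within {0..})"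
      if t: "0 \<le> t" for t
    proof -
      have "(p has_vector_derivative \<Phi> t ** N t ** transpose ((A - g t ** C) ** \<Phi> t) +
          (\<Phi> t ** f t + ((A - g t ** C) ** \<Phi> t) ** N t) ** transpose (\<Phi> t)) (at t within {0..})"
        unfolding p_def by (intro mmult.has_vector_derivative fundamental_pairD(3)[OF fp t] N' t
            bounded_linear.has_vector_derivative[OF bounded_linear_transpose])
      moreover have "\<Phi> t ** f t ** transpose (\<Phi> t) = \<Xi> t"
      proof -
        have "\<Phi> t ** f t ** transpose (\<Phi> t) = (\<Phi> t ** \<Gamma> t) ** \<Xi> t ** transpose (\<Phi> t ** \<Gamma> t)"
          by (simp add: f_def matrix_transpose_mul matrix_mul_assoc)
        thus ?thesis by (simp add: fundamental_pairD(5)[OF fp t])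
      qed
      ultimately show ?thesis
        by (simp add: p_def mmult.add_left matrix_transpose_mul matrix_mul_assoc algebra_simps)
    qed
    have pc: "continuous_on {0..} p" by (rule continuous_on_has_vector_derivative[OF p']) simp
    \<comment> \<open>What is known to be continuous in time is the gain, not the covariance, so the
      identity is extended in the form multiplied by \<open>G\<close>.\<close>
    have g_eq: "g t = p t ** G" if t: "0 \<le> t" for t
    proof -
      have cl: "closure ({0<..} \<inter> \<rat>) = ({0..} :: real set)"
        by (subst closure_open_Int_superset) (auto simp: Rats_closure_real)
      have "g t - p t ** G = 0"
      proof (rule continuous_constant_on_closure[where f = "\<lambda>t. g t - p t ** G" and S = "{0<..} \<inter> \<rat>"])
        show "continuous_on (closure ({0<..} \<inter> \<rat>)) (\<lambda>t. g t - p t ** G)"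
          unfolding cl by (intro continuous_intros mmult.continuous_on g pc)
        show "g x - p x ** G = 0" if "x \<in> {0<..} \<inter> \<rat>" for x
          using p_cov[of x] that by simp
        show "t \<in> closure ({0<..} \<inter> \<rat>)" unfolding cl using t by simp
      qed
      thus ?thesis by simp
    qed
    have "riccati_solution A S (R1h ** R1h) P0 p"
      unfolding riccati_solution_def
    proof (intro conjI allI impI)
      show "p 0 = P0"
        by (simp add: p_def N_def fundamental_pairD(1)[OF fp])
      fix t :: real assume t: "0 \<le> t"
      show "pos_semidef (p t)"
        unfolding pos_semidef_def p_quad
      proof (intro conjI allI p_sym add_nonneg_nonneg)
        show "0 \<le> (transpose (\<Phi> t) *v x) \<bullet> (P0 *v (transpose (\<Phi> t) *v x))" for x
          using P0 by (simp only: pos_semidef_def)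
        show "0 \<le> integral {0..t} (\<lambda>s. noise_form (g s, transpose (\<Phi> t ** \<Gamma> s) *v x))" for x
        proof (cases "(\<lambda>s. noise_form (g s, transpose (\<Phi> t ** \<Gamma> s) *v x)) integrable_on {0..t}")
          case True
          thus ?thesis by (rule Henstock_Kurzweil_Integration.integral_nonneg) (simp add: noise_form_def)
        qed (simp add: not_integrable_integral)
      qed
      \<comment> \<open>The closed-loop drift contributes \<open>p ** S ** p\<close> twice with a
        minus sign, the observation noise once with a plus sign.\<close>
      have "(A - g t ** C) ** p t + p t ** transpose (A - g t ** C) + \<Xi> t =
          A ** p t + p t ** transpose A - p t ** S ** p t + R1h ** R1h"
      proof -
        have gC: "g t ** C = p t ** S"
          by (simp add: g_eq[OF t] GC[symmetric] matrix_mul_assoc)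
        have "g t ** R2 ** transpose (g t) = p t ** (G ** R2 ** transpose G) ** p t"
          by (simp add: g_eq[OF t] matrix_transpose_mul p_sym matrix_mul_assoc)
        hence X: "\<Xi> t = R1h ** R1h + p t ** S ** p t" by (simp only: \<Xi>_def GRG)
        show ?thesis
          unfolding gC X by (simp add: mmult_distribs p_sym S_sym)
      qed
      with p'[OF t] show "(p has_vector_derivative (A ** p t + p t ** transpose A - p t ** S ** p t + R1h ** R1h)) (at t within {0..})"
        by simp
    qed
    thus ?case
      using g_eq unfolding S_def P0_def G_def R2_def g_def by blast
  qed
qed

text \<open>The existence claim does not involve \<open>\<omega>\<close>, so on a probability space
  its almost sure version is already the claim itself.\<close>

lemma riccati_solution_exists:
  "\<exists>p. riccati_solution A (information_matrix C R2h) (R1h ** R1h) (covariance_matrix (distr M borel (Xb 0))) p"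
proof (rule ccontr)
  assume none: "\<not> ?thesis"
  have "AE \<omega> in M. False"
    using gain_riccati_path by eventually_elim (use none in blast)
  thus False by simp
qed

text \<open>Uniqueness of Riccati solutions removes the dependence of \<open>p\<close> on the path:
  almost surely, the gain is a deterministic function of time.\<close>

lemma gain_riccati:
  assumes p: "riccati_solution A (information_matrix C R2h) (R1h ** R1h) (covariance_matrix (distr M borel (Xb 0))) p"
  shows "AE \<omega> in M. \<forall>t\<ge>0. gain t \<omega> = p t ** (transpose C ** matrix_inv (R2h ** R2h))"
  using gain_riccati_path
proof eventually_elim
  case (elim \<omega>)
  have S: "transpose (information_matrix C R2h) = information_matrix C R2h"
    using information_matrix_psd[OF R2h_sym R2h_inv, of C] by (simp add: pos_semidef_def)
  from elim show ?case using riccati_solution_unique[OF _ p S] by metis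
qed

end

section \<open>Wiener integrals of differentiable kernels\<close>

text \<open>Integration by parts makes the integral of a pair of kernels \<open>f\<close>, \<open>g\<close> with derivatives
  \<open>f'\<close>, \<open>g'\<close> against a pair of paths well defined pathwise.\<close>

definition wiener_integral ::
  "(real \<Rightarrow> real^'n^'k) \<Rightarrow> (real \<Rightarrow> real^'n^'k) \<Rightarrow> (real \<Rightarrow> real^'m^'k) \<Rightarrow> (real \<Rightarrow> real^'m^'k) \<Rightarrow> real \<Rightarrow>
   (real \<Rightarrow> real^'n) \<Rightarrow> (real \<Rightarrow> real^'m) \<Rightarrow> real^'k" where
  "wiener_integral f f' g g' T w v =
    (f T *v w T - f 0 *v w 0 - integral {0..T} (\<lambda>s. f' s *v w s)) +
    (g T *v v T - g 0 *v v 0 - integral {0..T} (\<lambda>s. g' s *v v s))"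

lemma wiener_integral_diff_paths:
  assumes "continuous_on {0..T} f'" "continuous_on {0..T} g'"
    "continuous_on {0..T} w" "continuous_on {0..T} w2" "continuous_on {0..T} v" "continuous_on {0..T} v2"
  shows "wiener_integral f f' g g' T (\<lambda>s. w s - w2 s) (\<lambda>s. v s - v2 s) =
    wiener_integral f f' g g' T w v - wiener_integral f f' g g' T w2 v2"
  unfolding wiener_integral_def mvmult.diff_right
  by (subst (1 2) Henstock_Kurzweil_Integration.integral_diff)
    (auto intro!: integrable_continuous_interval mvmult.continuous_on assms simp: algebra_simps)

lemma wiener_integral_diff_kernels:
  assumes "continuous_on {0..T} f'" "continuous_on {0..T} g'" "continuous_on {0..T} f2'" "continuous_on {0..T} g2'"
    "continuous_on {0..T} w" "continuous_on {0..T} v"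
  shows "wiener_integral (\<lambda>s. f s - f2 s) (\<lambda>s. f' s - f2' s) (\<lambda>s. g s - g2 s) (\<lambda>s. g' s - g2' s) T w v =
    wiener_integral f f' g g' T w v - wiener_integral f2 f2' g2 g2' T w v"
  unfolding wiener_integral_def mvmult.diff_left
  by (subst (1 2) Henstock_Kurzweil_Integration.integral_diff)
    (auto intro!: integrable_continuous_interval mvmult.continuous_on assms simp: algebra_simps)

lemma wiener_integral_measurable:
  fixes f :: "real \<Rightarrow> real^'n^'k" and g :: "real \<Rightarrow> real^'m^'k"
  assumes T: "0 \<le> T" and f': "continuous_on {0..T} f'" and g': "continuous_on {0..T} g'"
    and W: "\<And>s. 0 \<le> s \<Longrightarrow> W s \<in> borel_measurable N" and V: "\<And>s. 0 \<le> s \<Longrightarrow> V s \<in> borel_measurable N"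
    and Wc: "\<And>\<omega>. \<omega> \<in> space N \<Longrightarrow> continuous_on {0..} (\<lambda>s. W s \<omega>)"
    and Vc: "\<And>\<omega>. \<omega> \<in> space N \<Longrightarrow> continuous_on {0..} (\<lambda>s. V s \<omega>)"
  shows "(\<lambda>\<omega>. wiener_integral f f' g g' T (\<lambda>s. W s \<omega>) (\<lambda>s. V s \<omega>)) \<in> borel_measurable N"
proof -
  have "(\<lambda>\<omega>. integral {0..T} (\<lambda>s. f' s *v W s \<omega>)) \<in> borel_measurable N"
    by (rule borel_measurable_integral_process[OF T])
      (auto intro!: borel_measurable_matrix_vector_mult W mvmult.continuous_on f' continuous_on_subset[OF Wc])
  moreover have "(\<lambda>\<omega>. integral {0..T} (\<lambda>s. g' s *v V s \<omega>)) \<in> borel_measurable N"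
    by (rule borel_measurable_integral_process[OF T])
      (auto intro!: borel_measurable_matrix_vector_mult V mvmult.continuous_on g' continuous_on_subset[OF Vc])
  ultimately show ?thesis
    unfolding wiener_integral_def
    by (intro borel_measurable_add borel_measurable_diff borel_measurable_matrix_vector_mult
        borel_measurable_const W V T order_refl)
qed

lemma riemann_stieltjes_uniform:
  fixes f :: "real \<Rightarrow> real^'m^'n" and z :: "real \<Rightarrow> real^'m"
  assumes f: "\<And>t. 0 \<le> t \<Longrightarrow> t \<le> T \<Longrightarrow> (f has_vector_derivative f' t) (at t within {0..T})"
    and f': "continuous_on {0..T} f'" and z: "continuous_on {0..T} z" and T: "0 \<le> T"
    and N: "filterlim N at_top sequentially"
  shows "(\<lambda>n. \<Sum>i<N n. f (grid T (N n) i) *v (z (grid T (N n) (Suc i)) - z (grid T (N n) i)))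
    \<longlonglongrightarrow> f T *v z T - f 0 *v z 0 - integral {0..T} (\<lambda>s. f' s *v z s)"
proof (rule LIMSEQ_I)
  fix e :: real assume e: "0 < e"
  obtain d where d: "0 < d" "\<And>\<tau> N. \<tau> 0 = 0 \<Longrightarrow> \<tau> N = T \<Longrightarrow>
      (\<And>i. i < N \<Longrightarrow> \<tau> i \<le> \<tau> (Suc i) \<and> \<tau> (Suc i) - \<tau> i < d) \<Longrightarrow>
      norm ((\<Sum>i<N. f (\<tau> i) *v (z (\<tau> (Suc i)) - z (\<tau> i))) -
        (f T *v z T - f 0 *v z 0 - integral {0..T} (\<lambda>s. f' s *v z s))) \<le> e / 2"
    by (rule riemann_stieltjes_limit[OF _ f' z T half_gt_zero[OF e]], erule (1) f, rule that, assumption, blast)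
  obtain n0 :: nat where n0: "T / d < real n0" using reals_Archimedean2 by blast
  have "eventually (\<lambda>n. Suc n0 \<le> N n) sequentially"
    using N by (simp add: filterlim_at_top)
  then obtain n1 where n1: "\<And>n. n1 \<le> n \<Longrightarrow> Suc n0 \<le> N n"
    unfolding eventually_sequentially by blast
  show "\<exists>no. \<forall>n\<ge>no. norm ((\<Sum>i<N n. f (grid T (N n) i) *v (z (grid T (N n) (Suc i)) - z (grid T (N n) i))) -
      (f T *v z T - f 0 *v z 0 - integral {0..T} (\<lambda>s. f' s *v z s))) < e"
  proof (intro exI[of _ n1] allI impI)
    fix n assume "n1 \<le> n"
    hence n: "n0 < N n" using n1 by fastforce
    have N0: "0 < N n" using n by linarith
    have "T / d < real (N n)" using n0 n by linarith
    hence step: "T / real (N n) < d" using d(1) N0 by (simp add: field_simps)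
    have "norm ((\<Sum>i<N n. f (grid T (N n) i) *v (z (grid T (N n) (Suc i)) - z (grid T (N n) i))) -
        (f T *v z T - f 0 *v z 0 - integral {0..T} (\<lambda>s. f' s *v z s))) \<le> e / 2"
    proof (rule d(2))
      show "grid T (N n) 0 = 0" "grid T (N n) (N n) = T" using N0 by (simp_all add: grid_simps)
      show "grid T (N n) i \<le> grid T (N n) (Suc i) \<and> grid T (N n) (Suc i) - grid T (N n) i < d" for i
        using grid_bounds(3)[OF T, of i "Suc i"] step by (simp add: grid_simps)
    qed
    thus "norm ((\<Sum>i<N n. f (grid T (N n) i) *v (z (grid T (N n) (Suc i)) - z (grid T (N n) i))) -
      (f T *v z T - f 0 *v z 0 - integral {0..T} (\<lambda>s. f' s *v z s))) < e"
      using e by linarith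
  qed
qed

section \<open>Characteristic functions of Wiener integrals and variation of constants\<close>

lemma brownian_motion_components:
  fixes W :: "real \<Rightarrow> 'w \<Rightarrow> real^'n" and V :: "real \<Rightarrow> 'w \<Rightarrow> real^'m"
  assumes "brownian_motion M (\<lambda>t \<omega>. (W t \<omega>, V t \<omega>))"
  shows "0 \<le> s \<Longrightarrow> W s \<in> borel_measurable (process_sigma M {0..} (\<lambda>t \<omega>. (W t \<omega>, V t \<omega>)))"
    and "0 \<le> s \<Longrightarrow> V s \<in> borel_measurable (process_sigma M {0..} (\<lambda>t \<omega>. (W t \<omega>, V t \<omega>)))"
    and "\<omega> \<in> space M \<Longrightarrow> continuous_on {0..} (\<lambda>s. W s \<omega>)"
    and "\<omega> \<in> space M \<Longrightarrow> continuous_on {0..} (\<lambda>s. V s \<omega>)"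
    and "AE \<omega> in M. W 0 \<omega> = 0 \<and> V 0 \<omega> = 0"
    and "subalgebra M (process_sigma M {0..} (\<lambda>t \<omega>. (W t \<omega>, V t \<omega>)))"
proof -
  let ?N = "process_sigma M {0..} (\<lambda>t \<omega>. (W t \<omega>, V t \<omega>))"
  have cp: "continuous_process M (\<lambda>t \<omega>. (W t \<omega>, V t \<omega>))"
    using assms by (simp add: brownian_motion_def)
  have m: "(\<lambda>\<omega>. (W s \<omega>, V s \<omega>)) \<in> borel_measurable ?N" if "0 \<le> s" for s
    using that by (intro process_sigma_measurable[where Z = "\<lambda>t \<omega>. (W t \<omega>, V t \<omega>)"]) auto
  show "0 \<le> s \<Longrightarrow> W s \<in> borel_measurable ?N" "0 \<le> s \<Longrightarrow> V s \<in> borel_measurable ?N"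
    using borel_measurable_PairD[OF m] by simp_all
  have pc: "continuous_on {0..} (\<lambda>s. (W s \<omega>, V s \<omega>))" if "\<omega> \<in> space M" for \<omega>
    using cp that by (simp add: continuous_process_def)
  show "\<omega> \<in> space M \<Longrightarrow> continuous_on {0..} (\<lambda>s. W s \<omega>)" "\<omega> \<in> space M \<Longrightarrow> continuous_on {0..} (\<lambda>s. V s \<omega>)"
    using continuous_on_fst[OF pc] continuous_on_snd[OF pc] by simp_all
  show "AE \<omega> in M. W 0 \<omega> = 0 \<and> V 0 \<omega> = 0"
    using assms by (simp add: brownian_motion_def zero_prod_def)
  show "subalgebra M ?N"
    by (rule subalgebra_process_sigma) (use cp in \<open>simp add: continuous_process_def\<close>)
qed

text \<open>The integral by parts is a pathwise limit of Riemann sums, whose characteristic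
  functions are known from the Brownian increments; the exponents are in turn Riemann sums of the
  variance integral.\<close>

lemma (in prob_space) wiener_integral_cis:
  fixes f :: "real \<Rightarrow> real^'n^'k" and g :: "real \<Rightarrow> real^'m^'k"
  assumes bm: "brownian_motion M (\<lambda>t \<omega>. (W t \<omega>, V t \<omega>))" and T: "0 \<le> T"
    and f: "\<And>t. 0 \<le> t \<Longrightarrow> t \<le> T \<Longrightarrow> (f has_vector_derivative f' t) (at t within {0..T})"
    and f': "continuous_on {0..T} f'"
    and g: "\<And>t. 0 \<le> t \<Longrightarrow> t \<le> T \<Longrightarrow> (g has_vector_derivative g' t) (at t within {0..T})"
    and g': "continuous_on {0..T} g'"
  shows "(\<integral>\<omega>. cis (u \<bullet> wiener_integral f f' g g' T (\<lambda>s. W s \<omega>) (\<lambda>s. V s \<omega>)) \<partial>M) =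
    complex_of_real (exp (- integral {0..T} (\<lambda>s. (norm (transpose (f s) *v u))\<^sup>2 + (norm (transpose (g s) *v u))\<^sup>2) / 2))"
proof -
  note comp = brownian_motion_components[OF bm]
  note sub = measurable_from_subalg[OF comp(6)]
  define \<tau> where "\<tau> = (\<lambda>n. grid T (Suc n))"
  define w where "w = (\<lambda>s. (transpose (f s) *v u, transpose (g s) *v u))"
  define \<Delta> where "\<Delta> = (\<lambda>n i \<omega>. (W (\<tau> n (Suc i)) \<omega>, V (\<tau> n (Suc i)) \<omega>) - (W (\<tau> n i) \<omega>, V (\<tau> n i) \<omega>))"
  have \<tau>: "0 \<le> \<tau> n i" "\<tau> n i \<le> \<tau> n (Suc i)" "\<tau> n (Suc i) - \<tau> n i = T / real (Suc n)" for n i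
    unfolding \<tau>_def by (rule grid_bounds(1)[OF T], rule grid_bounds(3)[OF T], simp, rule grid_simps(3))
  have Suc_top: "filterlim Suc at_top sequentially" by (rule filterlim_Suc)
  have fc: "continuous_on {0..T} f" "continuous_on {0..T} g"
    by (rule continuous_on_has_vector_derivative, use f g in auto)+
  have path: "(\<lambda>n. \<Sum>i<Suc n. w (\<tau> n i) \<bullet> \<Delta> n i \<omega>) \<longlonglongrightarrow>
      u \<bullet> wiener_integral f f' g g' T (\<lambda>s. W s \<omega>) (\<lambda>s. V s \<omega>)" if om: "\<omega> \<in> space M" for \<omega>
  proof -
    have Wc: "continuous_on {0..T} (\<lambda>s. W s \<omega>)" and Vc: "continuous_on {0..T} (\<lambda>s. V s \<omega>)"
      using continuous_on_subset[OF comp(3)[OF om], of "{0..T}"] continuous_on_subset[OF comp(4)[OF om], of "{0..T}"] by auto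
    have "(\<lambda>n. u \<bullet> ((\<Sum>i<Suc n. f (\<tau> n i) *v (W (\<tau> n (Suc i)) \<omega> - W (\<tau> n i) \<omega>)) +
        (\<Sum>i<Suc n. g (\<tau> n i) *v (V (\<tau> n (Suc i)) \<omega> - V (\<tau> n i) \<omega>)))) \<longlonglongrightarrow>
        u \<bullet> wiener_integral f f' g g' T (\<lambda>s. W s \<omega>) (\<lambda>s. V s \<omega>)"
      unfolding wiener_integral_def \<tau>_def
      by (intro tendsto_inner tendsto_const tendsto_add riemann_stieltjes_uniform[OF f f' Wc T Suc_top]
          riemann_stieltjes_uniform[OF g g' Vc T Suc_top])
    moreover have "u \<bullet> ((\<Sum>i<Suc n. f (\<tau> n i) *v (W (\<tau> n (Suc i)) \<omega> - W (\<tau> n i) \<omega>)) +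
        (\<Sum>i<Suc n. g (\<tau> n i) *v (V (\<tau> n (Suc i)) \<omega> - V (\<tau> n i) \<omega>))) =
        (\<Sum>i<Suc n. w (\<tau> n i) \<bullet> \<Delta> n i \<omega>)" for n
      by (simp only: w_def \<Delta>_def diff_Pair inner_Pair inner_add_right inner_sum_right sum.distrib
          inner_matrix_transpose)
    ultimately show ?thesis by simp
  qed
  have "(\<lambda>n. \<integral>\<omega>. cis (\<Sum>i<Suc n. w (\<tau> n i) \<bullet> \<Delta> n i \<omega>) \<partial>M) \<longlonglongrightarrow>
      (\<integral>\<omega>. cis (u \<bullet> wiener_integral f f' g g' T (\<lambda>s. W s \<omega>) (\<lambda>s. V s \<omega>)) \<partial>M)"
  proof (rule integral_dominated_convergence[where w = "\<lambda>_. 1"])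
    have Wm: "W s \<in> borel_measurable M" "V s \<in> borel_measurable M" if "0 \<le> s" for s
      using sub comp(1,2) that by blast+
    show "(\<lambda>\<omega>. cis (u \<bullet> wiener_integral f f' g g' T (\<lambda>s. W s \<omega>) (\<lambda>s. V s \<omega>))) \<in> borel_measurable M"
      by (intro borel_measurable_cis borel_measurable_inner borel_measurable_const
          wiener_integral_measurable[OF T f' g' Wm comp(3,4)])
    show "(\<lambda>\<omega>. cis (\<Sum>i<Suc n. w (\<tau> n i) \<bullet> \<Delta> n i \<omega>)) \<in> borel_measurable M" for n
      unfolding \<Delta>_def
      by (intro borel_measurable_cis borel_measurable_sum borel_measurable_inner borel_measurable_const
          borel_measurable_diff borel_measurable_Pair Wm \<tau>)
    show "AE \<omega> in M. (\<lambda>n. cis (\<Sum>i<Suc n. w (\<tau> n i) \<bullet> \<Delta> n i \<omega>)) \<longlonglongrightarrow>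
        cis (u \<bullet> wiener_integral f f' g g' T (\<lambda>s. W s \<omega>) (\<lambda>s. V s \<omega>))"
      by (intro AE_I2 tendsto_cis path)
  qed auto
  moreover have "(\<integral>\<omega>. cis (\<Sum>i<Suc n. w (\<tau> n i) \<bullet> \<Delta> n i \<omega>) \<partial>M) =
      complex_of_real (exp (- (\<Sum>i<Suc n. (T / real (Suc n)) *\<^sub>R (norm (w (real i * T / real (Suc n))))\<^sup>2) / 2))" for n
  proof -
    have "(\<integral>\<omega>. cis (\<Sum>i<Suc n. w (\<tau> n i) \<bullet> \<Delta> n i \<omega>) \<partial>M) =
        complex_of_real (exp (- (\<Sum>i<Suc n. (\<tau> n (Suc i) - \<tau> n i) * (norm (w (\<tau> n i)))\<^sup>2) / 2))"
      unfolding \<Delta>_def by (rule brownian_increments_cis[OF bm]) (use \<tau> in auto)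
    thus ?thesis unfolding \<tau>(3) by (simp only: \<tau>_def grid_def real_scaleR_def)
  qed
  moreover have "(\<lambda>n. complex_of_real (exp (- (\<Sum>i<Suc n. (T / real (Suc n)) *\<^sub>R (norm (w (real i * T / real (Suc n))))\<^sup>2) / 2)))
      \<longlonglongrightarrow> complex_of_real (exp (- integral {0..T} (\<lambda>s. (norm (w s))\<^sup>2) / 2))"
  proof -
    have "continuous_on {0..T} (\<lambda>s. (norm (w s))\<^sup>2)"
      unfolding w_def
      by (intro continuous_intros mvmult.continuous_on bounded_linear.continuous_on[OF bounded_linear_transpose] fc)
    from LIMSEQ_Suc[OF riemann_sum_uniform[OF this T]] show ?thesis
      by (intro tendsto_of_real tendsto_exp tendsto_divide tendsto_minus tendsto_const) auto
  qed
  ultimately have "(\<integral>\<omega>. cis (u \<bullet> wiener_integral f f' g g' T (\<lambda>s. W s \<omega>) (\<lambda>s. V s \<omega>)) \<partial>M) =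
      complex_of_real (exp (- integral {0..T} (\<lambda>s. (norm (w s))\<^sup>2) / 2))"
    using LIMSEQ_unique by simp
  thus ?thesis by (simp add: w_def norm_Pair del: transpose_matrix_vector)
qed

text \<open>Variation of constants: \<open>e\<close> is the difference between the diffusion and the signal, and \<open>I\<close>
  is the stochastic integral, written by parts.\<close>

lemma filtering_error_formula:
  fixes e w :: "real \<Rightarrow> real^'n" and v Z :: "real \<Rightarrow> real^'m" and h :: "real \<Rightarrow> real^'m^'n"
    and R1h :: "real^'n^'n" and R2h :: "real^'m^'m"
  assumes fp: "fundamental_pair K \<Phi> \<Gamma>" and K: "\<And>s. 0 \<le> s \<Longrightarrow> K s = A - h s ** C"
    and h: "\<And>s. 0 \<le> s \<Longrightarrow> (h has_vector_derivative h' s) (at s within {0..})" and h': "continuous_on {0..} h'"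
    and e: "continuous_on {0..} e" and w: "continuous_on {0..} w" and v: "continuous_on {0..} v"
    and w0: "w 0 = 0" and v0: "v 0 = 0"
    and e_eq: "\<And>s. 0 \<le> s \<Longrightarrow> e s = e 0 + integral {0..s} (\<lambda>r. A *v e r) + R1h *v w s + I s"
    and I_eq: "\<And>s. 0 \<le> s \<Longrightarrow> I s = h s *v Z s - integral {0..s} (\<lambda>r. h' r *v Z r)"
    and Z_eq: "\<And>s. 0 \<le> s \<Longrightarrow> Z s = - integral {0..s} (\<lambda>r. C *v e r) - R2h *v v s"
    and t: "0 \<le> t"
  shows "e t = \<Phi> t *v e 0 + wiener_integral
      (\<lambda>s. \<Phi> t ** \<Gamma> s ** R1h) (\<lambda>s. \<Phi> t ** - (\<Gamma> s ** K s) ** R1h)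
      (\<lambda>s. - (\<Phi> t ** \<Gamma> s ** h s ** R2h)) (\<lambda>s. - (\<Phi> t ** (\<Gamma> s ** h' s + - (\<Gamma> s ** K s) ** h s) ** R2h)) t w v"
proof -
  define E where "E = (\<lambda>s. integral {0..s} (\<lambda>r. C *v e r))"
  have Ec: "continuous_on {0..} E"
    unfolding E_def by (intro continuous_on_integral_atLeast mvmult.continuous_on continuous_on_const e)
  define Z' where "Z' = (\<lambda>s. - E s - R2h *v v s)"
  have Z'c: "continuous_on {0..} Z'"
    unfolding Z'_def by (intro continuous_intros mvmult.continuous_on Ec v)
  have ZZ: "Z s = Z' s" if "0 \<le> s" for s using Z_eq[OF that] by (simp add: Z'_def E_def)
  \<comment> \<open>Removing the two rough terms leaves a differentiable function, although
    \<open>e\<close>, \<open>w\<close> and \<open>v\<close> are only assumed continuous.\<close>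
  define U where "U = (\<lambda>s. e s - R1h *v w s + (h s ** R2h) *v v s)"
  define U' where "U' = (\<lambda>s. K s *v e s + h' s *v (R2h *v v s))"
  have U_eq: "U s = e 0 + integral {0..s} (\<lambda>r. A *v e r) - h s *v E s - integral {0..s} (\<lambda>r. h' r *v Z' r)"
    if s: "0 \<le> s" for s
  proof -
    have "integral {0..s} (\<lambda>r. h' r *v Z r) = integral {0..s} (\<lambda>r. h' r *v Z' r)"
      by (intro Henstock_Kurzweil_Integration.integral_cong) (use ZZ in auto)
    thus ?thesis
      unfolding U_def e_eq[OF s] I_eq[OF s] ZZ[OF s]
      by (simp add: Z'_def mvmult.diff_right mvmult.minus_right matrix_vector_mul_assoc)
  qed
  have U': "(U has_vector_derivative U' s) (at s within {0..})" if s: "0 \<le> s" for s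
  proof -
    have "((\<lambda>s. e 0 + integral {0..s} (\<lambda>r. A *v e r) - h s *v E s - integral {0..s} (\<lambda>r. h' r *v Z' r))
        has_vector_derivative 0 + A *v e s - (h s *v (C *v e s) + h' s *v E s) - h' s *v Z' s) (at s within {0..})"
      unfolding E_def
      by (intro has_vector_derivative_diff has_vector_derivative_add has_vector_derivative_const
          mvmult.has_vector_derivative h s integral_has_vector_derivative_atLeast mvmult.continuous_on
          continuous_on_const e h' Z'c)
    moreover have "0 + A *v e s - (h s *v (C *v e s) + h' s *v E s) - h' s *v Z' s = U' s"
      by (simp add: U'_def Z'_def K[OF s] mvmult.diff_left mvmult.diff_right mvmult.minus_right
          matrix_vector_mul_assoc[symmetric])
    ultimately have "((\<lambda>s. e 0 + integral {0..s} (\<lambda>r. A *v e r) - h s *v E s - integral {0..s} (\<lambda>r. h' r *v Z' r))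
        has_vector_derivative U' s) (at s within {0..})" by simp
    thus ?thesis
      using s U_eq by (intro has_vector_derivative_transform[of s "{0..}" U]) auto
  qed
  \<comment> \<open>The derivative of \<open>\<Gamma> s *v U s\<close>. The state \<open>e\<close>
    has cancelled and only the two driving paths are left.\<close>
  define F where "F = (\<lambda>s. (\<Gamma> s ** K s ** R1h) *v w s + ((\<Gamma> s ** h' s - \<Gamma> s ** K s ** h s) ** R2h) *v v s)"
  have "((\<lambda>s. \<Gamma> s *v U s) has_vector_derivative F s) (at s within {0..})" if s: "0 \<le> s" for s
  proof -
    have "((\<lambda>s. \<Gamma> s *v U s) has_vector_derivative \<Gamma> s *v U' s + (- (\<Gamma> s ** K s)) *v U s) (at s within {0..})"
      by (intro mvmult.has_vector_derivative fundamental_pairD(4)[OF fp s] U' s)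
    moreover have "\<Gamma> s *v U' s + (- (\<Gamma> s ** K s)) *v U s = F s"
      by (simp add: U'_def U_def F_def mvmult.minus_left mvmult.add_right mvmult.diff_right mvmult.diff_left
          matrix_vector_mul_assoc mmult.diff_left mmult.minus_left matrix_mul_assoc)
    ultimately show ?thesis by simp
  qed
  from vector_derivative_integral[OF this order_refl t]
  have FI: "(F has_integral (\<Gamma> t *v U t - U 0)) {0..t}"
    by (simp add: fundamental_pairD(2)[OF fp])
  have "U 0 = e 0" by (simp add: U_def w0 v0)
  hence "\<Phi> t *v (e 0 + integral {0..t} F) = (\<Phi> t ** \<Gamma> t) *v U t"
    using integral_unique[OF FI] by (simp add: matrix_vector_mul_assoc)
  hence Ut: "U t = \<Phi> t *v e 0 + \<Phi> t *v integral {0..t} F"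
    by (simp add: fundamental_pairD(5)[OF fp t] mvmult.add_right)
  have Kc: "continuous_on {0..} K"
  proof -
    have hc: "continuous_on {0..} h" by (rule continuous_on_has_vector_derivative[OF h]) simp
    have "continuous_on {0..} (\<lambda>s. A - h s ** C)" by (intro continuous_intros mmult.continuous_on hc)
    thus ?thesis by (rule continuous_on_cong[THEN iffD1, rotated 2]) (use K in auto)
  qed
  have hc: "continuous_on {0..} h" by (rule continuous_on_has_vector_derivative[OF h]) simp
  note \<Gamma>c = fundamental_pairD(8)[OF fp]
  have sub: "{0..t} \<subseteq> {0..}" by auto
  let ?f' = "\<lambda>s. \<Phi> t ** - (\<Gamma> s ** K s) ** R1h"
  let ?g' = "\<lambda>s. - (\<Phi> t ** (\<Gamma> s ** h' s + - (\<Gamma> s ** K s) ** h s) ** R2h)"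
  have fi: "(\<lambda>s. ?f' s *v w s) integrable_on {0..t}" "(\<lambda>s. ?g' s *v v s) integrable_on {0..t}"
    by (intro integrable_continuous_interval continuous_on_subset[OF _ sub] mvmult.continuous_on mmult.continuous_on
        continuous_intros \<Gamma>c Kc hc h' w v)+
  have "\<Phi> t *v integral {0..t} F = integral {0..t} ((\<lambda>x. \<Phi> t *v x) \<circ> F)"
    by (rule integral_linear[OF has_integral_integrable[OF FI] mvmult.bounded_linear_right, symmetric])
  also have "(\<lambda>x. \<Phi> t *v x) \<circ> F = (\<lambda>s. - (?f' s *v w s) - (?g' s *v v s))"
    by (simp add: fun_eq_iff F_def mvmult.minus_left mvmult.add_right mvmult.diff_left mvmult.diff_right
        matrix_vector_mul_assoc mmult.diff_left mmult.diff_right mmult.add_left mmult.add_right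
        mmult.minus_left mmult.minus_right matrix_mul_assoc)
  also have "integral {0..t} \<dots> = - integral {0..t} (\<lambda>s. ?f' s *v w s) - integral {0..t} (\<lambda>s. ?g' s *v v s)"
    by (subst Henstock_Kurzweil_Integration.integral_diff[OF integrable_neg[OF fi(1)] fi(2)])
      (simp only: Henstock_Kurzweil_Integration.integral_neg)
  finally have "\<Phi> t *v integral {0..t} F = - integral {0..t} (\<lambda>s. ?f' s *v w s) - integral {0..t} (\<lambda>s. ?g' s *v v s)" .
  \<comment> \<open>Putting the rough terms at time \<open>t\<close> back supplies the boundary
    terms of \<open>wiener_integral\<close>.\<close>
  moreover have "e t = U t + R1h *v w t - (h t ** R2h) *v v t" by (simp add: U_def)
  ultimately show ?thesis
    unfolding wiener_integral_def Ut
    by (simp add: w0 v0 fundamental_pairD(5)[OF fp t] mvmult.minus_left)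
qed

section \<open>The law of a Kalman-Bucy diffusion\<close>

text \<open>The stochastic term of variation of constants: the state noise enters through
  \<open>\<Phi> t ** \<Gamma> s ** R1h\<close>, the observation noise through the gain and with a
  minus sign. The second and fourth kernels are the derivatives in \<open>s\<close> used in the
  integration by parts.\<close>

definition flow_noise ::
  "(real \<Rightarrow> real^'n^'n) \<Rightarrow> (real \<Rightarrow> real^'n^'n) \<Rightarrow> (real \<Rightarrow> real^'n^'n) \<Rightarrow> (real \<Rightarrow> real^'m^'n) \<Rightarrow> (real \<Rightarrow> real^'m^'n) \<Rightarrow>
   real^'n^'n \<Rightarrow> real^'m^'m \<Rightarrow> real \<Rightarrow> (real \<Rightarrow> real^'n) \<Rightarrow> (real \<Rightarrow> real^'m) \<Rightarrow> real^'n" where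
  "flow_noise \<Phi> \<Gamma> K h h' R1h R2h t = wiener_integral
      (\<lambda>s. \<Phi> t ** \<Gamma> s ** R1h) (\<lambda>s. \<Phi> t ** - (\<Gamma> s ** K s) ** R1h)
      (\<lambda>s. - (\<Phi> t ** \<Gamma> s ** h s ** R2h)) (\<lambda>s. - (\<Phi> t ** (\<Gamma> s ** h' s + - (\<Gamma> s ** K s) ** h s) ** R2h)) t"

lemma flow_kernels:
  fixes h :: "real \<Rightarrow> real^'m^'n" and R1h :: "real^'n^'n" and R2h :: "real^'m^'m"
  assumes fp: "fundamental_pair K \<Phi> \<Gamma>" and K: "continuous_on {0..} K"
    and h: "\<And>s. 0 \<le> s \<Longrightarrow> (h has_vector_derivative h' s) (at s within {0..})" and h': "continuous_on {0..} h'"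
  shows "0 \<le> s \<Longrightarrow> ((\<lambda>s. \<Phi> t ** \<Gamma> s ** R1h) has_vector_derivative \<Phi> t ** - (\<Gamma> s ** K s) ** R1h) (at s within {0..t})"
    and "0 \<le> s \<Longrightarrow> ((\<lambda>s. - (\<Phi> t ** \<Gamma> s ** h s ** R2h)) has_vector_derivative
      - (\<Phi> t ** (\<Gamma> s ** h' s + - (\<Gamma> s ** K s) ** h s) ** R2h)) (at s within {0..t})"
    and "continuous_on {0..t} (\<lambda>s. \<Phi> t ** - (\<Gamma> s ** K s) ** R1h)"
    and "continuous_on {0..t} (\<lambda>s. - (\<Phi> t ** (\<Gamma> s ** h' s + - (\<Gamma> s ** K s) ** h s) ** R2h))"
proof -
  have sub: "{0..t} \<subseteq> {0..}" by auto
  have hc: "continuous_on {0..} h" by (rule continuous_on_has_vector_derivative[OF h]) simp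
  note \<Gamma>c = fundamental_pairD(8)[OF fp]
  show "continuous_on {0..t} (\<lambda>s. \<Phi> t ** - (\<Gamma> s ** K s) ** R1h)"
    "continuous_on {0..t} (\<lambda>s. - (\<Phi> t ** (\<Gamma> s ** h' s + - (\<Gamma> s ** K s) ** h s) ** R2h))"
    by (intro continuous_on_subset[OF _ sub] mmult.continuous_on continuous_intros \<Gamma>c K hc h')+
  assume s: "0 \<le> s"
  have "((\<lambda>s. \<Phi> t ** \<Gamma> s ** R1h) has_vector_derivative \<Phi> t ** \<Gamma> s ** 0 + (\<Phi> t ** - (\<Gamma> s ** K s) + 0 ** \<Gamma> s) ** R1h) (at s within {0..})"
    by (intro mmult.has_vector_derivative has_vector_derivative_const fundamental_pairD(4)[OF fp s])
  from has_vector_derivative_within_subset[OF this sub]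
  show "((\<lambda>s. \<Phi> t ** \<Gamma> s ** R1h) has_vector_derivative \<Phi> t ** - (\<Gamma> s ** K s) ** R1h) (at s within {0..t})"
    by simp
  have "((\<lambda>s. - (\<Phi> t ** (\<Gamma> s ** h s) ** R2h)) has_vector_derivative
      - (\<Phi> t ** (\<Gamma> s ** h s) ** 0 + (\<Phi> t ** (\<Gamma> s ** h' s + - (\<Gamma> s ** K s) ** h s) + 0 ** (\<Gamma> s ** h s)) ** R2h)) (at s within {0..})"
    by (intro has_vector_derivative_minus mmult.has_vector_derivative has_vector_derivative_const
        fundamental_pairD(4)[OF fp s] h s)
  from has_vector_derivative_within_subset[OF this sub]
  show "((\<lambda>s. - (\<Phi> t ** \<Gamma> s ** h s ** R2h)) has_vector_derivative
      - (\<Phi> t ** (\<Gamma> s ** h' s + - (\<Gamma> s ** K s) ** h s) ** R2h)) (at s within {0..t})"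
    by (simp add: matrix_mul_assoc)
qed

lemma closure_positive_rationals: "closure ({0<..} \<inter> \<rat>) = ({0..} :: real set)"
  by (subst closure_open_Int_superset) (auto simp: Rats_closure_real)

text \<open>Riccati solution and flow are parameters rather than choices made inside, so that two
  diffusions on the same space can be treated together, each with a flow fixed in advance from its
  initial covariance.\<close>

locale kalman_bucy_riccati = kalman_bucy M A R1h a C c R2h W X V Y Wb Xb Vb \<eta>
  for M :: "'w measure" and A R1h :: "real^'n^'n" and a :: "real^'n" and C :: "real^'n^'m" and c :: "real^'m"
    and R2h :: "real^'m^'m"
    and W X :: "real \<Rightarrow> 'w \<Rightarrow> real^'n" and V Y :: "real \<Rightarrow> 'w \<Rightarrow> real^'m"
    and Wb Xb :: "real \<Rightarrow> 'w \<Rightarrow> real^'n" and Vb :: "real \<Rightarrow> 'w \<Rightarrow> real^'m"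
    and \<eta> :: "real \<Rightarrow> 'w \<Rightarrow> (real^'n) measure" +
  fixes p \<Phi> \<Gamma> :: "real \<Rightarrow> real^'n^'n" and P0 :: "real^'n^'n"
  assumes p: "riccati_solution A (information_matrix C R2h) (R1h ** R1h) P0 p"
    and gain_p: "AE \<omega> in M. \<forall>t\<ge>0. gain t \<omega> = p t ** (transpose C ** matrix_inv (R2h ** R2h))"
    and fp: "fundamental_pair (\<lambda>s. A - p s ** information_matrix C R2h) \<Phi> \<Gamma>"
begin

abbreviation "S \<equiv> information_matrix C R2h"
abbreviation "G \<equiv> transpose C ** matrix_inv (R2h ** R2h)"
abbreviation "h \<equiv> \<lambda>s. p s ** G"
abbreviation "h' \<equiv> \<lambda>s. (A ** p s + p s ** transpose A - p s ** S ** p s + R1h ** R1h) ** G"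
abbreviation "K \<equiv> \<lambda>s. A - p s ** S"
abbreviation "noise \<equiv> flow_noise \<Phi> \<Gamma> K h h' R1h R2h"
abbreviation "signal_sigma \<equiv> process_sigma M {0..} (\<lambda>t \<omega>. (X t \<omega>, Y t \<omega>))"

text \<open>What remains of the diffusion once the contributions of its own initial state and noise
  are removed: the signal, minus the same flow applied to the initial value and the noise of the
  signal.\<close>

definition signal_part :: "real \<Rightarrow> 'w \<Rightarrow> real^'n" where
  "signal_part t \<omega> = X t \<omega> - \<Phi> t *v X 0 \<omega> - noise t (\<lambda>s. W s \<omega>) (\<lambda>s. V s \<omega>)"

lemma K_eq: "K s = A - h s ** C"
  by (simp add: information_matrix_def matrix_mul_assoc)

lemma h_deriv: "0 \<le> s \<Longrightarrow> (h has_vector_derivative h' s) (at s within {0..})"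
  by (rule bounded_linear.has_vector_derivative[OF mmult.bounded_linear_left riccati_solutionD(4)[OF p]])

lemma h_cont: "continuous_on {0..} h"
  by (intro mmult.continuous_on continuous_on_const riccati_solutionD(5)[OF p])

lemma h'_cont: "continuous_on {0..} h'"
  by (intro mmult.continuous_on continuous_intros riccati_solutionD(5)[OF p])

lemmas kernels = flow_kernels[OF fp riccati_solutionD(6)[OF p] h_deriv h'_cont]

lemma bm_signal: "brownian_motion M (\<lambda>t \<omega>. (W t \<omega>, V t \<omega>))"
  and signal_eq: "AE \<omega> in M. \<forall>t\<ge>0. X t \<omega> = X 0 \<omega> + integral {0..t} (\<lambda>s. A *v X s \<omega> + a) + R1h *v W t \<omega> \<and>
        Y t \<omega> = integral {0..t} (\<lambda>s. C *v X s \<omega> + c) + R2h *v V t \<omega>"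
  using model unfolding filtering_model_def by blast+

text \<open>With a deterministic differentiable gain the Riemann sums of the stochastic integral
  converge along every path to the integral by parts \<open>J\<close>, so both agree almost surely.
  In the difference of diffusion and signal the affine terms cancel, and the pathwise formula
  applies.\<close>

lemma error_representation:
  assumes t: "0 \<le> t"
  shows "AE \<omega> in M. Xb t \<omega> = \<Phi> t *v Xb 0 \<omega> + noise t (\<lambda>s. Wb s \<omega>) (\<lambda>s. Vb s \<omega>) + signal_part t \<omega>"
proof -
  let ?Z = "\<lambda>t \<omega>. Y t \<omega> - (integral {0..t} (\<lambda>s. C *v Xb s \<omega> + c) + R2h *v Vb t \<omega>)"
  obtain I where ito: "has_ito_integral M gain ?Z I"
    and eq: "AE \<omega> in M. \<forall>t\<ge>0. Xb t \<omega> = Xb 0 \<omega> + integral {0..t} (\<lambda>s. A *v Xb s \<omega> + a) + R1h *v Wb t \<omega> + I t \<omega>"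
    using diffusion unfolding kalman_bucy_diffusion_def gain_def[abs_def] by blast
  have Zc: "continuous_on {0..} (\<lambda>t. ?Z t \<omega>)" and Ic: "continuous_on {0..} (\<lambda>t. I t \<omega>)" if "\<omega> \<in> space M" for \<omega>
    using ito that by (auto simp: has_ito_integral_def continuous_process_def)
  define J where "J = (\<lambda>t \<omega>. h t *v ?Z t \<omega> - h 0 *v ?Z 0 \<omega> - integral {0..t} (\<lambda>s. h' s *v ?Z s \<omega>))"
  have IJ: "AE \<omega> in M. I T \<omega> = J T \<omega>" if T: "0 < T" for T
  proof -
    obtain N where N: "\<And>m. 0 < N m"
      and sel: "AE \<omega> in M. (\<lambda>m. \<Sum>j\<le>Suc m. norm (I (grid T (Suc m) j) \<omega> - (\<Sum>k<j * N m. gain (grid T (Suc m * N m) k) \<omega> *v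
        (?Z (grid T (Suc m * N m) (Suc k)) \<omega> - ?Z (grid T (Suc m * N m) k) \<omega>)))) \<longlonglongrightarrow> 0"
      by (rule ito_sum_selection[OF ito T]) (rule that[rotated], assumption, blast)
    have "filterlim (\<lambda>m. Suc m * N m) at_top sequentially"
    proof (rule filterlim_at_top_mono[OF filterlim_Suc])
      have "Suc m * 1 \<le> Suc m * N m" for m using N[of m] by (intro mult_le_mono2) simp
      thus "\<forall>\<^sub>F m in sequentially. Suc m \<le> Suc m * N m" by simp
    qed
    note top = this
    show ?thesis
      using sel gain_p AE_space
    proof eventually_elim
      case (elim \<omega>)
      have hT: "(h has_vector_derivative h' s) (at s within {0..T})" if "0 \<le> s" for s
        by (rule has_vector_derivative_within_subset[OF h_deriv[OF that]]) auto
      have sub: "{0..T} \<subseteq> {0..}" by auto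
      have lim: "(\<lambda>m. \<Sum>k<Suc m * N m. h (grid T (Suc m * N m) k) *v
          (?Z (grid T (Suc m * N m) (Suc k)) \<omega> - ?Z (grid T (Suc m * N m) k) \<omega>)) \<longlonglongrightarrow> J T \<omega>"
        unfolding J_def using T
        by (intro riemann_stieltjes_uniform[OF hT _ _ _ top] continuous_on_subset[OF h'_cont sub]
            continuous_on_subset[OF Zc[OF elim(3)] sub]) auto
      have "(\<lambda>m. norm (I T \<omega> - (\<Sum>k<Suc m * N m. h (grid T (Suc m * N m) k) *v
          (?Z (grid T (Suc m * N m) (Suc k)) \<omega> - ?Z (grid T (Suc m * N m) k) \<omega>)))) \<longlonglongrightarrow> 0"
      proof (rule tendsto_sandwich[where f = "\<lambda>_. 0", OF _ _ tendsto_const elim(1)])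
        show "\<forall>\<^sub>F m in sequentially. norm (I T \<omega> - (\<Sum>k<Suc m * N m. h (grid T (Suc m * N m) k) *v
            (?Z (grid T (Suc m * N m) (Suc k)) \<omega> - ?Z (grid T (Suc m * N m) k) \<omega>)))
          \<le> (\<Sum>j\<le>Suc m. norm (I (grid T (Suc m) j) \<omega> - (\<Sum>k<j * N m. gain (grid T (Suc m * N m) k) \<omega> *v
            (?Z (grid T (Suc m * N m) (Suc k)) \<omega> - ?Z (grid T (Suc m * N m) k) \<omega>))))"
        proof (intro always_eventually allI)
          fix m
          have gh: "gain (grid T n k) \<omega> = h (grid T n k)" for n k
            using elim(2) grid_bounds(1)[of T n k] T by auto
          let ?s = "\<lambda>j. norm (I (grid T (Suc m) j) \<omega> - (\<Sum>k<j * N m. gain (grid T (Suc m * N m) k) \<omega> *v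
            (?Z (grid T (Suc m * N m) (Suc k)) \<omega> - ?Z (grid T (Suc m * N m) k) \<omega>)))"
          \<comment> \<open>Of the errors at all coarse points only the last one, at time
            \<open>T\<close>, is wanted here.\<close>
          have "?s (Suc m) \<le> (\<Sum>j\<le>Suc m. ?s j)"
            by (rule member_le_sum) auto
          thus "norm (I T \<omega> - (\<Sum>k<Suc m * N m. h (grid T (Suc m * N m) k) *v
            (?Z (grid T (Suc m * N m) (Suc k)) \<omega> - ?Z (grid T (Suc m * N m) k) \<omega>))) \<le> (\<Sum>j\<le>Suc m. ?s j)"
            unfolding gh grid_simps(2)[OF zero_less_Suc] .
        qed
      qed simp
      hence "(\<lambda>m. \<Sum>k<Suc m * N m. h (grid T (Suc m * N m) k) *v
          (?Z (grid T (Suc m * N m) (Suc k)) \<omega> - ?Z (grid T (Suc m * N m) k) \<omega>)) \<longlonglongrightarrow> I T \<omega>"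
        unfolding norm_minus_commute[of "I T \<omega>"] by (subst LIM_zero_iff[symmetric]) (rule tendsto_norm_zero_cancel)
      from LIMSEQ_unique[OF this lim] show ?case .
    qed
  qed
  \<comment> \<open>The identity is known almost surely at each fixed positive time; rational times
    and continuity of both sides give one event on which it holds at all times.\<close>
  have "countable ({0<..} \<inter> (\<rat> :: real set))" using countable_rat by (rule countable_subset[rotated]) auto
  hence "AE \<omega> in M. \<forall>T\<in>{0<..} \<inter> \<rat>. I T \<omega> = J T \<omega>"
    using IJ by (subst AE_ball_countable) auto
  with eq signal_eq brownian_motion_components(5)[OF bm] brownian_motion_components(5)[OF bm_signal] AE_space
  show ?thesis
  proof eventually_elim
    case (elim \<omega>)
    note om = elim(5)
    let ?W = "\<lambda>s. W s \<omega>" and ?V = "\<lambda>s. V s \<omega>" and ?Wb = "\<lambda>s. Wb s \<omega>" and ?Vb = "\<lambda>s. Vb s \<omega>"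
    have cont: "continuous_on {0..} ?W" "continuous_on {0..} ?V" "continuous_on {0..} ?Wb" "continuous_on {0..} ?Vb"
      "continuous_on {0..} (\<lambda>s. X s \<omega>)" "continuous_on {0..} (\<lambda>s. Xb s \<omega>)"
      using brownian_motion_components(3,4)[OF bm om] brownian_motion_components(3,4)[OF bm_signal om] Xb_path[OF om]
        X_cont om by (auto simp: continuous_process_def)
    have sub: "{0..s} \<subseteq> {0..}" for s :: real by auto
    have Xe: "X s \<omega> = X 0 \<omega> + integral {0..s} (\<lambda>r. A *v X r \<omega> + a) + R1h *v W s \<omega>"
      "Y s \<omega> = integral {0..s} (\<lambda>r. C *v X r \<omega> + c) + R2h *v V s \<omega>" if "0 \<le> s" for s
      using elim(2) that by blast+
    have Z0: "?Z 0 \<omega> = 0" using Xe(2)[of 0] elim(3,4) by simp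
    have Jc: "continuous_on {0..} (\<lambda>t. J t \<omega>)"
      unfolding J_def
      by (intro continuous_intros mvmult.continuous_on h_cont Zc[OF om] continuous_on_integral_atLeast h'_cont)
    have I_eq: "I s \<omega> = h s *v ?Z s \<omega> - integral {0..s} (\<lambda>r. h' r *v ?Z r \<omega>)" if s: "0 \<le> s" for s
    proof -
      have "I s \<omega> - J s \<omega> = 0"
      proof (rule continuous_constant_on_closure[where f = "\<lambda>s. I s \<omega> - J s \<omega>" and S = "{0<..} \<inter> \<rat>"])
        show "continuous_on (closure ({0<..} \<inter> \<rat>)) (\<lambda>s. I s \<omega> - J s \<omega>)"
          unfolding closure_positive_rationals by (intro continuous_intros Ic[OF om] Jc)
        show "I x \<omega> - J x \<omega> = 0" if "x \<in> {0<..} \<inter> \<rat>" for x using elim(6) that by auto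
        show "s \<in> closure ({0<..} \<inter> \<rat>)" unfolding closure_positive_rationals using s by simp
      qed
      hence "I s \<omega> = J s \<omega>" by simp
      thus ?thesis unfolding J_def Z0 mvmult.zero_right diff_zero .
    qed
    define e where "e = (\<lambda>s. Xb s \<omega> - X s \<omega>)"
    define w where "w = (\<lambda>s. Wb s \<omega> - W s \<omega>)"
    define v where "v = (\<lambda>s. Vb s \<omega> - V s \<omega>)"
    have ints: "(\<lambda>r. B *v X r \<omega> + b) integrable_on {0..s}" "(\<lambda>r. B *v Xb r \<omega> + b) integrable_on {0..s}"
      for B :: "real^'n^'k" and b s
      by (intro integrable_continuous_interval continuous_intros mvmult.continuous_on
          continuous_on_subset[OF cont(5) sub] continuous_on_subset[OF cont(6) sub])+
    have int_diff: "integral {0..s} (\<lambda>r. B *v Xb r \<omega> + b) - integral {0..s} (\<lambda>r. B *v X r \<omega> + b) = integral {0..s} (\<lambda>r. B *v e r)"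
      for B :: "real^'n^'k" and b s
      by (subst Henstock_Kurzweil_Integration.integral_diff[OF ints(2,1), symmetric]) (simp add: e_def mvmult.diff_right)
    have "e t = \<Phi> t *v e 0 + noise t w v"
      unfolding flow_noise_def
    proof (rule filtering_error_formula[OF fp K_eq h_deriv h'_cont _ _ _ _ _ _ I_eq _ t])
      show "continuous_on {0..} e" "continuous_on {0..} w" "continuous_on {0..} v"
        unfolding e_def w_def v_def by (intro continuous_intros cont)+
      show "w 0 = 0" "v 0 = 0" using elim(3,4) by (simp_all add: w_def v_def)
      fix s :: real assume s: "0 \<le> s"
      show "e s = e 0 + integral {0..s} (\<lambda>r. A *v e r) + R1h *v w s + I s \<omega>"
        unfolding int_diff[symmetric, of _ _ a] using elim(1)[THEN spec, THEN mp, OF s] Xe(1)[OF s]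
        by (simp add: e_def w_def mvmult.diff_right algebra_simps)
      show "?Z s \<omega> = - integral {0..s} (\<lambda>r. C *v e r) - R2h *v v s"
        unfolding int_diff[symmetric, of _ _ c] Xe(2)[OF s]
        by (simp add: v_def mvmult.diff_right algebra_simps)
    qed
    \<comment> \<open>The driving paths are differences, so linearity separates the noise of the
      diffusion from that of the signal, which becomes part of \<open>signal_part\<close>.\<close>
    also have "noise t w v = noise t ?Wb ?Vb - noise t ?W ?V"
      unfolding flow_noise_def w_def v_def
      by (intro wiener_integral_diff_paths kernels continuous_on_subset[OF cont(1) sub] continuous_on_subset[OF cont(2) sub]
          continuous_on_subset[OF cont(3) sub] continuous_on_subset[OF cont(4) sub])
    finally show ?case
      by (simp add: e_def signal_part_def mvmult.diff_right algebra_simps)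
  qed
qed

section \<open>Measurability, independence and laws of the summands\<close>

lemma noise_measurable_path:
  assumes "0 \<le> t" "\<And>s. 0 \<le> s \<Longrightarrow> W' s \<in> borel_measurable N" "\<And>s. 0 \<le> s \<Longrightarrow> V' s \<in> borel_measurable N"
    "\<And>\<omega>. \<omega> \<in> space N \<Longrightarrow> continuous_on {0..} (\<lambda>s. W' s \<omega>)"
    "\<And>\<omega>. \<omega> \<in> space N \<Longrightarrow> continuous_on {0..} (\<lambda>s. V' s \<omega>)"
  shows "(\<lambda>\<omega>. noise t (\<lambda>s. W' s \<omega>) (\<lambda>s. V' s \<omega>)) \<in> borel_measurable N"
  unfolding flow_noise_def by (intro wiener_integral_measurable kernels assms)

lemma noise_cis:
  assumes bm': "brownian_motion M (\<lambda>t \<omega>. (W' t \<omega>, V' t \<omega>))" and t: "0 \<le> t"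
  shows "(\<integral>\<omega>. cis (u \<bullet> noise t (\<lambda>s. W' s \<omega>) (\<lambda>s. V' s \<omega>)) \<partial>M) =
    complex_of_real (exp (- integral {0..t} (\<lambda>s. (norm (transpose (\<Phi> t ** \<Gamma> s ** R1h) *v u))\<^sup>2 +
      (norm (transpose (- (\<Phi> t ** \<Gamma> s ** h s ** R2h)) *v u))\<^sup>2) / 2))"
  unfolding flow_noise_def by (rule wiener_integral_cis[OF bm' t kernels(1) kernels(3) kernels(2) kernels(4)])

text \<open>Independence is available from the pair \<open>(X, Y)\<close>, whereas
  \<open>signal_part\<close> is written with \<open>W\<close> and \<open>V\<close>. As
  \<open>R1h\<close> and \<open>R2h\<close> are invertible, both noises are recovered from signal
  and observation outside a null set, by expressions that are measurable for
  \<open>signal_sigma\<close>.\<close>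

lemma signal_part_version:
  assumes t: "0 \<le> t"
  obtains O' where "O' \<in> borel_measurable signal_sigma" "AE \<omega> in M. signal_part t \<omega> = O' \<omega>"
proof -
  have XYm: "(\<lambda>\<omega>. (X s \<omega>, Y s \<omega>)) \<in> borel_measurable signal_sigma" if "0 \<le> s" for s
    using that by (intro process_sigma_measurable[where Z = "\<lambda>t \<omega>. (X t \<omega>, Y t \<omega>)"]) auto
  note Xm = borel_measurable_PairD(1)[OF XYm] and Ym = borel_measurable_PairD(2)[OF XYm]
  have Xp: "continuous_on {0..} (\<lambda>s. X s \<omega>)" and Yp: "continuous_on {0..} (\<lambda>s. Y s \<omega>)" if "\<omega> \<in> space M" for \<omega>
    using X_cont Y_cont that by (auto simp: continuous_process_def)
  have sub: "{0..s} \<subseteq> {0..}" for s :: real by auto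
  define W' where "W' = (\<lambda>s \<omega>. matrix_inv R1h *v (X s \<omega> - X 0 \<omega> - integral {0..s} (\<lambda>r. A *v X r \<omega> + a)))"
  define V' where "V' = (\<lambda>s \<omega>. matrix_inv R2h *v (Y s \<omega> - integral {0..s} (\<lambda>r. C *v X r \<omega> + c)))"
  have im: "(\<lambda>\<omega>. integral {0..s} (\<lambda>r. B *v X r \<omega> + b)) \<in> borel_measurable signal_sigma" if s: "0 \<le> s"
    for s and B :: "real^'n^'k" and b
    by (rule borel_measurable_integral_process[OF s])
      (auto intro!: borel_measurable_add borel_measurable_matrix_vector_mult Xm continuous_intros mvmult.continuous_on
        continuous_on_subset[OF Xp sub])
  have ic: "continuous_on {0..} (\<lambda>s. integral {0..s} (\<lambda>r. B *v X r \<omega> + b))" if "\<omega> \<in> space M"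
    for \<omega> and B :: "real^'n^'k" and b
    by (intro continuous_on_integral_atLeast continuous_intros mvmult.continuous_on Xp that)
  have W'm: "W' s \<in> borel_measurable signal_sigma" and V'm: "V' s \<in> borel_measurable signal_sigma" if "0 \<le> s" for s
    unfolding W'_def V'_def
    by (intro borel_measurable_matrix_vector_mult borel_measurable_const borel_measurable_diff Xm Ym im that order_refl)+
  have W'c: "continuous_on {0..} (\<lambda>s. W' s \<omega>)" and V'c: "continuous_on {0..} (\<lambda>s. V' s \<omega>)"
    if "\<omega> \<in> space signal_sigma" for \<omega>
  proof -
    from that have om: "\<omega> \<in> space M" by (simp only: space_process_sigma)
    show "continuous_on {0..} (\<lambda>s. W' s \<omega>)" "continuous_on {0..} (\<lambda>s. V' s \<omega>)"
      unfolding W'_def V'_def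
      by (intro mvmult.continuous_on continuous_intros Xp[OF om] Yp[OF om] ic[OF om])+
  qed
  define O' where "O' = (\<lambda>\<omega>. X t \<omega> - \<Phi> t *v X 0 \<omega> - noise t (\<lambda>s. W' s \<omega>) (\<lambda>s. V' s \<omega>))"
  show ?thesis
  proof (rule that[of O'])
    show "O' \<in> borel_measurable signal_sigma"
      unfolding O'_def
      by (intro borel_measurable_diff borel_measurable_matrix_vector_mult borel_measurable_const Xm t order_refl
          noise_measurable_path W'm V'm W'c V'c)
    show "AE \<omega> in M. signal_part t \<omega> = O' \<omega>"
      using signal_eq
    proof eventually_elim
      case (elim \<omega>)
      have WW: "W' s \<omega> = W s \<omega>" and VV: "V' s \<omega> = V s \<omega>" if s: "0 \<le> s" for s
      proof -
        have "X s \<omega> - X 0 \<omega> - integral {0..s} (\<lambda>r. A *v X r \<omega> + a) = R1h *v W s \<omega>"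
          using elim[THEN spec, THEN mp, OF s] by (simp add: algebra_simps)
        thus "W' s \<omega> = W s \<omega>"
          by (simp add: W'_def matrix_vector_mul_assoc matrix_inv_inverse(2)[OF R1h_inv])
        have "Y s \<omega> - integral {0..s} (\<lambda>r. C *v X r \<omega> + c) = R2h *v V s \<omega>"
          using elim[THEN spec, THEN mp, OF s] by (simp add: algebra_simps)
        thus "V' s \<omega> = V s \<omega>"
          by (simp add: V'_def matrix_vector_mul_assoc matrix_inv_inverse(2)[OF R2h_inv])
      qed
      have "wiener_integral f f' g g' t (\<lambda>s. W' s \<omega>) (\<lambda>s. V' s \<omega>) = wiener_integral f f' g g' t (\<lambda>s. W s \<omega>) (\<lambda>s. V s \<omega>)"
        for f f' :: "real \<Rightarrow> real^'n^'n" and g g' :: "real \<Rightarrow> real^'m^'n"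
        unfolding wiener_integral_def
        by (intro arg_cong2[where f = "(+)"] arg_cong2[where f = "(-)"] Henstock_Kurzweil_Integration.integral_cong)
          (simp_all add: WW VV t)
      thus ?case by (simp add: signal_part_def O'_def flow_noise_def)
    qed
  qed
qed

lemma signal_part_measurable:
  assumes t: "0 \<le> t"
  shows "signal_part t \<in> borel_measurable M"
proof -
  note comp = brownian_motion_components[OF bm_signal]
  have "(\<lambda>\<omega>. noise t (\<lambda>s. W s \<omega>) (\<lambda>s. V s \<omega>)) \<in> borel_measurable M"
    by (intro noise_measurable_path t measurable_from_subalg[OF comp(6) comp(1)]
        measurable_from_subalg[OF comp(6) comp(2)] comp(3,4))
  thus ?thesis
    unfolding signal_part_def[abs_def]
    by (intro borel_measurable_diff borel_measurable_matrix_vector_mult borel_measurable_const X_measurable t) auto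
qed

lemma bm_noise_subset: "sets (process_sigma M {0..} (\<lambda>t \<omega>. (Wb t \<omega>, Vb t \<omega>))) \<subseteq> sets noise_sigma"
  by (rule sets_process_sigma_subset) (auto intro!: borel_measurable_Pair noise_measurable)

lemma indep_bm_signal:
  "indep_set (sets (process_sigma M {0..} (\<lambda>t \<omega>. (Wb t \<omega>, Vb t \<omega>)))) (sets signal_sigma)"
  using indep_signal bm_noise_subset unfolding indep_sets2_eq by blast

text \<open>The law at time \<open>t\<close> does not change when the initial state and the noise are replaced by others
  with the same laws; this is what permits to couple two diffusions.\<close>

lemma law_representation:
  fixes Q :: "'q measure" and Z :: "'q \<Rightarrow> real^'n"
  assumes Q: "prob_space Q" and Z: "Z \<in> borel_measurable Q" and law: "distr Q borel Z = distr M borel (Xb 0)"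
    and bm': "brownian_motion M (\<lambda>t \<omega>. (W' t \<omega>, V' t \<omega>))"
    and ind': "indep_set (sets (process_sigma M {0..} (\<lambda>t \<omega>. (W' t \<omega>, V' t \<omega>)))) (sets signal_sigma)"
    and t: "0 \<le> t"
  defines "x \<equiv> \<lambda>z. \<Phi> t *v Z (fst z) + noise t (\<lambda>s. W' s (snd z)) (\<lambda>s. V' s (snd z)) + signal_part t (snd z)"
  shows "x \<in> borel_measurable (Q \<Otimes>\<^sub>M M)" "distr (Q \<Otimes>\<^sub>M M) borel x = distr M borel (Xb t)"
proof -
  interpret Q: prob_space Q by fact
  interpret QM: pair_prob_space Q M ..
  note comp = brownian_motion_components[OF bm']
  let ?n = "\<lambda>\<omega>. noise t (\<lambda>s. W' s \<omega>) (\<lambda>s. V' s \<omega>)"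
  let ?nb = "\<lambda>\<omega>. noise t (\<lambda>s. Wb s \<omega>) (\<lambda>s. Vb s \<omega>)"
  have nm': "?n \<in> borel_measurable (process_sigma M {0..} (\<lambda>t \<omega>. (W' t \<omega>, V' t \<omega>)))"
    using comp(1-4) t by (intro noise_measurable_path) auto
  have nm: "?n \<in> borel_measurable M" by (rule measurable_from_subalg[OF comp(6) nm'])
  have om: "signal_part t \<in> borel_measurable M" by (rule signal_part_measurable[OF t])
  show xm: "x \<in> borel_measurable (Q \<Otimes>\<^sub>M M)"
    unfolding x_def
    by (intro borel_measurable_add borel_measurable_matrix_vector_mult borel_measurable_const
        measurable_compose[OF measurable_fst Z] measurable_compose[OF measurable_snd nm] measurable_compose[OF measurable_snd om])
  obtain O' where O': "O' \<in> borel_measurable signal_sigma" and OO: "AE \<omega> in M. signal_part t \<omega> = O' \<omega>"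
    by (rule signal_part_version[OF t])
  have O'm: "O' \<in> borel_measurable M"
    using indep_setD_ev2[OF indep_signal] O' by (intro measurable_from_subalg[of M signal_sigma]) (auto simp: subalgebra_def)
  show "distr (Q \<Otimes>\<^sub>M M) borel x = distr M borel (Xb t)"
  proof (rule char_multivariate_unique)
    show "prob_space (distr (Q \<Otimes>\<^sub>M M) borel x)" by (rule QM.prob_space_distr[OF xm])
    show "prob_space (distr M borel (Xb t))" by (rule prob_space_distr[OF Xb_measurable[OF t]])
    fix u
    define y where "y = transpose (\<Phi> t) *v u"
    have y: "u \<bullet> (\<Phi> t *v z) = y \<bullet> z" for z by (simp add: y_def inner_matrix_transpose del: transpose_matrix_vector)
    \<comment> \<open>Exchanges \<open>signal_part\<close> for the version measurable for
      \<open>signal_sigma\<close>, to which independence applies.\<close>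
    have AEO: "(\<integral>\<omega>. cis (f \<omega> + u \<bullet> signal_part t \<omega>) \<partial>M) = (\<integral>\<omega>. cis (f \<omega> + u \<bullet> O' \<omega>) \<partial>M)"
      if [measurable]: "f \<in> borel_measurable M" for f
      using O'm om by (intro integral_cong_AE) (use OO in auto)
    have ZX: "(\<integral>z. cis (y \<bullet> Z z) \<partial>Q) = (\<integral>\<omega>. cis (y \<bullet> Xb 0 \<omega>) \<partial>M)"
      using arg_cong[OF law, of "\<lambda>N. \<integral>z. cis (y \<bullet> z) \<partial>N"] Z Xb_measurable[OF order_refl]
      by (simp add: integral_distr)
    have ind1: "indep_var borel (\<lambda>\<omega>. u \<bullet> ?n \<omega>) borel (\<lambda>\<omega>. u \<bullet> O' \<omega>)"
      by (rule indep_var_of_indep_set[OF ind'])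
        (auto intro!: borel_measurable_inner borel_measurable_const nm' O')
    \<comment> \<open>The initial state separates by Fubini on the product space, the noise from the
      signal part by independence under \<open>M\<close>.\<close>
    have left: "(\<integral>z. cis (u \<bullet> x z) \<partial>(Q \<Otimes>\<^sub>M M)) = (\<integral>\<omega>. cis (y \<bullet> Xb 0 \<omega>) \<partial>M) * ((\<integral>\<omega>. cis (u \<bullet> ?n \<omega>) \<partial>M) * (\<integral>\<omega>. cis (u \<bullet> O' \<omega>) \<partial>M))"
    proof -
      have split: "cis (u \<bullet> x z) = cis (y \<bullet> Z (fst z)) * cis (u \<bullet> ?n (snd z) + u \<bullet> signal_part t (snd z))" for z
        by (simp add: x_def inner_add_right y cis_mult add.assoc)
      have cm: "(\<lambda>z. cis (u \<bullet> x z)) \<in> borel_measurable (Q \<Otimes>\<^sub>M M)"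
        using xm by measurable
      have int: "integrable (Q \<Otimes>\<^sub>M M) (\<lambda>z. cis (u \<bullet> x z))"
        by (rule QM.integrable_const_bound[of _ 1]) (use cm in auto)
      have "(\<integral>z. cis (u \<bullet> x z) \<partial>(Q \<Otimes>\<^sub>M M)) = (\<integral>z. (\<integral>\<omega>. cis (u \<bullet> x (z, \<omega>)) \<partial>M) \<partial>Q)"
        by (rule QM.integral_fst'[OF int, symmetric])
      also have "\<dots> = (\<integral>z. cis (y \<bullet> Z z) \<partial>Q) * (\<integral>\<omega>. cis (u \<bullet> ?n \<omega> + u \<bullet> signal_part t \<omega>) \<partial>M)"
        unfolding split fst_conv snd_conv integral_mult_right_zero integral_mult_left_zero ..
      also have "(\<integral>\<omega>. cis (u \<bullet> ?n \<omega> + u \<bullet> signal_part t \<omega>) \<partial>M) = (\<integral>\<omega>. cis (u \<bullet> ?n \<omega> + u \<bullet> O' \<omega>) \<partial>M)"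
        by (rule AEO) (use nm in simp)
      finally show ?thesis unfolding ZX integral_cis_add[OF ind1] .
    qed
    have nb: "?nb \<in> borel_measurable (process_sigma M {0..} (\<lambda>t \<omega>. (Wb t \<omega>, Vb t \<omega>)))"
      using brownian_motion_components(1-4)[OF bm] t by (intro noise_measurable_path) auto
    have subn: "subalgebra noise_sigma (process_sigma M {0..} (\<lambda>t \<omega>. (Wb t \<omega>, Vb t \<omega>)))"
      using bm_noise_subset by (simp add: subalgebra_def)
    have nbn: "?nb \<in> borel_measurable noise_sigma" by (rule measurable_from_subalg[OF subn nb])
    have Xn: "Xb 0 \<in> borel_measurable noise_sigma" by (rule noise_measurable(3)[OF order_refl])
    have ind2: "indep_var borel (\<lambda>\<omega>. y \<bullet> Xb 0 \<omega> + u \<bullet> ?nb \<omega>) borel (\<lambda>\<omega>. u \<bullet> O' \<omega>)"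
      by (rule indep_var_of_indep_set[OF indep_signal])
        (auto intro!: borel_measurable_inner borel_measurable_add borel_measurable_const nbn Xn O')
    have ind3: "indep_var borel (\<lambda>\<omega>. y \<bullet> Xb 0 \<omega>) borel (\<lambda>\<omega>. u \<bullet> ?nb \<omega>)"
      by (rule indep_var_of_indep_set[OF indep_init])
        (auto intro!: borel_measurable_inner borel_measurable_const nb process_sigma_measurable)
    have "(\<integral>\<omega>. cis (u \<bullet> Xb t \<omega>) \<partial>M) = (\<integral>\<omega>. cis (y \<bullet> Xb 0 \<omega> + u \<bullet> ?nb \<omega> + u \<bullet> O' \<omega>) \<partial>M)"
    proof (rule integral_cong_AE)
      show "AE \<omega> in M. cis (u \<bullet> Xb t \<omega>) = cis (y \<bullet> Xb 0 \<omega> + u \<bullet> ?nb \<omega> + u \<bullet> O' \<omega>)"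
        using error_representation[OF t] OO
        by eventually_elim (simp add: inner_add_right y)
      show "(\<lambda>\<omega>. cis (u \<bullet> Xb t \<omega>)) \<in> borel_measurable M"
        using Xb_measurable[OF t] by measurable
      show "(\<lambda>\<omega>. cis (y \<bullet> Xb 0 \<omega> + u \<bullet> ?nb \<omega> + u \<bullet> O' \<omega>)) \<in> borel_measurable M"
        by (intro borel_measurable_cis borel_measurable_add borel_measurable_inner borel_measurable_const O'm
            measurable_from_subalg[OF subalgebra_noise nbn] Xb_measurable order_refl)
    qed
    also have "\<dots> = (\<integral>\<omega>. cis (y \<bullet> Xb 0 \<omega>) \<partial>M) * (\<integral>\<omega>. cis (u \<bullet> ?nb \<omega>) \<partial>M) * (\<integral>\<omega>. cis (u \<bullet> O' \<omega>) \<partial>M)"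
      unfolding integral_cis_add[OF ind2] integral_cis_add[OF ind3] ..
    also have "(\<integral>\<omega>. cis (u \<bullet> ?nb \<omega>) \<partial>M) = (\<integral>\<omega>. cis (u \<bullet> ?n \<omega>) \<partial>M)"
      unfolding noise_cis[OF bm t] noise_cis[OF bm' t] ..
    finally have right: "(\<integral>\<omega>. cis (u \<bullet> Xb t \<omega>) \<partial>M) =
        (\<integral>\<omega>. cis (y \<bullet> Xb 0 \<omega>) \<partial>M) * (\<integral>\<omega>. cis (u \<bullet> ?n \<omega>) \<partial>M) * (\<integral>\<omega>. cis (u \<bullet> O' \<omega>) \<partial>M)" .
    have "(\<integral>z. cis (u \<bullet> x z) \<partial>(Q \<Otimes>\<^sub>M M)) = (\<integral>\<omega>. cis (u \<bullet> Xb t \<omega>) \<partial>M)"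
      unfolding left right by (simp only: mult.assoc)
    thus "(\<integral>z. cis (u \<bullet> z) \<partial>distr (Q \<Otimes>\<^sub>M M) borel x) = (\<integral>z. cis (u \<bullet> z) \<partial>distr M borel (Xb t))"
      using xm Xb_measurable[OF t] by (simp add: integral_distr)
  qed simp_all
qed

end

section \<open>Coupling two Kalman-Bucy diffusions\<close>

text \<open>The sum is at most five times the largest of the norms, and the power of that norm is
  among the summands on the right. Five is the number of terms in the difference of the coupled
  states.\<close>

lemma norm_sum_five_power_le:
  fixes a b c d e :: "'a::real_normed_vector"
  shows "norm (a + (b - c) + (d - e)) ^ m \<le> 5 ^ m * (norm a ^ m + norm b ^ m + norm c ^ m + norm d ^ m + norm e ^ m)"
proof -
  define F where "F = {norm a, norm b, norm c, norm d, norm e}"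
  have F: "finite F" "F \<noteq> {}" by (auto simp: F_def)
  have le: "norm a \<le> Max F" "norm b \<le> Max F" "norm c \<le> Max F" "norm d \<le> Max F" "norm e \<le> Max F"
    by (rule Max_ge[OF F(1)], simp add: F_def)+
  have "norm (a + (b - c) + (d - e)) \<le> norm (a + (b - c)) + norm (d - e)"
    by (rule norm_triangle_ineq)
  also have "\<dots> \<le> norm a + norm (b - c) + norm (d - e)"
    by (intro add_mono norm_triangle_ineq order_refl)
  also have "\<dots> \<le> norm a + (norm b + norm c) + (norm d + norm e)"
    by (intro add_mono norm_triangle_ineq4 order_refl)
  also have "\<dots> \<le> 5 * Max F"
    using le by linarith
  finally have "norm (a + (b - c) + (d - e)) ^ m \<le> (5 * Max F) ^ m"
    by (intro power_mono) auto
  moreover have "Max F ^ m \<le> norm a ^ m + norm b ^ m + norm c ^ m + norm d ^ m + norm e ^ m"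
  proof -
    have n: "0 \<le> norm x ^ m" for x :: 'a by simp
    have "Max F \<in> F" by (rule Max_in[OF F])
    then obtain x where x: "Max F = norm x" "x \<in> {a, b, c, d, e}" by (auto simp: F_def)
    show ?thesis using x(2) n[of a] n[of b] n[of c] n[of d] n[of e] unfolding x(1) by auto
  qed
  ultimately show ?thesis
    unfolding power_mult_distrib by (rule order_trans[OF _ mult_left_mono]) simp
qed

lemma ennreal_root_mono: "0 < m \<Longrightarrow> x \<le> y \<Longrightarrow> ennreal_root m x \<le> ennreal_root m y"
  by (auto simp: ennreal_root_def top_unique intro!: ennreal_leI real_root_le_mono enn2real_mono simp: less_top)

text \<open>A bound for \<open>m\<close>-th powers becomes one for distances: powers are
  superadditive on nonnegative numbers, and \<open>x + b * d \<le> (1 + b) * (x + d)\<close> frees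
  \<open>d\<close> of its coefficient. For infinite \<open>J\<close> the right-hand side is
  infinite.\<close>

lemma ennreal_root_bound:
  assumes I: "I \<le> ennreal (q ^ m) * (J + ennreal ((b * d) ^ m))" and q: "0 < q" and b: "0 \<le> b" and d: "0 \<le> d"
    and m: "0 < m"
  shows "ennreal_root m I \<le> ennreal (q * (1 + b)) * (ennreal_root m J + ennreal d)"
proof (cases J)
  case top
  have "0 < q * (1 + b)" using q b by (intro mult_pos_pos) auto
  hence "ennreal (q * (1 + b)) * (ennreal_root m J + ennreal d) = \<top>"
    using q b by (simp add: top ennreal_root_def ennreal_mult_eq_top_iff)
  thus ?thesis by simp
next
  case (real j)
  define x where "x = root m j"
  have x: "0 \<le> x" "j = x ^ m" using real(1) m by (simp_all add: x_def)
  have bd: "0 \<le> b * d" using b d by simp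
  have sum: "x ^ m + (b * d) ^ m \<le> (x + b * d) ^ m"
  proof -
    obtain k where k: "m = Suc k" using m by (cases m) auto
    have "x ^ m + (b * d) ^ m \<le> x * (x + b * d) ^ k + (b * d) * (x + b * d) ^ k"
      unfolding k power_Suc using x(1) bd by (intro add_mono mult_left_mono power_mono) auto
    thus ?thesis unfolding k power_Suc by (simp add: distrib_right)
  qed
  have "ennreal (q ^ m) * (J + ennreal ((b * d) ^ m)) = ennreal (q ^ m * (x ^ m + (b * d) ^ m))"
    using q x bd by (simp add: real(2) ennreal_mult' ennreal_plus[symmetric] del: ennreal_plus)
  also have "\<dots> \<le> ennreal ((q * (x + b * d)) ^ m)"
    unfolding power_mult_distrib[of q "x + b * d"] using q sum by (intro ennreal_leI mult_left_mono) auto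
  finally have "ennreal_root m I \<le> ennreal_root m (ennreal ((q * (x + b * d)) ^ m))"
    using I m by (intro ennreal_root_mono) auto
  also have "\<dots> = ennreal (q * (x + b * d))"
  proof -
    have "0 \<le> q * (x + b * d)" using q x bd by simp
    thus ?thesis using m by (simp add: ennreal_root_def real_root_power_cancel)
  qed
  also have "\<dots> \<le> ennreal (q * (1 + b) * (x + d))"
  proof (intro ennreal_leI)
    have "x + b * d \<le> (1 + b) * (x + d)" using x b d by (simp add: algebra_simps)
    thus "q * (x + b * d) \<le> q * (1 + b) * (x + d)" using q by (simp add: mult.assoc)
  qed
  also have "\<dots> = ennreal (q * (1 + b)) * (ennreal x + ennreal d)"
    using x q b d by (simp add: ennreal_mult ennreal_plus[symmetric] del: ennreal_plus)
  also have "ennreal x = ennreal_root m J" using real by (simp add: ennreal_root_def x_def)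
  finally show ?thesis .
qed

text \<open>The estimate is proved for every initial coupling, and the infimum is taken afterwards,
  so attainment plays no part. Positivity of \<open>c\<close> makes the division legitimate.\<close>

lemma ennreal_le_mult_INF_add:
  fixes f :: "'i \<Rightarrow> ennreal"
  assumes le: "\<And>i. i \<in> I \<Longrightarrow> a \<le> ennreal c * (f i + ennreal d)" and c: "0 < c"
  shows "a \<le> ennreal c * ((INF i\<in>I. f i) + ennreal d)"
proof -
  have c': "0 < ennreal c" "ennreal c < \<infinity>" using c by auto
  have "a / ennreal c - ennreal d \<le> (INF i\<in>I. f i)"
  proof (rule INF_greatest)
    fix i assume "i \<in> I"
    from le[OF this] have "a / ennreal c \<le> f i + ennreal d"
      using c' by (intro divide_le_posI_ennreal) (auto simp: mult.commute)
    thus "a / ennreal c - ennreal d \<le> f i" by (simp add: ennreal_minus_le_iff add.commute)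
  qed
  hence "a / ennreal c \<le> (INF i\<in>I. f i) + ennreal d"
    by (simp add: ennreal_minus_le_iff add.commute)
  hence "ennreal c * (a / ennreal c) \<le> ennreal c * ((INF i\<in>I. f i) + ennreal d)"
    by (intro mult_left_mono) auto
  also have "ennreal c * (a / ennreal c) = a"
    using c by (simp add: ennreal_times_divide mult.commute[of "ennreal c"] ennreal_mult_divide_eq)
  finally show ?thesis .
qed

section \<open>Moment and Wasserstein estimates\<close>

lemma integral_exp_le:
  assumes t: "0 \<le> t" and \<mu>: "\<mu> < (0::real)"
  shows "integral {0..t} (\<lambda>s. exp (2 * \<mu> * (t + s))) \<le> exp (2 * \<mu> * t) / (- 2 * \<mu>)"
proof -
  let ?F = "\<lambda>s. exp (2 * \<mu> * (t + s)) / (2 * \<mu>)"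
  have "((\<lambda>s. exp (2 * \<mu> * (t + s))) has_integral (?F t - ?F 0)) {0..t}"
    using \<mu> by (intro fundamental_theorem_of_calculus t)
      (auto intro!: derivative_eq_intros simp: has_real_derivative_iff_has_vector_derivative[symmetric])
  hence "integral {0..t} (\<lambda>s. exp (2 * \<mu> * (t + s))) = ?F t - ?F 0" by (rule integral_unique)
  also have "\<dots> \<le> - ?F 0" using \<mu> by (simp add: divide_nonneg_neg)
  finally show ?thesis by simp
qed

context kalman_bucy_riccati
begin

text \<open>Noise terms of two flows driven by the same paths differ by the Wiener integral of the
  difference of their kernels, a centred Gaussian vector. Squaring the kernel bounds and integrating
  \<open>exp (2 * \<mu> * (t + s))\<close> bounds its variance and explains \<open>\<kappa>\<close>.
  The driving paths are arbitrary because the estimate serves for the noise of the diffusion as well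
  as for that of the signal.\<close>

lemma noise_difference_moment:
  fixes p2 \<Phi>2 \<Gamma>2 :: "real \<Rightarrow> real^'n^'n" and \<mu> k :: real
  assumes p2: "riccati_solution A S (R1h ** R1h) P2 p2" and fp2: "fundamental_pair (\<lambda>s. A - p2 s ** S) \<Phi>2 \<Gamma>2"
    and bm': "brownian_motion M (\<lambda>t \<omega>. (W' t \<omega>, V' t \<omega>))" and t: "0 \<le> t" and \<mu>: "\<mu> < 0" and k: "0 \<le> k"
    and b1: "\<And>s. 0 \<le> s \<Longrightarrow> s \<le> t \<Longrightarrow> norm (\<Phi> t ** \<Gamma> s - \<Phi>2 t ** \<Gamma>2 s) \<le> k * exp (\<mu> * (t + s))"
    and b2: "\<And>s. 0 \<le> s \<Longrightarrow> s \<le> t \<Longrightarrow>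
      norm (\<Phi> t ** \<Gamma> s ** (p s ** G) - \<Phi>2 t ** \<Gamma>2 s ** (p2 s ** G)) \<le> k * exp (\<mu> * (t + s))"
  defines "D \<equiv> \<lambda>\<omega>. noise t (\<lambda>s. W' s \<omega>) (\<lambda>s. V' s \<omega>) - flow_noise \<Phi>2 \<Gamma>2 (\<lambda>s. A - p2 s ** S) (\<lambda>s. p2 s ** G)
      (\<lambda>s. (A ** p2 s + p2 s ** transpose A - p2 s ** S ** p2 s + R1h ** R1h) ** G) R1h R2h t (\<lambda>s. W' s \<omega>) (\<lambda>s. V' s \<omega>)"
  defines "\<kappa> \<equiv> sqrt (((norm R1h)\<^sup>2 + (norm R2h)\<^sup>2) / (- 2 * \<mu>))"
  shows "D \<in> borel_measurable M"
    "(\<integral>\<^sup>+\<omega>. ennreal (norm (D \<omega>) ^ (2 * n)) \<partial>M) \<le>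
      ennreal (real CARD('n) ^ (2 * n) * (real CARD('n) * fact (2 * n)) * (k * \<kappa> * exp (\<mu> * t)) ^ (2 * n))"
proof -
  let ?h2 = "\<lambda>s. p2 s ** G" and ?K2 = "\<lambda>s. A - p2 s ** S"
  let ?h2' = "\<lambda>s. (A ** p2 s + p2 s ** transpose A - p2 s ** S ** p2 s + R1h ** R1h) ** G"
  have h2_deriv: "0 \<le> s \<Longrightarrow> (?h2 has_vector_derivative ?h2' s) (at s within {0..})" for s
    by (rule bounded_linear.has_vector_derivative[OF mmult.bounded_linear_left riccati_solutionD(4)[OF p2]])
  have h2'_cont: "continuous_on {0..} ?h2'"
    by (intro mmult.continuous_on continuous_intros riccati_solutionD(5)[OF p2])
  note kernels2 = flow_kernels[OF fp2 riccati_solutionD(6)[OF p2] h2_deriv h2'_cont]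
  have sub: "{0..t} \<subseteq> {0..}" by auto
  note comp = brownian_motion_components[OF bm']

  define f where "f = (\<lambda>s. \<Phi> t ** \<Gamma> s ** R1h - \<Phi>2 t ** \<Gamma>2 s ** R1h)"
  define f' where "f' = (\<lambda>s. \<Phi> t ** - (\<Gamma> s ** K s) ** R1h - \<Phi>2 t ** - (\<Gamma>2 s ** ?K2 s) ** R1h)"
  define g where "g = (\<lambda>s. - (\<Phi> t ** \<Gamma> s ** h s ** R2h) - - (\<Phi>2 t ** \<Gamma>2 s ** ?h2 s ** R2h))"
  define g' where "g' = (\<lambda>s. - (\<Phi> t ** (\<Gamma> s ** h' s + - (\<Gamma> s ** K s) ** h s) ** R2h) -
    - (\<Phi>2 t ** (\<Gamma>2 s ** ?h2' s + - (\<Gamma>2 s ** ?K2 s) ** ?h2 s) ** R2h))"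
  have f'c: "continuous_on {0..t} f'" unfolding f'_def by (rule continuous_on_diff[OF kernels(3) kernels2(3)])
  have g'c: "continuous_on {0..t} g'" unfolding g'_def by (rule continuous_on_diff[OF kernels(4) kernels2(4)])
  have fd: "(f has_vector_derivative f' s) (at s within {0..t})" if "0 \<le> s" for s
    unfolding f_def f'_def by (rule has_vector_derivative_diff[OF kernels(1)[OF _ that] kernels2(1)[OF _ that]])
  have gd: "(g has_vector_derivative g' s) (at s within {0..t})" if "0 \<le> s" for s
    unfolding g_def g'_def by (rule has_vector_derivative_diff[OF kernels(2)[OF _ that] kernels2(2)[OF _ that]])
  have D: "D \<omega> = wiener_integral f f' g g' t (\<lambda>s. W' s \<omega>) (\<lambda>s. V' s \<omega>)" if "\<omega> \<in> space M" for \<omega>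
    unfolding D_def flow_noise_def f_def f'_def g_def g'_def
    by (rule wiener_integral_diff_kernels[OF kernels(3) kernels(4) kernels2(3) kernels2(4)
          continuous_on_subset[OF comp(3)[OF that] sub] continuous_on_subset[OF comp(4)[OF that] sub], symmetric])
  have wm: "(\<lambda>\<omega>. wiener_integral f f' g g' t (\<lambda>s. W' s \<omega>) (\<lambda>s. V' s \<omega>)) \<in> borel_measurable M"
    by (intro wiener_integral_measurable t f'c g'c measurable_from_subalg[OF comp(6) comp(1)]
        measurable_from_subalg[OF comp(6) comp(2)] comp(3,4))
  show Dm: "D \<in> borel_measurable M"
    using wm by (subst measurable_cong[OF D])
  have fc: "continuous_on {0..t} f" and gc: "continuous_on {0..t} g"
    by (rule continuous_on_has_vector_derivative, use fd gd in auto)+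
  define I where "I = (\<lambda>u s. (norm (transpose (f s) *v u))\<^sup>2 + (norm (transpose (g s) *v u))\<^sup>2)"
  have Ic: "continuous_on {0..t} (I u)" for u
    unfolding I_def by (intro continuous_intros mvmult.continuous_on
        bounded_linear.continuous_on[OF bounded_linear_transpose] fc gc)
  have \<kappa>: "0 \<le> \<kappa>" "\<kappa>\<^sup>2 = ((norm R1h)\<^sup>2 + (norm R2h)\<^sup>2) / (- 2 * \<mu>)"
    using \<mu> by (simp_all add: \<kappa>_def divide_nonneg_pos divide_nonneg_neg divide_nonpos_neg)
  show "(\<integral>\<^sup>+\<omega>. ennreal (norm (D \<omega>) ^ (2 * n)) \<partial>M) \<le>
      ennreal (real CARD('n) ^ (2 * n) * (real CARD('n) * fact (2 * n)) * (k * \<kappa> * exp (\<mu> * t)) ^ (2 * n))"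
  proof (rule gaussian_moment_bound[OF Dm, where v = "\<lambda>u. integral {0..t} (I u)"])
    fix u :: "real^'n"
    have "(\<integral>\<omega>. cis (u \<bullet> D \<omega>) \<partial>M) = (\<integral>\<omega>. cis (u \<bullet> wiener_integral f f' g g' t (\<lambda>s. W' s \<omega>) (\<lambda>s. V' s \<omega>)) \<partial>M)"
      by (rule Bochner_Integration.integral_cong[OF refl]) (simp only: D)
    also have "\<dots> = complex_of_real (exp (- integral {0..t} (I u) / 2))"
      unfolding I_def by (rule wiener_integral_cis[OF bm' t fd f'c gd g'c])
    finally show "(\<integral>\<omega>. cis (u \<bullet> D \<omega>) \<partial>M) = complex_of_real (exp (- integral {0..t} (I u) / 2))" .
    show "0 \<le> integral {0..t} (I u)"
      by (intro Henstock_Kurzweil_Integration.integral_nonneg integrable_continuous_interval Ic) (simp add: I_def)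
    have "I (x *\<^sub>R u) = (\<lambda>s. x\<^sup>2 * I u s)" for x
      by (rule ext) (simp add: I_def mvmult.scaleR_right power_mult_distrib distrib_left del: transpose_matrix_vector)
    thus "integral {0..t} (I (x *\<^sub>R u)) = x\<^sup>2 * integral {0..t} (I u)" for x by simp
    assume u: "norm u = 1"
    have Ib: "I u s \<le> (k\<^sup>2 * ((norm R1h)\<^sup>2 + (norm R2h)\<^sup>2)) * exp (2 * \<mu> * (t + s))" if s: "s \<in> {0..t}" for s
    proof -
      have tr: "norm (transpose B *v u) \<le> norm B" for B :: "real^'k^'n"
        using norm_matrix_vector_le[of "transpose B" u] unfolding norm_transpose u by simp
      have "f s = (\<Phi> t ** \<Gamma> s - \<Phi>2 t ** \<Gamma>2 s) ** R1h" by (simp add: f_def mmult.diff_left)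
      hence "norm (f s) \<le> norm (\<Phi> t ** \<Gamma> s - \<Phi>2 t ** \<Gamma>2 s) * norm R1h" by (simp only: norm_matrix_mult_le)
      also have "\<dots> \<le> k * exp (\<mu> * (t + s)) * norm R1h" using s by (intro mult_right_mono b1) auto
      finally have 1: "norm (transpose (f s) *v u) \<le> k * exp (\<mu> * (t + s)) * norm R1h"
        using tr[of "f s"] by (rule order_trans[rotated])
      have "g s = - ((\<Phi> t ** \<Gamma> s ** h s - \<Phi>2 t ** \<Gamma>2 s ** ?h2 s) ** R2h)" by (simp add: g_def mmult.diff_left)
      hence "norm (g s) \<le> norm (\<Phi> t ** \<Gamma> s ** h s - \<Phi>2 t ** \<Gamma>2 s ** ?h2 s) * norm R2h"
        by (simp only: norm_minus_cancel norm_matrix_mult_le)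
      also have "\<dots> \<le> k * exp (\<mu> * (t + s)) * norm R2h" using s by (intro mult_right_mono b2) auto
      finally have 2: "norm (transpose (g s) *v u) \<le> k * exp (\<mu> * (t + s)) * norm R2h"
        using tr[of "g s"] by (rule order_trans[rotated])
      have e: "exp (2 * \<mu> * (t + s)) = (exp (\<mu> * (t + s)))\<^sup>2"
        by (simp add: exp_double[symmetric] mult.assoc)
      have "I u s \<le> (k * exp (\<mu> * (t + s)) * norm R1h)\<^sup>2 + (k * exp (\<mu> * (t + s)) * norm R2h)\<^sup>2"
        unfolding I_def using 1 2 by (intro add_mono power_mono) auto
      also have "\<dots> = (k\<^sup>2 * ((norm R1h)\<^sup>2 + (norm R2h)\<^sup>2)) * exp (2 * \<mu> * (t + s))"
        unfolding e by (simp add: power_mult_distrib algebra_simps)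
      finally show ?thesis .
    qed
    have "integral {0..t} (I u) \<le> integral {0..t} (\<lambda>s. (k\<^sup>2 * ((norm R1h)\<^sup>2 + (norm R2h)\<^sup>2)) * exp (2 * \<mu> * (t + s)))"
      by (intro integral_le integrable_continuous_interval Ic Ib) (auto intro!: continuous_intros)
    also have "\<dots> = (k\<^sup>2 * ((norm R1h)\<^sup>2 + (norm R2h)\<^sup>2)) * integral {0..t} (\<lambda>s. exp (2 * \<mu> * (t + s)))"
      by simp
    also have "\<dots> \<le> (k\<^sup>2 * ((norm R1h)\<^sup>2 + (norm R2h)\<^sup>2)) * (exp (2 * \<mu> * t) / (- 2 * \<mu>))"
      by (intro mult_left_mono integral_exp_le t \<mu>) auto
    also have "\<dots> = (k * \<kappa> * exp (\<mu> * t))\<^sup>2"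
      unfolding power_mult_distrib \<kappa>(2) by (simp add: exp_double[symmetric] mult.assoc)
    finally show "integral {0..t} (I u) \<le> (k * \<kappa> * exp (\<mu> * t))\<^sup>2" .
  qed (use k \<kappa> in simp)
qed

text \<open>Of the five terms of the coupled difference, one transports the initial difference and
  the other four carry the factor \<open>\<delta>\<close> from differences of the flows. Under the
  root, \<open>B1\<close> stands for the second initial state, \<open>B2\<close> for that of the
  signal and \<open>L * \<kappa> ^ (2 * n)\<close>, twice, for the two Gaussian vectors; the factor
  5 comes from \<open>norm_sum_five_power_le\<close>.\<close>

lemma wasserstein_le:
  fixes p2 \<Phi>2 \<Gamma>2 :: "real \<Rightarrow> real^'n^'n" and \<mu> k \<delta> B1 B2 :: real
  assumes D2: "kalman_bucy_riccati M A R1h a C c R2h W X V Y Wc Xc Vc \<theta> p2 \<Phi>2 \<Gamma>2 P2"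
    and t: "0 \<le> t" and \<mu>: "\<mu> < 0" and k: "0 < k" and \<delta>: "0 \<le> \<delta>" and n: "1 \<le> n"
    and \<Phi>b: "norm (\<Phi> t) \<le> k * exp (\<mu> * t)" and \<Phi>d: "norm (\<Phi> t - \<Phi>2 t) \<le> k * exp (\<mu> * t) * \<delta>"
    and b1: "\<And>s. 0 \<le> s \<Longrightarrow> s \<le> t \<Longrightarrow> norm (\<Phi> t ** \<Gamma> s - \<Phi>2 t ** \<Gamma>2 s) \<le> k * exp (\<mu> * (t + s)) * \<delta>"
    and b2: "\<And>s. 0 \<le> s \<Longrightarrow> s \<le> t \<Longrightarrow>
      norm (\<Phi> t ** \<Gamma> s ** (p s ** G) - \<Phi>2 t ** \<Gamma>2 s ** (p2 s ** G)) \<le> k * exp (\<mu> * (t + s)) * \<delta>"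
    and B: "0 \<le> B1" "(\<integral>\<^sup>+\<omega>. ennreal (norm (Xc 0 \<omega>) ^ (2 * n)) \<partial>M) \<le> ennreal B1"
      "0 \<le> B2" "(\<integral>\<^sup>+\<omega>. ennreal (norm (X 0 \<omega>) ^ (2 * n)) \<partial>M) \<le> ennreal B2"
  defines "\<kappa> \<equiv> sqrt (((norm R1h)\<^sup>2 + (norm R2h)\<^sup>2) / (- 2 * \<mu>))"
    and "L \<equiv> real CARD('n) ^ (2 * n) * (real CARD('n) * fact (2 * n))"
  shows "wasserstein (2 * n) (distr M borel (Xb t)) (distr M borel (Xc t)) \<le>
    ennreal (5 * k * exp (\<mu> * t) * (1 + root (2 * n) (B1 + B2 + 2 * L * \<kappa> ^ (2 * n)))) *
      (wasserstein (2 * n) (distr M borel (Xb 0)) (distr M borel (Xc 0)) + ennreal \<delta>)"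
proof -
  interpret E: kalman_bucy_riccati M A R1h a C c R2h W X V Y Wc Xc Vc \<theta> p2 \<Phi>2 \<Gamma>2 P2 by (rule D2)
  let ?m = "2 * n"
  let ?b = "B1 + B2 + 2 * L * \<kappa> ^ ?m"
  let ?q = "5 * k * exp (\<mu> * t)"
  have m: "0 < ?m" using n by simp
  have \<kappa>: "0 \<le> \<kappa>" unfolding \<kappa>_def using \<mu> by (intro real_sqrt_ge_zero divide_nonneg_pos) auto
  have L: "0 \<le> L" by (simp add: L_def)
  have b: "0 \<le> ?b" using B \<kappa> L by simp
  have q: "0 < ?q" using k by simp
  have rb: "0 \<le> root ?m ?b" by (rule real_root_ge_zero[OF b])
  show ?thesis
    unfolding wasserstein_def[of _ "distr M borel (Xb 0)"]
  proof (rule ennreal_le_mult_INF_add)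
    show "0 < ?q * (1 + root ?m ?b)" by (rule mult_pos_pos[OF q]) (use rb in linarith)
    fix \<gamma> assume "\<gamma> \<in> couplings (distr M borel (Xb 0)) (distr M borel (Xc 0))"
    hence sets_\<gamma>: "sets \<gamma> = sets borel" and law1: "distr \<gamma> borel fst = distr M borel (Xb 0)"
      and law2: "distr \<gamma> borel snd = distr M borel (Xc 0)"
      by (auto simp: couplings_def)
    have fm: "fst \<in> borel_measurable \<gamma>" and sm: "snd \<in> borel_measurable \<gamma>"
      unfolding measurable_cong_sets[OF sets_\<gamma> refl] by (intro borel_measurable_continuous_onI continuous_intros)+
    interpret g: prob_space \<gamma>
    proof
      have "emeasure \<gamma> (space \<gamma>) = emeasure (distr \<gamma> borel fst) UNIV"
        using fm by (subst emeasure_distr) auto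
      also have "\<dots> = emeasure M (space M)"
        unfolding law1 using Xb_measurable[OF order_refl] by (subst emeasure_distr) auto
      finally show "emeasure \<gamma> (space \<gamma>) = 1" by (simp add: emeasure_space_1)
    qed
    interpret GM: pair_prob_space \<gamma> M ..
    define x where "x = (\<lambda>z :: ((real^'n) \<times> (real^'n)) \<times> 'w. \<Phi> t *v fst (fst z) + noise t (\<lambda>s. Wb s (snd z)) (\<lambda>s. Vb s (snd z)) + signal_part t (snd z))"
    define y where "y = (\<lambda>z :: ((real^'n) \<times> (real^'n)) \<times> 'w. \<Phi>2 t *v snd (fst z) + E.noise t (\<lambda>s. Wb s (snd z)) (\<lambda>s. Vb s (snd z)) + E.signal_part t (snd z))"
    have xm: "x \<in> borel_measurable (\<gamma> \<Otimes>\<^sub>M M)" and xlaw: "distr (\<gamma> \<Otimes>\<^sub>M M) borel x = distr M borel (Xb t)"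
      unfolding x_def by (rule law_representation[OF g.prob_space_axioms fm law1 bm indep_bm_signal t])+
    \<comment> \<open>The second diffusion is given the noise \<open>Wb\<close>, \<open>Vb\<close>
      of the first instead of its own; its law at time \<open>t\<close> stays the same.\<close>
    have ym: "y \<in> borel_measurable (\<gamma> \<Otimes>\<^sub>M M)" and ylaw: "distr (\<gamma> \<Otimes>\<^sub>M M) borel y = distr M borel (Xc t)"
      unfolding y_def by (rule E.law_representation[OF g.prob_space_axioms sm law2 bm indep_bm_signal t])+
    have xym: "(\<lambda>z. (x z, y z)) \<in> borel_measurable (\<gamma> \<Otimes>\<^sub>M M)" by (rule borel_measurable_Pair[OF xm ym])
    define D where "D = (\<lambda>W' V' (\<omega> :: 'w). noise t (\<lambda>s. W' s \<omega>) (\<lambda>s. V' s \<omega>) - E.noise t (\<lambda>s. W' s \<omega>) (\<lambda>s. V' s \<omega>))"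
    have Dm: "D W' V' \<in> borel_measurable M"
      and Db: "(\<integral>\<^sup>+\<omega>. ennreal (norm (D W' V' \<omega>) ^ ?m) \<partial>M) \<le> ennreal (L * (k * \<delta> * \<kappa> * exp (\<mu> * t)) ^ ?m)"
      if bm': "brownian_motion M (\<lambda>t \<omega>. (W' t \<omega>, V' t \<omega>))" for W' V'
    proof -
      have "0 \<le> k * \<delta>" using k \<delta> by simp
      note nd = noise_difference_moment[OF E.p E.fp bm' t \<mu> this]
      have c: "k * exp z * \<delta> = k * \<delta> * exp z" for z by simp
      show "D W' V' \<in> borel_measurable M"
        unfolding D_def by (rule nd(1)) (use b1 b2 in \<open>simp_all add: c\<close>)
      show "(\<integral>\<^sup>+\<omega>. ennreal (norm (D W' V' \<omega>) ^ ?m) \<partial>M) \<le> ennreal (L * (k * \<delta> * \<kappa> * exp (\<mu> * t)) ^ ?m)"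
        unfolding D_def L_def \<kappa>_def by (rule nd(2)) (use b1 b2 in \<open>simp_all add: c\<close>)
    qed
    define F where "F = (\<lambda>z :: (real^'n) \<times> (real^'n). norm (fst z - snd z) ^ ?m)"
    define J where "J = (\<integral>\<^sup>+z. ennreal (F z) \<partial>\<gamma>)"
    have Fm: "F \<in> borel_measurable \<gamma>"
      unfolding F_def by (intro borel_measurable_power measurable_compose[OF _ borel_measurable_norm] borel_measurable_diff fm sm)
    let ?a = "k * exp (\<mu> * t)"
    have a: "0 \<le> ?a" using k by simp
    have pw: "norm (x z - y z) ^ ?m \<le> 5 ^ ?m * (?a ^ ?m * F (fst z) + (?a * \<delta>) ^ ?m * norm (snd (fst z)) ^ ?m +
        (?a * \<delta>) ^ ?m * norm (X 0 (snd z)) ^ ?m + norm (D Wb Vb (snd z)) ^ ?m + norm (D W V (snd z)) ^ ?m)" for z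
    proof -
      \<comment> \<open>The signal at time \<open>t\<close> cancels; its initial value and its noise
        survive through the difference of the two flows.\<close>
      have xy: "x z - y z = \<Phi> t *v (fst (fst z) - snd (fst z)) + ((\<Phi> t - \<Phi>2 t) *v snd (fst z) - (\<Phi> t - \<Phi>2 t) *v X 0 (snd z)) +
          (D Wb Vb (snd z) - D W V (snd z))"
        unfolding x_def y_def D_def signal_part_def E.signal_part_def mvmult.diff_left mvmult.diff_right
        by (simp add: algebra_simps)
      have op: "norm (B *v v) ^ ?m \<le> r ^ ?m * norm v ^ ?m" if "norm B \<le> r" for B :: "real^'n^'n" and r v
        unfolding power_mult_distrib[symmetric]
        using norm_matrix_vector_le[of B v] mult_right_mono[OF that norm_ge_zero[of v]] by (intro power_mono) auto
      show ?thesis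
        unfolding F_def xy
        by (rule order_trans[OF norm_sum_five_power_le], intro mult_left_mono add_mono order_refl op \<Phi>b \<Phi>d) simp
    qed
    have fst_int: "(\<integral>\<^sup>+z. f (fst z) \<partial>(\<gamma> \<Otimes>\<^sub>M M)) = (\<integral>\<^sup>+z. f z \<partial>\<gamma>)" if "f \<in> borel_measurable \<gamma>" for f :: "_ \<Rightarrow> ennreal"
      using measurable_compose[OF measurable_fst that] by (subst nn_integral_fst[symmetric]) (auto simp: emeasure_space_1)
    have snd_int: "(\<integral>\<^sup>+z. f (snd z) \<partial>(\<gamma> \<Otimes>\<^sub>M M)) = (\<integral>\<^sup>+z. f z \<partial>M)" if "f \<in> borel_measurable M" for f :: "_ \<Rightarrow> ennreal"
      using measurable_compose[OF measurable_snd that] by (subst nn_integral_fst[symmetric]) (auto simp: g.emeasure_space_1)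
    have idm: "(\<lambda>v :: real^'n. ennreal (norm v ^ ?m)) \<in> borel_measurable borel"
      by (intro measurable_compose[OF _ measurable_ennreal] borel_measurable_power borel_measurable_norm)
    have nm: "(\<lambda>z. ennreal (norm (f z) ^ ?m)) \<in> borel_measurable N" if "f \<in> borel_measurable N"
      for f :: "_ \<Rightarrow> real^'n" and N :: "'z measure"
      by (intro measurable_compose[OF _ measurable_ennreal] borel_measurable_power measurable_compose[OF that borel_measurable_norm])
    have I1: "(\<integral>\<^sup>+z. ennreal (F (fst z)) \<partial>(\<gamma> \<Otimes>\<^sub>M M)) = J"
      unfolding J_def by (rule fst_int) (rule measurable_compose[OF Fm measurable_ennreal])
    have I2: "(\<integral>\<^sup>+z. ennreal (norm (snd (fst z)) ^ ?m) \<partial>(\<gamma> \<Otimes>\<^sub>M M)) \<le> ennreal B1"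
    proof -
      have "(\<integral>\<^sup>+z. ennreal (norm (snd (fst z)) ^ ?m) \<partial>(\<gamma> \<Otimes>\<^sub>M M)) = (\<integral>\<^sup>+z. ennreal (norm (snd z) ^ ?m) \<partial>\<gamma>)"
        by (rule fst_int[OF nm[OF sm]])
      also have "\<dots> = (\<integral>\<^sup>+v. ennreal (norm v ^ ?m) \<partial>distr \<gamma> borel snd)"
        by (rule nn_integral_distr[OF sm, symmetric]) (simp add: idm)
      also have "\<dots> = (\<integral>\<^sup>+\<omega>. ennreal (norm (Xc 0 \<omega>) ^ ?m) \<partial>M)"
        unfolding law2 by (rule nn_integral_distr[OF E.Xb_measurable[OF order_refl]]) (simp add: idm)
      finally show ?thesis using B(2) by simp
    qed
    have I3: "(\<integral>\<^sup>+z. ennreal (norm (X 0 (snd z)) ^ ?m) \<partial>(\<gamma> \<Otimes>\<^sub>M M)) \<le> ennreal B2"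
      using snd_int[OF nm[OF X_measurable[OF order_refl]]] B(4) by simp
    have I4: "(\<integral>\<^sup>+z. ennreal (norm (D W' V' (snd z)) ^ ?m) \<partial>(\<gamma> \<Otimes>\<^sub>M M)) \<le> ennreal (L * (k * \<delta> * \<kappa> * exp (\<mu> * t)) ^ ?m)"
      if "brownian_motion M (\<lambda>t \<omega>. (W' t \<omega>, V' t \<omega>))" for W' V'
      using snd_int[OF nm[OF Dm[OF that]]] Db[OF that] by simp
    note meas = measurable_compose[OF measurable_compose[OF measurable_fst Fm] measurable_ennreal]
      nm[OF measurable_compose[OF measurable_fst sm]] nm[OF measurable_compose[OF measurable_snd X_measurable[OF order_refl]]]
      nm[OF measurable_compose[OF measurable_snd Dm[OF bm]]] nm[OF measurable_compose[OF measurable_snd Dm[OF bm_signal]]]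
    have "(\<integral>\<^sup>+z. ennreal (norm (x z - y z) ^ ?m) \<partial>(\<gamma> \<Otimes>\<^sub>M M)) \<le>
        (\<integral>\<^sup>+z. ennreal (5 ^ ?m) * (ennreal (?a ^ ?m) * ennreal (F (fst z)) + ennreal ((?a * \<delta>) ^ ?m) * ennreal (norm (snd (fst z)) ^ ?m) +
          ennreal ((?a * \<delta>) ^ ?m) * ennreal (norm (X 0 (snd z)) ^ ?m) + ennreal (norm (D Wb Vb (snd z)) ^ ?m) +
          ennreal (norm (D W V (snd z)) ^ ?m)) \<partial>(\<gamma> \<Otimes>\<^sub>M M))"
    proof (rule nn_integral_mono)
      fix z
      show "ennreal (norm (x z - y z) ^ ?m) \<le> ennreal (5 ^ ?m) * (ennreal (?a ^ ?m) * ennreal (F (fst z)) +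
          ennreal ((?a * \<delta>) ^ ?m) * ennreal (norm (snd (fst z)) ^ ?m) +
          ennreal ((?a * \<delta>) ^ ?m) * ennreal (norm (X 0 (snd z)) ^ ?m) + ennreal (norm (D Wb Vb (snd z)) ^ ?m) +
          ennreal (norm (D W V (snd z)) ^ ?m))"
        using ennreal_leI[OF pw[of z]] a \<delta>
        by (simp add: F_def ennreal_mult ennreal_plus add_nonneg_nonneg mult_nonneg_nonneg del: power_mult_distrib)
    qed
    also have "\<dots> = ennreal (5 ^ ?m) * (ennreal (?a ^ ?m) * (\<integral>\<^sup>+z. ennreal (F (fst z)) \<partial>(\<gamma> \<Otimes>\<^sub>M M)) +
        ennreal ((?a * \<delta>) ^ ?m) * (\<integral>\<^sup>+z. ennreal (norm (snd (fst z)) ^ ?m) \<partial>(\<gamma> \<Otimes>\<^sub>M M)) +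
        ennreal ((?a * \<delta>) ^ ?m) * (\<integral>\<^sup>+z. ennreal (norm (X 0 (snd z)) ^ ?m) \<partial>(\<gamma> \<Otimes>\<^sub>M M)) +
        (\<integral>\<^sup>+z. ennreal (norm (D Wb Vb (snd z)) ^ ?m) \<partial>(\<gamma> \<Otimes>\<^sub>M M)) +
        (\<integral>\<^sup>+z. ennreal (norm (D W V (snd z)) ^ ?m) \<partial>(\<gamma> \<Otimes>\<^sub>M M)))"
      by (simp only: nn_integral_cmult nn_integral_add meas borel_measurable_add borel_measurable_times_ennreal borel_measurable_const)
    also have "\<dots> \<le> ennreal (5 ^ ?m) * (ennreal (?a ^ ?m) * J + ennreal ((?a * \<delta>) ^ ?m) * ennreal B1 +
        ennreal ((?a * \<delta>) ^ ?m) * ennreal B2 + ennreal (L * (k * \<delta> * \<kappa> * exp (\<mu> * t)) ^ ?m) +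
        ennreal (L * (k * \<delta> * \<kappa> * exp (\<mu> * t)) ^ ?m))"
      unfolding I1 by (intro mult_left_mono add_mono I2 I3 I4 bm bm_signal order_refl) auto
    also have "\<dots> = ennreal (?q ^ ?m) * (J + ennreal ((root ?m ?b * \<delta>) ^ ?m))"
    proof -
      have eq: "(root ?m ?b * \<delta>) ^ ?m = \<delta> ^ ?m * B1 + \<delta> ^ ?m * B2 + L * (\<delta> * \<kappa>) ^ ?m + L * (\<delta> * \<kappa>) ^ ?m"
        unfolding power_mult_distrib real_root_pow_pos2[OF m b] by (simp add: algebra_simps)
      have q_eq: "?q ^ ?m = 5 ^ ?m * ?a ^ ?m" by (simp add: power_mult_distrib)
      have d: "ennreal ((?a * \<delta>) ^ ?m) * ennreal b = ennreal (?a ^ ?m) * ennreal (\<delta> ^ ?m * b)" if "0 \<le> b" for b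
        using a \<delta> that by (simp add: ennreal_mult[symmetric] power_mult_distrib mult.assoc)
      have e: "ennreal (L * (k * \<delta> * \<kappa> * exp (\<mu> * t)) ^ ?m) = ennreal (?a ^ ?m) * ennreal (L * (\<delta> * \<kappa>) ^ ?m)"
      proof -
        have "L * (k * \<delta> * \<kappa> * exp (\<mu> * t)) ^ ?m = ?a ^ ?m * (L * (\<delta> * \<kappa>) ^ ?m)"
          by (simp add: power_mult_distrib mult_ac)
        thus ?thesis using a \<delta> L \<kappa> by (simp only:) (intro ennreal_mult; simp)
      qed
      have nn: "0 \<le> \<delta> ^ ?m * B1" "0 \<le> \<delta> ^ ?m * B2" "0 \<le> L * (\<delta> * \<kappa>) ^ ?m" using \<delta> B L \<kappa> by simp_all
      have "ennreal (?q ^ ?m) = ennreal (5 ^ ?m) * ennreal (?a ^ ?m)"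
        unfolding q_eq using a by (intro ennreal_mult) auto
      moreover have "ennreal ((root ?m ?b * \<delta>) ^ ?m) =
          ennreal (\<delta> ^ ?m * B1) + ennreal (\<delta> ^ ?m * B2) + ennreal (L * (\<delta> * \<kappa>) ^ ?m) + ennreal (L * (\<delta> * \<kappa>) ^ ?m)"
        unfolding eq using nn by (simp only: ennreal_plus add_nonneg_nonneg)
      ultimately show ?thesis
        unfolding d[OF B(1)] d[OF B(3)] e by (simp only: distrib_left mult.assoc add.assoc)
    qed
    finally have cost: "(\<integral>\<^sup>+z. ennreal (norm (x z - y z) ^ ?m) \<partial>(\<gamma> \<Otimes>\<^sub>M M)) \<le>
        ennreal (?q ^ ?m) * (J + ennreal ((root ?m ?b * \<delta>) ^ ?m))" .
    let ?\<gamma>t = "distr (\<gamma> \<Otimes>\<^sub>M M) borel (\<lambda>z. (x z, y z))"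
    have proj: "fst \<in> borel_measurable (borel :: ((real^'n) \<times> (real^'n)) measure)"
      "snd \<in> borel_measurable (borel :: ((real^'n) \<times> (real^'n)) measure)"
      by (intro borel_measurable_continuous_onI continuous_intros)+
    have "?\<gamma>t \<in> couplings (distr M borel (Xb t)) (distr M borel (Xc t))"
      unfolding couplings_def using xlaw ylaw distr_distr[OF proj(1) xym] distr_distr[OF proj(2) xym] by (simp add: comp_def)
    hence "wasserstein ?m (distr M borel (Xb t)) (distr M borel (Xc t)) \<le>
        ennreal_root ?m (\<integral>\<^sup>+z. ennreal (norm (fst z - snd z) ^ ?m) \<partial>?\<gamma>t)"
      unfolding wasserstein_def by (rule INF_lower)
    also have "(\<integral>\<^sup>+z. ennreal (norm (fst z - snd z) ^ ?m) \<partial>?\<gamma>t) = (\<integral>\<^sup>+z. ennreal (norm (x z - y z) ^ ?m) \<partial>(\<gamma> \<Otimes>\<^sub>M M))"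
      by (subst nn_integral_distr[OF xym]) (simp_all add: nm[OF borel_measurable_diff[OF proj]])
    also have "ennreal_root ?m \<dots> \<le> ennreal (?q * (1 + root ?m ?b)) * (ennreal_root ?m J + ennreal \<delta>)"
      by (rule ennreal_root_bound[OF cost q rb \<delta> m])
    finally show "wasserstein ?m (distr M borel (Xb t)) (distr M borel (Xc t)) \<le>
        ennreal (?q * (1 + root ?m ?b)) *
          (ennreal_root ?m (\<integral>\<^sup>+z. ennreal (norm (fst z - snd z) ^ ?m) \<partial>\<gamma>) + ennreal \<delta>)"
      unfolding J_def F_def .
  qed
qed

end

text \<open>The norm of \<open>B *v x\<close> is at least that of \<open>x\<close> divided by the
  norm of the inverse; adding 1 makes the denominator positive outright.\<close>

lemma square_coercive:
  fixes B :: "real^'n^'n"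
  assumes "transpose B = B" and inv: "invertible B"
  obtains r where "0 < r" "\<And>x. r * (norm x)\<^sup>2 \<le> x \<bullet> ((B ** B) *v x)"
proof
  let ?i = "norm (matrix_inv B) + 1"
  have i: "0 < ?i" by (simp add: add_nonneg_pos)
  thus "0 < 1 / ?i\<^sup>2" by simp
  fix x :: "real^'n"
  have "norm x = norm (matrix_inv B *v (B *v x))"
    by (simp add: matrix_vector_mul_assoc matrix_inv_inverse(2)[OF inv])
  also have "\<dots> \<le> norm (matrix_inv B) * norm (B *v x)" by (rule norm_matrix_vector_le)
  also have "\<dots> \<le> ?i * norm (B *v x)" by (intro mult_right_mono) auto
  finally have "(norm x)\<^sup>2 \<le> (?i * norm (B *v x))\<^sup>2" by (intro power_mono) auto
  hence "1 / ?i\<^sup>2 * (norm x)\<^sup>2 \<le> (norm (B *v x))\<^sup>2"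
    using i by (simp add: power_mult_distrib divide_le_eq mult.commute)
  also have "\<dots> = x \<bullet> ((B ** B) *v x)"
    using inner_transpose_matrix[of x B "B *v x"] assms(1)
    by (simp add: matrix_vector_mul_assoc[symmetric] power2_norm_eq_inner)
  finally show "1 / ?i\<^sup>2 * (norm x)\<^sup>2 \<le> x \<bullet> ((B ** B) *v x)" .
qed

section \<open>Assembling the estimate\<close>

lemma (in kalman_bucy) kalman_bucy_riccatiI:
  assumes p: "riccati_solution A (information_matrix C R2h) (R1h ** R1h) P0 p"
    and fp: "fundamental_pair (\<lambda>s. A - p s ** information_matrix C R2h) \<Phi> \<Gamma>"
    and P0: "covariance_matrix (distr M borel (Xb 0)) = P0"
  shows "kalman_bucy_riccati M A R1h a C c R2h W X V Y Wb Xb Vb \<eta> p \<Phi> \<Gamma> P0"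
  by (intro kalman_bucy_riccati.intro kalman_bucy_riccati_axioms.intro kalman_bucy_axioms p fp
      gain_riccati p[folded P0])

text \<open>The flows depend only on the model and the two initial covariance matrices, so they and
  the constant, which also takes in \<open>n\<close> and the moment bound \<open>K\<close>, are
  fixed before the diffusions are quantified: one constant serves all such pairs.\<close>

theorem theorem3p4:
  fixes M :: "'w measure"
    and A R1h P P0 P0' :: "real^'n^'n" and a :: "real^'n"
    and C :: "real^'n^'m" and c :: "real^'m" and R2h :: "real^'m^'m"
    and W X :: "real \<Rightarrow> 'w \<Rightarrow> real^'n" and V Y :: "real \<Rightarrow> 'w \<Rightarrow> real^'m"
    and n :: nat and \<epsilon> K :: real
  assumes model: "filtering_model M A a C c R1h R2h W V X Y"
    and controllable: "controllable_pair A R1h"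
    and observable: "observable_pair A C"
    and P_psd: "pos_semidef P"
    and P_riccati:
      "A ** P + P ** transpose A - P ** information_matrix C R2h ** P + R1h ** R1h = 0"
    and log_norm_neg: "log_norm (A - P ** information_matrix C R2h) < 0"
    and n_ge_1: "n \<ge> 1"
    and eps: "0 < \<epsilon>" "\<epsilon> \<le> 1/2"
  shows "\<exists>c\<epsilon>::real. \<forall>Wb Vb Xb \<eta> Wc Vc Xc \<theta>.
    kalman_bucy_diffusion M A a C c R1h R2h X Y Wb Vb Xb \<eta> \<longrightarrow>
    kalman_bucy_diffusion M A a C c R1h R2h X Y Wc Vc Xc \<theta> \<longrightarrow>
    covariance_matrix (distr M borel (Xb 0)) = P0 \<longrightarrow>
    covariance_matrix (distr M borel (Xc 0)) = P0' \<longrightarrow>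
    (\<integral>\<^sup>+\<omega>. ennreal (norm (Xb 0 \<omega>) ^ (2 * n)) \<partial>M) \<le> ennreal K \<longrightarrow>
    (\<integral>\<^sup>+\<omega>. ennreal (norm (Xc 0 \<omega>) ^ (2 * n)) \<partial>M) \<le> ennreal K \<longrightarrow>
    (\<forall>t\<ge>0.
      wasserstein (2 * n) (distr M borel (Xb t)) (distr M borel (Xc t))
      \<le> ennreal (c\<epsilon> * exp ((1 - \<epsilon>) * log_norm (A - P ** information_matrix C R2h) * t)) *
        (wasserstein (2 * n) (distr M borel (Xb 0)) (distr M borel (Xc 0))
          + ennreal (frobenius_norm (P0 - P0'))))"
proof -
  interpret prob_space M using model by (simp add: filtering_model_def)
  let ?S = "information_matrix C R2h" and ?R = "R1h ** R1h" and ?m = "2 * n"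
  let ?\<mu> = "log_norm (A - P ** ?S)" and ?G = "transpose C ** matrix_inv (R2h ** R2h)"
  have R1h: "transpose R1h = R1h" "invertible R1h" and R2h: "transpose R2h = R2h" "invertible R2h"
    and X0: "gaussian_vector M (X 0)"
    using model by (auto simp: filtering_model_def)
  obtain r where r: "0 < r" "\<And>x. r * (norm x)\<^sup>2 \<le> x \<bullet> (?R *v x)"
    by (rule square_coercive[OF R1h]) (rule that, assumption, blast)
  interpret stable_riccati A ?S ?R P ?\<mu> r
    by unfold_locales (rule information_matrix_psd[OF R2h] P_psd r P_riccati log_norm_neg inner_le_log_norm)+
  obtain B2 where B2: "0 \<le> B2" "(\<integral>\<^sup>+\<omega>. ennreal (norm (X 0 \<omega>) ^ ?m) \<partial>M) \<le> ennreal B2"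
    by (rule gaussian_vector_moment_finite[OF X0])
  have kb: "kalman_bucy M A R1h a C c R2h W X V Y Wb Xb Vb \<eta>"
    if "kalman_bucy_diffusion M A a C c R1h R2h X Y Wb Vb Xb \<eta>" for Wb Vb Xb \<eta>
    by unfold_locales (rule model that)+
  show ?thesis
  \<comment> \<open>The constant has to be named before any diffusion is at hand, but Riccati
    solutions are obtained only from diffusions. If one of the two is missing, no pair of diffusions
    with these covariances exists and the claim is vacuous.\<close>
  proof (cases "\<exists>p p2. riccati_solution A ?S ?R P0 p \<and> riccati_solution A ?S ?R P0' p2")
    case True
    then obtain p p2 where p: "riccati_solution A ?S ?R P0 p" and p2: "riccati_solution A ?S ?R P0' p2"
      by blast
    obtain \<Phi> \<Gamma> where fp: "fundamental_pair (\<lambda>s. A - p s ** ?S) \<Phi> \<Gamma>"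
      by (rule fundamental_pair_exists[OF riccati_solutionD(6)[OF p]])
    obtain \<Phi>2 \<Gamma>2 where fp2: "fundamental_pair (\<lambda>s. A - p2 s ** ?S) \<Phi>2 \<Gamma>2"
      by (rule fundamental_pair_exists[OF riccati_solutionD(6)[OF p2]])
    obtain k where k: "0 < k" "\<And>t. 0 \<le> t \<Longrightarrow> norm (\<Phi> t) \<le> k * exp (?\<mu> * t)"
      "\<And>t. 0 \<le> t \<Longrightarrow> norm (\<Phi> t - \<Phi>2 t) \<le> k * exp (?\<mu> * t) * norm (P0 - P0')"
      "\<And>s t. 0 \<le> s \<Longrightarrow> s \<le> t \<Longrightarrow>
         norm (\<Phi> t ** \<Gamma> s - \<Phi>2 t ** \<Gamma>2 s) \<le> k * exp (?\<mu> * (t + s)) * norm (P0 - P0')"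
      "\<And>s t. 0 \<le> s \<Longrightarrow> s \<le> t \<Longrightarrow>
         norm (\<Phi> t ** \<Gamma> s ** (p s ** ?G) - \<Phi>2 t ** \<Gamma>2 s ** (p2 s ** ?G)) \<le> k * exp (?\<mu> * (t + s)) * norm (P0 - P0')"
      by (rule flow_difference[OF p fp p2 fp2, of ?G]) (rule that, assumption, blast+)
    \<comment> \<open>A negative \<open>K\<close> acts as 0 under \<open>ennreal\<close>; the real
      constant follows suit.\<close>
    have K0: "0 \<le> max 0 K" by simp
    define b where "b = max 0 K + B2 + 2 * (real CARD('n) ^ ?m * (real CARD('n) * fact ?m)) *
      sqrt (((norm R1h)\<^sup>2 + (norm R2h)\<^sup>2) / (- 2 * ?\<mu>)) ^ ?m"
    have b: "0 \<le> root ?m b"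
    proof (rule real_root_ge_zero)
      have "0 \<le> sqrt (((norm R1h)\<^sup>2 + (norm R2h)\<^sup>2) / (- 2 * ?\<mu>))"
        using log_norm_neg by (intro real_sqrt_ge_zero divide_nonneg_pos) auto
      thus "0 \<le> b" unfolding b_def using B2(1) by simp
    qed
    show ?thesis
    proof (intro exI[of _ "5 * k * (1 + root ?m b)"] allI impI)
      fix Wb Vb Xb \<eta> Wc Vc Xc \<theta> and t :: real
      assume D1: "kalman_bucy_diffusion M A a C c R1h R2h X Y Wb Vb Xb \<eta>"
        and D2: "kalman_bucy_diffusion M A a C c R1h R2h X Y Wc Vc Xc \<theta>"
        and P0: "covariance_matrix (distr M borel (Xb 0)) = P0"
        and P0': "covariance_matrix (distr M borel (Xc 0)) = P0'"
        and Xc: "(\<integral>\<^sup>+\<omega>. ennreal (norm (Xc 0 \<omega>) ^ ?m) \<partial>M) \<le> ennreal K" and t: "0 \<le> t"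
      have B1: "(\<integral>\<^sup>+\<omega>. ennreal (norm (Xc 0 \<omega>) ^ ?m) \<partial>M) \<le> ennreal (max 0 K)"
        by (rule order_trans[OF Xc ennreal_leI]) simp
      have "wasserstein ?m (distr M borel (Xb t)) (distr M borel (Xc t)) \<le>
          ennreal (5 * k * exp (?\<mu> * t) * (1 + root ?m b)) *
            (wasserstein ?m (distr M borel (Xb 0)) (distr M borel (Xc 0)) + ennreal (norm (P0 - P0')))"
        unfolding b_def
        by (rule kalman_bucy_riccati.wasserstein_le[OF kalman_bucy.kalman_bucy_riccatiI[OF kb[OF D1] p fp P0]
              kalman_bucy.kalman_bucy_riccatiI[OF kb[OF D2] p2 fp2 P0'] t log_norm_neg k(1) norm_ge_zero n_ge_1
              k(2)[OF t] k(3)[OF t] k(4) k(5) K0 B1 B2])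
      also have "\<dots> \<le> ennreal (5 * k * (1 + root ?m b) * exp ((1 - \<epsilon>) * ?\<mu> * t)) *
            (wasserstein ?m (distr M borel (Xb 0)) (distr M borel (Xc 0)) + ennreal (norm (P0 - P0')))"
      proof (intro mult_right_mono ennreal_leI zero_le)
        \<comment> \<open>\<open>?\<mu>\<close> is negative, so multiplying it by
          \<open>1 - \<epsilon>\<close> slows the decay and enlarges the exponential.\<close>
        have "?\<mu> * t \<le> (1 - \<epsilon>) * ?\<mu> * t"
          using mult_nonneg_nonpos[of "\<epsilon> * t" ?\<mu>] eps(1) t log_norm_neg by (simp add: algebra_simps)
        hence "5 * k * (1 + root ?m b) * exp (?\<mu> * t) \<le> 5 * k * (1 + root ?m b) * exp ((1 - \<epsilon>) * ?\<mu> * t)"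
          using k(1) b by (intro mult_left_mono) auto
        thus "5 * k * exp (?\<mu> * t) * (1 + root ?m b) \<le> 5 * k * (1 + root ?m b) * exp ((1 - \<epsilon>) * ?\<mu> * t)"
          by (simp only: mult_ac)
      qed
      finally show "wasserstein ?m (distr M borel (Xb t)) (distr M borel (Xc t)) \<le>
          ennreal (5 * k * (1 + root ?m b) * exp ((1 - \<epsilon>) * ?\<mu> * t)) *
            (wasserstein ?m (distr M borel (Xb 0)) (distr M borel (Xc 0)) + ennreal (frobenius_norm (P0 - P0')))"
        unfolding norm_eq_frobenius .
    qed
  next
    case False
    have "\<exists>p. riccati_solution A ?S ?R (covariance_matrix (distr M borel (Xb 0))) p"
      if "kalman_bucy_diffusion M A a C c R1h R2h X Y Wb Vb Xb \<eta>" for Wb Vb Xb \<eta>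
      by (rule kalman_bucy.riccati_solution_exists[OF kb[OF that]])
    with False show ?thesis by blast
  qed
qed

end
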